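(* In every sharp theory with purification, the following statements are equivalent: (1) the RaRe, noisy and unital resource theories are equivalent in terms of state convertibility, i.e. for all normalised states $\rho,\sigma$ of the same system, $\rho\succeq_{\mathrm{RaRe}}\sigma\iff\rho\succeq_{\mathrm{noisy}}\sigma\iff\rho\succeq_{\mathrm{unital}}\sigma$; (2) the theory has unrestricted reversibility.
   Context: Framework. A causal operational probabilistic theory (OPT) has systems $A,B,\dots$ (including a trivial system $I$), with associative composites $AB$ ($AI=IA=A$; $AB$ and $BA$ related by a reversible swap), and tests. A test from $A$ to $B$ is a finite family $\{\mathcal C_i\}_{i\in X}$ of transformations from $A$ to $B$. Tests are closed under sequential composition, parallel composition $\otimes$ and coarse-graining (summing transformations over the blocks of a partition of $X$); identities $\mathcal I_A$ and swaps are one-outcome tests; systems and transformations form a strict symmetric monoidal category. Tests on $I$ are probability distributions, numbers compose by multiplication, and all probabilities in $[0,1]$ are available. A state of $A$ is a transformation $I\to A$, an effect is a transformation $A\to I$, $(a|\rho)\in[0,1]$ is their composition; tests $A\to I$ are observation-tests. States (effects) are equal iff they have the same pairing with all effects (states); transformations $\mathcal C,\mathcal C'$ from $A$ to $B$ are equal iff $(\mathcal C\otimes\mathcal I_S)\rho=(\mathcal C'\otimes\mathcal I_S)\rho$ for every system $S$ and state $\rho$ of $AS$. The spanned real vector spaces are finite-dimensional; the sets of states, effects and transformations are closed (hence compact). $\mathcal T_n\to\mathcal T$ means $(E|(\mathcal T_n\otimes\mathcal I_S)|\rho)\to(E|(\mathcal T\otimes\mathcal I_S)|\rho)$ for all $S$,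 states $\rho$, effects $E$. Every test $\{\mathcal A_i\}$ from $A$ to $B$ has the form $\mathcal A_i=(\mathcal I_B\otimes e_i)\mathcal A$ with $\mathcal A$ a deterministic transformation from $A$ to some $BX$ and $\{e_i\}$ an observation-test on $X$. A channel is a deterministic (one-outcome-test) transformation; it is reversible if it has an inverse channel. A transformation $\mathcal T$ is pure if whenever $\mathcal T=\sum_{i\in X_0}\mathcal D_i$ with $X_0\subseteq X$ and $\{\mathcal D_i\}_{i\in X}$ a test, every $\mathcal D_i$, $i\in X_0$, is a multiple of $\mathcal T$. Causality: every system has a unique deterministic effect $u_A$; the marginal on $A$ of a state of $AB$ is obtained by applying $u_B$. A state is normalised if $(u|\rho)=1$. Tests may be chosen conditionally on earlier outcomes and randomised, so normalised states form a convex set; every nonzero state is a multiple of a normalised one. A sharp theory with purification is a causal OPT satisfying: Purity Preservation (sequential and parallel compositions of pure transformations are pure); Pure Sharpness (for every system there is a pure effect $a$ and a state $\rho$ with $(a|\rho)=1$); Purification (every normalised state $\rho$ of $A$ is the marginal of a normalised pure state of some composite $AB$, and if two normalised pure states $\Psi,\Psi'$ of $AB$ have the same marginal on $A$ then $\Psi'=(\mathcal I_A\otimes\mathcal U)\Psi$ for a reversible channel $\mathcal U$ on $B$). Normalised states $\{\rho_i\}$ are perfectly distinguishable if there is an observation-test $\{a_i\}$ with $(a_i|\rho_j)=\delta_{ij}$. A pure maximal set is a set of perfectly distinguishable normalised pure states to which no state can be added keeping perfect distinguishability. In sharp theories with purification all pure maximal sets of a system have the same cardinality $d$; and each system $A$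 has a unique normalised state $\chi_A$ invariant under all reversible channels (the microcanonical state), with $\chi_{AB}=\chi_A\otimes\chi_B$. Free operations. RaRe channels on $A$: channels $\sum_ip_i\,\mathcal U_i$ with $\{p_i\}$ a probability distribution and $\mathcal U_i$ reversible channels on $A$. Basic noisy operations from $A$ to $A'$: channels $(\mathcal I_{A'}\otimes u_{E'})\,\mathcal U\,(\mathcal I_A\otimes\chi_E)$ with $\mathcal U$ a reversible channel from $AE$ to $A'E'$; noisy operations: limits of sequences of basic noisy operations. Unital channels from $A$ to $A'$: channels $\mathcal D$ with $\mathcal D\chi_A=\chi_{A'}$. For $F$ = RaRe, noisy or unital, $\rho\succeq_F\sigma$ means $\sigma=\mathcal F\rho$ for some free operation $\mathcal F$ in the set $F$. Unrestricted reversibility: the theory satisfies one (equivalently, in sharp theories with purification, all) of the following. Permutability: every permutation of every pure maximal set can be implemented by a reversible channel. Strong Symmetry: for every two pure maximal sets $\{\varphi_i\}_{i=1}^d$, $\{\psi_i\}_{i=1}^d$ of a system there is a reversible channel $\mathcal U$ with $\mathcal U\varphi_i=\psi_i$ for all $i$. Reversible Controllability: for all systems $A,B$, every pure maximal set $\{\alpha_i\}_{i=1}^d$ of $A$ and all reversible channels $\{\mathcal U_i\}_{i=1}^d$ on $B$ there is a reversible channel $\mathcal U$ on $AB$ with $\mathcal U(\alpha_i\otimes\mathcal I_B)=\alpha_i\otimes\mathcal U_i$ for every $i$. *)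

theory Defs
  imports "HOL-Analysis.Analysis" "HOL-Library.Multiset"
begin

text \<open>
  A theory is given by a type \<open>'s\<close> of systems and a type \<open>'t\<close> of transformations, each transformation
  carrying its input system \<open>src\<close> and output system \<open>tgt\<close>.  Sequential composition \<open>g \<cdot> f\<close> (first \<open>f\<close>,
  then \<open>g\<close>) is only meaningful if \<open>tgt f = src g\<close>; no axiom constrains it otherwise.
  The field \<open>prob\<close> reads off the probability of a transformation of the trivial system and is
  unconstrained elsewhere.

  A test is a finite family of transformations.  The names of its outcomes are immaterial, so the
  primitive datum is the finite multiset of the transformations in the family; \<open>test\<close> below recovers
  families indexed by an arbitrary finite set.
\<close>

record ('s, 't) opt =
  triv :: 's
  comp :: "'s \<Rightarrow> 's \<Rightarrow> 's"  (infixr "\<boxtimes>\<index>" 75)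
  src :: "'t \<Rightarrow> 's"
  tgt :: "'t \<Rightarrow> 's"
  ident :: "'s \<Rightarrow> 't"
  seq :: "'t \<Rightarrow> 't \<Rightarrow> 't"  (infixr "\<cdot>\<index>" 70)
  par :: "'t \<Rightarrow> 't \<Rightarrow> 't"  (infixr "\<otimes>\<index>" 75)
  swp :: "'s \<Rightarrow> 's \<Rightarrow> 't"
  prob :: "'t \<Rightarrow> real"
  tests :: "'t multiset set"

definition hom :: "('s, 't) opt \<Rightarrow> 's \<Rightarrow> 's \<Rightarrow> 't set" where
  "hom T A B = {f. src T f = A \<and> tgt T f = B}"

definition states :: "('s, 't) opt \<Rightarrow> 's \<Rightarrow> 't set" where
  "states T A = hom T (triv T) A"

definition effects :: "('s, 't) opt \<Rightarrow> 's \<Rightarrow> 't set" where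
  "effects T A = hom T A (triv T)"

definition pairing :: "('s, 't) opt \<Rightarrow> 't \<Rightarrow> 't \<Rightarrow> real" where
  "pairing T a \<rho> = prob T (a \<cdot>\<^bsub>T\<^esub> \<rho>)"

definition test :: "('s, 't) opt \<Rightarrow> 's \<Rightarrow> 's \<Rightarrow> 'i set \<Rightarrow> ('i \<Rightarrow> 't) \<Rightarrow> bool" where
  "test T A B X c \<longleftrightarrow>
     finite X \<and> (\<forall>i\<in>X. c i \<in> hom T A B) \<and> image_mset c (mset_set X) \<in> tests T"

text \<open>
  The real vector space spanned by the transformations from \<open>A\<close> to \<open>B\<close> is handled through the
  functionals \<open>f \<mapsto> (E|(f \<otimes> id\<^sub>S)|\<rho>)\<close>, one for each probe \<open>(S, \<rho>, E)\<close>: linear relations and limits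
  of transformations are those of these numbers.  Taking \<open>A\<close> or \<open>B\<close> trivial gives the spaces of
  states and effects.
\<close>

definition probes :: "('s, 't) opt \<Rightarrow> 's \<Rightarrow> 's \<Rightarrow> ('s \<times> 't \<times> 't) set" where
  "probes T A B =
     {(S, \<rho>, E). \<rho> \<in> states T (A \<boxtimes>\<^bsub>T\<^esub> S) \<and> E \<in> effects T (B \<boxtimes>\<^bsub>T\<^esub> S)}"

definition probe_value :: "('s, 't) opt \<Rightarrow> 't \<Rightarrow> 's \<times> 't \<times> 't \<Rightarrow> real" where
  "probe_value T f = (\<lambda>(S, \<rho>, E). pairing T E ((f \<otimes>\<^bsub>T\<^esub> ident T S) \<cdot>\<^bsub>T\<^esub> \<rho>))"

definition is_lincomb ::
  "('s, 't) opt \<Rightarrow> 's \<Rightarrow> 's \<Rightarrow> 't \<Rightarrow> 'i set \<Rightarrow> ('i \<Rightarrow> real) \<Rightarrow> ('i \<Rightarrow> 't) \<Rightarrow> bool" where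
  "is_lincomb T A B f X p c \<longleftrightarrow>
     finite X \<and> f \<in> hom T A B \<and> (\<forall>i\<in>X. c i \<in> hom T A B) \<and>
     (\<forall>w\<in>probes T A B. probe_value T f w = (\<Sum>i\<in>X. p i * probe_value T (c i) w))"

abbreviation is_sum :: "('s, 't) opt \<Rightarrow> 's \<Rightarrow> 's \<Rightarrow> 't \<Rightarrow> 'i set \<Rightarrow> ('i \<Rightarrow> 't) \<Rightarrow> bool" where
  "is_sum T A B f X c \<equiv> is_lincomb T A B f X (\<lambda>_. 1) c"

definition is_multiple :: "('s, 't) opt \<Rightarrow> 's \<Rightarrow> 's \<Rightarrow> 't \<Rightarrow> 't \<Rightarrow> bool" where
  "is_multiple T A B f g \<longleftrightarrow> (\<exists>p. is_lincomb T A B f {()} (\<lambda>_. p) (\<lambda>_. g))"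

definition converges_to :: "('s, 't) opt \<Rightarrow> 's \<Rightarrow> 's \<Rightarrow> (nat \<Rightarrow> 't) \<Rightarrow> 't \<Rightarrow> bool" where
  "converges_to T A B F f \<longleftrightarrow>
     range F \<subseteq> hom T A B \<and> f \<in> hom T A B \<and>
     (\<forall>w\<in>probes T A B. (\<lambda>n. probe_value T (F n) w) \<longlonglongrightarrow> probe_value T f w)"

definition channel :: "('s, 't) opt \<Rightarrow> 's \<Rightarrow> 's \<Rightarrow> 't \<Rightarrow> bool" where
  "channel T A B f \<longleftrightarrow> test T A B {()} (\<lambda>_. f)"

definition reversible :: "('s, 't) opt \<Rightarrow> 's \<Rightarrow> 's \<Rightarrow> 't \<Rightarrow> bool" where
  "reversible T A B U \<longleftrightarrow> channel T A B U \<and>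
     (\<exists>V. channel T B A V \<and> V \<cdot>\<^bsub>T\<^esub> U = ident T A \<and> U \<cdot>\<^bsub>T\<^esub> V = ident T B)"

definition pure :: "('s, 't) opt \<Rightarrow> 't \<Rightarrow> bool" where
  "pure T f \<longleftrightarrow> (\<forall>(X :: nat set) X0 D.
     test T (src T f) (tgt T f) X D \<and> X0 \<subseteq> X \<and> is_sum T (src T f) (tgt T f) f X0 D \<longrightarrow>
     (\<forall>i\<in>X0. is_multiple T (src T f) (tgt T f) (D i) f))"

text \<open>The deterministic effect; causality makes the description proper.\<close>

definition discard :: "('s, 't) opt \<Rightarrow> 's \<Rightarrow> 't" where
  "discard T A = (THE e. channel T A (triv T) e)"

definition normalised :: "('s, 't) opt \<Rightarrow> 's \<Rightarrow> 't \<Rightarrow> bool" where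
  "normalised T A \<rho> \<longleftrightarrow> \<rho> \<in> states T A \<and> pairing T (discard T A) \<rho> = 1"

definition marginal :: "('s, 't) opt \<Rightarrow> 's \<Rightarrow> 's \<Rightarrow> 't \<Rightarrow> 't" where
  "marginal T A B \<Psi> = (ident T A \<otimes>\<^bsub>T\<^esub> discard T B) \<cdot>\<^bsub>T\<^esub> \<Psi>"

locale strict_symmetric_monoidal =
  fixes T :: "('s, 't) opt" (structure)
  assumes comp_assoc: "(A \<boxtimes> B) \<boxtimes> C = A \<boxtimes> (B \<boxtimes> C)"
    and comp_triv: "A \<boxtimes> triv T = A" "triv T \<boxtimes> A = A"
    and ident_hom: "ident T A \<in> hom T A A"
    and seq_hom: "f \<in> hom T A B \<Longrightarrow> g \<in> hom T B C \<Longrightarrow> g \<cdot> f \<in> hom T A C"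
    and par_hom: "f \<in> hom T A B \<Longrightarrow> g \<in> hom T A' B' \<Longrightarrow> f \<otimes> g \<in> hom T (A \<boxtimes> A') (B \<boxtimes> B')"
    and swp_hom: "swp T A B \<in> hom T (A \<boxtimes> B) (B \<boxtimes> A)"
    and seq_ident: "f \<in> hom T A B \<Longrightarrow> f \<cdot> ident T A = f" "f \<in> hom T A B \<Longrightarrow> ident T B \<cdot> f = f"
    and seq_assoc: "f \<in> hom T A B \<Longrightarrow> g \<in> hom T B C \<Longrightarrow> h \<in> hom T C D \<Longrightarrow>
          (h \<cdot> g) \<cdot> f = h \<cdot> (g \<cdot> f)"
    and par_assoc: "(f \<otimes> g) \<otimes> h = f \<otimes> (g \<otimes> h)"
    and par_triv: "f \<otimes> ident T (triv T) = f" "ident T (triv T) \<otimes> f = f"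
    and par_ident: "ident T A \<otimes> ident T B = ident T (A \<boxtimes> B)"
    and interchange: "f \<in> hom T A B \<Longrightarrow> g \<in> hom T B C \<Longrightarrow> f' \<in> hom T A' B' \<Longrightarrow> g' \<in> hom T B' C' \<Longrightarrow>
          (g \<cdot> f) \<otimes> (g' \<cdot> f') = (g \<otimes> g') \<cdot> (f \<otimes> f')"
    and swp_natural: "f \<in> hom T A B \<Longrightarrow> f' \<in> hom T A' B' \<Longrightarrow>
          swp T B B' \<cdot> (f \<otimes> f') = (f' \<otimes> f) \<cdot> swp T A A'"
    and swp_swp: "swp T B A \<cdot> swp T A B = ident T (A \<boxtimes> B)"
    and swp_comp: "swp T A (B \<boxtimes> C) = (ident T B \<otimes> swp T A C) \<cdot> (swp T A B \<otimes> ident T C)"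

text \<open>
  In the axioms on tests outcomes are labelled by natural numbers, which loses nothing as index sets
  are finite.  \<open>test_conditional\<close> with \<open>Y\<close> and \<open>d\<close> not depending on \<open>i\<close> is closure under sequential
  composition.  In \<open>test_coarse\<close> the blocks of the partition are the fibres of \<open>g\<close> over \<open>g ` X\<close>.
  Since the spanned spaces are finite-dimensional (\<open>finite_dim\<close>), a pointwise limit of the
  functionals of transformations lies in the span again, so \<open>closed\<close> is closedness there.
\<close>

locale causal_opt = strict_symmetric_monoidal T for T :: "('s, 't) opt" (structure) +
  assumes tests_nonempty: "M \<in> tests T \<Longrightarrow> M \<noteq> {#}"
    and tests_hom: "M \<in> tests T \<Longrightarrow> \<exists>A B. set_mset M \<subseteq> hom T A B"
    and in_test: "\<exists>M\<in>tests T. f \<in># M"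
    and test_ident: "channel T A A (ident T A)"
    and test_swp: "channel T (A \<boxtimes> B) (B \<boxtimes> A) (swp T A B)"
    and test_conditional: "\<And>(X :: nat set) c (Y :: nat \<Rightarrow> nat set) d.
          test T A B X c \<Longrightarrow> (\<And>i. i \<in> X \<Longrightarrow> test T B C (Y i) (d i)) \<Longrightarrow>
          test T A C (SIGMA i:X. Y i) (\<lambda>(i, j). d i j \<cdot> c i)"
    and test_par: "\<And>(X :: nat set) c (Y :: nat set) d.
          test T A B X c \<Longrightarrow> test T A' B' Y d \<Longrightarrow>
          test T (A \<boxtimes> A') (B \<boxtimes> B') (X \<times> Y) (\<lambda>(i, j). c i \<otimes> d j)"
    and test_coarse: "\<And>(X :: nat set) c (g :: nat \<Rightarrow> nat). test T A B X c \<Longrightarrow>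
          \<exists>h. test T A B (g ` X) h \<and> (\<forall>j\<in>g ` X. is_sum T A B (h j) {i\<in>X. g i = j} c)"
    and prob_bij: "bij_betw (prob T) (hom T (triv T) (triv T)) {0..1}"
    and prob_seq: "p \<in> hom T (triv T) (triv T) \<Longrightarrow> q \<in> hom T (triv T) (triv T) \<Longrightarrow>
          prob T (q \<cdot> p) = prob T q * prob T p"
    and test_triv: "\<And>(X :: nat set) c. test T (triv T) (triv T) X c \<longleftrightarrow>
          finite X \<and> (\<forall>i\<in>X. c i \<in> hom T (triv T) (triv T)) \<and> (\<Sum>i\<in>X. prob T (c i)) = 1"
    and state_eqI: "\<rho> \<in> states T A \<Longrightarrow> \<sigma> \<in> states T A \<Longrightarrow>
          (\<And>a. a \<in> effects T A \<Longrightarrow> pairing T a \<rho> = pairing T a \<sigma>) \<Longrightarrow> \<rho> = \<sigma>"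
    and effect_eqI: "a \<in> effects T A \<Longrightarrow> b \<in> effects T A \<Longrightarrow>
          (\<And>\<rho>. \<rho> \<in> states T A \<Longrightarrow> pairing T a \<rho> = pairing T b \<rho>) \<Longrightarrow> a = b"
    and transformation_eqI: "f \<in> hom T A B \<Longrightarrow> f' \<in> hom T A B \<Longrightarrow>
          (\<And>S \<rho>. \<rho> \<in> states T (A \<boxtimes> S) \<Longrightarrow>
             (f \<otimes> ident T S) \<cdot> \<rho> = (f' \<otimes> ident T S) \<cdot> \<rho>) \<Longrightarrow> f = f'"
    and finite_dim: "\<exists>G. finite G \<and> G \<subseteq> hom T A B \<and>
          (\<forall>f\<in>hom T A B. \<exists>p. is_lincomb T A B f G p (\<lambda>g. g))"
    and closed: "\<And>F. range F \<subseteq> hom T A B \<Longrightarrow>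
          (\<And>w. w \<in> probes T A B \<Longrightarrow> convergent (\<lambda>n. probe_value T (F n) w)) \<Longrightarrow>
          \<exists>f. converges_to T A B F f"
    and dilation: "\<And>(X :: nat set) c. test T A B X c \<Longrightarrow>
          \<exists>S C e. channel T A (B \<boxtimes> S) C \<and> test T S (triv T) X e \<and>
            (\<forall>i\<in>X. c i = (ident T B \<otimes> e i) \<cdot> C)"
    and causality: "\<exists>!e. channel T A (triv T) e"
    and normalisation: "\<rho> \<in> states T A \<Longrightarrow> \<exists>a\<in>effects T A. pairing T a \<rho> \<noteq> 0 \<Longrightarrow>
          \<exists>\<sigma>. normalised T A \<sigma> \<and> is_multiple T (triv T) A \<rho> \<sigma>"

locale sharp_theory_with_purification = causal_opt T for T :: "('s, 't) opt" (structure) +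
  assumes pure_seq: "f \<in> hom T A B \<Longrightarrow> g \<in> hom T B C \<Longrightarrow> pure T f \<Longrightarrow> pure T g \<Longrightarrow> pure T (g \<cdot> f)"
    and pure_par: "pure T f \<Longrightarrow> pure T g \<Longrightarrow> pure T (f \<otimes> g)"
    and pure_sharpness: "\<exists>a\<in>effects T A. pure T a \<and> (\<exists>\<rho>\<in>states T A. pairing T a \<rho> = 1)"
    and purification: "normalised T A \<rho> \<Longrightarrow>
          \<exists>B \<Psi>. normalised T (A \<boxtimes> B) \<Psi> \<and> pure T \<Psi> \<and> marginal T A B \<Psi> = \<rho>"
    and purification_unique:
          "normalised T (A \<boxtimes> B) \<Psi> \<Longrightarrow> pure T \<Psi> \<Longrightarrow> normalised T (A \<boxtimes> B) \<Psi>' \<Longrightarrow> pure T \<Psi>' \<Longrightarrow>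
           marginal T A B \<Psi> = marginal T A B \<Psi>' \<Longrightarrow>
           \<exists>U. reversible T B B U \<and> \<Psi>' = (ident T A \<otimes> U) \<cdot> \<Psi>"

text \<open>
  Perfectly distinguishable states are pairwise different, so a family of them is the same as a set,
  which serves as its own index set.
\<close>

definition perfectly_distinguishable :: "('s, 't) opt \<Rightarrow> 's \<Rightarrow> 't set \<Rightarrow> bool" where
  "perfectly_distinguishable T A P \<longleftrightarrow>
     (\<forall>\<rho>\<in>P. normalised T A \<rho>) \<and>
     (\<exists>a. test T A (triv T) P a \<and>
        (\<forall>\<rho>\<in>P. \<forall>\<sigma>\<in>P. pairing T (a \<rho>) \<sigma> = (if \<rho> = \<sigma> then 1 else 0)))"

definition pure_maximal_set :: "('s, 't) opt \<Rightarrow> 's \<Rightarrow> 't set \<Rightarrow> bool" where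
  "pure_maximal_set T A P \<longleftrightarrow>
     perfectly_distinguishable T A P \<and> (\<forall>\<phi>\<in>P. pure T \<phi>) \<and>
     (\<forall>\<rho>. \<rho> \<notin> P \<longrightarrow> \<not> perfectly_distinguishable T A (insert \<rho> P))"

definition microcanonical :: "('s, 't) opt \<Rightarrow> 's \<Rightarrow> 't" where
  "microcanonical T A =
     (THE \<rho>. normalised T A \<rho> \<and> (\<forall>U. reversible T A A U \<longrightarrow> U \<cdot>\<^bsub>T\<^esub> \<rho> = \<rho>))"

definition rare_channels :: "('s, 't) opt \<Rightarrow> 's \<Rightarrow> 't set" where
  "rare_channels T A = {F. channel T A A F \<and>
     (\<exists>(X :: nat set) p U. (\<forall>i\<in>X. 0 \<le> p i) \<and> (\<Sum>i\<in>X. p i) = 1 \<and>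
        (\<forall>i\<in>X. reversible T A A (U i)) \<and> is_lincomb T A A F X p U)}"

definition basic_noisy_operations :: "('s, 't) opt \<Rightarrow> 's \<Rightarrow> 's \<Rightarrow> 't set" where
  "basic_noisy_operations T A A' =
     {(ident T A' \<otimes>\<^bsub>T\<^esub> discard T E') \<cdot>\<^bsub>T\<^esub> U \<cdot>\<^bsub>T\<^esub> (ident T A \<otimes>\<^bsub>T\<^esub> microcanonical T E) |
      E E' U. reversible T (A \<boxtimes>\<^bsub>T\<^esub> E) (A' \<boxtimes>\<^bsub>T\<^esub> E') U}"

definition noisy_operations :: "('s, 't) opt \<Rightarrow> 's \<Rightarrow> 's \<Rightarrow> 't set" where
  "noisy_operations T A A' =
     {F. \<exists>B. range B \<subseteq> basic_noisy_operations T A A' \<and> converges_to T A A' B F}"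

definition unital_channels :: "('s, 't) opt \<Rightarrow> 's \<Rightarrow> 's \<Rightarrow> 't set" where
  "unital_channels T A A' =
     {D. channel T A A' D \<and> D \<cdot>\<^bsub>T\<^esub> microcanonical T A = microcanonical T A'}"

definition convertible :: "('s, 't) opt \<Rightarrow> 't set \<Rightarrow> 't \<Rightarrow> 't \<Rightarrow> bool" where
  "convertible T free \<rho> \<sigma> \<longleftrightarrow> (\<exists>F\<in>free. \<sigma> = F \<cdot>\<^bsub>T\<^esub> \<rho>)"

definition equivalent_convertibility :: "('s, 't) opt \<Rightarrow> bool" where
  "equivalent_convertibility T \<longleftrightarrow> (\<forall>A \<rho> \<sigma>. normalised T A \<rho> \<and> normalised T A \<sigma> \<longrightarrow>
     (convertible T (rare_channels T A) \<rho> \<sigma> \<longleftrightarrow> convertible T (noisy_operations T A A) \<rho> \<sigma>) \<and>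
     (convertible T (noisy_operations T A A) \<rho> \<sigma> \<longleftrightarrow> convertible T (unital_channels T A A) \<rho> \<sigma>))"

definition permutability :: "('s, 't) opt \<Rightarrow> bool" where
  "permutability T \<longleftrightarrow> (\<forall>A P \<pi>. pure_maximal_set T A P \<and> bij_betw \<pi> P P \<longrightarrow>
     (\<exists>U. reversible T A A U \<and> (\<forall>\<phi>\<in>P. U \<cdot>\<^bsub>T\<^esub> \<phi> = \<pi> \<phi>)))"

text \<open>Two enumerations of pure maximal sets by the same indices amount to a bijection between the sets.\<close>

definition strong_symmetry :: "('s, 't) opt \<Rightarrow> bool" where
  "strong_symmetry T \<longleftrightarrow> (\<forall>A P Q \<beta>.
     pure_maximal_set T A P \<and> pure_maximal_set T A Q \<and> bij_betw \<beta> P Q \<longrightarrow>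
     (\<exists>U. reversible T A A U \<and> (\<forall>\<phi>\<in>P. U \<cdot>\<^bsub>T\<^esub> \<phi> = \<beta> \<phi>)))"

definition reversible_controllability :: "('s, 't) opt \<Rightarrow> bool" where
  "reversible_controllability T \<longleftrightarrow> (\<forall>A B P U.
     pure_maximal_set T A P \<and> (\<forall>\<alpha>\<in>P. reversible T B B (U \<alpha>)) \<longrightarrow>
     (\<exists>V. reversible T (A \<boxtimes>\<^bsub>T\<^esub> B) (A \<boxtimes>\<^bsub>T\<^esub> B) V \<and>
        (\<forall>\<alpha>\<in>P. V \<cdot>\<^bsub>T\<^esub> (\<alpha> \<otimes>\<^bsub>T\<^esub> ident T B) = \<alpha> \<otimes>\<^bsub>T\<^esub> U \<alpha>)))"

definition unrestricted_reversibility :: "('s, 't) opt \<Rightarrow> bool" where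
  "unrestricted_reversibility T \<longleftrightarrow>
     permutability T \<or> strong_symmetry T \<or> reversible_controllability T"

end

theory Submission
  imports Defs
begin

text \<open>
  The microcanonical state is a uniform mixture of every pure maximal set, and every state is a mixture of the
  elements of some pure maximal set.  The latter follows by duality: each pure state has a unique pure effect
  of weight one on it, and a state on which such an effect has maximal probability contains that pure state as a
  component, as one sees by steering through a purification.

  A unital channel therefore acts on spectra as a doubly stochastic matrix.  Under Strong Symmetry a convex
  combination of permutations of the spectrum is realised by a RaRe channel; it is also a limit of basic noisy
  operations whose environment is a power of the system, a pure maximal set of which serves as an almost uniform
  random number controlling the permutation.

  Conversely, let \<open>\<rho>\<close> have strictly decreasing eigenvalues along a pure maximal set.  Measuring it and preparing a
  permuted set is unital, so a RaRe channel achieves the same; comparing eigenvalues one by one forces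
  each reversible channel in its support to implement the permutation.  Permutability gives Strong Symmetry by
  permuting the product of two pure maximal sets on two copies of the system and reducing to one factor.
\<close>

section \<open>Strict symmetric monoidal calculus\<close>

text \<open>One object carries most of the argument: an interior state that every reversible channel
  leaves fixed. As an interior state it contains every state with positive weight, so a purification
  of it separates transformations and turns questions about effects into questions about states of
  the purifying system. As an invariant state it assigns the same probability to all effects in the
  orbit of one sharp effect. That probability turns out to be the reciprocal of the size of a pure
  maximal set; it bounds all orthogonal families and makes the greedy constructions stop. Purity of
  identities and reversible channels is not an axiom, so purity of a transformed state has to come
  from extremality until a faithful pure state is available. A unital channel has to be imitated on
  a single state only, so it suffices to write one spectrum as a convex combination of
  rearrangements of the other. RaRe channels realise the weights exactly, whereas a microcanonical
  environment offers only multiples of the reciprocal of its basis size; this is where limits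
  enter.\<close>

lemmas hom_iffs = hom_def states_def effects_def

context strict_symmetric_monoidal
begin

abbreviation unit_system ("\<one>") where "\<one> \<equiv> triv T"
abbreviation idn ("\<iota>") where "\<iota> \<equiv> ident T"
abbreviation discarding ("\<epsilon>") where "\<epsilon> \<equiv> discard T"
abbreviation pairing_bracket ("\<langle>_, _\<rangle>") where "\<langle>a, \<rho>\<rangle> \<equiv> pairing T a \<rho>"

lemma src_ident [simp]: "src T (\<iota> A) = A" and tgt_ident [simp]: "tgt T (\<iota> A) = A"
  using ident_hom[of A] by (simp_all add: hom_def)

lemma src_par [simp]: "src T (f \<otimes> g) = src T f \<boxtimes> src T g"
  and tgt_par [simp]: "tgt T (f \<otimes> g) = tgt T f \<boxtimes> tgt T g"
  using par_hom[of f "src T f" "tgt T f" g "src T g" "tgt T g"] by (simp_all add: hom_def)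

lemma src_seq [simp]: "tgt T f = src T g \<Longrightarrow> src T (g \<cdot> f) = src T f"
  and tgt_seq [simp]: "tgt T f = src T g \<Longrightarrow> tgt T (g \<cdot> f) = tgt T g"
  using seq_hom[of f "src T f" "tgt T f" g "tgt T g"] by (simp_all add: hom_def)

lemma src_swp [simp]: "src T (swp T A B) = A \<boxtimes> B"
  and tgt_swp [simp]: "tgt T (swp T A B) = B \<boxtimes> A"
  using swp_hom[of A B] by (simp_all add: hom_def)

lemmas comp_simps [simp] = comp_assoc comp_triv par_assoc par_triv

lemma seq_ident_right [simp]: "src T f = A \<Longrightarrow> f \<cdot> \<iota> A = f"
  and seq_ident_left [simp]: "tgt T f = A \<Longrightarrow> \<iota> A \<cdot> f = f"
  using seq_ident[of f "src T f" "tgt T f"] by (auto simp: hom_def)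

lemma assoc: "tgt T f = src T g \<Longrightarrow> tgt T g = src T h \<Longrightarrow> (h \<cdot> g) \<cdot> f = h \<cdot> (g \<cdot> f)"
  using seq_assoc[of f "src T f" "tgt T f" g "tgt T g" h "tgt T h"] by (simp add: hom_def)

lemma par_seq: "tgt T f = src T g \<Longrightarrow> tgt T f' = src T g' \<Longrightarrow>
    (g \<otimes> g') \<cdot> (f \<otimes> f') = (g \<cdot> f) \<otimes> (g' \<cdot> f')"
  using interchange[of f "src T f" "tgt T f" g "tgt T g" f' "src T f'" "tgt T f'" g' "tgt T g'"]
  by (simp add: hom_def)

lemma par_seq_assoc: "tgt T f = src T g \<Longrightarrow> tgt T f' = src T g' \<Longrightarrow> tgt T h = src T f \<boxtimes> src T f' \<Longrightarrow>
    (g \<otimes> g') \<cdot> ((f \<otimes> f') \<cdot> h) = ((g \<cdot> f) \<otimes> (g' \<cdot> f')) \<cdot> h"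
  by (subst assoc[symmetric]) (simp_all add: par_seq)

lemma swp_nat: "src T f = A \<Longrightarrow> tgt T f = B \<Longrightarrow> src T f' = A' \<Longrightarrow> tgt T f' = B' \<Longrightarrow>
    swp T B B' \<cdot> (f \<otimes> f') = (f' \<otimes> f) \<cdot> swp T A A'"
  using swp_natural[of f A B f' A' B'] by (simp add: hom_def)

text \<open>The hexagon identity \<open>swp_comp\<close> at trivial factors makes this swap
  idempotent, and an invertible idempotent is the identity.\<close>

lemma swp_triv_right [simp]: "swp T A \<one> = \<iota> A"
proof -
  have idem: "swp T A \<one> = swp T A \<one> \<cdot> swp T A \<one>"
    using swp_comp[of A \<one> \<one>] by simp
  have "swp T \<one> A \<cdot> swp T A \<one> = swp T \<one> A \<cdot> (swp T A \<one> \<cdot> swp T A \<one>)"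
    using idem by simp
  also have "\<dots> = (swp T \<one> A \<cdot> swp T A \<one>) \<cdot> swp T A \<one>"
    by (subst assoc) simp_all
  finally show ?thesis
    by (simp add: swp_swp)
qed

lemma swp_triv_left [simp]: "swp T \<one> A = \<iota> A"
  using swp_swp[of A \<one>] by simp

lemma par_split: "src T f = A \<Longrightarrow> tgt T f = B \<Longrightarrow> src T g = C \<Longrightarrow> tgt T g = D \<Longrightarrow>
    f \<otimes> g = (\<iota> B \<otimes> g) \<cdot> (f \<otimes> \<iota> C)"
  and par_split': "src T f = A \<Longrightarrow> tgt T f = B \<Longrightarrow> src T g = C \<Longrightarrow> tgt T g = D \<Longrightarrow>
    f \<otimes> g = (f \<otimes> \<iota> D) \<cdot> (\<iota> A \<otimes> g)"
  by (simp_all add: par_seq)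

lemma par_state_right: "src T f = A \<Longrightarrow> src T \<rho> = \<one> \<Longrightarrow> (\<iota> (tgt T f) \<otimes> \<rho>) \<cdot> f = f \<otimes> \<rho>"
  using par_seq[of f "\<iota> (tgt T f)" "\<iota> \<one>" \<rho>] by simp

lemma par_state_left: "src T f = A \<Longrightarrow> src T \<rho> = \<one> \<Longrightarrow> (\<rho> \<otimes> \<iota> (tgt T f)) \<cdot> f = \<rho> \<otimes> f"
  using par_seq[of "\<iota> \<one>" \<rho> f "\<iota> (tgt T f)"] by simp

text \<open>Probabilities enter transformations as a scalar tensor factor. These rules let the
  factor slide out of any composition, after which \<open>scalar_par\<close> turns it into a
  composition of scalars, that is, a product of numbers.\<close>

lemma scalar_par_seq: "src T s = \<one> \<Longrightarrow> tgt T s = \<one> \<Longrightarrow> tgt T f = src T g \<Longrightarrow>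
    g \<cdot> (s \<otimes> f) = s \<otimes> (g \<cdot> f)"
  using par_seq[of s "\<iota> \<one>" f g] by simp

lemma scalar_par_seq': "src T s = \<one> \<Longrightarrow> tgt T s = \<one> \<Longrightarrow> tgt T f = src T g \<Longrightarrow>
    (s \<otimes> g) \<cdot> f = s \<otimes> (g \<cdot> f)"
  using par_seq[of "\<iota> \<one>" s f g] by simp

lemma scalar_par: "src T s = \<one> \<Longrightarrow> tgt T s = \<one> \<Longrightarrow> tgt T t = \<one> \<Longrightarrow> s \<otimes> t = s \<cdot> t"
  using par_seq[of "\<iota> \<one>" s t "\<iota> \<one>"] by simp

lemma pairing_seq: "tgt T \<rho> = src T f \<Longrightarrow> tgt T f = src T a \<Longrightarrow> \<langle>a, f \<cdot> \<rho>\<rangle> = \<langle>a \<cdot> f, \<rho>\<rangle>"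
  by (simp add: pairing_def assoc)

end

section \<open>Tests over arbitrary index sets\<close>

text \<open>The primitive datum is a multiset, so renaming outcomes is free. This carries the
  axioms, stated for outcomes in \<open>nat\<close>, to tests indexed by pure states, pairs or
  booleans.\<close>

lemma test_reindex:
  assumes "bij_betw h Y X"
  shows "test T A B Y (\<lambda>y. c (h y)) \<longleftrightarrow> test T A B X c"
proof -
  have "image_mset (\<lambda>y. c (h y)) (mset_set Y) = image_mset c (image_mset h (mset_set Y))"
    by (simp add: multiset.map_comp o_def)
  also have "image_mset h (mset_set Y) = mset_set X"
    using assms by (metis bij_betw_def image_mset_mset_set)
  finally show ?thesis
    using assms unfolding test_def by (auto simp: bij_betw_finite bij_betw_def)
qed

lemma test_cong:
  assumes "\<And>i. i \<in> X \<Longrightarrow> c i = d i"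
  shows "test T A B X c \<longleftrightarrow> test T A B X d"
proof (cases "finite X")
  case True
  have "image_mset c (mset_set X) = image_mset d (mset_set X)"
    using assms True by (intro image_mset_cong) simp
  then show ?thesis
    using assms by (auto simp: test_def)
qed (simp add: test_def)

lemma test_singleton: "test T A B {x} c \<longleftrightarrow> channel T A B (c x)"
  using test_reindex[of "\<lambda>_. x" "{()}" "{x}" T A B c] by (simp add: channel_def bij_betw_def)

lemma test_finite: "test T A B X c \<Longrightarrow> finite X"
  by (simp add: test_def)

lemma test_hom: "test T A B X c \<Longrightarrow> i \<in> X \<Longrightarrow> c i \<in> hom T A B"
  by (simp add: test_def)

lemma channel_hom: "channel T A B f \<Longrightarrow> f \<in> hom T A B"
  by (simp add: channel_def test_def)

lemma channel_src: "channel T A B f \<Longrightarrow> src T f = A"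
  and channel_tgt: "channel T A B f \<Longrightarrow> tgt T f = B"
  by (auto dest: channel_hom simp: hom_def)

lemma finite_nat_bij:
  assumes "finite X"
  obtains h :: "nat \<Rightarrow> 'i" where "bij_betw h {..<card X} X"
  using ex_bij_betw_nat_finite[OF assms] by (auto simp: atLeast0LessThan)

context causal_opt
begin

lemma conditional:
  assumes c: "test T A B X c" and d: "\<And>i. i \<in> X \<Longrightarrow> test T B C (Y i) (d i)"
  shows "test T A C (SIGMA i:X. Y i) (\<lambda>(i, j). d i j \<cdot> c i)"
proof -
  obtain h where h: "bij_betw h {..<card X} X"
    using finite_nat_bij[OF test_finite[OF c]] .
  have "\<exists>k. i \<in> X \<longrightarrow> bij_betw k {..<card (Y i)} (Y i)" for i
    using d[of i] by (metis finite_nat_bij test_finite)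
  then obtain k where k: "\<And>i. i \<in> X \<Longrightarrow> bij_betw (k i) {..<card (Y i)} (Y i)"
    by metis
  have hX: "a < card X \<Longrightarrow> h a \<in> X" for a
    using h by (auto simp: bij_betw_def)
  have "test T A C (SIGMA a:{..<card X}. {..<card (Y (h a))}) (\<lambda>(a, b). d (h a) (k (h a) b) \<cdot> c (h a))"
    using c d k h hX
    by (intro test_conditional) (auto simp: test_reindex[OF h] test_reindex[OF k])
  also have "(\<lambda>(a, b). d (h a) (k (h a) b) \<cdot> c (h a)) =
      (\<lambda>y. (\<lambda>(i, j). d i j \<cdot> c i) ((\<lambda>(a, b). (h a, k (h a) b)) y))"
    by (auto simp: fun_eq_iff)
  also have "test T A C (SIGMA a:{..<card X}. {..<card (Y (h a))}) \<dots> \<longleftrightarrow> ?thesis"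
  proof (rule test_reindex)
    show "bij_betw (\<lambda>(a, b). (h a, k (h a) b)) (SIGMA a:{..<card X}. {..<card (Y (h a))}) (SIGMA i:X. Y i)"
      unfolding bij_betw_def
    proof
      show "inj_on (\<lambda>(a, b). (h a, k (h a) b)) (SIGMA a:{..<card X}. {..<card (Y (h a))})"
        using h k hX by (fastforce simp: inj_on_def bij_betw_def)
      show "(\<lambda>(a, b). (h a, k (h a) b)) ` (SIGMA a:{..<card X}. {..<card (Y (h a))}) = (SIGMA i:X. Y i)"
      proof (intro equalityI subsetI)
        fix z assume "z \<in> (SIGMA i:X. Y i)"
        then obtain i j where z: "z = (i, j)" "i \<in> X" "j \<in> Y i"
          by auto
        obtain a where a: "a < card X" "h a = i"
          using h z(2) by (force simp: bij_betw_def)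
        obtain b where b: "b < card (Y i)" "k i b = j"
          using k[OF z(2)] z(3) by (force simp: bij_betw_def)
        show "z \<in> (\<lambda>(a, b). (h a, k (h a) b)) ` (SIGMA a:{..<card X}. {..<card (Y (h a))})"
          using a b z by (intro image_eqI[of _ _ "(a, b)"]) auto
      next
        fix z assume "z \<in> (\<lambda>(a, b). (h a, k (h a) b)) ` (SIGMA a:{..<card X}. {..<card (Y (h a))})"
        then show "z \<in> (SIGMA i:X. Y i)"
          using k hX by (force simp: bij_betw_def)
      qed
    qed
  qed
  finally show ?thesis .
qed

lemma test_then:
  assumes c: "test T A B X c" and g: "\<And>i. i \<in> X \<Longrightarrow> channel T B C (g i)"
  shows "test T A C X (\<lambda>i. g i \<cdot> c i)"
proof -
  have "test T A C (SIGMA i:X. {()}) (\<lambda>(i, j). g i \<cdot> c i)"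
    using g by (intro conditional[OF c]) (simp add: test_singleton)
  moreover have "bij_betw fst (SIGMA i:X. {()}) X"
    by (auto simp: bij_betw_def inj_on_def)
  from test_reindex[OF this, of T A C "\<lambda>i. g i \<cdot> c i"]
  have "test T A C (SIGMA i:X. {()}) (\<lambda>y. g (fst y) \<cdot> c (fst y)) \<longleftrightarrow> ?thesis" .
  ultimately show ?thesis
    by (simp add: case_prod_unfold)
qed

lemma test_seq: "test T A B X c \<Longrightarrow> channel T B C g \<Longrightarrow> test T A C X (\<lambda>i. g \<cdot> c i)"
  by (rule test_then)

lemma test_seq': "channel T A B g \<Longrightarrow> test T B C X c \<Longrightarrow> test T A C X (\<lambda>i. c i \<cdot> g)"
proof -
  assume g: "channel T A B g" and c: "test T B C X c"
  have "test T A C (SIGMA i:{()}. X) (\<lambda>(i, j). c j \<cdot> g)"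
    using g c by (intro conditional[of A B _ "\<lambda>_. g"]) (simp_all add: test_singleton)
  moreover have "bij_betw snd (SIGMA i:{()}. X) X"
    by (force simp: bij_betw_def inj_on_def)
  from test_reindex[OF this, of T A C "\<lambda>i. c i \<cdot> g"]
  have "test T A C (SIGMA i:{()}. X) (\<lambda>y. c (snd y) \<cdot> g) \<longleftrightarrow> test T A C X (\<lambda>i. c i \<cdot> g)" .
  ultimately show ?thesis
    by (simp add: case_prod_unfold)
qed

lemma channel_seq: "channel T A B f \<Longrightarrow> channel T B C g \<Longrightarrow> channel T A C (g \<cdot> f)"
  using test_seq[of A B "{()}" "\<lambda>_. f" C g] by (simp add: channel_def)

lemma parallel:
  assumes c: "test T A B X c" and d: "test T A' B' Y d"
  shows "test T (A \<boxtimes> A') (B \<boxtimes> B') (X \<times> Y) (\<lambda>(i, j). c i \<otimes> d j)"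
proof -
  obtain h where h: "bij_betw h {..<card X} X"
    using finite_nat_bij[OF test_finite[OF c]] .
  obtain k where k: "bij_betw k {..<card Y} Y"
    using finite_nat_bij[OF test_finite[OF d]] .
  have "test T (A \<boxtimes> A') (B \<boxtimes> B') ({..<card X} \<times> {..<card Y}) (\<lambda>(a, b). c (h a) \<otimes> d (k b))"
    using c d by (intro test_par) (auto simp: test_reindex[OF h] test_reindex[OF k])
  also have "(\<lambda>(a, b). c (h a) \<otimes> d (k b)) = (\<lambda>y. (\<lambda>(i, j). c i \<otimes> d j) (map_prod h k y))"
    by (auto simp: fun_eq_iff)
  also have "test T (A \<boxtimes> A') (B \<boxtimes> B') ({..<card X} \<times> {..<card Y}) \<dots> \<longleftrightarrow> ?thesis"
  proof (rule test_reindex)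
    show "bij_betw (map_prod h k) ({..<card X} \<times> {..<card Y}) (X \<times> Y)"
      using h k by (auto simp: bij_betw_def map_prod_surj_on intro: map_prod_inj_on)
  qed
  finally show ?thesis .
qed

lemma channel_par: "channel T A B f \<Longrightarrow> channel T A' B' g \<Longrightarrow> channel T (A \<boxtimes> A') (B \<boxtimes> B') (f \<otimes> g)"
  using parallel[of A B "{()}" "\<lambda>_. f" A' B' "{()}" "\<lambda>_. g"]
  by (simp add: test_singleton)

lemma coarse:
  fixes X :: "'i set" and g :: "'i \<Rightarrow> nat"
  assumes c: "test T A B X c"
  obtains h where "test T A B (g ` X) h" "\<And>j. j \<in> g ` X \<Longrightarrow> is_sum T A B (h j) {i \<in> X. g i = j} c"
proof -
  obtain k where k: "bij_betw k {..<card X} X"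
    using finite_nat_bij[OF test_finite[OF c]] .
  have img: "(\<lambda>x. g (k x)) ` {..<card X} = g ` X"
    using k by (auto simp: bij_betw_def image_image[symmetric])
  have t: "test T A B {..<card X} (\<lambda>a. c (k a))"
    using c by (simp add: test_reindex[OF k])
  from test_coarse[OF t, of "\<lambda>x. g (k x)"] obtain h
    where h: "test T A B (g ` X) h" and
      s: "\<And>j. j \<in> g ` X \<Longrightarrow> is_sum T A B (h j) {i \<in> {..<card X}. g (k i) = j} (\<lambda>a. c (k a))"
    unfolding img by auto
  have "is_sum T A B (h j) {i \<in> X. g i = j} c" if j: "j \<in> g ` X" for j
  proof -
    have b: "bij_betw k {i \<in> {..<card X}. g (k i) = j} {i \<in> X. g i = j}"
      using k by (auto simp: bij_betw_def inj_on_def)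
    show ?thesis
      using s[OF j] test_finite[OF c] c
      by (auto simp: is_lincomb_def test_def sum.reindex_bij_betw[OF b, symmetric])
  qed
  with h that show thesis by blast
qed

lemma sum_channel:
  assumes c: "test T A B X c" and "X \<noteq> {}"
  obtains h where "channel T A B h" "is_sum T A B h X c"
proof -
  from assms(2) have img: "(\<lambda>_. 0::nat) ` X = {0}" by auto
  obtain h where "test T A B {0::nat} h" "is_sum T A B (h 0) X c"
    using coarse[OF c, where g = "\<lambda>_. 0"] unfolding img by auto
  then show thesis
    using that[of "h 0"] by (simp add: test_singleton)
qed

lemma test_not_empty: "test T A B X c \<Longrightarrow> X \<noteq> {}"
  using tests_nonempty by (force simp: test_def)

text \<open>The axiom \<open>in_test\<close> only puts \<open>f\<close> into some multiset; placing
  it at outcome 0 of an indexed family allows the other outcomes to be addressed and merged by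
  coarse-graining.\<close>

lemma in_test_family:
  assumes "f \<in> hom T A B"
  obtains n :: nat and c where "test T A B {..<Suc n} c" "c 0 = f"
proof -
  obtain M where M: "M \<in> tests T" "f \<in># M" using in_test by blast
  obtain M' where M': "M = add_mset f M'" using M(2) by (metis mset_add)
  obtain xs where xs: "mset xs = M'" using ex_mset by blast
  obtain A' B' where h: "set_mset M \<subseteq> hom T A' B'" using tests_hom M(1) by blast
  have AB: "A' = A" "B' = B" using h M(2) assms by (auto simp: hom_def)
  have M_eq: "M = mset (f # xs)" using M' xs by simp
  have "M = mset (map ((!) (f # xs)) [0..<length (f # xs)])"
    unfolding map_nth by (rule M_eq)
  also have "\<dots> = image_mset ((!) (f # xs)) (mset_set {0..<Suc (length xs)})"
    by (simp only: mset_map mset_upt length_Cons)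
  finally have im: "image_mset ((!) (f # xs)) (mset_set {..<Suc (length xs)}) = M"
    by (simp add: atLeast0LessThan)
  have "(f # xs) ! i \<in> hom T A B" if "i < Suc (length xs)" for i
  proof -
    have "(f # xs) ! i \<in> set (f # xs)" using that by (intro nth_mem) simp
    then have "(f # xs) ! i \<in># M" unfolding M_eq set_mset_mset .
    with h AB show ?thesis by auto
  qed
  then have "test T A B {..<Suc (length xs)} ((!) (f # xs))"
    using im M(1) by (simp add: test_def)
  then show thesis by (rule that) simp
qed

end

section \<open>Scalars, deterministic effects and convex combinations\<close>

context causal_opt
begin

lemma prob_range: "src T s = \<one> \<Longrightarrow> tgt T s = \<one> \<Longrightarrow> 0 \<le> prob T s \<and> prob T s \<le> 1"
  using bij_betwE[OF prob_bij] by (auto simp: hom_def)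

lemma prob_inj: "src T s = \<one> \<Longrightarrow> tgt T s = \<one> \<Longrightarrow> src T t = \<one> \<Longrightarrow> tgt T t = \<one> \<Longrightarrow>
    prob T s = prob T t \<Longrightarrow> s = t"
  using inj_onD[OF bij_betw_imp_inj_on[OF prob_bij]] by (auto simp: hom_def)

definition scalar :: "real \<Rightarrow> 't" where
  "scalar t = inv_into (hom T \<one> \<one>) (prob T) t"

lemma scalar:
  assumes "0 \<le> t" "t \<le> 1"
  shows "src T (scalar t) = \<one>" "tgt T (scalar t) = \<one>" "prob T (scalar t) = t"
proof -
  have t: "t \<in> prob T ` hom T \<one> \<one>"
    using bij_betw_imp_surj_on[OF prob_bij] assms by auto
  show "src T (scalar t) = \<one>" "tgt T (scalar t) = \<one>"
    using inv_into_into[OF t] by (auto simp: scalar_def hom_def)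
  show "prob T (scalar t) = t"
    using f_inv_into_f[OF t] by (simp add: scalar_def)
qed

lemma prob_mult: "src T p = \<one> \<Longrightarrow> tgt T p = \<one> \<Longrightarrow> src T q = \<one> \<Longrightarrow> tgt T q = \<one> \<Longrightarrow>
    prob T (q \<cdot> p) = prob T q * prob T p"
  using prob_seq by (simp add: hom_def)

text \<open>Idempotence alone would also allow the value 0; composing with a scalar of probability 1
  excludes it.\<close>

lemma prob_ident [simp]: "prob T (\<iota> \<one>) = 1"
proof -
  have "prob T (scalar 1 \<cdot> \<iota> \<one>) = prob T (scalar 1) * prob T (\<iota> \<one>)"
    by (rule prob_mult) (simp_all add: scalar)
  then show ?thesis by (simp add: scalar)
qed

lemma prob_eq_1: "src T s = \<one> \<Longrightarrow> tgt T s = \<one> \<Longrightarrow> prob T s = 1 \<Longrightarrow> s = \<iota> \<one>"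
  by (rule prob_inj) simp_all

lemma triv_test: "test T \<one> \<one> X c \<longleftrightarrow>
    finite X \<and> (\<forall>i\<in>X. c i \<in> hom T \<one> \<one>) \<and> (\<Sum>i\<in>X. prob T (c i)) = 1"
proof (cases "finite X")
  case True
  obtain h where h: "bij_betw h {..<card X} X" using finite_nat_bij[OF True] .
  have "test T \<one> \<one> X c \<longleftrightarrow> test T \<one> \<one> {..<card X} (\<lambda>a. c (h a))"
    by (simp add: test_reindex[OF h])
  also have "\<dots> \<longleftrightarrow> (\<forall>i\<in>X. c i \<in> hom T \<one> \<one>) \<and> (\<Sum>i\<in>X. prob T (c i)) = 1"
  proof -
    have "(\<forall>a\<in>{..<card X}. c (h a) \<in> hom T \<one> \<one>) \<longleftrightarrow> (\<forall>i\<in>h ` {..<card X}. c i \<in> hom T \<one> \<one>)"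
      by simp
    then show ?thesis
      using sum.reindex_bij_betw[OF h, of "\<lambda>i. prob T (c i)"]
      unfolding bij_betw_imp_surj_on[OF h] test_triv by simp
  qed
  finally show ?thesis using True by simp
qed (simp add: test_def)

lemma discard_channel: "channel T A \<one> (\<epsilon> A)"
  unfolding discard_def by (rule theI'[OF causality])

lemma discard_unique: "channel T A \<one> e \<Longrightarrow> e = \<epsilon> A"
  using causality[of A] discard_channel by blast

lemma src_discard [simp]: "src T (\<epsilon> A) = A" and tgt_discard [simp]: "tgt T (\<epsilon> A) = \<one>"
  using discard_channel[of A] by (auto dest: channel_src channel_tgt)

lemma discard_effect [simp]: "\<epsilon> A \<in> effects T A"
  by (simp add: hom_iffs)

lemma discard_seq: "channel T A B f \<Longrightarrow> \<epsilon> B \<cdot> f = \<epsilon> A"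
  by (rule discard_unique) (rule channel_seq[OF _ discard_channel])

lemma discard_par: "\<epsilon> (A \<boxtimes> B) = \<epsilon> A \<otimes> \<epsilon> B"
  using discard_unique[OF channel_par[OF discard_channel[of A] discard_channel[of B], simplified]]
  by simp

lemma discard_triv [simp]: "\<epsilon> \<one> = \<iota> \<one>"
  using discard_unique[OF test_ident] by simp

lemma pairing_range:
  "a \<in> effects T A \<Longrightarrow> \<rho> \<in> states T A \<Longrightarrow> 0 \<le> \<langle>a, \<rho>\<rangle> \<and> \<langle>a, \<rho>\<rangle> \<le> 1"
  unfolding pairing_def by (rule prob_range) (simp_all add: hom_iffs)

lemma pairing_nonneg: "a \<in> effects T A \<Longrightarrow> \<rho> \<in> states T A \<Longrightarrow> 0 \<le> \<langle>a, \<rho>\<rangle>"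
  and pairing_le_1: "a \<in> effects T A \<Longrightarrow> \<rho> \<in> states T A \<Longrightarrow> \<langle>a, \<rho>\<rangle> \<le> 1"
  using pairing_range by blast+

section \<open>Equality and linear relations of transformations through probes\<close>

lemma probe_eqI:
  assumes f: "f \<in> hom T A B" and g: "g \<in> hom T A B"
    and eq: "\<And>w. w \<in> probes T A B \<Longrightarrow> probe_value T f w = probe_value T g w"
  shows "f = g"
proof (rule transformation_eqI[OF f g])
  fix S \<rho> assume r: "\<rho> \<in> states T (A \<boxtimes> S)"
  show "(f \<otimes> \<iota> S) \<cdot> \<rho> = (g \<otimes> \<iota> S) \<cdot> \<rho>"
  proof (rule state_eqI)
    show "(f \<otimes> \<iota> S) \<cdot> \<rho> \<in> states T (B \<boxtimes> S)" "(g \<otimes> \<iota> S) \<cdot> \<rho> \<in> states T (B \<boxtimes> S)"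
      using f g r by (simp_all add: hom_iffs)
    fix a assume "a \<in> effects T (B \<boxtimes> S)"
    then show "\<langle>a, (f \<otimes> \<iota> S) \<cdot> \<rho>\<rangle> = \<langle>a, (g \<otimes> \<iota> S) \<cdot> \<rho>\<rangle>"
      using eq[of "(S, \<rho>, a)"] r by (simp add: probes_def probe_value_def)
  qed
qed

lemma probe_effect: "e \<in> effects T A \<Longrightarrow> \<rho> \<in> states T A \<Longrightarrow> probe_value T e (\<one>, \<rho>, \<iota> \<one>) = \<langle>e, \<rho>\<rangle>"
  by (simp add: probe_value_def pairing_def hom_iffs)

lemma probe_state: "\<rho> \<in> states T A \<Longrightarrow> a \<in> effects T A \<Longrightarrow> probe_value T \<rho> (\<one>, \<iota> \<one>, a) = \<langle>a, \<rho>\<rangle>"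
  by (simp add: probe_value_def pairing_def hom_iffs)

text \<open>The ancilla of a probe is absorbed into a state of the system itself, so linear
  relations between effects can be tested on states of the system alone.
  \<open>probe_state_conv\<close> is the dual statement for states.\<close>

lemma probe_effect_conv:
  "e \<in> effects T A \<Longrightarrow> (S, \<rho>, E) \<in> probes T A \<one> \<Longrightarrow>
   (\<iota> A \<otimes> E) \<cdot> \<rho> \<in> states T A \<and> probe_value T e (S, \<rho>, E) = \<langle>e, (\<iota> A \<otimes> E) \<cdot> \<rho>\<rangle>"
  unfolding probe_value_def probes_def pairing_def hom_iffs
  using par_split[of e A \<one> E S \<one>] par_split'[of e A \<one> E S \<one>] by (simp add: assoc flip: assoc)

lemma probe_state_conv:
  "\<sigma> \<in> states T A \<Longrightarrow> (S, \<rho>, E) \<in> probes T \<one> A \<Longrightarrow>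
   E \<cdot> (\<iota> A \<otimes> \<rho>) \<in> effects T A \<and> probe_value T \<sigma> (S, \<rho>, E) = \<langle>E \<cdot> (\<iota> A \<otimes> \<rho>), \<sigma>\<rangle>"
  unfolding probe_value_def probes_def pairing_def hom_iffs
  using par_state_left[of \<rho> \<one> \<sigma>] par_state_right[of \<sigma> \<one> \<rho>] by (simp add: assoc)

lemma probe_range: "f \<in> hom T A B \<Longrightarrow> w \<in> probes T A B \<Longrightarrow> 0 \<le> probe_value T f w \<and> probe_value T f w \<le> 1"
  by (auto simp: probes_def probe_value_def hom_iffs intro!: pairing_range[unfolded hom_iffs])

lemma effect_lincomb_iff:
  "is_lincomb T A \<one> e X p c \<longleftrightarrow> finite X \<and> e \<in> effects T A \<and> (\<forall>i\<in>X. c i \<in> effects T A) \<and>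
    (\<forall>\<rho>\<in>states T A. \<langle>e, \<rho>\<rangle> = (\<Sum>i\<in>X. p i * \<langle>c i, \<rho>\<rangle>))" (is "?L \<longleftrightarrow> ?R")
proof
  assume L: ?L
  have "\<langle>e, \<rho>\<rangle> = (\<Sum>i\<in>X. p i * \<langle>c i, \<rho>\<rangle>)" if r: "\<rho> \<in> states T A" for \<rho>
  proof -
    have "(\<one>, \<rho>, \<iota> \<one>) \<in> probes T A \<one>" using r by (simp add: probes_def hom_iffs)
    then have "probe_value T e (\<one>, \<rho>, \<iota> \<one>) = (\<Sum>i\<in>X. p i * probe_value T (c i) (\<one>, \<rho>, \<iota> \<one>))"
      using L by (simp add: is_lincomb_def)
    also have "\<dots> = (\<Sum>i\<in>X. p i * \<langle>c i, \<rho>\<rangle>)"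
      using L r by (intro sum.cong) (auto simp: probe_effect is_lincomb_def effects_def)
    finally show ?thesis using L r probe_effect[of e A \<rho>] by (simp add: is_lincomb_def effects_def)
  qed
  then show ?R using L by (simp add: is_lincomb_def effects_def)
next
  assume R: ?R
  have "probe_value T e w = (\<Sum>i\<in>X. p i * probe_value T (c i) w)" if w: "w \<in> probes T A \<one>" for w
  proof -
    obtain S \<rho> E where w': "w = (S, \<rho>, E)" by (cases w)
    have "probe_value T e w = \<langle>e, (\<iota> A \<otimes> E) \<cdot> \<rho>\<rangle>" "(\<iota> A \<otimes> E) \<cdot> \<rho> \<in> states T A"
      using R w probe_effect_conv[of e A S \<rho> E] by (simp_all add: w')
    moreover have "i \<in> X \<Longrightarrow> probe_value T (c i) w = \<langle>c i, (\<iota> A \<otimes> E) \<cdot> \<rho>\<rangle>" for i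
      using R w probe_effect_conv[of "c i" A S \<rho> E] by (simp add: w')
    ultimately show ?thesis using R by simp
  qed
  then show ?L using R by (simp add: is_lincomb_def effects_def)
qed

lemma state_lincomb_iff:
  "is_lincomb T \<one> A \<sigma> X p c \<longleftrightarrow> finite X \<and> \<sigma> \<in> states T A \<and> (\<forall>i\<in>X. c i \<in> states T A) \<and>
    (\<forall>a\<in>effects T A. \<langle>a, \<sigma>\<rangle> = (\<Sum>i\<in>X. p i * \<langle>a, c i\<rangle>))" (is "?L \<longleftrightarrow> ?R")
proof
  assume L: ?L
  have "\<langle>a, \<sigma>\<rangle> = (\<Sum>i\<in>X. p i * \<langle>a, c i\<rangle>)" if r: "a \<in> effects T A" for a
  proof -
    have "(\<one>, \<iota> \<one>, a) \<in> probes T \<one> A" using r by (simp add: probes_def hom_iffs)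
    then have "probe_value T \<sigma> (\<one>, \<iota> \<one>, a) = (\<Sum>i\<in>X. p i * probe_value T (c i) (\<one>, \<iota> \<one>, a))"
      using L by (simp add: is_lincomb_def)
    also have "\<dots> = (\<Sum>i\<in>X. p i * \<langle>a, c i\<rangle>)"
      using L r by (intro sum.cong) (auto simp: probe_state is_lincomb_def states_def)
    finally show ?thesis using L r probe_state[of \<sigma> A a] by (simp add: is_lincomb_def states_def)
  qed
  then show ?R using L by (simp add: is_lincomb_def states_def)
next
  assume R: ?R
  have "probe_value T \<sigma> w = (\<Sum>i\<in>X. p i * probe_value T (c i) w)" if w: "w \<in> probes T \<one> A" for w
  proof -
    obtain S \<rho> E where w': "w = (S, \<rho>, E)" by (cases w)
    have "probe_value T \<sigma> w = \<langle>E \<cdot> (\<iota> A \<otimes> \<rho>), \<sigma>\<rangle>" "E \<cdot> (\<iota> A \<otimes> \<rho>) \<in> effects T A"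
      using R w probe_state_conv[of \<sigma> A S \<rho> E] by (simp_all add: w')
    moreover have "i \<in> X \<Longrightarrow> probe_value T (c i) w = \<langle>E \<cdot> (\<iota> A \<otimes> \<rho>), c i\<rangle>" for i
      using R w probe_state_conv[of "c i" A S \<rho> E] by (simp add: w')
    ultimately show ?thesis using R by simp
  qed
  then show ?L using R by (simp add: is_lincomb_def states_def)
qed

lemma probe_scale:
  assumes s: "src T s = \<one>" "tgt T s = \<one>" and f: "f \<in> hom T A B" and w: "w \<in> probes T A B"
  shows "probe_value T (s \<otimes> f) w = prob T s * probe_value T f w"
proof -
  obtain S \<rho> E where w': "w = (S, \<rho>, E)" by (cases w)
  have ty: "src T \<rho> = \<one>" "tgt T \<rho> = A \<boxtimes> S" "src T E = B \<boxtimes> S" "tgt T E = \<one>" "src T f = A" "tgt T f = B"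
    using w f by (auto simp: w' probes_def hom_iffs)
  have "E \<cdot> ((s \<otimes> (f \<otimes> \<iota> S)) \<cdot> \<rho>) = s \<cdot> (E \<cdot> ((f \<otimes> \<iota> S) \<cdot> \<rho>))"
    using s ty by (simp add: scalar_par_seq scalar_par_seq' scalar_par)
  then show ?thesis
    using s ty by (simp add: w' probe_value_def pairing_def prob_mult)
qed

lemma scale_state:
  assumes "src T s = \<one>" "tgt T s = \<one>" "\<sigma> \<in> states T A"
  shows "\<sigma> \<cdot> s \<in> states T A" "a \<in> effects T A \<Longrightarrow> \<langle>a, \<sigma> \<cdot> s\<rangle> = prob T s * \<langle>a, \<sigma>\<rangle>"
  using assms by (auto simp: hom_iffs pairing_def prob_mult simp flip: assoc)

lemma scale_effect:
  assumes "src T s = \<one>" "tgt T s = \<one>" "e \<in> effects T A"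
  shows "s \<cdot> e \<in> effects T A" "\<rho> \<in> states T A \<Longrightarrow> \<langle>s \<cdot> e, \<rho>\<rangle> = prob T s * \<langle>e, \<rho>\<rangle>"
  using assms by (auto simp: hom_iffs pairing_def prob_mult assoc)

lemma observation_sum:
  assumes e: "test T A \<one> X e" and r: "\<rho> \<in> states T A"
  shows "(\<Sum>i\<in>X. \<langle>e i, \<rho>\<rangle>) = \<langle>\<epsilon> A, \<rho>\<rangle>"
proof -
  obtain h where h: "channel T A \<one> h" "is_sum T A \<one> h X e"
    using sum_channel[OF e test_not_empty[OF e]] .
  from h(2) r have "\<langle>h, \<rho>\<rangle> = (\<Sum>i\<in>X. \<langle>e i, \<rho>\<rangle>)"
    by (simp add: effect_lincomb_iff)
  with discard_unique[OF h(1)] show ?thesis by simp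
qed

section \<open>Complements, normalisation and convex mixtures\<close>

lemma effect_complement:
  assumes a: "a \<in> effects T A"
  obtains a' where "a' \<in> effects T A" "\<And>\<rho>. \<rho> \<in> states T A \<Longrightarrow> \<langle>a, \<rho>\<rangle> + \<langle>a', \<rho>\<rangle> = \<langle>\<epsilon> A, \<rho>\<rangle>"
proof -
  obtain n c where c: "test T A \<one> {..<Suc n} c" "c 0 = a"
    using in_test_family a unfolding effects_def by metis
  show thesis
  proof (cases n)
    \<comment> \<open>With a single outcome nothing is left to merge: \<open>a\<close> is
      deterministic and its complement is the zero effect.\<close>
    case 0
    then have "\<langle>a, \<rho>\<rangle> = \<langle>\<epsilon> A, \<rho>\<rangle>" if "\<rho> \<in> states T A" for \<rho>
      using observation_sum[OF c(1) that] c(2) by simp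
    then show thesis
      using that[of "scalar 0 \<cdot> \<epsilon> A"] scale_effect[of "scalar 0" "\<epsilon> A" A] by (simp add: scalar)
  next
    case (Suc m)
    define g where "g i = (if i = 0 then 0 else 1 :: nat)" for i :: nat
    obtain h where h: "test T A \<one> (g ` {..<Suc n}) h"
      "\<And>j. j \<in> g ` {..<Suc n} \<Longrightarrow> is_sum T A \<one> (h j) {i \<in> {..<Suc n}. g i = j} c"
      using coarse[OF c(1), where g = g] by blast
    have "1 \<in> g ` {..<Suc n}" using Suc by (intro image_eqI[of _ _ 1]) (auto simp: g_def)
    moreover have "{i \<in> {..<Suc n}. g i = 1} = {..<Suc n} - {0}" by (auto simp: g_def)
    ultimately have h1: "is_sum T A \<one> (h 1) ({..<Suc n} - {0}) c" using h(2)[of 1] by simp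
    have "\<langle>a, \<rho>\<rangle> + \<langle>h 1, \<rho>\<rangle> = \<langle>\<epsilon> A, \<rho>\<rangle>" if r: "\<rho> \<in> states T A" for \<rho>
    proof -
      have "(\<Sum>i<Suc n. \<langle>c i, \<rho>\<rangle>) = \<langle>c 0, \<rho>\<rangle> + (\<Sum>i\<in>{..<Suc n} - {0}. \<langle>c i, \<rho>\<rangle>)"
        by (rule sum.remove) auto
      then show ?thesis
        using h1 r observation_sum[OF c(1) r] c(2) unfolding effect_lincomb_iff by simp
    qed
    then show thesis using h1 by (intro that[of "h 1"]) (auto simp: effect_lincomb_iff)
  qed
qed

lemma effect_le_discard: "a \<in> effects T A \<Longrightarrow> \<rho> \<in> states T A \<Longrightarrow> \<langle>a, \<rho>\<rangle> \<le> \<langle>\<epsilon> A, \<rho>\<rangle>"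
  by (metis effect_complement le_add_same_cancel1 pairing_nonneg)

text \<open>Complete \<open>f\<close> to a test; its total is a channel. If \<open>f\<close> already
  preserves the deterministic effect, the other outcomes have total probability zero. As every
  effect lies below the deterministic one, they vanish on every probe and the total is
  \<open>f\<close> itself.\<close>

lemma channel_if_discard_preserving:
  assumes f: "f \<in> hom T A B" and d: "\<epsilon> B \<cdot> f = \<epsilon> A"
  shows "channel T A B f"
proof -
  obtain n c where c: "test T A B {..<Suc n} c" "c 0 = f"
    using in_test_family[OF f] by metis
  define X where "X = {..<Suc n}"
  have c: "test T A B X c" "c 0 = f" "finite X" "0 \<in> X" using c by (auto simp: X_def)
  obtain C where C: "channel T A B C" "is_sum T A B C X c"
    using sum_channel[OF c(1) test_not_empty[OF c(1)]] .
  have "C = f"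
  proof (rule probe_eqI[OF channel_hom[OF C(1)] f])
    fix w assume w: "w \<in> probes T A B"
    obtain S \<rho> E where w': "w = (S, \<rho>, E)" by (cases w)
    have r: "\<rho> \<in> states T (A \<boxtimes> S)" and E: "E \<in> effects T (B \<boxtimes> S)"
      using w by (auto simp: w' probes_def)
    let ?w = "(S, \<rho>, \<epsilon> (B \<boxtimes> S))"
    have w2: "?w \<in> probes T A B" using r by (simp add: probes_def)
    have disc: "probe_value T g ?w = \<langle>\<epsilon> (A \<boxtimes> S), \<rho>\<rangle>" if "g \<in> hom T A B" "\<epsilon> B \<cdot> g = \<epsilon> A" for g
      using that r unfolding probe_value_def
      by (simp add: hom_iffs pairing_seq discard_par par_seq)
    have le: "probe_value T g w \<le> probe_value T g ?w" if "g \<in> hom T A B" for g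
      unfolding w' probe_value_def prod.case
      by (rule effect_le_discard[OF E]) (use that r in \<open>simp add: hom_iffs\<close>)
    have split: "probe_value T C v = probe_value T f v + (\<Sum>i\<in>X-{0}. probe_value T (c i) v)"
      if "v \<in> probes T A B" for v
      using C(2) that c sum.remove[of X 0 "\<lambda>i. probe_value T (c i) v"] by (simp add: is_lincomb_def)
    have "probe_value T C ?w = probe_value T f ?w"
      using disc[OF channel_hom[OF C(1)] discard_seq[OF C(1)]] disc[OF f d] by simp
    then have "(\<Sum>i\<in>X-{0}. probe_value T (c i) ?w) = 0" using split[OF w2] by simp
    moreover have "(\<Sum>i\<in>X-{0}. probe_value T (c i) w) \<le> (\<Sum>i\<in>X-{0}. probe_value T (c i) ?w)"
      using le test_hom[OF c(1)] by (intro sum_mono) auto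
    moreover have "0 \<le> (\<Sum>i\<in>X-{0}. probe_value T (c i) w)"
      using probe_range[OF test_hom[OF c(1)] w] by (intro sum_nonneg) auto
    ultimately show "probe_value T C w = probe_value T f w" using split[OF w] by simp
  qed
  with C(1) show ?thesis by simp
qed

lemma normalised_state: "normalised T A \<rho> \<Longrightarrow> \<rho> \<in> states T A"
  and normalised_pairing: "normalised T A \<rho> \<Longrightarrow> \<langle>\<epsilon> A, \<rho>\<rangle> = 1"
  and normalised_src: "normalised T A \<rho> \<Longrightarrow> src T \<rho> = \<one>"
  and normalised_tgt: "normalised T A \<rho> \<Longrightarrow> tgt T \<rho> = A"
  by (auto simp: normalised_def hom_iffs)

lemma normalised_discard: "normalised T A \<rho> \<Longrightarrow> \<epsilon> A \<cdot> \<rho> = \<iota> \<one>"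
  by (rule prob_eq_1) (auto simp: normalised_def hom_iffs pairing_def)

lemma normalised_iff_channel: "normalised T A \<rho> \<longleftrightarrow> channel T \<one> A \<rho>"
proof
  assume "normalised T A \<rho>"
  then show "channel T \<one> A \<rho>"
    by (intro channel_if_discard_preserving) (simp_all add: normalised_discard, simp add: normalised_def states_def)
next
  assume c: "channel T \<one> A \<rho>"
  have "\<epsilon> A \<cdot> \<rho> = \<iota> \<one>" using discard_seq[OF c] by simp
  then show "normalised T A \<rho>" using channel_hom[OF c] by (simp add: normalised_def states_def pairing_def)
qed

lemma channel_normalised: "channel T A B f \<Longrightarrow> normalised T A \<rho> \<Longrightarrow> normalised T B (f \<cdot> \<rho>)"
  unfolding normalised_iff_channel by (rule channel_seq)

lemma normalised_par: "normalised T A \<rho> \<Longrightarrow> normalised T B \<sigma> \<Longrightarrow> normalised T (A \<boxtimes> B) (\<rho> \<otimes> \<sigma>)"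
  unfolding normalised_iff_channel using channel_par[of \<one> A \<rho> \<one> B \<sigma>] by simp

lemma normalise:
  assumes r: "\<rho> \<in> states T A" and nz: "\<langle>\<epsilon> A, \<rho>\<rangle> \<noteq> 0"
  obtains \<sigma> where "normalised T A \<sigma>" "\<And>a. a \<in> effects T A \<Longrightarrow> \<langle>a, \<rho>\<rangle> = \<langle>\<epsilon> A, \<rho>\<rangle> * \<langle>a, \<sigma>\<rangle>"
proof -
  obtain \<sigma> where s: "normalised T A \<sigma>" "is_multiple T \<one> A \<rho> \<sigma>"
    using normalisation[OF r] nz by (meson discard_effect)
  then obtain p where p: "\<And>a. a \<in> effects T A \<Longrightarrow> \<langle>a, \<rho>\<rangle> = p * \<langle>a, \<sigma>\<rangle>"
    by (auto simp: is_multiple_def state_lincomb_iff)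
  with s(1) have "\<langle>\<epsilon> A, \<rho>\<rangle> = p" by (simp add: normalised_pairing)
  with p s(1) that show thesis by blast
qed

text \<open>A random choice made by a test that leaves the system alone; conditioning on its outcome
  produces convex mixtures.\<close>

lemma scalar_ident_test:
  assumes "finite X" "\<And>i. i \<in> X \<Longrightarrow> 0 \<le> w i" "(\<Sum>i\<in>X. w i) = 1"
  shows "test T A A X (\<lambda>i. scalar (w i) \<otimes> \<iota> A)"
proof -
  have w1: "w i \<le> 1" if "i \<in> X" for i
    using member_le_sum[of i X w] assms that by auto
  have t: "test T \<one> \<one> X (\<lambda>i. scalar (w i))"
    using assms w1 by (simp add: triv_test hom_def scalar)
  have "test T (\<one> \<boxtimes> A) (\<one> \<boxtimes> A) (X \<times> {()}) (\<lambda>(i, j). scalar (w i) \<otimes> \<iota> A)"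
    by (rule parallel[OF t]) (simp add: test_singleton test_ident)
  moreover have "bij_betw fst (X \<times> {()}) X"
    by (auto simp: bij_betw_def inj_on_def)
  from test_reindex[OF this, of T A A "\<lambda>i. scalar (w i) \<otimes> \<iota> A"]
  have "test T A A (X \<times> {()}) (\<lambda>y. scalar (w (fst y)) \<otimes> \<iota> A) \<longleftrightarrow> test T A A X (\<lambda>i. scalar (w i) \<otimes> \<iota> A)" .
  ultimately show ?thesis by (simp add: case_prod_unfold)
qed

lemma mix_channels:
  assumes X: "finite X" "\<And>i. i \<in> X \<Longrightarrow> 0 \<le> w i" "(\<Sum>i\<in>X. w i) = 1"
    and f: "\<And>i. i \<in> X \<Longrightarrow> channel T A B (f i)"
  obtains F where "channel T A B F" "is_lincomb T A B F X w f"
proof -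
  have w1: "w i \<le> 1" if "i \<in> X" for i
    using member_le_sum[of i X w] X that by auto
  have t: "test T A B X (\<lambda>i. f i \<cdot> (scalar (w i) \<otimes> \<iota> A))"
    by (rule test_then[OF scalar_ident_test[OF X]]) (use f in auto)
  obtain F where F: "channel T A B F" "is_sum T A B F X (\<lambda>i. f i \<cdot> (scalar (w i) \<otimes> \<iota> A))"
    using sum_channel[OF t test_not_empty[OF t]] .
  have "probe_value T (f i \<cdot> (scalar (w i) \<otimes> \<iota> A)) v = w i * probe_value T (f i) v"
    if "i \<in> X" "v \<in> probes T A B" for i v
    using that f X w1 probe_scale[of "scalar (w i)" "f i" A B v] channel_hom[OF f[OF that(1)]]
    by (simp add: scalar_par_seq scalar hom_def)
  then have "is_lincomb T A B F X w f"
    using F(2) f by (simp add: is_lincomb_def channel_hom)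
  with F(1) that show thesis by blast
qed

text \<open>Each effect sits at outcome 0 of its own test. The tests are run conditionally on a
  random choice, and all outcomes numbered 0 are merged.\<close>

lemma mix_effects:
  assumes X: "finite X" "\<And>i. i \<in> X \<Longrightarrow> 0 \<le> w i" "(\<Sum>i\<in>X. w i) = 1"
    and e: "\<And>i. i \<in> X \<Longrightarrow> e i \<in> effects T A"
  obtains a where "a \<in> effects T A" "\<And>\<rho>. \<rho> \<in> states T A \<Longrightarrow> \<langle>a, \<rho>\<rangle> = (\<Sum>i\<in>X. w i * \<langle>e i, \<rho>\<rangle>)"
proof -
  have w1: "w i \<le> 1" if "i \<in> X" for i
    using member_le_sum[of i X w] X that by auto
  have "\<exists>n c. i \<in> X \<longrightarrow> test T A \<one> {..<Suc n} c \<and> c 0 = e i" for i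
    using in_test_family[of "e i" A \<one>] e[of i] unfolding effects_def by metis
  then obtain n c where c: "\<And>i. i \<in> X \<Longrightarrow> test T A \<one> {..<Suc (n i)} (c i)" "\<And>i. i \<in> X \<Longrightarrow> c i 0 = e i"
    by metis
  let ?Y = "SIGMA i:X. {..<Suc (n i)}"
  let ?c = "\<lambda>(i, j). c i j \<cdot> (scalar (w i) \<otimes> \<iota> A)"
  have t: "test T A \<one> ?Y ?c"
    by (rule conditional[OF scalar_ident_test[OF X]]) (use c in auto)
  obtain h where h: "\<And>j. j \<in> snd ` ?Y \<Longrightarrow> is_sum T A \<one> (h j) {y \<in> ?Y. snd y = j} ?c"
    using coarse[OF t, where g = snd] by blast
  obtain i0 where "i0 \<in> X" using X(3) by fastforce
  then have "0 \<in> snd ` ?Y" by force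
  from h[OF this] have h0: "is_sum T A \<one> (h 0) {y \<in> ?Y. snd y = 0} ?c" .
  have b: "bij_betw (\<lambda>i. (i, 0)) X {y \<in> ?Y. snd y = 0}"
    by (auto simp: bij_betw_def inj_on_def)
  have "\<langle>h 0, \<rho>\<rangle> = (\<Sum>i\<in>X. w i * \<langle>e i, \<rho>\<rangle>)" if r: "\<rho> \<in> states T A" for \<rho>
  proof -
    have "\<langle>h 0, \<rho>\<rangle> = (\<Sum>y | y \<in> ?Y \<and> snd y = 0. \<langle>?c y, \<rho>\<rangle>)"
      using h0 r by (simp add: effect_lincomb_iff)
    also have "\<dots> = (\<Sum>i\<in>X. \<langle>?c (i, 0), \<rho>\<rangle>)"
      by (rule sum.reindex_bij_betw[OF b, symmetric])
    also have "\<dots> = (\<Sum>i\<in>X. w i * \<langle>e i, \<rho>\<rangle>)"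
    proof (rule sum.cong[OF refl])
      fix i assume i: "i \<in> X"
      have "c i 0 \<cdot> (scalar (w i) \<otimes> \<iota> A) = scalar (w i) \<cdot> e i"
        using i e[OF i] c(2)[OF i] X(2)[OF i] w1[OF i]
        by (simp add: scalar_par_seq scalar hom_iffs scalar_par[symmetric])
      then show "\<langle>?c (i, 0), \<rho>\<rangle> = w i * \<langle>e i, \<rho>\<rangle>"
        using i e[OF i] X(2)[OF i] w1[OF i] r scale_effect(2)[of "scalar (w i)" "e i" A \<rho>]
        by (simp add: scalar)
    qed
    finally show ?thesis .
  qed
  then show thesis using h0 by (intro that[of "h 0"]) (auto simp: effect_lincomb_iff)
qed

end

section \<open>Finite-dimensional interpolation\<close>

lemma bounded_image_sum:
  fixes f :: "'i \<Rightarrow> 'x \<Rightarrow> real"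
  assumes "\<And>i. i \<in> I \<Longrightarrow> bounded (f i ` X)"
  shows "bounded ((\<lambda>x. \<Sum>i\<in>I. f i x) ` X)"
  using assms
proof (induction I rule: infinite_finite_induct)
  case (insert i I)
  then have "bounded ((\<lambda>x. f i x + (\<Sum>i\<in>I. f i x)) ` X)"
    by (intro bounded_plus_comp) auto
  with insert show ?case by simp
qed (auto simp: bounded_iff)

lemma bounded_image_mult:
  fixes f :: "'x \<Rightarrow> real"
  assumes "bounded (f ` X)"
  shows "bounded ((\<lambda>x. c * f x) ` X)"
  using bounded_scaleR_comp[OF assms, of c] by simp

text \<open>Functions from a finite-dimensional space are determined by finitely many values. The
  nodes are found one at a time, as in Newton interpolation. The coefficient functions have to be
  bounded because later they multiply differences that tend to zero.\<close>

lemma interpolation_set: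
  fixes G :: "('x \<Rightarrow> real) set"
  assumes "finite G" and "\<And>g. g \<in> G \<Longrightarrow> bounded (g ` X)"
  shows "\<exists>(n::nat) y E. (\<forall>i<n. y i \<in> X \<and> bounded (E i ` X)) \<and>
    (\<forall>g\<in>G. \<forall>x\<in>X. g x = (\<Sum>i<n. g (y i) * E i x))"
  using assms
proof (induction G)
  case empty
  show ?case by (intro exI[of _ 0]) simp
next
  case (insert g G)
  then obtain n :: nat and y E where
    y: "\<And>i. i < n \<Longrightarrow> y i \<in> X" and E: "\<And>i. i < n \<Longrightarrow> bounded (E i ` X)" and
    eq: "\<And>h x. h \<in> G \<Longrightarrow> x \<in> X \<Longrightarrow> h x = (\<Sum>i<n. h (y i) * E i x)"
    by auto blast
  \<comment> \<open>The error of the current interpolation formula; either it vanishes identically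
    or it supplies a new node.\<close>
  define r where "r x = g x - (\<Sum>i<n. g (y i) * E i x)" for x
  have rb: "bounded (r ` X)"
    unfolding r_def using insert.prems E
    by (intro bounded_minus_comp bounded_image_sum bounded_image_mult) auto
  show ?case
  proof (cases "\<forall>x\<in>X. r x = 0")
    case True
    then have "\<forall>h\<in>insert g G. \<forall>x\<in>X. h x = (\<Sum>i<n. h (y i) * E i x)"
      using eq by (auto simp: r_def)
    then show ?thesis using y E by blast
  next
    case False
    then obtain z where z: "z \<in> X" "r z \<noteq> 0" by blast
    \<comment> \<open>The old formula at \<open>x\<close> is corrected by \<open>r x / r z\<close>
      times its own error at the new node \<open>z\<close>. That error is 0 for functions in
      \<open>G\<close> and \<open>r z\<close> for \<open>g\<close>, so both are reproduced.\<close>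
    define E' where "E' i x = (if i < n then E i x - (E i z / r z) * r x else (1 / r z) * r x)" for i x
    define y' where "y' = y(n := z)"
    have "bounded (E' i ` X)" if "i < Suc n" for i
      using E[of i] rb bounded_minus_comp[of "E i" X "\<lambda>x. (E i z / r z) * r x"]
        bounded_image_mult[OF rb, of "E i z / r z"] bounded_image_mult[OF rb, of "1 / r z"]
      by (cases "i < n") (simp_all add: E'_def)
    moreover have "y' i \<in> X" if "i < Suc n" for i
      using y[of i] z that by (auto simp: y'_def less_Suc_eq)
    moreover have "h x = (\<Sum>i<Suc n. h (y' i) * E' i x)" if h: "h \<in> insert g G" and x: "x \<in> X" for h x
    proof -
      have "(\<Sum>i<Suc n. h (y' i) * E' i x) =
          (\<Sum>i<n. h (y i) * E i x - (h (y i) * E i z) * (r x / r z)) + h z * (r x / r z)"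
        by (simp add: y'_def E'_def algebra_simps)
      also have "\<dots> = (\<Sum>i<n. h (y i) * E i x) + (h z - (\<Sum>i<n. h (y i) * E i z)) * (r x / r z)"
        by (simp only: sum_subtractf sum_distrib_right[symmetric]) (simp add: algebra_simps diff_divide_distrib)
      also have "\<dots> = h x"
      proof (cases "h \<in> G")
        case True
        then show ?thesis using eq[OF True x] eq[OF True z(1)] by simp
      next
        case False
        then have "h = g" using h by simp
        then have "h z - (\<Sum>i<n. h (y i) * E i z) = r z" by (simp add: r_def)
        then show ?thesis using z(2) \<open>h = g\<close> by (simp add: r_def)
      qed
      finally show ?thesis by simp
    qed
    ultimately show ?thesis by blast
  qed
qed

lemma interpolation:
  fixes \<phi> :: "'g \<Rightarrow> 'x \<Rightarrow> real"
  assumes "finite G" and "\<forall>g\<in>G. bounded (\<phi> g ` X)"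
  shows "\<exists>(n::nat) y E C. (\<forall>i<n. y i \<in> X \<and> (\<forall>x\<in>X. \<bar>E i x\<bar> \<le> C)) \<and>
    (\<forall>f p. (\<forall>x\<in>X. f x = (\<Sum>g\<in>G. p g * \<phi> g x)) \<longrightarrow> (\<forall>x\<in>X. f x = (\<Sum>i<n. f (y i) * E i x)))"
proof -
  obtain n :: nat and y E where
    y: "\<And>i. i < n \<Longrightarrow> y i \<in> X" and E: "\<And>i. i < n \<Longrightarrow> bounded (E i ` X)" and
    eq: "\<And>g x. g \<in> G \<Longrightarrow> x \<in> X \<Longrightarrow> \<phi> g x = (\<Sum>i<n. \<phi> g (y i) * E i x)"
    using interpolation_set[of "\<phi> ` G" X] assms by auto blast
  have "\<exists>C. i < n \<longrightarrow> (\<forall>x\<in>X. \<bar>E i x\<bar> \<le> C)" for i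
    using E[of i] by (auto simp: bounded_iff)
  then obtain C where C: "\<And>i x. i < n \<Longrightarrow> x \<in> X \<Longrightarrow> \<bar>E i x\<bar> \<le> C i"
    by metis
  define D where "D = (\<Sum>i<n. \<bar>C i\<bar>)"
  have "\<bar>E i x\<bar> \<le> D" if "i < n" "x \<in> X" for i x
  proof -
    have "\<bar>C i\<bar> \<le> D" unfolding D_def by (rule member_le_sum) (use that in auto)
    with C[OF that] show ?thesis by linarith
  qed
  moreover have "f x = (\<Sum>i<n. f (y i) * E i x)"
    if f: "\<forall>x\<in>X. f x = (\<Sum>g\<in>G. p g * \<phi> g x)" and x: "x \<in> X" for f p x
  proof -
    have "f x = (\<Sum>g\<in>G. p g * (\<Sum>i<n. \<phi> g (y i) * E i x))"
      using f x eq[OF _ x] by simp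
    also have "\<dots> = (\<Sum>i<n. \<Sum>g\<in>G. p g * \<phi> g (y i) * E i x)"
      unfolding sum_distrib_left by (subst sum.swap) (simp add: mult.assoc)
    also have "\<dots> = (\<Sum>i<n. f (y i) * E i x)"
      using f y by (simp add: sum_distrib_right)
    finally show ?thesis .
  qed
  ultimately show ?thesis using y by (intro exI[of _ n] exI[of _ y] exI[of _ E] exI[of _ D]) blast
qed

lemma common_subsequence:
  fixes x :: "nat \<Rightarrow> nat \<Rightarrow> real"
  assumes "\<And>i k. i < n \<Longrightarrow> 0 \<le> x i k \<and> x i k \<le> 1"
  shows "\<exists>r. strict_mono r \<and> (\<forall>i<n. convergent (\<lambda>k. x i (r k)))"
  using assms
proof (induction n)
  case 0
  show ?case by (intro exI[of _ id]) (simp add: strict_mono_def)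
next
  case (Suc n)
  then obtain r where r: "strict_mono r" "\<And>i. i < n \<Longrightarrow> convergent (\<lambda>k. x i (r k))"
    by force
  have "bounded (range (\<lambda>k. x n (r k)))"
    using Suc.prems[of n] by (auto simp: bounded_iff intro!: exI[of _ 1])
  then obtain l s where s: "strict_mono s" "((\<lambda>k. x n (r k)) \<circ> s) \<longlonglongrightarrow> l"
    using bounded_imp_convergent_subsequence by blast
  have "convergent (\<lambda>k. x i (r (s k)))" if "i < Suc n" for i
  proof (cases "i = n")
    case True
    then show ?thesis using s(2) by (auto simp: convergent_def o_def)
  next
    case False
    then have "convergent ((\<lambda>k. x i (r k)) \<circ> s)"
      using r(2)[of i] that s(1) by (intro convergent_subseq_convergent) auto
    then show ?thesis by (simp add: o_def)
  qed
  then show ?case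
    using strict_mono_o[OF r(1) s(1)] by (auto simp: o_def)
qed

section \<open>Compactness\<close>

context causal_opt
begin

text \<open>Sequential compactness. The probabilities at the interpolation nodes converge along a
  subsequence, all other probes are fixed combinations of these, and \<open>closed\<close> supplies
  the limit.\<close>

lemma hom_subsequence:
  fixes F :: "nat \<Rightarrow> 't"
  assumes F: "\<And>k. F k \<in> hom T A B"
  obtains r f where "strict_mono r" "converges_to T A B (\<lambda>k. F (r k)) f"
proof -
  obtain G where G: "finite G" "G \<subseteq> hom T A B"
    "\<And>f. f \<in> hom T A B \<Longrightarrow> \<exists>p. is_lincomb T A B f G p (\<lambda>g. g)"
    using finite_dim by metis
  have b: "\<forall>g\<in>G. bounded (probe_value T g ` probes T A B)"
    using probe_range[of _ A B] G(2) by (force simp: bounded_iff intro!: exI[of _ 1])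
  obtain n :: nat and w E C where wE: "(\<forall>i<n. w i \<in> probes T A B \<and> (\<forall>v\<in>probes T A B. \<bar>E i v\<bar> \<le> C)) \<and>
      (\<forall>f p. (\<forall>v\<in>probes T A B. f v = (\<Sum>g\<in>G. p g * probe_value T g v)) \<longrightarrow>
        (\<forall>v\<in>probes T A B. f v = (\<Sum>i<n. f (w i) * E i v)))"
    using interpolation[where \<phi> = "probe_value T", OF G(1) b] by (elim exE) (rule that)
  then have w: "\<And>i. i < n \<Longrightarrow> w i \<in> probes T A B" by blast
  have eq': "probe_value T f v = (\<Sum>i<n. probe_value T f (w i) * E i v)"
    if "f \<in> hom T A B" "v \<in> probes T A B" for f v
  proof -
    obtain p where "is_lincomb T A B f G p (\<lambda>g. g)" using G(3)[OF \<open>f \<in> hom T A B\<close>] by blast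
    then have "\<forall>v\<in>probes T A B. probe_value T f v = (\<Sum>g\<in>G. p g * probe_value T g v)"
      by (simp add: is_lincomb_def)
    with wE that(2) show ?thesis by blast
  qed
  obtain r where r: "strict_mono r" "\<And>i. i < n \<Longrightarrow> convergent (\<lambda>k. probe_value T (F (r k)) (w i))"
    using common_subsequence[of n "\<lambda>i k. probe_value T (F k) (w i)"] probe_range[OF F w] by blast
  have "convergent (\<lambda>k. probe_value T (F (r k)) v)" if "v \<in> probes T A B" for v
  proof -
    have "convergent (\<lambda>k. \<Sum>i<n. probe_value T (F (r k)) (w i) * E i v)"
      using r(2) by (intro convergent_sum convergent_mult convergent_const) auto
    then show ?thesis using eq'[OF F that] by simp
  qed
  then obtain f where "converges_to T A B (\<lambda>k. F (r k)) f"
    using closed[of "\<lambda>k. F (r k)" A B] F by blast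
  with r(1) that show thesis by blast
qed

text \<open>The extreme value theorem for sequentially closed sets, the form in which compactness of
  states and of reversible channels is applied.\<close>

lemma hom_maximum:
  fixes \<Phi> :: "'t \<Rightarrow> real"
  assumes ne: "K \<noteq> {}" and sub: "K \<subseteq> hom T A B" and bd: "\<And>f. f \<in> K \<Longrightarrow> \<Phi> f \<le> M"
    and cl: "\<And>F f. (\<And>k. F k \<in> K) \<Longrightarrow> converges_to T A B F f \<Longrightarrow> f \<in> K \<and> (\<lambda>k. \<Phi> (F k)) \<longlonglongrightarrow> \<Phi> f"
  obtains f where "f \<in> K" "\<And>g. g \<in> K \<Longrightarrow> \<Phi> g \<le> \<Phi> f"
proof -
  define s where "s = Sup (\<Phi> ` K)"
  have bdd: "bdd_above (\<Phi> ` K)" using bd by (auto simp: bdd_above_def)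
  have upper: "g \<in> K \<Longrightarrow> \<Phi> g \<le> s" for g
    unfolding s_def by (rule cSUP_upper[OF _ bdd])
  have "\<exists>f\<in>K. s - 1 / Suc k < \<Phi> f" for k
    using less_cSUP_iff[OF ne bdd, of "s - 1 / Suc k"] by (simp add: s_def)
  then obtain F where F: "\<And>k. F k \<in> K" "\<And>k. s - 1 / Suc k < \<Phi> (F k)"
    by metis
  obtain r f where r: "strict_mono r" "converges_to T A B (\<lambda>k. F (r k)) f"
    using hom_subsequence[of F A B] F(1) sub by blast
  have f: "f \<in> K" "(\<lambda>k. \<Phi> (F (r k))) \<longlonglongrightarrow> \<Phi> f"
    using cl[OF _ r(2)] F(1) by auto
  have "(\<lambda>k. \<Phi> (F k)) \<longlonglongrightarrow> s"
  proof (rule tendsto_sandwich)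
    show "(\<lambda>k. s - 1 / Suc k) \<longlonglongrightarrow> s"
      using tendsto_diff[OF tendsto_const[of s] LIMSEQ_inverse_real_of_nat]
      by (simp add: inverse_eq_divide)
    show "\<forall>\<^sub>F k in sequentially. s - 1 / Suc k \<le> \<Phi> (F k)"
      using F(2) by (auto intro: less_imp_le always_eventually)
    show "\<forall>\<^sub>F k in sequentially. \<Phi> (F k) \<le> s"
      using upper F(1) by simp
  qed simp
  then have "(\<lambda>k. \<Phi> (F (r k))) \<longlonglongrightarrow> s"
    using LIMSEQ_subseq_LIMSEQ[OF _ r(1)] by (simp add: o_def)
  with f(2) have "\<Phi> f = s" by (rule LIMSEQ_unique)
  with f(1) upper that show thesis by metis
qed

lemma converges_state:
  "converges_to T \<one> A F \<sigma> \<Longrightarrow> \<sigma> \<in> states T A"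
  "converges_to T \<one> A F \<sigma> \<Longrightarrow> a \<in> effects T A \<Longrightarrow> (\<lambda>k. \<langle>a, F k\<rangle>) \<longlonglongrightarrow> \<langle>a, \<sigma>\<rangle>"
proof -
  assume c: "converges_to T \<one> A F \<sigma>"
  then show s: "\<sigma> \<in> states T A" by (simp add: converges_to_def states_def)
  assume a: "a \<in> effects T A"
  then have "(\<one>, \<iota> \<one>, a) \<in> probes T \<one> A" by (simp add: probes_def hom_iffs)
  with c have "(\<lambda>k. probe_value T (F k) (\<one>, \<iota> \<one>, a)) \<longlonglongrightarrow> probe_value T \<sigma> (\<one>, \<iota> \<one>, a)"
    by (simp add: converges_to_def)
  moreover have "F k \<in> states T A" for k using c by (auto simp: converges_to_def states_def)
  note probe_state[OF this a]
  ultimately show "(\<lambda>k. \<langle>a, F k\<rangle>) \<longlonglongrightarrow> \<langle>a, \<sigma>\<rangle>"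
    unfolding probe_state[OF s a] by simp
qed

lemma state_limit:
  assumes s: "\<And>k. \<sigma> k \<in> states T A" and c: "\<And>a. a \<in> effects T A \<Longrightarrow> convergent (\<lambda>k. \<langle>a, \<sigma> k\<rangle>)"
  obtains \<tau> where "converges_to T \<one> A \<sigma> \<tau>"
proof -
  have "convergent (\<lambda>k. probe_value T (\<sigma> k) w)" if w: "w \<in> probes T \<one> A" for w
  proof -
    obtain S \<rho> E where w': "w = (S, \<rho>, E)" by (cases w)
    have "E \<cdot> (\<iota> A \<otimes> \<rho>) \<in> effects T A" "\<And>k. probe_value T (\<sigma> k) w = \<langle>E \<cdot> (\<iota> A \<otimes> \<rho>), \<sigma> k\<rangle>"
      using probe_state_conv[OF s w[unfolded w']] by (auto simp: w')
    with c show ?thesis by simp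
  qed
  with closed[of \<sigma> \<one> A] s that show thesis by (auto simp: states_def)
qed

section \<open>Coordinates and joint continuity of the pairing\<close>

text \<open>The coordinate effects are taken inside \<open>X\<close>, so that a statement about all
  of \<open>X\<close>, such as an orbit of effects, can be read off from finitely many of its
  members.\<close>

lemma effect_coordinates:
  assumes "X \<subseteq> effects T A"
  shows "\<exists>(n::nat) a E C. (\<forall>i<n. a i \<in> X \<and> (\<forall>b\<in>X. \<bar>E i b\<bar> \<le> C)) \<and>
    (\<forall>\<rho>\<in>states T A. \<forall>b\<in>X. \<langle>b, \<rho>\<rangle> = (\<Sum>i<n. \<langle>a i, \<rho>\<rangle> * E i b))"
proof -
  obtain G where G: "finite G" "G \<subseteq> states T A"
    "\<And>f. f \<in> states T A \<Longrightarrow> \<exists>p. is_lincomb T \<one> A f G p (\<lambda>g. g)"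
    using finite_dim[of \<one> A] unfolding states_def by metis
  have b: "\<forall>g\<in>G. bounded ((\<lambda>b. \<langle>b, g\<rangle>) ` X)"
    using pairing_range[of _ A] G(2) assms by (force simp: bounded_iff intro!: exI[of _ 1])
  obtain n :: nat and a E C where w: "(\<forall>i<n. a i \<in> X \<and> (\<forall>b\<in>X. \<bar>E i b\<bar> \<le> C)) \<and>
      (\<forall>f p. (\<forall>b\<in>X. f b = (\<Sum>g\<in>G. p g * \<langle>b, g\<rangle>)) \<longrightarrow> (\<forall>b\<in>X. f b = (\<Sum>i<n. f (a i) * E i b)))"
    using interpolation[where \<phi> = "\<lambda>g b. \<langle>b, g\<rangle>", OF G(1) b] by (elim exE) (rule that)
  have "\<langle>b, \<rho>\<rangle> = (\<Sum>i<n. \<langle>a i, \<rho>\<rangle> * E i b)" if "\<rho> \<in> states T A" "b \<in> X" for \<rho> b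
  proof -
    obtain p where "is_lincomb T \<one> A \<rho> G p (\<lambda>g. g)" using G(3)[OF \<open>\<rho> \<in> states T A\<close>] by blast
    then have "\<forall>b\<in>X. \<langle>b, \<rho>\<rangle> = (\<Sum>g\<in>G. p g * \<langle>b, g\<rangle>)"
      using assms by (auto simp: state_lincomb_iff)
    with w[THEN conjunct2, rule_format, of "\<lambda>b. \<langle>b, \<rho>\<rangle>" p] that(2) show ?thesis by blast
  qed
  with w show ?thesis by (intro exI[of _ n] exI[of _ a] exI[of _ E] exI[of _ C]) blast
qed

lemma state_coordinates:
  assumes "X \<subseteq> states T A"
  shows "\<exists>(n::nat) \<sigma> E C. (\<forall>i<n. \<sigma> i \<in> X \<and> (\<forall>\<rho>\<in>X. \<bar>E i \<rho>\<bar> \<le> C)) \<and>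
    (\<forall>a\<in>effects T A. \<forall>\<rho>\<in>X. \<langle>a, \<rho>\<rangle> = (\<Sum>i<n. \<langle>a, \<sigma> i\<rangle> * E i \<rho>))"
proof -
  obtain G where G: "finite G" "G \<subseteq> effects T A"
    "\<And>f. f \<in> effects T A \<Longrightarrow> \<exists>p. is_lincomb T A \<one> f G p (\<lambda>g. g)"
    using finite_dim[of A \<one>] unfolding effects_def by metis
  have b: "\<forall>g\<in>G. bounded ((\<lambda>\<rho>. \<langle>g, \<rho>\<rangle>) ` X)"
    using pairing_range[of _ A] G(2) assms by (force simp: bounded_iff intro!: exI[of _ 1])
  obtain n :: nat and \<sigma> E C where w: "(\<forall>i<n. \<sigma> i \<in> X \<and> (\<forall>\<rho>\<in>X. \<bar>E i \<rho>\<bar> \<le> C)) \<and>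
      (\<forall>f p. (\<forall>\<rho>\<in>X. f \<rho> = (\<Sum>g\<in>G. p g * \<langle>g, \<rho>\<rangle>)) \<longrightarrow> (\<forall>\<rho>\<in>X. f \<rho> = (\<Sum>i<n. f (\<sigma> i) * E i \<rho>)))"
    using interpolation[where \<phi> = "\<lambda>g b. \<langle>g, b\<rangle>", OF G(1) b] by (elim exE) (rule that)
  have "\<langle>a, \<rho>\<rangle> = (\<Sum>i<n. \<langle>a, \<sigma> i\<rangle> * E i \<rho>)" if "a \<in> effects T A" "\<rho> \<in> X" for \<rho> a
  proof -
    obtain p where "is_lincomb T A \<one> a G p (\<lambda>g. g)" using G(3)[OF \<open>a \<in> effects T A\<close>] by blast
    then have "\<forall>\<rho>\<in>X. \<langle>a, \<rho>\<rangle> = (\<Sum>g\<in>G. p g * \<langle>g, \<rho>\<rangle>)"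
      using assms by (auto simp: effect_lincomb_iff)
    with w[THEN conjunct2, rule_format, of "\<lambda>\<rho>. \<langle>a, \<rho>\<rangle>" p] that(2) show ?thesis by blast
  qed
  with w show ?thesis by (intro exI[of _ n] exI[of _ \<sigma>] exI[of _ E] exI[of _ C]) blast
qed

text \<open>Both arguments vary. The varying effect is expanded over fixed effects with bounded
  coefficients, so replacing \<open>\<rho> k\<close> by its limit costs an error that
  vanishes.\<close>

lemma pairing_tendsto:
  assumes e: "\<And>k. e k \<in> effects T A" and s: "\<And>k. \<rho> k \<in> states T A" "\<sigma> \<in> states T A"
    and el: "\<And>\<tau>. \<tau> \<in> states T A \<Longrightarrow> (\<lambda>k. \<langle>e k, \<tau>\<rangle>) \<longlonglongrightarrow> \<langle>b, \<tau>\<rangle>"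
    and sl: "\<And>a. a \<in> effects T A \<Longrightarrow> (\<lambda>k. \<langle>a, \<rho> k\<rangle>) \<longlonglongrightarrow> \<langle>a, \<sigma>\<rangle>"
  shows "(\<lambda>k. \<langle>e k, \<rho> k\<rangle>) \<longlonglongrightarrow> \<langle>b, \<sigma>\<rangle>"
proof -
  obtain n :: nat and a E C where aE: "(\<forall>i<n. a i \<in> effects T A \<and> (\<forall>b\<in>effects T A. \<bar>E i b\<bar> \<le> C)) \<and>
      (\<forall>\<rho>\<in>states T A. \<forall>b\<in>effects T A. \<langle>b, \<rho>\<rangle> = (\<Sum>i<n. \<langle>a i, \<rho>\<rangle> * E i b))"
    using effect_coordinates[OF subset_refl, of A] by (elim exE) (rule that)
  then have a: "\<And>i. i < n \<Longrightarrow> a i \<in> effects T A"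
    and C: "\<And>i b. i < n \<Longrightarrow> b \<in> effects T A \<Longrightarrow> \<bar>E i b\<bar> \<le> C"
    and eq: "\<And>\<rho> b. \<rho> \<in> states T A \<Longrightarrow> b \<in> effects T A \<Longrightarrow> \<langle>b, \<rho>\<rangle> = (\<Sum>i<n. \<langle>a i, \<rho>\<rangle> * E i b)"
    by blast+
  have "(\<lambda>k. (\<langle>a i, \<rho> k\<rangle> - \<langle>a i, \<sigma>\<rangle>) * E i (e k)) \<longlonglongrightarrow> 0" if i: "i < n" for i
  proof (rule Lim_null_comparison)
    show "\<forall>\<^sub>F k in sequentially. norm ((\<langle>a i, \<rho> k\<rangle> - \<langle>a i, \<sigma>\<rangle>) * E i (e k)) \<le> \<bar>\<langle>a i, \<rho> k\<rangle> - \<langle>a i, \<sigma>\<rangle>\<bar> * C"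
      using C[OF i e] by (auto simp: abs_mult intro!: mult_left_mono always_eventually)
    have "(\<lambda>k. \<langle>a i, \<rho> k\<rangle> - \<langle>a i, \<sigma>\<rangle>) \<longlonglongrightarrow> 0"
      using sl[OF a[OF i]] by (simp add: LIM_zero_iff)
    then show "(\<lambda>k. \<bar>\<langle>a i, \<rho> k\<rangle> - \<langle>a i, \<sigma>\<rangle>\<bar> * C) \<longlonglongrightarrow> 0"
      by (intro tendsto_mult_left_zero tendsto_rabs_zero)
  qed
  then have "(\<lambda>k. \<Sum>i<n. (\<langle>a i, \<rho> k\<rangle> - \<langle>a i, \<sigma>\<rangle>) * E i (e k)) \<longlonglongrightarrow> 0"
    by (intro tendsto_null_sum) auto
  then have "(\<lambda>k. \<langle>e k, \<rho> k\<rangle> - \<langle>e k, \<sigma>\<rangle>) \<longlonglongrightarrow> 0"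
    using eq[OF s(1) e] eq[OF s(2) e] by (simp add: left_diff_distrib sum_subtractf)
  from tendsto_add[OF this el[OF s(2)]] show ?thesis by simp
qed

end

section \<open>Ensembles and pure states\<close>

context sharp_theory_with_purification
begin

lemma normalised_exists: obtains \<rho> where "normalised T A \<rho>"
proof -
  obtain a \<rho> where a: "a \<in> effects T A" "\<rho> \<in> states T A" "\<langle>a, \<rho>\<rangle> = 1"
    using pure_sharpness by blast
  then have "\<langle>\<epsilon> A, \<rho>\<rangle> \<noteq> 0" using effect_le_discard[OF a(1,2)] by linarith
  with normalise[OF a(2)] that show thesis by metis
qed

text \<open>The factor \<open>w\<close> may exceed 1 as long as the total weight stays admissible,
  since the rescaling passes through the normalised state. A zero state is treated as the zero
  multiple of some normalised state.\<close>

lemma state_scale: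
  assumes s: "\<sigma> \<in> states T A" and w: "0 \<le> w" "w * \<langle>\<epsilon> A, \<sigma>\<rangle> \<le> 1"
  obtains \<tau> where "\<tau> \<in> states T A" "\<And>a. a \<in> effects T A \<Longrightarrow> \<langle>a, \<tau>\<rangle> = w * \<langle>a, \<sigma>\<rangle>"
proof -
  obtain \<sigma>' where n: "normalised T A \<sigma>'" "\<And>a. a \<in> effects T A \<Longrightarrow> \<langle>a, \<sigma>\<rangle> = \<langle>\<epsilon> A, \<sigma>\<rangle> * \<langle>a, \<sigma>'\<rangle>"
  proof (cases "\<langle>\<epsilon> A, \<sigma>\<rangle> = 0")
    case True
    obtain \<sigma>' where n: "normalised T A \<sigma>'" using normalised_exists .
    have "\<langle>a, \<sigma>\<rangle> = 0" if "a \<in> effects T A" for a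
      using effect_le_discard[OF that s] pairing_nonneg[OF that s] True by simp
    with True show thesis by (intro that[OF n]) simp
  qed (use normalise[OF s] that in blast)
  let ?t = "scalar (w * \<langle>\<epsilon> A, \<sigma>\<rangle>)"
  have t: "src T ?t = \<one>" "tgt T ?t = \<one>" "prob T ?t = w * \<langle>\<epsilon> A, \<sigma>\<rangle>"
    using w pairing_nonneg[OF discard_effect s] by (auto intro!: scalar)
  show thesis
  proof (rule that[OF scale_state(1)[OF t(1,2) normalised_state[OF n(1)]]])
    fix a assume a: "a \<in> effects T A"
    show "\<langle>a, \<sigma>' \<cdot> ?t\<rangle> = w * \<langle>a, \<sigma>\<rangle>"
      using scale_state(2)[OF t(1,2) normalised_state[OF n(1)] a] t(3) n(2)[OF a] by simp
  qed
qed

text \<open>Any decomposition of a normalised state arises from a random choice: pick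
  \<open>i\<close> with the weight of \<open>\<sigma> i\<close>, then prepare its normalised
  version.\<close>

lemma preparation_test:
  assumes X: "finite X" and s: "\<And>i. i \<in> X \<Longrightarrow> \<sigma> i \<in> states T A" and one: "(\<Sum>i\<in>X. \<langle>\<epsilon> A, \<sigma> i\<rangle>) = 1"
  shows "test T \<one> A X \<sigma>"
proof -
  have "\<exists>\<sigma>'. i \<in> X \<longrightarrow> normalised T A \<sigma>' \<and> (\<forall>a\<in>effects T A. \<langle>a, \<sigma> i\<rangle> = \<langle>\<epsilon> A, \<sigma> i\<rangle> * \<langle>a, \<sigma>'\<rangle>)" for i
  proof (cases "i \<in> X \<and> \<langle>\<epsilon> A, \<sigma> i\<rangle> \<noteq> 0")
    case True
    then show ?thesis using normalise[OF s] by (metis (no_types, lifting))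
  next
    case False
    obtain \<sigma>' where n: "normalised T A \<sigma>'" using normalised_exists .
    have "\<langle>a, \<sigma> i\<rangle> = 0" if "i \<in> X" "a \<in> effects T A" for a
      using effect_le_discard[OF that(2) s[OF that(1)]] pairing_nonneg[OF that(2) s[OF that(1)]] False that
      by simp
    with n False show ?thesis by auto
  qed
  then obtain \<sigma>' where n: "\<And>i. i \<in> X \<Longrightarrow> normalised T A (\<sigma>' i)" and
    eq: "\<And>i a. i \<in> X \<Longrightarrow> a \<in> effects T A \<Longrightarrow> \<langle>a, \<sigma> i\<rangle> = \<langle>\<epsilon> A, \<sigma> i\<rangle> * \<langle>a, \<sigma>' i\<rangle>"
    by metis
  let ?t = "\<lambda>i. scalar \<langle>\<epsilon> A, \<sigma> i\<rangle>"
  have t: "src T (?t i) = \<one>" "tgt T (?t i) = \<one>" "prob T (?t i) = \<langle>\<epsilon> A, \<sigma> i\<rangle>" if "i \<in> X" for i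
    using pairing_range[OF discard_effect s[OF that]] by (auto intro!: scalar)
  have "test T \<one> \<one> X ?t"
    using X one t by (simp add: triv_test hom_def)
  then have "test T \<one> A X (\<lambda>i. \<sigma>' i \<cdot> ?t i)"
    by (rule test_then) (use n in \<open>simp add: normalised_iff_channel\<close>)
  moreover have "\<sigma>' i \<cdot> ?t i = \<sigma> i" if i: "i \<in> X" for i
  proof (rule state_eqI)
    show "\<sigma>' i \<cdot> ?t i \<in> states T A"
      by (rule scale_state(1)[OF t(1,2)[OF i] normalised_state[OF n[OF i]]])
    fix a assume a: "a \<in> effects T A"
    show "\<langle>a, \<sigma>' i \<cdot> ?t i\<rangle> = \<langle>a, \<sigma> i\<rangle>"
      unfolding scale_state(2)[OF t(1,2)[OF i] normalised_state[OF n[OF i]] a] t(3)[OF i] eq[OF i a] ..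
  qed (rule s[OF i])
  then have "test T \<one> A X (\<lambda>i. \<sigma>' i \<cdot> ?t i) \<longleftrightarrow> test T \<one> A X \<sigma>" by (rule test_cong)
  ultimately show ?thesis by simp
qed

lemma state_cone:
  fixes X :: "'i set"
  assumes X: "finite X" and s: "\<And>i. i \<in> X \<Longrightarrow> \<sigma> i \<in> states T A" and w: "\<And>i. i \<in> X \<Longrightarrow> 0 \<le> w i"
    and le: "(\<Sum>i\<in>X. w i * \<langle>\<epsilon> A, \<sigma> i\<rangle>) \<le> 1"
  obtains \<tau> where "\<tau> \<in> states T A" "\<And>a. a \<in> effects T A \<Longrightarrow> \<langle>a, \<tau>\<rangle> = (\<Sum>i\<in>X. w i * \<langle>a, \<sigma> i\<rangle>)"
proof (cases "X = {}")
  case True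
  obtain \<rho> where "normalised T A \<rho>" using normalised_exists .
  then obtain \<tau> where "\<tau> \<in> states T A" "\<And>a. a \<in> effects T A \<Longrightarrow> \<langle>a, \<tau>\<rangle> = 0 * \<langle>a, \<rho>\<rangle>"
    using state_scale[of \<rho> A 0] normalised_state by auto
  then show thesis using True by (intro that) simp_all
next
  case False
  have nn: "0 \<le> w i * \<langle>\<epsilon> A, \<sigma> i\<rangle>" if "i \<in> X" for i
    using w[OF that] pairing_nonneg[OF discard_effect s[OF that]] by simp
  have "\<exists>\<tau>. i \<in> X \<longrightarrow> \<tau> \<in> states T A \<and> (\<forall>a\<in>effects T A. \<langle>a, \<tau>\<rangle> = w i * \<langle>a, \<sigma> i\<rangle>)" for i
  proof (cases "i \<in> X")
    case True
    have "w i * \<langle>\<epsilon> A, \<sigma> i\<rangle> \<le> (\<Sum>i\<in>X. w i * \<langle>\<epsilon> A, \<sigma> i\<rangle>)"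
      by (rule member_le_sum) (use True X nn in auto)
    then show ?thesis using state_scale[OF s w] True le by (metis (no_types, lifting) order_trans)
  qed simp
  then obtain \<tau> where \<tau>: "\<And>i. i \<in> X \<Longrightarrow> \<tau> i \<in> states T A"
    "\<And>i a. i \<in> X \<Longrightarrow> a \<in> effects T A \<Longrightarrow> \<langle>a, \<tau> i\<rangle> = w i * \<langle>a, \<sigma> i\<rangle>"
    by metis
  obtain \<rho> where \<rho>: "normalised T A \<rho>" using normalised_exists .
  obtain \<kappa> where \<kappa>: "\<kappa> \<in> states T A"
    "\<And>a. a \<in> effects T A \<Longrightarrow> \<langle>a, \<kappa>\<rangle> = (1 - (\<Sum>i\<in>X. w i * \<langle>\<epsilon> A, \<sigma> i\<rangle>)) * \<langle>a, \<rho>\<rangle>"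
    using state_scale[OF normalised_state[OF \<rho>], of "1 - (\<Sum>i\<in>X. w i * \<langle>\<epsilon> A, \<sigma> i\<rangle>)"] le
      sum_nonneg[of X, OF nn] normalised_pairing[OF \<rho>] by auto
  \<comment> \<open>A preparation test has total weight 1, so \<open>None\<close> carries the
    missing weight; merging all other outcomes leaves the desired combination.\<close>
  define c where "c = case_option \<kappa> \<tau>"
  have "(\<Sum>i\<in>insert None (Some ` X). \<langle>\<epsilon> A, c i\<rangle>) = 1"
    using X \<tau>(2) \<kappa>(2) normalised_pairing[OF \<rho>] by (simp add: c_def sum.reindex)
  then have t: "test T \<one> A (insert None (Some ` X)) c"
    using X \<tau>(1) \<kappa>(1) by (intro preparation_test) (auto simp: c_def)
  define g where "g = case_option (0::nat) (\<lambda>_::'i. 1)"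
  obtain h where h: "\<And>j. j \<in> g ` insert None (Some ` X) \<Longrightarrow>
      is_sum T \<one> A (h j) {i \<in> insert None (Some ` X). g i = j} c"
    using coarse[OF t, where g = g] by blast
  have "{i \<in> insert None (Some ` X). g i = 1} = Some ` X" by (auto simp: g_def)
  moreover have "1 \<in> g ` insert None (Some ` X)" using False by (force simp: g_def image_image)
  ultimately have "is_sum T \<one> A (h 1) (Some ` X) c" using h[of 1] by simp
  then show thesis
    using \<tau>(2) X by (intro that[of "h 1"]) (auto simp: state_lincomb_iff sum.reindex c_def)
qed

lemma mix_states:
  assumes s: "\<sigma> \<in> states T A" "\<tau> \<in> states T A" and w: "0 \<le> v" "0 \<le> w" "v * \<langle>\<epsilon> A, \<sigma>\<rangle> + w * \<langle>\<epsilon> A, \<tau>\<rangle> \<le> 1"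
  obtains \<rho> where "\<rho> \<in> states T A" "\<And>a. a \<in> effects T A \<Longrightarrow> \<langle>a, \<rho>\<rangle> = v * \<langle>a, \<sigma>\<rangle> + w * \<langle>a, \<tau>\<rangle>"
proof -
  obtain \<rho> where "\<rho> \<in> states T A"
    "\<And>a. a \<in> effects T A \<Longrightarrow> \<langle>a, \<rho>\<rangle> = (\<Sum>i\<in>{True, False}. (if i then v else w) * \<langle>a, if i then \<sigma> else \<tau>\<rangle>)"
    by (rule state_cone[of "{True, False}" "\<lambda>i. if i then \<sigma> else \<tau>" A "\<lambda>i. if i then v else w"])
      (use assms in auto)
  then show thesis by (intro that) simp_all
qed

lemma is_multiple_stateI:
  assumes "\<sigma> \<in> states T A" "\<rho> \<in> states T A" "\<And>a. a \<in> effects T A \<Longrightarrow> \<langle>a, \<sigma>\<rangle> = c * \<langle>a, \<rho>\<rangle>"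
  shows "is_multiple T \<one> A \<sigma> \<rho>"
  unfolding is_multiple_def state_lincomb_iff by (rule exI[of _ c]) (use assms in simp)

section \<open>Pure states as extreme points\<close>

text \<open>Merging all outcomes other than \<open>i\<close> turns a decomposition with many parts
  into a convex combination of two. Parts of weight 0 or 1 are settled by domination through the
  deterministic effect.\<close>

lemma pure_if_extreme:
  assumes \<rho>: "normalised T A \<rho>"
    and ext: "\<And>t \<sigma> \<tau>. 0 < t \<Longrightarrow> t < 1 \<Longrightarrow> normalised T A \<sigma> \<Longrightarrow> normalised T A \<tau> \<Longrightarrow>
      (\<And>a. a \<in> effects T A \<Longrightarrow> \<langle>a, \<rho>\<rangle> = t * \<langle>a, \<sigma>\<rangle> + (1 - t) * \<langle>a, \<tau>\<rangle>) \<Longrightarrow> \<sigma> = \<rho>"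
  shows "pure T \<rho>"
  unfolding pure_def normalised_src[OF \<rho>] normalised_tgt[OF \<rho>]
proof (intro allI impI ballI, elim conjE)
  fix X X0 :: "nat set" and D i
  assume D: "test T \<one> A X D" "X0 \<subseteq> X" "is_sum T \<one> A \<rho> X0 D" and i: "i \<in> X0"
  have fin: "finite X0" and Ds: "\<And>i. i \<in> X0 \<Longrightarrow> D i \<in> states T A"
    using D(3) by (auto simp: state_lincomb_iff)
  have sum: "\<langle>a, \<rho>\<rangle> = \<langle>a, D i\<rangle> + (\<Sum>j\<in>X0 - {i}. \<langle>a, D j\<rangle>)" if "a \<in> effects T A" for a
    using D(3) that sum.remove[OF fin i, of "\<lambda>j. \<langle>a, D j\<rangle>"] by (simp add: state_lincomb_iff)
  let ?t = "\<langle>\<epsilon> A, D i\<rangle>"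
  have t: "0 \<le> ?t" "?t \<le> 1" using pairing_range[OF discard_effect Ds[OF i]] by auto
  obtain \<tau>' where \<tau>': "\<tau>' \<in> states T A" "\<And>a. a \<in> effects T A \<Longrightarrow> \<langle>a, \<tau>'\<rangle> = (\<Sum>j\<in>X0 - {i}. 1 * \<langle>a, D j\<rangle>)"
    using state_cone[of "X0 - {i}" D A "\<lambda>_. 1"] fin Ds sum[OF discard_effect] t
      normalised_pairing[OF \<rho>] by auto
  have sum': "\<langle>a, \<rho>\<rangle> = \<langle>a, D i\<rangle> + \<langle>a, \<tau>'\<rangle>" if "a \<in> effects T A" for a
    using sum \<tau>'(2) that by simp
  have t': "\<langle>\<epsilon> A, \<tau>'\<rangle> = 1 - ?t" using sum'[OF discard_effect] normalised_pairing[OF \<rho>] by simp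
  have zero: "\<langle>a, \<sigma>\<rangle> = 0" if "\<sigma> \<in> states T A" "\<langle>\<epsilon> A, \<sigma>\<rangle> = 0" "a \<in> effects T A" for a \<sigma>
    using effect_le_discard[OF that(3,1)] pairing_nonneg[OF that(3,1)] that(2) by simp
  have "\<langle>a, D i\<rangle> = ?t * \<langle>a, \<rho>\<rangle>" if a: "a \<in> effects T A" for a
  proof -
    consider "?t = 0" | "?t = 1" | "0 < ?t" "?t < 1" using t by linarith
    then show ?thesis
    proof cases
      case 1
      then show ?thesis using zero[OF Ds[OF i] _ a] by simp
    next
      case 2
      then show ?thesis using zero[OF \<tau>'(1) _ a] sum'[OF a] t' by simp
    next
      case 3
      obtain \<sigma> where \<sigma>: "normalised T A \<sigma>" "\<And>a. a \<in> effects T A \<Longrightarrow> \<langle>a, D i\<rangle> = ?t * \<langle>a, \<sigma>\<rangle>"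
        using normalise[OF Ds[OF i]] 3 by auto
      obtain \<tau> where \<tau>: "normalised T A \<tau>" "\<And>a. a \<in> effects T A \<Longrightarrow> \<langle>a, \<tau>'\<rangle> = (1 - ?t) * \<langle>a, \<tau>\<rangle>"
        using normalise[OF \<tau>'(1)] 3 t' by auto
      have "\<sigma> = \<rho>"
      proof (rule ext[OF 3 \<sigma>(1) \<tau>(1)])
        fix b assume b: "b \<in> effects T A"
        show "\<langle>b, \<rho>\<rangle> = ?t * \<langle>b, \<sigma>\<rangle> + (1 - ?t) * \<langle>b, \<tau>\<rangle>"
          unfolding sum'[OF b] \<sigma>(2)[OF b] \<tau>(2)[OF b] ..
      qed
      then show ?thesis using \<sigma>(2)[OF a] by simp
    qed
  qed
  then show "is_multiple T \<one> A (D i) \<rho>"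
    by (rule is_multiple_stateI[OF Ds[OF i] normalised_state[OF \<rho>]])
qed

text \<open>Purity speaks of tests, so the two parts are completed by a third outcome that carries
  the weight missing from \<rho>.\<close>

lemma pure_state_split:
  assumes p: "pure T \<rho>" and \<rho>: "\<rho> \<in> states T A" and s: "\<sigma> \<in> states T A" "\<tau> \<in> states T A"
    and sum: "\<And>a. a \<in> effects T A \<Longrightarrow> \<langle>a, \<rho>\<rangle> = \<langle>a, \<sigma>\<rangle> + \<langle>a, \<tau>\<rangle>"
  obtains c where "\<And>a. a \<in> effects T A \<Longrightarrow> \<langle>a, \<sigma>\<rangle> = c * \<langle>a, \<rho>\<rangle>"
proof -
  obtain \<kappa> where \<kappa>: "normalised T A \<kappa>" using normalised_exists .
  obtain \<kappa>' where \<kappa>': "\<kappa>' \<in> states T A" "\<And>a. a \<in> effects T A \<Longrightarrow> \<langle>a, \<kappa>'\<rangle> = (1 - \<langle>\<epsilon> A, \<rho>\<rangle>) * \<langle>a, \<kappa>\<rangle>"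
    using state_scale[OF normalised_state[OF \<kappa>], of "1 - \<langle>\<epsilon> A, \<rho>\<rangle>"] pairing_range[OF discard_effect \<rho>]
      normalised_pairing[OF \<kappa>] by auto
  define D where "D i = (if i = 0 then \<sigma> else if i = 1 then \<tau> else \<kappa>')" for i :: nat
  have t: "test T \<one> A {0, 1, 2} D"
    using s \<kappa>' sum[OF discard_effect] normalised_pairing[OF \<kappa>]
    by (intro preparation_test) (auto simp: D_def)
  have "is_sum T \<one> A \<rho> {0, 1} D"
    using s sum \<rho> by (auto simp: state_lincomb_iff D_def)
  moreover have "src T \<rho> = \<one>" "tgt T \<rho> = A" using \<rho> by (auto simp: hom_iffs)
  ultimately have "\<forall>i\<in>{0, 1}. is_multiple T \<one> A (D i) \<rho>"
    using p[unfolded pure_def, THEN spec, THEN spec, THEN spec, of "{0, 1, 2}" D "{0, 1}"] t by simp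
  then have "is_multiple T \<one> A (D 0) \<rho>" by simp
  then show thesis using that by (auto simp: is_multiple_def state_lincomb_iff D_def)
qed

lemma pure_extreme:
  assumes p: "pure T \<rho>" "normalised T A \<rho>" and s: "normalised T A \<sigma>" "normalised T A \<tau>" and t: "0 < t" "t \<le> 1"
    and sum: "\<And>a. a \<in> effects T A \<Longrightarrow> \<langle>a, \<rho>\<rangle> = t * \<langle>a, \<sigma>\<rangle> + (1 - t) * \<langle>a, \<tau>\<rangle>"
  shows "\<sigma> = \<rho>"
proof -
  note st = normalised_state[OF s(1)] normalised_state[OF s(2)] normalised_state[OF p(2)]
  note e1 = normalised_pairing[OF s(1)] normalised_pairing[OF s(2)] normalised_pairing[OF p(2)]
  obtain \<sigma>' where \<sigma>': "\<sigma>' \<in> states T A" "\<And>a. a \<in> effects T A \<Longrightarrow> \<langle>a, \<sigma>'\<rangle> = t * \<langle>a, \<sigma>\<rangle>"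
    using state_scale[OF st(1), of t] t e1 by auto
  obtain \<tau>' where \<tau>': "\<tau>' \<in> states T A" "\<And>a. a \<in> effects T A \<Longrightarrow> \<langle>a, \<tau>'\<rangle> = (1 - t) * \<langle>a, \<tau>\<rangle>"
    using state_scale[OF st(2), of "1 - t"] t e1 by auto
  obtain c where c: "\<And>a. a \<in> effects T A \<Longrightarrow> \<langle>a, \<sigma>'\<rangle> = c * \<langle>a, \<rho>\<rangle>"
    by (rule pure_state_split[OF p(1) st(3) \<sigma>'(1) \<tau>'(1)]) (use sum \<sigma>'(2) \<tau>'(2) in auto)
  have "c = t" using c[OF discard_effect] \<sigma>'(2)[OF discard_effect] e1 by simp
  then have "\<langle>a, \<sigma>\<rangle> = \<langle>a, \<rho>\<rangle>" if "a \<in> effects T A" for a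
    using c[OF that] \<sigma>'(2)[OF that] t by simp
  then show ?thesis by (rule state_eqI[OF st(1,3)])
qed

text \<open>A decomposition of the normalised state scales down to one of \<rho>, to which purity
  applies.\<close>

lemma pure_normalise:
  assumes p: "pure T \<rho>" "\<rho> \<in> states T A" and nz: "\<langle>\<epsilon> A, \<rho>\<rangle> \<noteq> 0"
  obtains \<sigma> where "normalised T A \<sigma>" "pure T \<sigma>" "\<And>a. a \<in> effects T A \<Longrightarrow> \<langle>a, \<rho>\<rangle> = \<langle>\<epsilon> A, \<rho>\<rangle> * \<langle>a, \<sigma>\<rangle>"
proof -
  let ?t = "\<langle>\<epsilon> A, \<rho>\<rangle>"
  obtain \<sigma> where s: "normalised T A \<sigma>" "\<And>a. a \<in> effects T A \<Longrightarrow> \<langle>a, \<rho>\<rangle> = ?t * \<langle>a, \<sigma>\<rangle>"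
    using normalise[OF p(2) nz] by blast
  have t: "0 \<le> ?t" "?t \<le> 1" using pairing_range[OF discard_effect p(2)] by auto
  have "pure T \<sigma>"
  proof (rule pure_if_extreme[OF s(1)])
    fix v \<sigma>1 \<sigma>2 assume v: "0 < v" "v < 1" and n: "normalised T A \<sigma>1" "normalised T A \<sigma>2"
      and eq: "\<And>a. a \<in> effects T A \<Longrightarrow> \<langle>a, \<sigma>\<rangle> = v * \<langle>a, \<sigma>1\<rangle> + (1 - v) * \<langle>a, \<sigma>2\<rangle>"
    have le: "?t * v \<le> 1" "?t * (1 - v) \<le> 1" using t v by (auto intro!: mult_le_one)
    obtain \<tau>1 where 1: "\<tau>1 \<in> states T A" "\<And>a. a \<in> effects T A \<Longrightarrow> \<langle>a, \<tau>1\<rangle> = (?t * v) * \<langle>a, \<sigma>1\<rangle>"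
      using state_scale[OF normalised_state[OF n(1)], of "?t * v"] t v le normalised_pairing[OF n(1)] by auto
    obtain \<tau>2 where 2: "\<tau>2 \<in> states T A" "\<And>a. a \<in> effects T A \<Longrightarrow> \<langle>a, \<tau>2\<rangle> = (?t * (1 - v)) * \<langle>a, \<sigma>2\<rangle>"
      using state_scale[OF normalised_state[OF n(2)], of "?t * (1 - v)"] t v le normalised_pairing[OF n(2)] by auto
    obtain c where c: "\<And>a. a \<in> effects T A \<Longrightarrow> \<langle>a, \<tau>1\<rangle> = c * \<langle>a, \<rho>\<rangle>"
    proof (rule pure_state_split[OF p 1(1) 2(1)])
      fix a assume a: "a \<in> effects T A"
      show "\<langle>a, \<rho>\<rangle> = \<langle>a, \<tau>1\<rangle> + \<langle>a, \<tau>2\<rangle>"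
        unfolding s(2)[OF a] 1(2)[OF a] 2(2)[OF a] eq[OF a] by (simp add: algebra_simps)
    qed blast
    have cv: "c = v" using c[OF discard_effect] 1(2)[OF discard_effect] normalised_pairing[OF n(1)] nz by simp
    have "\<langle>a, \<sigma>1\<rangle> = \<langle>a, \<sigma>\<rangle>" if "a \<in> effects T A" for a
      using c[OF that] 1(2)[OF that] s(2)[OF that] v nz by (simp add: cv)
    then show "\<sigma>1 = \<sigma>" by (rule state_eqI[OF normalised_state[OF n(1)] normalised_state[OF s(1)]])
  qed
  with s that show thesis by blast
qed

lemma normalised_limit:
  assumes "\<And>k. normalised T A (F k)" "converges_to T \<one> A F \<sigma>"
  shows "normalised T A \<sigma>"
proof -
  have "(\<lambda>k. \<langle>\<epsilon> A, F k\<rangle>) \<longlonglongrightarrow> \<langle>\<epsilon> A, \<sigma>\<rangle>" by (rule converges_state(2)[OF assms(2) discard_effect])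
  then have "\<langle>\<epsilon> A, \<sigma>\<rangle> = 1" using normalised_pairing[OF assms(1)] by (simp add: LIMSEQ_const_iff)
  then show ?thesis using converges_state(1)[OF assms(2)] by (simp add: normalised_def)
qed

text \<open>Among the maximisers of the effect, one that also maximises a strictly convex function is extreme.\<close>

lemma pure_maximiser:
  assumes e: "e \<in> effects T A"
  obtains \<alpha> where "normalised T A \<alpha>" "pure T \<alpha>" "\<And>\<rho>. normalised T A \<rho> \<Longrightarrow> \<langle>e, \<rho>\<rangle> \<le> \<langle>e, \<alpha>\<rangle>"
proof -
  obtain \<rho>0 where \<rho>0: "normalised T A \<rho>0" "\<And>\<rho>. normalised T A \<rho> \<Longrightarrow> \<langle>e, \<rho>\<rangle> \<le> \<langle>e, \<rho>0\<rangle>"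
  proof (rule hom_maximum[of "{\<rho>. normalised T A \<rho>}" \<one> A "\<lambda>\<rho>. \<langle>e, \<rho>\<rangle>" 1])
    show "{\<rho>. normalised T A \<rho>} \<noteq> {}" using normalised_exists by blast
    show "{\<rho>. normalised T A \<rho>} \<subseteq> hom T \<one> A"
      using normalised_state by (auto simp: states_def)
    show "\<langle>e, f\<rangle> \<le> 1" if "f \<in> {\<rho>. normalised T A \<rho>}" for f
      using that by (intro pairing_le_1[OF e] normalised_state) simp
    fix F f assume F: "\<And>k. F k \<in> {\<rho>. normalised T A \<rho>}" "converges_to T \<one> A F f"
    have "normalised T A f" by (rule normalised_limit[OF _ F(2)]) (use F(1) in simp)
    then show "f \<in> {\<rho>. normalised T A \<rho>} \<and> (\<lambda>k. \<langle>e, F k\<rangle>) \<longlonglongrightarrow> \<langle>e, f\<rangle>"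
      using converges_state(2)[OF F(2) e] by simp
  qed (rule that, blast+)
  obtain n :: nat and a E C where aE: "(\<forall>i<n. a i \<in> effects T A \<and> (\<forall>b\<in>effects T A. \<bar>E i b\<bar> \<le> C)) \<and>
      (\<forall>\<rho>\<in>states T A. \<forall>b\<in>effects T A. \<langle>b, \<rho>\<rangle> = (\<Sum>i<n. \<langle>a i, \<rho>\<rangle> * E i b))"
    using effect_coordinates[OF subset_refl, of A] by (elim exE) (rule that)
  then have a: "\<And>i. i < n \<Longrightarrow> a i \<in> effects T A"
    and eq: "\<And>\<rho> b. \<rho> \<in> states T A \<Longrightarrow> b \<in> effects T A \<Longrightarrow> \<langle>b, \<rho>\<rangle> = (\<Sum>i<n. \<langle>a i, \<rho>\<rangle> * E i b)"
    by blast+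
  define N where "N \<rho> = (\<Sum>i<n. \<langle>a i, \<rho>\<rangle>\<^sup>2)" for \<rho>
  let ?K = "{\<rho>. normalised T A \<rho> \<and> \<langle>e, \<rho>\<rangle> = \<langle>e, \<rho>0\<rangle>}"
  obtain \<alpha> where \<alpha>: "\<alpha> \<in> ?K" "\<And>\<rho>. \<rho> \<in> ?K \<Longrightarrow> N \<rho> \<le> N \<alpha>"
  proof (rule hom_maximum[of ?K \<one> A N n])
    show "?K \<noteq> {}" using \<rho>0(1) by blast
    show "?K \<subseteq> hom T \<one> A" using normalised_state by (auto simp: states_def)
    show "N f \<le> n" if "f \<in> ?K" for f
    proof -
      have "N f \<le> (\<Sum>i<n. 1)" unfolding N_def
        using that pairing_range[OF a normalised_state] by (intro sum_mono) (auto simp: power_le_one)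
      then show ?thesis by simp
    qed
    fix F f assume F: "\<And>k. F k \<in> ?K" "converges_to T \<one> A F f"
    have "(\<lambda>k. \<langle>e, F k\<rangle>) \<longlonglongrightarrow> \<langle>e, f\<rangle>" by (rule converges_state(2)[OF F(2) e])
    then have "\<langle>e, f\<rangle> = \<langle>e, \<rho>0\<rangle>" using F(1) by (simp add: LIMSEQ_const_iff)
    moreover have "normalised T A f" by (rule normalised_limit[OF _ F(2)]) (use F(1) in auto)
    moreover have "(\<lambda>k. N (F k)) \<longlonglongrightarrow> N f"
      unfolding N_def by (intro tendsto_sum tendsto_power converges_state(2)[OF F(2)] a) simp
    ultimately show "f \<in> ?K \<and> (\<lambda>k. N (F k)) \<longlonglongrightarrow> N f" by simp
  qed (rule that, blast+)
  have "pure T \<alpha>"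
  proof (rule pure_if_extreme)
    show "normalised T A \<alpha>" using \<alpha> by simp
    fix t \<sigma> \<tau> assume t: "0 < t" "t < 1" and n: "normalised T A \<sigma>" "normalised T A \<tau>"
      and s: "\<And>a. a \<in> effects T A \<Longrightarrow> \<langle>a, \<alpha>\<rangle> = t * \<langle>a, \<sigma>\<rangle> + (1 - t) * \<langle>a, \<tau>\<rangle>"
    let ?m = "\<langle>e, \<rho>0\<rangle>"
    have m: "\<langle>e, \<sigma>\<rangle> \<le> ?m" "\<langle>e, \<tau>\<rangle> \<le> ?m" using \<rho>0(2) n by auto
    have "t * (?m - \<langle>e, \<sigma>\<rangle>) + (1 - t) * (?m - \<langle>e, \<tau>\<rangle>) = 0" using s[OF e] \<alpha>(1) by (simp add: algebra_simps)
    moreover have "0 \<le> t * (?m - \<langle>e, \<sigma>\<rangle>)" "0 \<le> (1 - t) * (?m - \<langle>e, \<tau>\<rangle>)" using t m by auto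
    ultimately have "t * (?m - \<langle>e, \<sigma>\<rangle>) = 0" "(1 - t) * (?m - \<langle>e, \<tau>\<rangle>) = 0" by linarith+
    then have K: "\<sigma> \<in> ?K" "\<tau> \<in> ?K" using t n by auto
    \<comment> \<open>The subtracted square is the strict convexity defect. Maximality of
      \<open>N \<alpha>\<close> leaves no room for it, so the two parts agree in all
      coordinates.\<close>
    have "N \<alpha> = (\<Sum>i<n. t * \<langle>a i, \<sigma>\<rangle>\<^sup>2 + (1 - t) * \<langle>a i, \<tau>\<rangle>\<^sup>2 - t * (1 - t) * (\<langle>a i, \<sigma>\<rangle> - \<langle>a i, \<tau>\<rangle>)\<^sup>2)"
      unfolding N_def
    proof (rule sum.cong[OF refl])
      fix i assume "i \<in> {..<n}"
      then have ai: "a i \<in> effects T A" by (simp add: a)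
      show "\<langle>a i, \<alpha>\<rangle>\<^sup>2 = t * \<langle>a i, \<sigma>\<rangle>\<^sup>2 + (1 - t) * \<langle>a i, \<tau>\<rangle>\<^sup>2 - t * (1 - t) * (\<langle>a i, \<sigma>\<rangle> - \<langle>a i, \<tau>\<rangle>)\<^sup>2"
        unfolding s[OF ai] by (simp add: power2_eq_square algebra_simps)
    qed
    also have "\<dots> = t * N \<sigma> + (1 - t) * N \<tau> - t * (1 - t) * (\<Sum>i<n. (\<langle>a i, \<sigma>\<rangle> - \<langle>a i, \<tau>\<rangle>)\<^sup>2)"
      by (simp add: N_def sum_subtractf sum.distrib sum_distrib_left)
    also have "t * N \<sigma> + (1 - t) * N \<tau> \<le> t * N \<alpha> + (1 - t) * N \<alpha>"
      using \<alpha>(2) K t by (intro add_mono mult_left_mono) auto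
    finally have "t * (1 - t) * (\<Sum>i<n. (\<langle>a i, \<sigma>\<rangle> - \<langle>a i, \<tau>\<rangle>)\<^sup>2) \<le> 0" by (simp add: algebra_simps)
    moreover have "0 < t * (1 - t)" using t by simp
    ultimately have "(\<Sum>i<n. (\<langle>a i, \<sigma>\<rangle> - \<langle>a i, \<tau>\<rangle>)\<^sup>2) \<le> 0" by (meson mult_pos_pos not_le)
    then have "(\<Sum>i<n. (\<langle>a i, \<sigma>\<rangle> - \<langle>a i, \<tau>\<rangle>)\<^sup>2) = 0" by (simp add: sum_nonneg order_antisym)
    then have eqa: "\<langle>a i, \<sigma>\<rangle> = \<langle>a i, \<tau>\<rangle>" if "i < n" for i
      using that by (simp add: sum_nonneg_eq_0_iff)
    have "\<langle>b, \<sigma>\<rangle> = \<langle>b, \<alpha>\<rangle>" if b: "b \<in> effects T A" for b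
      using eq[OF normalised_state[OF n(1)] b] eq[OF normalised_state[OF n(2)] b] eqa s[OF b]
      by (simp add: algebra_simps)
    then show "\<sigma> = \<alpha>" using \<alpha>(1) n by (intro state_eqI[of _ A]) (auto intro: normalised_state)
  qed
  with \<alpha>(1) \<rho>0(2) that show thesis by auto
qed

lemma pure_exists: obtains \<alpha> where "normalised T A \<alpha>" "pure T \<alpha>"
  using pure_maximiser[OF discard_effect] by metis

end

section \<open>Reversible channels and invariant states\<close>

context sharp_theory_with_purification
begin

lemma reversible_channel: "reversible T A B U \<Longrightarrow> channel T A B U"
  by (simp add: reversible_def)

lemma reversible_src: "reversible T A B U \<Longrightarrow> src T U = A"
  and reversible_tgt: "reversible T A B U \<Longrightarrow> tgt T U = B"
  by (auto dest: reversible_channel channel_src channel_tgt)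

lemma reversible_inverse:
  assumes "reversible T A B U"
  obtains V where "reversible T B A V" "V \<cdot> U = \<iota> A" "U \<cdot> V = \<iota> B"
  using assms unfolding reversible_def by blast

lemma reversible_ident: "reversible T A A (\<iota> A)"
  using test_ident by (auto simp: reversible_def intro!: exI[of _ "\<iota> A"])

lemma reversible_swp: "reversible T (A \<boxtimes> B) (B \<boxtimes> A) (swp T A B)"
  using test_swp by (auto simp: reversible_def swp_swp intro!: exI[of _ "swp T B A"])

lemma reversible_seq:
  assumes "reversible T A B U" "reversible T B C V"
  shows "reversible T A C (V \<cdot> U)"
proof -
  obtain U' where U': "reversible T B A U'" "U' \<cdot> U = \<iota> A" "U \<cdot> U' = \<iota> B"
    using reversible_inverse[OF assms(1)] .
  obtain V' where V': "reversible T C B V'" "V' \<cdot> V = \<iota> B" "V \<cdot> V' = \<iota> C"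
    using reversible_inverse[OF assms(2)] .
  note ty = reversible_src[OF assms(1)] reversible_tgt[OF assms(1)] reversible_src[OF assms(2)]
    reversible_tgt[OF assms(2)] reversible_src[OF U'(1)] reversible_tgt[OF U'(1)]
    reversible_src[OF V'(1)] reversible_tgt[OF V'(1)]
  have "(U' \<cdot> V') \<cdot> (V \<cdot> U) = U' \<cdot> ((V' \<cdot> V) \<cdot> U)" "(V \<cdot> U) \<cdot> (U' \<cdot> V') = V \<cdot> ((U \<cdot> U') \<cdot> V')"
    by (simp_all add: ty assoc)
  then have "(U' \<cdot> V') \<cdot> (V \<cdot> U) = \<iota> A" "(V \<cdot> U) \<cdot> (U' \<cdot> V') = \<iota> C"
    using U' V' ty by simp_all
  then show ?thesis
    unfolding reversible_def
    using channel_seq[OF reversible_channel[OF assms(1)] reversible_channel[OF assms(2)]]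
      channel_seq[OF reversible_channel[OF V'(1)] reversible_channel[OF U'(1)]] by blast
qed

lemma reversible_par:
  assumes "reversible T A B U" "reversible T A' B' V"
  shows "reversible T (A \<boxtimes> A') (B \<boxtimes> B') (U \<otimes> V)"
proof -
  obtain U' where U': "reversible T B A U'" "U' \<cdot> U = \<iota> A" "U \<cdot> U' = \<iota> B"
    using reversible_inverse[OF assms(1)] .
  obtain V' where V': "reversible T B' A' V'" "V' \<cdot> V = \<iota> A'" "V \<cdot> V' = \<iota> B'"
    using reversible_inverse[OF assms(2)] .
  note ty = reversible_src[OF assms(1)] reversible_tgt[OF assms(1)] reversible_src[OF assms(2)]
    reversible_tgt[OF assms(2)] reversible_src[OF U'(1)] reversible_tgt[OF U'(1)]
    reversible_src[OF V'(1)] reversible_tgt[OF V'(1)]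
  have "(U' \<otimes> V') \<cdot> (U \<otimes> V) = \<iota> (A \<boxtimes> A')" "(U \<otimes> V) \<cdot> (U' \<otimes> V') = \<iota> (B \<boxtimes> B')"
    using U' V' ty by (simp_all add: par_seq par_ident)
  then show ?thesis
    unfolding reversible_def
    using channel_par[OF reversible_channel[OF assms(1)] reversible_channel[OF assms(2)]]
      channel_par[OF reversible_channel[OF U'(1)] reversible_channel[OF V'(1)]] by blast
qed

lemma reversible_cancel:
  assumes "reversible T B A V" "V \<cdot> U = \<iota> A" "reversible T A B U" "tgt T f = A"
  shows "V \<cdot> (U \<cdot> f) = f"
  using assms assoc[of f U V] reversible_src[of A B U] reversible_tgt[of A B U] reversible_src[of B A V]
  by simp

lemma reversible_pairing:
  assumes U: "reversible T A B U" and V: "reversible T B A V" "V \<cdot> U = \<iota> A"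
    and a: "a \<in> effects T A" and r: "\<rho> \<in> states T A"
  shows "\<langle>a \<cdot> V, U \<cdot> \<rho>\<rangle> = \<langle>a, \<rho>\<rangle>"
proof -
  have "\<langle>a \<cdot> V, U \<cdot> \<rho>\<rangle> = \<langle>a, V \<cdot> (U \<cdot> \<rho>)\<rangle>"
    using a r reversible_src[OF U] reversible_tgt[OF U] reversible_src[OF V(1)] reversible_tgt[OF V(1)]
    by (subst pairing_seq) (simp_all add: hom_iffs)
  also have "\<dots> = \<langle>a, \<rho>\<rangle>"
    using reversible_cancel[OF V U, of \<rho>] r by (simp add: hom_iffs)
  finally show ?thesis .
qed

lemma effect_channel: "a \<in> effects T B \<Longrightarrow> channel T A B f \<Longrightarrow> a \<cdot> f \<in> effects T A"
  by (frule channel_src, drule channel_tgt) (simp add: hom_iffs)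

lemma channel_state: "\<rho> \<in> states T A \<Longrightarrow> channel T A B f \<Longrightarrow> f \<cdot> \<rho> \<in> states T B"
  by (frule channel_src, drule channel_tgt) (simp add: hom_iffs)

lemma pairing_channel: "a \<in> effects T B \<Longrightarrow> channel T A B f \<Longrightarrow> \<rho> \<in> states T A \<Longrightarrow> \<langle>a, f \<cdot> \<rho>\<rangle> = \<langle>a \<cdot> f, \<rho>\<rangle>"
  by (rule pairing_seq) (auto dest: channel_src channel_tgt simp: hom_iffs)

section \<open>Interior states\<close>

text \<open>Interior points of the convex set of normalised states. The weight \<open>e\<close> is a
  parameter, the same for all \<open>\<sigma>\<close>, so that midpoints, images under reversible
  channels and limits stay inside one fixed set.\<close>

definition mixed :: "'s \<Rightarrow> real \<Rightarrow> 't \<Rightarrow> bool" where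
  "mixed A e \<omega> \<longleftrightarrow> normalised T A \<omega> \<and> (\<forall>\<sigma>. normalised T A \<sigma> \<longrightarrow>
     (\<exists>\<tau>. normalised T A \<tau> \<and> (\<forall>a\<in>effects T A. \<langle>a, \<omega>\<rangle> = e * \<langle>a, \<sigma>\<rangle> + (1 - e) * \<langle>a, \<tau>\<rangle>)))"

lemma mixed_exists:
  obtains e \<omega> where "0 < e" "e < 1" "mixed A e \<omega>"
proof -
  let ?X = "{\<rho>. normalised T A \<rho>}"
  have sub: "?X \<subseteq> states T A" using normalised_state by blast
  obtain n :: nat and \<sigma> E C where *: "(\<forall>i<n. \<sigma> i \<in> ?X \<and> (\<forall>\<rho>\<in>?X. \<bar>E i \<rho>\<bar> \<le> C)) \<and>
      (\<forall>a\<in>effects T A. \<forall>\<rho>\<in>?X. \<langle>a, \<rho>\<rangle> = (\<Sum>i<n. \<langle>a, \<sigma> i\<rangle> * E i \<rho>))"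
    using state_coordinates[OF sub] by (elim exE) (rule that)
  have s: "\<And>i. i < n \<Longrightarrow> normalised T A (\<sigma> i)" and C: "\<And>i \<rho>. i < n \<Longrightarrow> normalised T A \<rho> \<Longrightarrow> \<bar>E i \<rho>\<bar> \<le> C"
    and eq: "\<And>a \<rho>. a \<in> effects T A \<Longrightarrow> normalised T A \<rho> \<Longrightarrow> \<langle>a, \<rho>\<rangle> = (\<Sum>i<n. \<langle>a, \<sigma> i\<rangle> * E i \<rho>)"
    using * by auto
  have E1: "(\<Sum>i<n. E i \<rho>) = 1" if "normalised T A \<rho>" for \<rho>
    using eq[OF discard_effect that] normalised_pairing[OF that] normalised_pairing[OF s] by simp
  obtain \<rho>0 where "normalised T A \<rho>0" using normalised_exists .
  from E1[OF this] have n: "0 < n" by (cases n) auto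
  \<comment> \<open>The coefficients are bounded by \<open>C\<close>, so
    \<open>e * E i \<rho>\<close> is at most half of \<open>1 / n\<close>, and removing
    \<open>e\<close> times \<rho> from the uniform mixture of the nodes leaves nonnegative weights.
    The summand 1 prevents a division by zero, and \<open>n > 0\<close> gives
    \<open>e < 1\<close>.\<close>
  define e where "e = 1 / (2 * n * (\<bar>C\<bar> + 1))"
  have e: "0 < e" "e < 1"
  proof -
    show "0 < e" using n by (simp add: e_def add_nonneg_pos)
    have "1 * 1 \<le> real n * (\<bar>C\<bar> + 1)" using n by (intro mult_mono) auto
    then have "1 < 2 * real n * (\<bar>C\<bar> + 1)" by simp
    then show "e < 1" by (simp add: e_def)
  qed
  have small: "e * E i \<rho> \<le> 1 / n" if "i < n" "normalised T A \<rho>" for i \<rho>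
  proof -
    have "e * E i \<rho> \<le> e * (\<bar>C\<bar> + 1)" using C[OF that] e(1) by (intro mult_left_mono) auto
    also have "\<dots> = 1 / (2 * n)" by (simp add: e_def add_nonneg_eq_0_iff)
    also have "\<dots> \<le> 1 / n" using n by (simp add: field_simps)
    finally show ?thesis .
  qed
  obtain \<omega> where \<omega>: "\<omega> \<in> states T A" "\<And>a. a \<in> effects T A \<Longrightarrow> \<langle>a, \<omega>\<rangle> = (\<Sum>i<n. 1 / n * \<langle>a, \<sigma> i\<rangle>)"
    by (rule state_cone[of "{..<n}" \<sigma> A "\<lambda>_. 1 / n"])
      (use s normalised_state normalised_pairing n in auto)
  have \<omega>n: "normalised T A \<omega>"
    using \<omega> n normalised_pairing[OF s] by (simp add: normalised_def)
  have "mixed A e \<omega>"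
    unfolding mixed_def
  proof (intro conjI allI impI \<omega>n)
    fix \<rho> assume \<rho>: "normalised T A \<rho>"
    let ?w = "\<lambda>i. (1 / n - e * E i \<rho>) / (1 - e)"
    have w: "0 \<le> ?w i" if "i < n" for i using small[OF that \<rho>] e by simp
    have tot: "(\<Sum>i<n. ?w i) = 1"
    proof -
      have "(\<Sum>i<n. ?w i) = ((\<Sum>i<n. 1 / n) - e * (\<Sum>i<n. E i \<rho>)) / (1 - e)"
        by (simp only: sum_divide_distrib[symmetric] sum_subtractf sum_distrib_left)
      then show ?thesis using E1[OF \<rho>] n e by simp
    qed
    obtain \<tau> where \<tau>: "\<tau> \<in> states T A" "\<And>a. a \<in> effects T A \<Longrightarrow> \<langle>a, \<tau>\<rangle> = (\<Sum>i<n. ?w i * \<langle>a, \<sigma> i\<rangle>)"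
      by (rule state_cone[of "{..<n}" \<sigma> A ?w])
        (use s normalised_state normalised_pairing w tot in auto)
    have "normalised T A \<tau>" using \<tau> tot normalised_pairing[OF s] by (simp add: normalised_def)
    moreover have "\<langle>a, \<omega>\<rangle> = e * \<langle>a, \<rho>\<rangle> + (1 - e) * \<langle>a, \<tau>\<rangle>" if a: "a \<in> effects T A" for a
    proof -
      have "(1 - e) * \<langle>a, \<tau>\<rangle> = (\<Sum>i<n. (1 / n - e * E i \<rho>) * \<langle>a, \<sigma> i\<rangle>)"
        using \<tau>(2)[OF a] e by (simp add: sum_distrib_left)
      also have "\<dots> = \<langle>a, \<omega>\<rangle> - e * \<langle>a, \<rho>\<rangle>"
        unfolding \<omega>(2)[OF a] eq[OF a \<rho>] sum_distrib_left sum_subtractf[symmetric]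
        by (rule sum.cong) (simp_all add: algebra_simps)
      finally show ?thesis by simp
    qed
    ultimately show "\<exists>\<tau>. normalised T A \<tau> \<and> (\<forall>a\<in>effects T A. \<langle>a, \<omega>\<rangle> = e * \<langle>a, \<rho>\<rangle> + (1 - e) * \<langle>a, \<tau>\<rangle>)"
      by blast
  qed
  with e that show thesis by blast
qed

lemma normalised_midpoint:
  assumes "normalised T A \<sigma>" "normalised T A \<tau>"
  obtains \<mu> where "normalised T A \<mu>" "\<And>a. a \<in> effects T A \<Longrightarrow> \<langle>a, \<mu>\<rangle> = (\<langle>a, \<sigma>\<rangle> + \<langle>a, \<tau>\<rangle>) / 2"
proof -
  note n = normalised_state[OF assms(1)] normalised_state[OF assms(2)]
    normalised_pairing[OF assms(1)] normalised_pairing[OF assms(2)]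
  obtain \<mu> where \<mu>: "\<mu> \<in> states T A" "\<And>a. a \<in> effects T A \<Longrightarrow> \<langle>a, \<mu>\<rangle> = 1/2 * \<langle>a, \<sigma>\<rangle> + 1/2 * \<langle>a, \<tau>\<rangle>"
    by (rule mix_states[OF n(1,2), of "1/2" "1/2"]) (simp_all add: n)
  show thesis
  proof (rule that)
    show "normalised T A \<mu>" using \<mu>(1) \<mu>(2)[OF discard_effect] n by (simp add: normalised_def)
    show "\<langle>a, \<mu>\<rangle> = (\<langle>a, \<sigma>\<rangle> + \<langle>a, \<tau>\<rangle>) / 2" if "a \<in> effects T A" for a
      using \<mu>(2)[OF that] by simp
  qed
qed

lemma mixed_midpoint:
  assumes m: "mixed A e \<sigma>" "mixed A e \<tau>" and \<mu>: "normalised T A \<mu>"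
    "\<And>a. a \<in> effects T A \<Longrightarrow> \<langle>a, \<mu>\<rangle> = (\<langle>a, \<sigma>\<rangle> + \<langle>a, \<tau>\<rangle>) / 2"
  shows "mixed A e \<mu>"
  unfolding mixed_def
proof (intro conjI allI impI \<mu>(1))
  fix \<rho> assume \<rho>: "normalised T A \<rho>"
  obtain \<sigma>' where \<sigma>': "normalised T A \<sigma>'" "\<And>a. a \<in> effects T A \<Longrightarrow> \<langle>a, \<sigma>\<rangle> = e * \<langle>a, \<rho>\<rangle> + (1 - e) * \<langle>a, \<sigma>'\<rangle>"
    using m(1) \<rho> unfolding mixed_def by blast
  obtain \<tau>' where \<tau>': "normalised T A \<tau>'" "\<And>a. a \<in> effects T A \<Longrightarrow> \<langle>a, \<tau>\<rangle> = e * \<langle>a, \<rho>\<rangle> + (1 - e) * \<langle>a, \<tau>'\<rangle>"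
    using m(2) \<rho> unfolding mixed_def by blast
  obtain \<kappa> where \<kappa>: "normalised T A \<kappa>" "\<And>a. a \<in> effects T A \<Longrightarrow> \<langle>a, \<kappa>\<rangle> = (\<langle>a, \<sigma>'\<rangle> + \<langle>a, \<tau>'\<rangle>) / 2"
    using normalised_midpoint[OF \<sigma>'(1) \<tau>'(1)] by blast
  have "\<langle>a, \<mu>\<rangle> = e * \<langle>a, \<rho>\<rangle> + (1 - e) * \<langle>a, \<kappa>\<rangle>" if "a \<in> effects T A" for a
    unfolding \<mu>(2)[OF that] \<sigma>'(2)[OF that] \<tau>'(2)[OF that] \<kappa>(2)[OF that] by (simp add: field_simps)
  with \<kappa>(1) show "\<exists>\<tau>. normalised T A \<tau> \<and> (\<forall>a\<in>effects T A. \<langle>a, \<mu>\<rangle> = e * \<langle>a, \<rho>\<rangle> + (1 - e) * \<langle>a, \<tau>\<rangle>)"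
    by blast
qed

lemma mixed_reversible:
  assumes m: "mixed A e \<omega>" and U: "reversible T A A U"
  shows "mixed A e (U \<cdot> \<omega>)"
  unfolding mixed_def
proof (intro conjI allI impI)
  have \<omega>: "normalised T A \<omega>" using m by (simp add: mixed_def)
  then show "normalised T A (U \<cdot> \<omega>)" by (rule channel_normalised[OF reversible_channel[OF U]])
  fix \<rho> assume \<rho>: "normalised T A \<rho>"
  obtain V where V: "reversible T A A V" "V \<cdot> U = \<iota> A" "U \<cdot> V = \<iota> A" using reversible_inverse[OF U] .
  have Vr: "normalised T A (V \<cdot> \<rho>)" by (rule channel_normalised[OF reversible_channel[OF V(1)] \<rho>])
  obtain \<tau> where \<tau>: "normalised T A \<tau>" "\<And>a. a \<in> effects T A \<Longrightarrow> \<langle>a, \<omega>\<rangle> = e * \<langle>a, V \<cdot> \<rho>\<rangle> + (1 - e) * \<langle>a, \<tau>\<rangle>"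
    using m Vr unfolding mixed_def by blast
  have "\<langle>a, U \<cdot> \<omega>\<rangle> = e * \<langle>a, \<rho>\<rangle> + (1 - e) * \<langle>a, U \<cdot> \<tau>\<rangle>" if a: "a \<in> effects T A" for a
  proof -
    note aU = effect_channel[OF a reversible_channel[OF U]]
    note pc = pairing_channel[OF a reversible_channel[OF U]]
    have "U \<cdot> (V \<cdot> \<rho>) = \<rho>" by (rule reversible_cancel[OF U V(3,1) normalised_tgt[OF \<rho>]])
    then have "\<langle>a \<cdot> U, V \<cdot> \<rho>\<rangle> = \<langle>a, \<rho>\<rangle>" using pc[OF normalised_state[OF Vr]] by simp
    then show ?thesis
      using \<tau>(2)[OF aU] by (simp add: pc normalised_state[OF \<omega>] normalised_state[OF \<tau>(1)])
  qed
  moreover have "normalised T A (U \<cdot> \<tau>)" by (rule channel_normalised[OF reversible_channel[OF U] \<tau>(1)])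
  ultimately show "\<exists>\<tau>. normalised T A \<tau> \<and> (\<forall>a\<in>effects T A. \<langle>a, U \<cdot> \<omega>\<rangle> = e * \<langle>a, \<rho>\<rangle> + (1 - e) * \<langle>a, \<tau>\<rangle>)"
    by blast
qed

text \<open>Since \<open>e\<close> is fixed and below 1, the complementary states
  \<open>\<tau> k\<close> are affine functions of \<open>F k\<close> and converge together with
  it.\<close>

lemma mixed_limit:
  assumes m: "\<And>k. mixed A e (F k)" and lim: "converges_to T \<one> A F \<omega>" and e: "e < 1"
  shows "mixed A e \<omega>"
  unfolding mixed_def
proof (intro conjI allI impI)
  show "normalised T A \<omega>" by (rule normalised_limit[OF _ lim]) (use m in \<open>simp add: mixed_def\<close>)
  fix \<rho> assume \<rho>: "normalised T A \<rho>"
  have "\<exists>\<tau>. normalised T A \<tau> \<and> (\<forall>a\<in>effects T A. \<langle>a, F k\<rangle> = e * \<langle>a, \<rho>\<rangle> + (1 - e) * \<langle>a, \<tau>\<rangle>)" for k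
    using m[of k] \<rho> unfolding mixed_def by blast
  then obtain \<tau> where \<tau>: "\<And>k. normalised T A (\<tau> k)"
    "\<And>k a. a \<in> effects T A \<Longrightarrow> \<langle>a, F k\<rangle> = e * \<langle>a, \<rho>\<rangle> + (1 - e) * \<langle>a, \<tau> k\<rangle>"
    by metis
  have c: "(\<lambda>k. \<langle>a, \<tau> k\<rangle>) \<longlonglongrightarrow> (\<langle>a, \<omega>\<rangle> - e * \<langle>a, \<rho>\<rangle>) / (1 - e)" if a: "a \<in> effects T A" for a
  proof -
    have "\<langle>a, \<tau> k\<rangle> = (\<langle>a, F k\<rangle> - e * \<langle>a, \<rho>\<rangle>) / (1 - e)" for k using \<tau>(2)[OF a, of k] e by simp
    then show ?thesis using e by (auto intro!: tendsto_intros converges_state(2)[OF lim a])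
  qed
  obtain \<kappa> where \<kappa>: "converges_to T \<one> A \<tau> \<kappa>"
    using state_limit[of \<tau> A] normalised_state[OF \<tau>(1)] c convergentI by metis
  have "\<langle>a, \<omega>\<rangle> = e * \<langle>a, \<rho>\<rangle> + (1 - e) * \<langle>a, \<kappa>\<rangle>" if a: "a \<in> effects T A" for a
  proof -
    have "\<langle>a, \<kappa>\<rangle> = (\<langle>a, \<omega>\<rangle> - e * \<langle>a, \<rho>\<rangle>) / (1 - e)"
      by (rule LIMSEQ_unique[OF converges_state(2)[OF \<kappa> a] c[OF a]])
    then show ?thesis using e by simp
  qed
  with normalised_limit[OF \<tau>(1) \<kappa>]
  show "\<exists>\<tau>. normalised T A \<tau> \<and> (\<forall>a\<in>effects T A. \<langle>a, \<omega>\<rangle> = e * \<langle>a, \<rho>\<rangle> + (1 - e) * \<langle>a, \<tau>\<rangle>)"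
    by blast
qed

text \<open>
  The supremum over the reversible group of a Euclidean norm squared is an invariant, uniformly convex
  function; its unique minimiser is invariant.  This replaces averaging over the group.
\<close>

lemma invariant_mixed_exists:
  obtains e \<xi> where "0 < e" "e < 1" "mixed A e \<xi>" "\<And>U. reversible T A A U \<Longrightarrow> U \<cdot> \<xi> = \<xi>"
proof -
  obtain e \<omega>0 where e: "0 < e" "e < 1" and \<omega>0: "mixed A e \<omega>0" using mixed_exists .
  obtain n :: nat and a E C where aE: "(\<forall>i<n. a i \<in> effects T A \<and> (\<forall>b\<in>effects T A. \<bar>E i b\<bar> \<le> C)) \<and>
      (\<forall>\<rho>\<in>states T A. \<forall>b\<in>effects T A. \<langle>b, \<rho>\<rangle> = (\<Sum>i<n. \<langle>a i, \<rho>\<rangle> * E i b))"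
    using effect_coordinates[OF subset_refl, of A] by (elim exE) (rule that)
  have a: "\<And>i. i < n \<Longrightarrow> a i \<in> effects T A"
    and C: "\<And>i b. i < n \<Longrightarrow> b \<in> effects T A \<Longrightarrow> \<bar>E i b\<bar> \<le> C"
    and eq: "\<And>\<rho> b. \<rho> \<in> states T A \<Longrightarrow> b \<in> effects T A \<Longrightarrow> \<langle>b, \<rho>\<rangle> = (\<Sum>i<n. \<langle>a i, \<rho>\<rangle> * E i b)"
    using aE by blast+
  define R where "R = {U. reversible T A A U}"
  define N where "N \<rho> = (\<Sum>i<n. \<langle>a i, \<rho>\<rangle>\<^sup>2)" for \<rho>
  define D where "D \<rho> \<sigma> = (\<Sum>i<n. (\<langle>a i, \<rho>\<rangle> - \<langle>a i, \<sigma>\<rangle>)\<^sup>2)" for \<rho> \<sigma>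
  define f where "f \<rho> = (SUP U\<in>R. N (U \<cdot> \<rho>))" for \<rho>
  \<comment> \<open>Bounds from below how much a reversible channel can shrink distances.
    Coordinates before \<open>U\<close> are combinations of coordinates after \<open>U\<close> with
    coefficients bounded by \<open>C\<close> independently of \<open>U\<close>; Cauchy-Schwarz then
    costs the factor \<open>n * (C^2 * n)\<close>. The summand 1 keeps the denominator
    positive.\<close>
  define c where "c = 1 / (real n * (C\<^sup>2 * real n) + 1)"
  have c: "0 < c" unfolding c_def by (simp add: add_nonneg_pos)
  have RU: "U \<in> R \<Longrightarrow> reversible T A A U" for U by (simp add: R_def)
  have Un: "normalised T A (U \<cdot> \<rho>)" if "U \<in> R" "normalised T A \<rho>" for U \<rho>
    by (rule channel_normalised[OF reversible_channel[OF RU[OF that(1)]] that(2)])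
  have Rne: "R \<noteq> {}" using reversible_ident by (auto simp: R_def)
  have Nle: "N \<rho> \<le> n" if "normalised T A \<rho>" for \<rho>
  proof -
    have "N \<rho> \<le> (\<Sum>i<n. 1)" unfolding N_def
      using pairing_range[OF a normalised_state[OF that]] by (intro sum_mono) (auto simp: power_le_one)
    then show ?thesis by simp
  qed
  have bdd: "bdd_above ((\<lambda>U. N (U \<cdot> \<rho>)) ` R)" if "normalised T A \<rho>" for \<rho>
    using Nle[OF Un[OF _ that]] by (auto simp: bdd_above_def)
  have f_upper: "N (U \<cdot> \<rho>) \<le> f \<rho>" if "U \<in> R" "normalised T A \<rho>" for U \<rho>
    unfolding f_def by (rule cSUP_upper[OF that(1) bdd[OF that(2)]])
  have f_least: "f \<rho> \<le> x" if "\<And>U. U \<in> R \<Longrightarrow> N (U \<cdot> \<rho>) \<le> x" for \<rho> x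
    unfolding f_def by (rule cSUP_least[OF Rne that])
  have D_le: "c * D \<rho> \<sigma> \<le> D (U \<cdot> \<rho>) (U \<cdot> \<sigma>)"
    if U: "U \<in> R" and n\<rho>: "normalised T A \<rho>" and n\<sigma>: "normalised T A \<sigma>" for U \<rho> \<sigma>
  proof -
    obtain V where V: "reversible T A A V" "V \<cdot> U = \<iota> A" using reversible_inverse[OF RU[OF U]] .
    let ?x = "\<lambda>j. \<langle>a j, U \<cdot> \<rho>\<rangle> - \<langle>a j, U \<cdot> \<sigma>\<rangle>"
    have each: "(\<langle>a i, \<rho>\<rangle> - \<langle>a i, \<sigma>\<rangle>)\<^sup>2 \<le> C\<^sup>2 * n * D (U \<cdot> \<rho>) (U \<cdot> \<sigma>)" if i: "i < n" for i
    proof -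
      have aV: "a i \<cdot> V \<in> effects T A" by (rule effect_channel[OF a[OF i] reversible_channel[OF V(1)]])
      have "\<langle>a i, \<rho>\<rangle> - \<langle>a i, \<sigma>\<rangle> = \<langle>a i \<cdot> V, U \<cdot> \<rho>\<rangle> - \<langle>a i \<cdot> V, U \<cdot> \<sigma>\<rangle>"
        using reversible_pairing[OF RU[OF U] V a[OF i]] normalised_state n\<rho> n\<sigma> by simp
      also have "\<dots> = (\<Sum>j<n. ?x j * E j (a i \<cdot> V))"
        using eq[OF normalised_state[OF Un[OF U n\<rho>]] aV] eq[OF normalised_state[OF Un[OF U n\<sigma>]] aV]
        by (simp add: left_diff_distrib sum_subtractf)
      finally have "(\<langle>a i, \<rho>\<rangle> - \<langle>a i, \<sigma>\<rangle>)\<^sup>2 = (\<Sum>j<n. ?x j * E j (a i \<cdot> V))\<^sup>2" by simp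
      also have "\<dots> \<le> (\<Sum>j<n. (?x j)\<^sup>2) * (\<Sum>j<n. (E j (a i \<cdot> V))\<^sup>2)"
        by (rule Cauchy_Schwarz_ineq_sum)
      also have "\<dots> \<le> D (U \<cdot> \<rho>) (U \<cdot> \<sigma>) * (\<Sum>j<n. C\<^sup>2)"
        unfolding D_def using C[OF _ aV]
        by (intro mult_left_mono sum_mono sum_nonneg) (auto simp: abs_le_square_iff[symmetric] intro: order_trans[OF _ abs_ge_self])
      finally show ?thesis by (simp add: mult_ac)
    qed
    have nn: "0 \<le> D (U \<cdot> \<rho>) (U \<cdot> \<sigma>)" unfolding D_def by (rule sum_nonneg) simp
    have "D \<rho> \<sigma> \<le> (\<Sum>i<n. C\<^sup>2 * n * D (U \<cdot> \<rho>) (U \<cdot> \<sigma>))"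
      unfolding D_def[of \<rho>] by (rule sum_mono) (use each in auto)
    also have "\<dots> \<le> (real n * (C\<^sup>2 * real n) + 1) * D (U \<cdot> \<rho>) (U \<cdot> \<sigma>)"
      using nn by (simp add: algebra_simps)
    finally have "D \<rho> \<sigma> \<le> D (U \<cdot> \<rho>) (U \<cdot> \<sigma>) / c" by (simp add: c_def mult_ac)
    then show ?thesis using c by (simp add: field_simps)
  qed
  have pairU: "\<langle>a i, U \<cdot> \<rho>\<rangle> = \<langle>a i \<cdot> U, \<rho>\<rangle>" if "i < n" "U \<in> R" "\<rho> \<in> states T A" for i U \<rho>
    by (rule pairing_channel[OF a[OF that(1)] reversible_channel[OF RU[OF that(2)]] that(3)])
  \<comment> \<open>The parallelogram law for each \<open>U\<close>, with its distance term bounded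
    below by \<open>D_le\<close> uniformly in \<open>U\<close>, so that the gain survives the
    supremum.\<close>
  have f_mid: "f \<mu> \<le> (f \<rho> + f \<sigma>) / 2 - c * D \<rho> \<sigma> / 4"
    if n\<rho>: "normalised T A \<rho>" and n\<sigma>: "normalised T A \<sigma>" and n\<mu>: "normalised T A \<mu>"
      and mid: "\<And>a. a \<in> effects T A \<Longrightarrow> \<langle>a, \<mu>\<rangle> = (\<langle>a, \<rho>\<rangle> + \<langle>a, \<sigma>\<rangle>) / 2" for \<rho> \<sigma> \<mu>
  proof (rule f_least)
    fix U assume U: "U \<in> R"
    have half: "\<langle>a i, U \<cdot> \<mu>\<rangle> = (\<langle>a i, U \<cdot> \<rho>\<rangle> + \<langle>a i, U \<cdot> \<sigma>\<rangle>) / 2" if i: "i < n" for i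
      using mid[OF effect_channel[OF a[OF i] reversible_channel[OF RU[OF U]]]] i U n\<rho> n\<sigma> n\<mu>
      by (simp add: pairU normalised_state)
    have "N (U \<cdot> \<mu>) = (\<Sum>i<n. (\<langle>a i, U \<cdot> \<rho>\<rangle>\<^sup>2 + \<langle>a i, U \<cdot> \<sigma>\<rangle>\<^sup>2) / 2
        - (\<langle>a i, U \<cdot> \<rho>\<rangle> - \<langle>a i, U \<cdot> \<sigma>\<rangle>)\<^sup>2 / 4)"
      unfolding N_def
    proof (rule sum.cong[OF refl])
      fix i assume "i \<in> {..<n}"
      then have i: "i < n" by simp
      have "((x + y) / 2)\<^sup>2 = (x\<^sup>2 + y\<^sup>2) / 2 - (x - y)\<^sup>2 / 4" for x y :: real
        by (simp add: power2_eq_square field_simps)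
      then show "\<langle>a i, U \<cdot> \<mu>\<rangle>\<^sup>2 = (\<langle>a i, U \<cdot> \<rho>\<rangle>\<^sup>2 + \<langle>a i, U \<cdot> \<sigma>\<rangle>\<^sup>2) / 2
          - (\<langle>a i, U \<cdot> \<rho>\<rangle> - \<langle>a i, U \<cdot> \<sigma>\<rangle>)\<^sup>2 / 4"
        unfolding half[OF i] .
    qed
    also have "\<dots> = (N (U \<cdot> \<rho>) + N (U \<cdot> \<sigma>)) / 2 - D (U \<cdot> \<rho>) (U \<cdot> \<sigma>) / 4"
      by (simp add: N_def D_def sum_subtractf sum.distrib add_divide_distrib sum_divide_distrib)
    also have "\<dots> \<le> (f \<rho> + f \<sigma>) / 2 - c * D \<rho> \<sigma> / 4"
    proof -
      have "(x1 + x2) / 2 - d / 4 \<le> (y1 + y2) / 2 - z / 4" if "x1 \<le> y1" "x2 \<le> y2" "z \<le> d"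
        for x1 x2 y1 y2 z d :: real using that by (simp add: field_simps)
      from this[OF f_upper[OF U n\<rho>] f_upper[OF U n\<sigma>] D_le[OF U n\<rho> n\<sigma>]] show ?thesis .
    qed
    finally show "N (U \<cdot> \<mu>) \<le> (f \<rho> + f \<sigma>) / 2 - c * D \<rho> \<sigma> / 4" .
  qed
  \<comment> \<open>Minimising over the interior states of fixed weight \<open>e\<close>, rather
    than over all states, makes the invariant minimiser an interior state as well.\<close>
  define K where "K = {\<omega>. mixed A e \<omega>}"
  have Kn: "\<omega> \<in> K \<Longrightarrow> normalised T A \<omega>" for \<omega> by (simp add: K_def mixed_def)
  have f_nonneg: "0 \<le> f \<omega>" if "\<omega> \<in> K" for \<omega>
  proof -
    obtain U where "U \<in> R" using Rne by blast
    have "0 \<le> N (U \<cdot> \<omega>)" unfolding N_def by (rule sum_nonneg) simp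
    also have "\<dots> \<le> f \<omega>" by (rule f_upper[OF \<open>U \<in> R\<close> Kn[OF that]])
    finally show ?thesis .
  qed
  define m where "m = Inf (f ` K)"
  have bddb: "bdd_below (f ` K)" using f_nonneg by (auto simp: bdd_below_def)
  have Kne: "K \<noteq> {}" using \<omega>0 by (auto simp: K_def)
  have m_le: "m \<le> f \<omega>" if "\<omega> \<in> K" for \<omega> unfolding m_def by (rule cINF_lower[OF bddb that])
  have "\<exists>\<omega>\<in>K. f \<omega> < m + 1 / Suc k" for k
    using cINF_less_iff[OF Kne bddb, of "m + 1 / Suc k"] by (simp add: m_def)
  then obtain F where F: "\<And>k. F k \<in> K" "\<And>k. f (F k) < m + 1 / Suc k" by metis
  have Fh: "F k \<in> hom T \<one> A" for k using normalised_state[OF Kn[OF F(1)]] by (simp add: states_def)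
  obtain r \<xi> where r: "strict_mono r" "converges_to T \<one> A (\<lambda>k. F (r k)) \<xi>"
    using hom_subsequence[of F, OF Fh] .
  have \<xi>K: "\<xi> \<in> K"
    using mixed_limit[OF _ r(2) e(2)] F(1) by (auto simp: K_def)
  \<comment> \<open>A supremum of continuous functions is lower semicontinuous, so the limit of a
    minimising sequence attains the infimum.\<close>
  have f\<xi>: "f \<xi> \<le> m"
  proof (rule f_least)
    fix U assume U: "U \<in> R"
    have "(\<lambda>k. \<langle>a i, U \<cdot> F (r k)\<rangle>) \<longlonglongrightarrow> \<langle>a i, U \<cdot> \<xi>\<rangle>" if i: "i < n" for i
      using converges_state(2)[OF r(2) effect_channel[OF a[OF i] reversible_channel[OF RU[OF U]]]]
        pairU[OF i U normalised_state[OF Kn[OF F(1)]]] pairU[OF i U normalised_state[OF Kn[OF \<xi>K]]] by simp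
    then have "(\<lambda>k. N (U \<cdot> F (r k))) \<longlonglongrightarrow> N (U \<cdot> \<xi>)"
      unfolding N_def by (intro tendsto_sum tendsto_power) auto
    moreover have "(\<lambda>k. m + 1 / Suc (r k)) \<longlonglongrightarrow> m"
    proof -
      have "(\<lambda>k. 1 / real (Suc k)) \<longlonglongrightarrow> 0"
        using LIMSEQ_inverse_real_of_nat by (simp add: inverse_eq_divide)
      from LIMSEQ_subseq_LIMSEQ[OF this r(1)] have "(\<lambda>k. 1 / real (Suc (r k))) \<longlonglongrightarrow> 0" by (simp add: o_def)
      from tendsto_add[OF tendsto_const[of m] this] show ?thesis by simp
    qed
    moreover have "N (U \<cdot> F (r k)) \<le> m + 1 / Suc (r k)" for k
      using f_upper[OF U Kn[OF F(1)], of "r k"] F(2)[of "r k"] by linarith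
    ultimately show "N (U \<cdot> \<xi>) \<le> m" by (intro LIMSEQ_le) auto
  qed
  have "U \<cdot> \<xi> = \<xi>" if U: "reversible T A A U" for U
  proof -
    have UR: "U \<in> R" using U by (simp add: R_def)
    have n1: "normalised T A \<xi>" and n2: "normalised T A (U \<cdot> \<xi>)" using Kn[OF \<xi>K] Un[OF UR] by auto
    have UK: "U \<cdot> \<xi> \<in> K" using mixed_reversible[OF _ U] \<xi>K by (simp add: K_def)
    have fU: "f (U \<cdot> \<xi>) \<le> m"
    proof (rule f_least)
      fix V assume V: "V \<in> R"
      have "V \<cdot> U \<in> R" using reversible_seq[OF U RU[OF V]] by (simp add: R_def)
      from f_upper[OF this n1] f\<xi> have "N ((V \<cdot> U) \<cdot> \<xi>) \<le> m" by simp
      also have "(V \<cdot> U) \<cdot> \<xi> = V \<cdot> (U \<cdot> \<xi>)"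
        using normalised_tgt[OF n1] reversible_src[OF U] reversible_tgt[OF U] reversible_src[OF RU[OF V]]
        by (intro assoc) auto
      finally show "N (V \<cdot> (U \<cdot> \<xi>)) \<le> m" .
    qed
    obtain \<mu> where \<mu>: "normalised T A \<mu>" "\<And>a. a \<in> effects T A \<Longrightarrow> \<langle>a, \<mu>\<rangle> = (\<langle>a, U \<cdot> \<xi>\<rangle> + \<langle>a, \<xi>\<rangle>) / 2"
      using normalised_midpoint[OF n2 n1] by blast
    \<comment> \<open>If \<open>U \<cdot> \<xi>\<close> differed from \<open>\<xi>\<close>, the
      midpoint of these two minimisers would have a value below the minimum.\<close>
    have "\<mu> \<in> K" using mixed_midpoint[OF _ _ \<mu>] UK \<xi>K by (simp add: K_def)
    note m_le[OF this]
    also have "f \<mu> \<le> (f (U \<cdot> \<xi>) + f \<xi>) / 2 - c * D (U \<cdot> \<xi>) \<xi> / 4"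
      by (rule f_mid[OF n2 n1 \<mu>(1) \<mu>(2)])
    finally have "c * D (U \<cdot> \<xi>) \<xi> \<le> 0" using fU f\<xi> by (simp add: field_simps)
    then have "D (U \<cdot> \<xi>) \<xi> \<le> 0" using c by (simp add: mult_le_0_iff)
    moreover have "0 \<le> D (U \<cdot> \<xi>) \<xi>" unfolding D_def by (rule sum_nonneg) simp
    ultimately have "D (U \<cdot> \<xi>) \<xi> = 0" by simp
    then have "\<langle>a i, U \<cdot> \<xi>\<rangle> = \<langle>a i, \<xi>\<rangle>" if "i < n" for i
      using that by (simp add: D_def sum_nonneg_eq_0_iff)
    then have "\<langle>b, U \<cdot> \<xi>\<rangle> = \<langle>b, \<xi>\<rangle>" if "b \<in> effects T A" for b
      using eq[OF normalised_state[OF n1] that] eq[OF normalised_state[OF n2] that] by simp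
    then show ?thesis by (rule state_eqI[OF normalised_state[OF n2] normalised_state[OF n1]])
  qed
  with e \<xi>K that show thesis by (auto simp: K_def)
qed

end

section \<open>Extensions, steering and faithful states\<close>

context causal_opt
begin

lemma par_ident_seq: "tgt T f = src T g \<Longrightarrow> \<iota> A \<otimes> (g \<cdot> f) = (\<iota> A \<otimes> g) \<cdot> (\<iota> A \<otimes> f)"
  by (simp add: par_seq)

lemma seq_par_ident: "tgt T f = src T g \<Longrightarrow> (g \<cdot> f) \<otimes> \<iota> A = (g \<otimes> \<iota> A) \<cdot> (f \<otimes> \<iota> A)"
  by (simp add: par_seq)

text \<open>A joint measurement can be read as conditioning either half on an outcome of the other;
  this exchange underlies steering and conjugation.\<close>

lemma pairing_slide:
  assumes "a \<in> effects T A" "e \<in> effects T B" "\<Theta> \<in> states T (A \<boxtimes> B)"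
  shows "\<langle>a, (\<iota> A \<otimes> e) \<cdot> \<Theta>\<rangle> = \<langle>a \<otimes> e, \<Theta>\<rangle>" "\<langle>e, (a \<otimes> \<iota> B) \<cdot> \<Theta>\<rangle> = \<langle>a \<otimes> e, \<Theta>\<rangle>"
proof -
  have "a \<cdot> (\<iota> A \<otimes> e) = a \<otimes> e"
    using assms par_split'[of a A \<one> e B \<one>] by (simp add: hom_iffs)
  moreover have "e \<cdot> (a \<otimes> \<iota> B) = a \<otimes> e"
    using assms par_split[of a A \<one> e B \<one>] by (simp add: hom_iffs)
  ultimately show "\<langle>a, (\<iota> A \<otimes> e) \<cdot> \<Theta>\<rangle> = \<langle>a \<otimes> e, \<Theta>\<rangle>" "\<langle>e, (a \<otimes> \<iota> B) \<cdot> \<Theta>\<rangle> = \<langle>a \<otimes> e, \<Theta>\<rangle>"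
    using assms by (simp_all add: pairing_seq hom_iffs)
qed

lemma effect_par: "a \<in> effects T A \<Longrightarrow> b \<in> effects T B \<Longrightarrow> a \<otimes> b \<in> effects T (A \<boxtimes> B)"
  by (simp add: hom_iffs)

lemma state_apply_right: "\<Theta> \<in> states T (A \<boxtimes> B) \<Longrightarrow> e \<in> effects T B \<Longrightarrow> (\<iota> A \<otimes> e) \<cdot> \<Theta> \<in> states T A"
  and state_apply_left: "\<Theta> \<in> states T (A \<boxtimes> B) \<Longrightarrow> a \<in> effects T A \<Longrightarrow> (a \<otimes> \<iota> B) \<cdot> \<Theta> \<in> states T B"
  by (simp_all add: hom_iffs)

lemma pairing_par:
  assumes "a \<in> effects T A" "b \<in> effects T B" "\<rho> \<in> states T A" "\<sigma> \<in> states T B"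
  shows "\<langle>a \<otimes> b, \<rho> \<otimes> \<sigma>\<rangle> = \<langle>a, \<rho>\<rangle> * \<langle>b, \<sigma>\<rangle>"
  using assms by (simp add: pairing_def hom_iffs par_seq scalar_par prob_mult)

lemma discard_apply_right: "normalised T B \<sigma> \<Longrightarrow> \<rho> \<in> states T A \<Longrightarrow> (\<iota> A \<otimes> \<epsilon> B) \<cdot> (\<rho> \<otimes> \<sigma>) = \<rho>"
  using par_seq[of \<rho> "\<iota> A" \<sigma> "\<epsilon> B"]
  by (simp add: normalised_discard normalised_tgt hom_iffs)

lemma discard_apply_left: "normalised T A \<rho> \<Longrightarrow> \<sigma> \<in> states T B \<Longrightarrow> (\<epsilon> A \<otimes> \<iota> B) \<cdot> (\<rho> \<otimes> \<sigma>) = \<sigma>"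
  using par_seq[of \<rho> "\<epsilon> A" \<sigma> "\<iota> B"]
  by (simp add: normalised_discard normalised_tgt hom_iffs)

lemma marginal_channel: "channel T (A \<boxtimes> B) A (\<iota> A \<otimes> \<epsilon> B)" "channel T (A \<boxtimes> B) B (\<epsilon> A \<otimes> \<iota> B)"
  using channel_par[OF test_ident[of A] discard_channel[of B]]
    channel_par[OF discard_channel[of A] test_ident[of B]] by simp_all

lemma dilation':
  assumes c: "test T A B X c"
  obtains S C e where "channel T A (B \<boxtimes> S) C" "test T S \<one> X e" "\<And>i. i \<in> X \<Longrightarrow> c i = (\<iota> B \<otimes> e i) \<cdot> C"
proof -
  obtain h where h: "bij_betw h {..<card X} X"
    using finite_nat_bij[OF test_finite[OF c]] .
  have "test T A B {..<card X} (\<lambda>a. c (h a))" using c by (simp add: test_reindex[OF h])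
  from dilation[OF this] obtain S C e where e: "channel T A (B \<boxtimes> S) C" "test T S \<one> {..<card X} e"
    "\<forall>a\<in>{..<card X}. c (h a) = (\<iota> B \<otimes> e a) \<cdot> C" by blast
  let ?g = "inv_into {..<card X} h"
  have g: "bij_betw ?g X {..<card X}" by (rule bij_betw_inv_into[OF h])
  have "test T S \<one> X (\<lambda>i. e (?g i))" using e(2) by (simp add: test_reindex[OF g])
  moreover have "c i = (\<iota> B \<otimes> e (?g i)) \<cdot> C" if "i \<in> X" for i
    using e(3) bij_betwE[OF g] that bij_betw_inv_into_right[OF h that] by (metis lessThan_iff)
  ultimately show thesis using e(1) that by blast
qed

lemma lincomb_post:
  assumes l: "is_lincomb T A B f X p c" and g: "g \<in> hom T B C"
  shows "is_lincomb T A C (g \<cdot> f) X p (\<lambda>i. g \<cdot> c i)"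
proof -
  have move: "probe_value T (g \<cdot> h) (S, \<rho>, E) = probe_value T h (S, \<rho>, E \<cdot> (g \<otimes> \<iota> S))"
    if "h \<in> hom T A B" "(S, \<rho>, E) \<in> probes T A C" for h S \<rho> E
    using that g unfolding probe_value_def probes_def
    by (simp add: hom_iffs seq_par_ident assoc pairing_def)
  have pr: "(S, \<rho>, E) \<in> probes T A C \<Longrightarrow> (S, \<rho>, E \<cdot> (g \<otimes> \<iota> S)) \<in> probes T A B" for S \<rho> E
    using g by (simp add: probes_def hom_iffs)
  have "probe_value T (g \<cdot> f) w = (\<Sum>i\<in>X. p i * probe_value T (g \<cdot> c i) w)" if w: "w \<in> probes T A C" for w
  proof -
    obtain S \<rho> E where w': "w = (S, \<rho>, E)" by (cases w)
    have "probe_value T (g \<cdot> c i) w = probe_value T (c i) (S, \<rho>, E \<cdot> (g \<otimes> \<iota> S))" if "i \<in> X" for i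
      using move[of "c i"] l w that by (simp add: w' is_lincomb_def)
    moreover have "probe_value T (g \<cdot> f) w = probe_value T f (S, \<rho>, E \<cdot> (g \<otimes> \<iota> S))"
      using move[of f] l w by (simp add: w' is_lincomb_def)
    ultimately show ?thesis using l pr[of S \<rho> E] w by (simp add: w' is_lincomb_def)
  qed
  then show ?thesis using l g by (auto simp: is_lincomb_def hom_def)
qed

end

context sharp_theory_with_purification
begin

abbreviation pure_normalised :: "'s \<Rightarrow> 't \<Rightarrow> bool" where
  "pure_normalised A \<alpha> \<equiv> normalised T A \<alpha> \<and> pure T \<alpha>"

text \<open>Purity preservation would require \<open>U\<close> to be pure, but
  \<open>reversible_pure\<close> itself rests on this lemma through \<open>faithful\<close>.
  Extremality is transported along the inverse instead.\<close>

lemma reversible_pure_normalised: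
  assumes \<psi>: "pure_normalised A \<psi>" and U: "reversible T A B U"
  shows "pure_normalised B (U \<cdot> \<psi>)"
proof
  show nU: "normalised T B (U \<cdot> \<psi>)" by (rule channel_normalised[OF reversible_channel[OF U]]) (use \<psi> in simp)
  obtain V where V: "reversible T B A V" "V \<cdot> U = \<iota> A" "U \<cdot> V = \<iota> B" using reversible_inverse[OF U] .
  note Vc = reversible_channel[OF V(1)]
  show "pure T (U \<cdot> \<psi>)"
  proof (rule pure_if_extreme[OF nU])
    fix t \<sigma> \<tau> assume t: "0 < t" "t < 1" and n: "normalised T B \<sigma>" "normalised T B \<tau>"
      and eq: "\<And>a. a \<in> effects T B \<Longrightarrow> \<langle>a, U \<cdot> \<psi>\<rangle> = t * \<langle>a, \<sigma>\<rangle> + (1 - t) * \<langle>a, \<tau>\<rangle>"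
    have "V \<cdot> \<sigma> = \<psi>"
    proof (rule pure_extreme[OF _ _ channel_normalised[OF Vc n(1)] channel_normalised[OF Vc n(2)]])
      fix a assume a: "a \<in> effects T A"
      have "\<langle>a, \<psi>\<rangle> = \<langle>a \<cdot> V, U \<cdot> \<psi>\<rangle>"
        using reversible_pairing[OF U V(1,2) a normalised_state] \<psi> by simp
      also have "\<dots> = t * \<langle>a \<cdot> V, \<sigma>\<rangle> + (1 - t) * \<langle>a \<cdot> V, \<tau>\<rangle>"
        by (rule eq[OF effect_channel[OF a Vc]])
      finally show "\<langle>a, \<psi>\<rangle> = t * \<langle>a, V \<cdot> \<sigma>\<rangle> + (1 - t) * \<langle>a, V \<cdot> \<tau>\<rangle>"
        using pairing_channel[OF a Vc] n normalised_state by simp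
    qed (use \<psi> t in simp_all)
    then show "\<sigma> = U \<cdot> \<psi>"
      using reversible_cancel[OF U V(3,1) normalised_tgt[OF n(1)]] by simp
  qed
qed

lemma pure_normalised_par:
  "pure_normalised A \<alpha> \<Longrightarrow> pure_normalised B \<beta> \<Longrightarrow> pure_normalised (A \<boxtimes> B) (\<alpha> \<otimes> \<beta>)"
  by (simp add: normalised_par pure_par)

text \<open>The purifying system holds whatever any extension can hold. Purify \<Theta>, pad both
  pure states with pure states to one common system, and let uniqueness of purification supply a
  reversible channel; the surplus outputs are then discarded.\<close>

lemma extension:
  assumes \<Psi>: "pure_normalised (A \<boxtimes> B) \<Psi>" and \<Theta>: "normalised T (A \<boxtimes> Z) \<Theta>"
    and eq: "(\<iota> A \<otimes> \<epsilon> B) \<cdot> \<Psi> = (\<iota> A \<otimes> \<epsilon> Z) \<cdot> \<Theta>"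
  obtains C where "channel T B Z C" "\<Theta> = (\<iota> A \<otimes> C) \<cdot> \<Psi>"
proof -
  obtain Y \<Theta>' where \<Theta>': "normalised T ((A \<boxtimes> Z) \<boxtimes> Y) \<Theta>'" "pure T \<Theta>'" "marginal T (A \<boxtimes> Z) Y \<Theta>' = \<Theta>"
    using purification[OF \<Theta>] by blast
  obtain \<eta> where \<eta>: "normalised T (Z \<boxtimes> Y) \<eta>" "pure T \<eta>" using pure_exists .
  obtain \<zeta> where \<zeta>: "normalised T B \<zeta>" "pure T \<zeta>" using pure_exists .
  have ty [simp]: "src T \<Psi> = \<one>" "tgt T \<Psi> = A \<boxtimes> B" "src T \<Theta>' = \<one>" "tgt T \<Theta>' = A \<boxtimes> Z \<boxtimes> Y"
    "src T \<eta> = \<one>" "tgt T \<eta> = Z \<boxtimes> Y" "src T \<zeta> = \<one>" "tgt T \<zeta> = B" "src T \<Theta> = \<one>" "tgt T \<Theta> = A \<boxtimes> Z"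
    using \<Psi> \<Theta> \<Theta>'(1) \<eta>(1) \<zeta>(1) by (auto simp: normalised_def hom_iffs)
  \<comment> \<open>Brings the factors of \<open>\<Theta>' \<otimes> \<zeta>\<close> into the order
    of \<open>\<Psi> \<otimes> \<eta>\<close>, as uniqueness compares states of literally the same
    composite.\<close>
  define W where "W = \<iota> A \<otimes> swp T (Z \<boxtimes> Y) B"
  have W: "reversible T (A \<boxtimes> Z \<boxtimes> Y \<boxtimes> B) (A \<boxtimes> B \<boxtimes> Z \<boxtimes> Y) W"
    using reversible_par[OF reversible_ident[of A] reversible_swp[of "Z \<boxtimes> Y" B]] by (simp add: W_def)
  define \<Psi>1 where "\<Psi>1 = \<Psi> \<otimes> \<eta>"
  define \<Psi>2 where "\<Psi>2 = W \<cdot> (\<Theta>' \<otimes> \<zeta>)"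
  have p1: "pure_normalised (A \<boxtimes> B \<boxtimes> Z \<boxtimes> Y) \<Psi>1"
    using pure_normalised_par[OF \<Psi>, of "Z \<boxtimes> Y" \<eta>] \<eta> by (simp add: \<Psi>1_def)
  have p2: "pure_normalised (A \<boxtimes> B \<boxtimes> Z \<boxtimes> Y) \<Psi>2"
    unfolding \<Psi>2_def
    by (rule reversible_pure_normalised[OF _ W])
      (use pure_normalised_par[of "(A \<boxtimes> Z) \<boxtimes> Y" \<Theta>' B \<zeta>] \<Theta>' \<zeta> in simp)
  have m1: "(\<iota> A \<otimes> \<epsilon> (B \<boxtimes> Z \<boxtimes> Y)) \<cdot> \<Psi>1 = (\<iota> A \<otimes> \<epsilon> B) \<cdot> \<Psi>"
  proof -
    have "(\<iota> A \<otimes> \<epsilon> (B \<boxtimes> Z \<boxtimes> Y)) \<cdot> \<Psi>1 = ((\<iota> A \<otimes> \<epsilon> B) \<otimes> \<epsilon> (Z \<boxtimes> Y)) \<cdot> (\<Psi> \<otimes> \<eta>)"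
      by (simp only: \<Psi>1_def discard_par[of B] par_assoc)
    also have "\<dots> = ((\<iota> A \<otimes> \<epsilon> B) \<cdot> \<Psi>) \<otimes> (\<epsilon> (Z \<boxtimes> Y) \<cdot> \<eta>)"
      by (rule par_seq) simp_all
    also have "\<dots> = (\<iota> A \<otimes> \<epsilon> B) \<cdot> \<Psi>"
      by (simp only: normalised_discard[OF \<eta>(1)] par_triv)
    finally show ?thesis .
  qed
  have m2: "(\<iota> A \<otimes> \<epsilon> (B \<boxtimes> Z \<boxtimes> Y)) \<cdot> \<Psi>2 = (\<iota> A \<otimes> \<epsilon> Z) \<cdot> \<Theta>"
  proof -
    have "(\<iota> A \<otimes> \<epsilon> (B \<boxtimes> Z \<boxtimes> Y)) \<cdot> \<Psi>2 = ((\<iota> A \<otimes> \<epsilon> (B \<boxtimes> Z \<boxtimes> Y)) \<cdot> W) \<cdot> (\<Theta>' \<otimes> \<zeta>)"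
      unfolding \<Psi>2_def W_def by (rule assoc[symmetric]) simp_all
    also have "(\<iota> A \<otimes> \<epsilon> (B \<boxtimes> Z \<boxtimes> Y)) \<cdot> W = \<iota> A \<otimes> (\<epsilon> (B \<boxtimes> Z \<boxtimes> Y) \<cdot> swp T (Z \<boxtimes> Y) B)"
      unfolding W_def by (rule par_ident_seq[symmetric]) simp
    also have "\<epsilon> (B \<boxtimes> Z \<boxtimes> Y) \<cdot> swp T (Z \<boxtimes> Y) B = \<epsilon> ((Z \<boxtimes> Y) \<boxtimes> B)"
      by (rule discard_seq) (rule test_swp)
    also have "\<iota> A \<otimes> \<epsilon> ((Z \<boxtimes> Y) \<boxtimes> B) = (\<iota> A \<otimes> \<epsilon> Z \<otimes> \<epsilon> Y) \<otimes> \<epsilon> B"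
      by (simp add: discard_par)
    also have "\<dots> \<cdot> (\<Theta>' \<otimes> \<zeta>) = ((\<iota> A \<otimes> \<epsilon> Z \<otimes> \<epsilon> Y) \<cdot> \<Theta>') \<otimes> (\<epsilon> B \<cdot> \<zeta>)"
      by (rule par_seq) simp_all
    also have "\<dots> = (\<iota> A \<otimes> \<epsilon> Z \<otimes> \<epsilon> Y) \<cdot> \<Theta>'"
      by (simp only: normalised_discard[OF \<zeta>(1)] par_triv)
    also have "\<iota> A \<otimes> \<epsilon> Z \<otimes> \<epsilon> Y = (\<iota> A \<otimes> \<epsilon> Z) \<cdot> (\<iota> (A \<boxtimes> Z) \<otimes> \<epsilon> Y)"
      using par_split[of "\<iota> \<one>" \<one> \<one>, of "\<epsilon> Y" Y \<one>] par_seq[of "\<iota> (A \<boxtimes> Z)" "\<iota> A \<otimes> \<epsilon> Z" "\<epsilon> Y" "\<iota> \<one>"] by simp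
    also have "\<dots> \<cdot> \<Theta>' = (\<iota> A \<otimes> \<epsilon> Z) \<cdot> ((\<iota> (A \<boxtimes> Z) \<otimes> \<epsilon> Y) \<cdot> \<Theta>')"
      by (rule assoc) simp_all
    also have "(\<iota> (A \<boxtimes> Z) \<otimes> \<epsilon> Y) \<cdot> \<Theta>' = \<Theta>"
      using \<Theta>'(3) by (simp add: marginal_def)
    finally show ?thesis .
  qed
  obtain U where U: "reversible T (B \<boxtimes> Z \<boxtimes> Y) (B \<boxtimes> Z \<boxtimes> Y) U" "\<Psi>2 = (\<iota> A \<otimes> U) \<cdot> \<Psi>1"
    using purification_unique[of A "B \<boxtimes> Z \<boxtimes> Y" \<Psi>1 \<Psi>2] p1 p2 m1 m2 eq by (auto simp: marginal_def)
  have Uty [simp]: "src T U = B \<boxtimes> Z \<boxtimes> Y" "tgt T U = B \<boxtimes> Z \<boxtimes> Y"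
    using U(1) by (auto dest: reversible_src reversible_tgt)
  \<comment> \<open>The reversible channel touches only the purifying side. Supplying
    \<open>\<eta>\<close> at its input and keeping \<open>Z\<close> alone at its output makes it a
    channel from \<open>B\<close> to \<open>Z\<close>.\<close>
  define K where "K = \<epsilon> B \<otimes> \<iota> Z \<otimes> \<epsilon> Y"
  define C where "C = K \<cdot> (U \<cdot> (\<iota> B \<otimes> \<eta>))"
  have Kty [simp]: "src T K = B \<boxtimes> Z \<boxtimes> Y" "tgt T K = Z" by (simp_all add: K_def)
  have "channel T B Z C"
    unfolding C_def
  proof (intro channel_seq)
    show "channel T B (B \<boxtimes> Z \<boxtimes> Y) (\<iota> B \<otimes> \<eta>)"
      using channel_par[OF test_ident[of B] \<eta>(1)[unfolded normalised_iff_channel]] by simp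
    show "channel T (B \<boxtimes> Z \<boxtimes> Y) (B \<boxtimes> Z \<boxtimes> Y) U" by (rule reversible_channel[OF U(1)])
    show "channel T (B \<boxtimes> Z \<boxtimes> Y) Z K"
      using channel_par[OF discard_channel[of B] channel_par[OF test_ident[of Z] discard_channel[of Y]]]
      by (simp add: K_def)
  qed
  moreover have "(\<iota> A \<otimes> C) \<cdot> \<Psi> = \<Theta>"
  proof -
    have "(\<iota> A \<otimes> C) \<cdot> \<Psi> = (\<iota> A \<otimes> K) \<cdot> ((\<iota> A \<otimes> U) \<cdot> ((\<iota> A \<otimes> (\<iota> B \<otimes> \<eta>)) \<cdot> \<Psi>))"
      by (simp add: C_def par_ident_seq assoc)
    also have "(\<iota> A \<otimes> (\<iota> B \<otimes> \<eta>)) \<cdot> \<Psi> = \<Psi>1"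
      using par_state_right[of \<Psi> \<one> \<eta>] by (simp add: \<Psi>1_def par_ident[symmetric])
    also have "(\<iota> A \<otimes> U) \<cdot> \<Psi>1 = \<Psi>2" by (rule U(2)[symmetric])
    also have "(\<iota> A \<otimes> K) \<cdot> \<Psi>2 = ((\<iota> A \<otimes> K) \<cdot> W) \<cdot> (\<Theta>' \<otimes> \<zeta>)"
      unfolding \<Psi>2_def by (rule assoc[symmetric]) (simp_all add: W_def)
    also have "(\<iota> A \<otimes> K) \<cdot> W = \<iota> A \<otimes> (K \<cdot> swp T (Z \<boxtimes> Y) B)"
      unfolding W_def by (rule par_ident_seq[symmetric]) simp
    also have "K \<cdot> swp T (Z \<boxtimes> Y) B = (\<iota> Z \<otimes> \<epsilon> Y) \<otimes> \<epsilon> B"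
      using swp_nat[of "\<iota> Z \<otimes> \<epsilon> Y" "Z \<boxtimes> Y" Z "\<epsilon> B" B \<one>] by (simp add: K_def)
    also have "\<iota> A \<otimes> ((\<iota> Z \<otimes> \<epsilon> Y) \<otimes> \<epsilon> B) = (\<iota> (A \<boxtimes> Z) \<otimes> \<epsilon> Y) \<otimes> \<epsilon> B"
      by (simp add: par_ident[symmetric])
    also have "\<dots> \<cdot> (\<Theta>' \<otimes> \<zeta>) = ((\<iota> (A \<boxtimes> Z) \<otimes> \<epsilon> Y) \<cdot> \<Theta>') \<otimes> (\<epsilon> B \<cdot> \<zeta>)"
      by (rule par_seq) simp_all
    also have "\<dots> = \<Theta>"
      using \<Theta>'(3) by (simp only: normalised_discard[OF \<zeta>(1)] par_triv marginal_def)
    finally show ?thesis .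
  qed
  ultimately show thesis using that by metis
qed

text \<open>The axiom fixes the marginal on the first factor; conjugation with the swap gives the
  mirror image.\<close>

lemma purification_unique':
  assumes \<Psi>: "pure_normalised (A \<boxtimes> B) \<Psi>" and \<Psi>': "pure_normalised (A \<boxtimes> B) \<Psi>'"
    and eq: "(\<epsilon> A \<otimes> \<iota> B) \<cdot> \<Psi> = (\<epsilon> A \<otimes> \<iota> B) \<cdot> \<Psi>'"
  obtains U where "reversible T A A U" "\<Psi>' = (U \<otimes> \<iota> B) \<cdot> \<Psi>"
proof -
  have ty [simp]: "src T \<Psi> = \<one>" "tgt T \<Psi> = A \<boxtimes> B" "src T \<Psi>' = \<one>" "tgt T \<Psi>' = A \<boxtimes> B"
    using \<Psi> \<Psi>' by (auto simp: normalised_def hom_iffs)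
  have swap: "(\<iota> B \<otimes> \<epsilon> A) \<cdot> (swp T A B \<cdot> \<Phi>) = (\<epsilon> A \<otimes> \<iota> B) \<cdot> \<Phi>" if "tgt T \<Phi> = A \<boxtimes> B" for \<Phi>
  proof -
    have "(\<iota> B \<otimes> \<epsilon> A) \<cdot> (swp T A B \<cdot> \<Phi>) = ((\<iota> B \<otimes> \<epsilon> A) \<cdot> swp T A B) \<cdot> \<Phi>"
      by (rule assoc[symmetric]) (use that in simp_all)
    also have "(\<iota> B \<otimes> \<epsilon> A) \<cdot> swp T A B = \<epsilon> A \<otimes> \<iota> B"
      using swp_nat[of "\<epsilon> A" A \<one> "\<iota> B" B B] by simp
    finally show ?thesis .
  qed
  have p: "pure_normalised (B \<boxtimes> A) (swp T A B \<cdot> \<Psi>)" "pure_normalised (B \<boxtimes> A) (swp T A B \<cdot> \<Psi>')"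
    using reversible_pure_normalised[OF \<Psi> reversible_swp] reversible_pure_normalised[OF \<Psi>' reversible_swp] by auto
  obtain U where U: "reversible T A A U" "swp T A B \<cdot> \<Psi>' = (\<iota> B \<otimes> U) \<cdot> (swp T A B \<cdot> \<Psi>)"
    using purification_unique[of B A "swp T A B \<cdot> \<Psi>" "swp T A B \<cdot> \<Psi>'"] p eq swap by (auto simp: marginal_def)
  have Uty [simp]: "src T U = A" "tgt T U = A" using U(1) by (auto dest: reversible_src reversible_tgt)
  have "(\<iota> B \<otimes> U) \<cdot> (swp T A B \<cdot> \<Psi>) = ((\<iota> B \<otimes> U) \<cdot> swp T A B) \<cdot> \<Psi>"
    by (rule assoc[symmetric]) simp_all
  also have "(\<iota> B \<otimes> U) \<cdot> swp T A B = swp T A B \<cdot> (U \<otimes> \<iota> B)"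
    by (rule swp_nat[symmetric]) simp_all
  also have "(swp T A B \<cdot> (U \<otimes> \<iota> B)) \<cdot> \<Psi> = swp T A B \<cdot> ((U \<otimes> \<iota> B) \<cdot> \<Psi>)"
    by (rule assoc) simp_all
  finally have "swp T B A \<cdot> (swp T A B \<cdot> \<Psi>') = swp T B A \<cdot> (swp T A B \<cdot> ((U \<otimes> \<iota> B) \<cdot> \<Psi>))"
    using U(2) by simp
  then have "\<Psi>' = (U \<otimes> \<iota> B) \<cdot> \<Psi>"
    using reversible_cancel[OF reversible_swp swp_swp reversible_swp, of _ A B] by simp
  with U(1) that show thesis by blast
qed

lemma dilated_state_marginal:
  assumes \<Theta>: "\<Theta> \<in> states T (A \<boxtimes> S)" and e: "test T S \<one> X e" and a: "a \<in> effects T A"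
  shows "\<langle>a, (\<iota> A \<otimes> \<epsilon> S) \<cdot> \<Theta>\<rangle> = (\<Sum>i\<in>X. \<langle>a, (\<iota> A \<otimes> e i) \<cdot> \<Theta>\<rangle>)"
proof -
  have ei: "e i \<in> effects T S" if "i \<in> X" for i using test_hom[OF e that] by (simp add: effects_def)
  have "\<langle>a, (\<iota> A \<otimes> \<epsilon> S) \<cdot> \<Theta>\<rangle> = \<langle>\<epsilon> S, (a \<otimes> \<iota> S) \<cdot> \<Theta>\<rangle>"
    using pairing_slide[OF a discard_effect \<Theta>] by simp
  also have "\<dots> = (\<Sum>i\<in>X. \<langle>e i, (a \<otimes> \<iota> S) \<cdot> \<Theta>\<rangle>)"
    by (rule observation_sum[OF e state_apply_left[OF \<Theta> a], symmetric])
  also have "\<dots> = (\<Sum>i\<in>X. \<langle>a, (\<iota> A \<otimes> e i) \<cdot> \<Theta>\<rangle>)"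
    using pairing_slide[OF a ei \<Theta>] by (intro sum.cong) auto
  finally show ?thesis .
qed

text \<open>An ensemble is a preparation test, whose dilation is a joint state with the same
  marginal. By \<open>extension\<close> a channel on the purifying system reaches that state from
  \<open>\<Psi>\<close>, and the channel is absorbed into the measurement.\<close>

lemma steering:
  assumes \<Psi>: "pure_normalised (A \<boxtimes> B) \<Psi>" and X: "finite X" and s: "\<And>i. i \<in> X \<Longrightarrow> \<sigma> i \<in> states T A"
    and sum: "\<And>a. a \<in> effects T A \<Longrightarrow> \<langle>a, (\<iota> A \<otimes> \<epsilon> B) \<cdot> \<Psi>\<rangle> = (\<Sum>i\<in>X. \<langle>a, \<sigma> i\<rangle>)"
  obtains b where "test T B \<one> X b" "\<And>i. i \<in> X \<Longrightarrow> (\<iota> A \<otimes> b i) \<cdot> \<Psi> = \<sigma> i"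
proof -
  have nm: "normalised T A ((\<iota> A \<otimes> \<epsilon> B) \<cdot> \<Psi>)"
    by (rule channel_normalised[OF marginal_channel(1)]) (use \<Psi> in simp)
  have t: "test T \<one> A X \<sigma>"
    by (rule preparation_test[OF X s]) (use sum[OF discard_effect] normalised_pairing[OF nm] in auto)
  obtain S \<Theta> e where \<Theta>: "channel T \<one> (A \<boxtimes> S) \<Theta>" and e: "test T S \<one> X e"
    and \<sigma>: "\<And>i. i \<in> X \<Longrightarrow> \<sigma> i = (\<iota> A \<otimes> e i) \<cdot> \<Theta>"
    using dilation'[OF t] by blast
  have \<Theta>n: "normalised T (A \<boxtimes> S) \<Theta>" using \<Theta> by (simp add: normalised_iff_channel)
  have "(\<iota> A \<otimes> \<epsilon> B) \<cdot> \<Psi> = (\<iota> A \<otimes> \<epsilon> S) \<cdot> \<Theta>"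
  proof (rule state_eqI[OF normalised_state[OF nm]])
    show "(\<iota> A \<otimes> \<epsilon> S) \<cdot> \<Theta> \<in> states T A"
      by (rule state_apply_right[OF normalised_state[OF \<Theta>n] discard_effect])
    fix a assume a: "a \<in> effects T A"
    have "(\<Sum>i\<in>X. \<langle>a, (\<iota> A \<otimes> e i) \<cdot> \<Theta>\<rangle>) = (\<Sum>i\<in>X. \<langle>a, \<sigma> i\<rangle>)"
      by (rule sum.cong) (use \<sigma> in auto)
    then show "\<langle>a, (\<iota> A \<otimes> \<epsilon> B) \<cdot> \<Psi>\<rangle> = \<langle>a, (\<iota> A \<otimes> \<epsilon> S) \<cdot> \<Theta>\<rangle>"
      unfolding sum[OF a] dilated_state_marginal[OF normalised_state[OF \<Theta>n] e a] by simp
  qed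
  from extension[OF \<Psi> \<Theta>n this] obtain C where C: "channel T B S C" "\<Theta> = (\<iota> A \<otimes> C) \<cdot> \<Psi>" .
  have "(\<iota> A \<otimes> (e i \<cdot> C)) \<cdot> \<Psi> = \<sigma> i" if i: "i \<in> X" for i
  proof -
    have ty: "src T \<Psi> = \<one>" "tgt T \<Psi> = A \<boxtimes> B" "src T C = B" "tgt T C = S" "src T (e i) = S" "tgt T (e i) = \<one>"
      using \<Psi> channel_src[OF C(1)] channel_tgt[OF C(1)] test_hom[OF e i] by (auto simp: normalised_def hom_iffs)
    then have "(\<iota> A \<otimes> (e i \<cdot> C)) \<cdot> \<Psi> = (\<iota> A \<otimes> e i) \<cdot> ((\<iota> A \<otimes> C) \<cdot> \<Psi>)"
      by (simp add: par_ident_seq assoc)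
    then show ?thesis using C(2) \<sigma>[OF i] by simp
  qed
  then show thesis by (rule that[OF test_seq'[OF C(1) e]])
qed

text \<open>Steering for joint states. The marginal of \<rho> is contained in the interior marginal
  of \<open>\<Psi>\<close> with weight \<open>e\<close>, so one outcome of a test on
  \<open>B\<close> prepares \<open>e\<close> times \<rho>.\<close>

lemma mixed_steering:
  assumes \<Psi>: "pure_normalised (A \<boxtimes> B) \<Psi>" and m: "mixed A e ((\<iota> A \<otimes> \<epsilon> B) \<cdot> \<Psi>)" and e: "0 < e" "e < 1"
    and \<rho>: "normalised T (A \<boxtimes> S) \<rho>"
  obtains D where "D \<in> hom T B S" "\<And>E. E \<in> effects T (A \<boxtimes> S) \<Longrightarrow> \<langle>E, (\<iota> A \<otimes> D) \<cdot> \<Psi>\<rangle> = e * \<langle>E, \<rho>\<rangle>"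
proof -
  let ?\<omega> = "(\<iota> A \<otimes> \<epsilon> B) \<cdot> \<Psi>"
  let ?\<sigma> = "(\<iota> A \<otimes> \<epsilon> S) \<cdot> \<rho>"
  have \<sigma>: "normalised T A ?\<sigma>" by (rule channel_normalised[OF marginal_channel(1) \<rho>])
  have \<omega>: "normalised T A ?\<omega>" using m by (simp add: mixed_def)
  obtain \<tau> where \<tau>: "normalised T A \<tau>" "\<forall>a\<in>effects T A. \<langle>a, ?\<omega>\<rangle> = e * \<langle>a, ?\<sigma>\<rangle> + (1 - e) * \<langle>a, \<tau>\<rangle>"
    using m \<sigma> unfolding mixed_def by blast
  obtain \<eta> where \<eta>: "normalised T S \<eta>" using normalised_exists .
  have \<tau>\<eta>: "normalised T (A \<boxtimes> S) (\<tau> \<otimes> \<eta>)" by (rule normalised_par[OF \<tau>(1) \<eta>])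
  obtain \<rho>' where \<rho>': "\<rho>' \<in> states T (A \<boxtimes> S)" "\<And>E. E \<in> effects T (A \<boxtimes> S) \<Longrightarrow> \<langle>E, \<rho>'\<rangle> = e * \<langle>E, \<rho>\<rangle>"
    using state_scale[OF normalised_state[OF \<rho>], of e] e normalised_pairing[OF \<rho>] by auto
  obtain \<kappa> where \<kappa>: "\<kappa> \<in> states T (A \<boxtimes> S)" "\<And>E. E \<in> effects T (A \<boxtimes> S) \<Longrightarrow> \<langle>E, \<kappa>\<rangle> = (1 - e) * \<langle>E, \<tau> \<otimes> \<eta>\<rangle>"
    using state_scale[OF normalised_state[OF \<tau>\<eta>], of "1 - e"] e normalised_pairing[OF \<tau>\<eta>] by auto
  \<comment> \<open>\<open>True\<close> carries \<rho> with weight \<open>e\<close>;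
    \<open>False\<close> carries a product state that fills up the marginal on
    \<open>A\<close>.\<close>
  have t: "test T \<one> (A \<boxtimes> S) {True, False} (\<lambda>i. if i then \<rho>' else \<kappa>)"
    by (rule preparation_test)
      (use \<rho>'(1) \<kappa>(1) \<rho>'(2)[OF discard_effect] \<kappa>(2)[OF discard_effect] normalised_pairing[OF \<rho>] normalised_pairing[OF \<tau>\<eta>] in auto)
  obtain S' \<Theta> f where \<Theta>: "channel T \<one> ((A \<boxtimes> S) \<boxtimes> S') \<Theta>" and f: "test T S' \<one> {True, False} f"
    and eq: "\<And>i. i \<in> {True, False} \<Longrightarrow> (if i then \<rho>' else \<kappa>) = (\<iota> (A \<boxtimes> S) \<otimes> f i) \<cdot> \<Theta>"
    using dilation'[OF t] by blast
  have \<Theta>n: "normalised T (A \<boxtimes> S \<boxtimes> S') \<Theta>" using \<Theta> by (simp add: normalised_iff_channel)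
  have \<Theta>s: "\<Theta> \<in> states T ((A \<boxtimes> S) \<boxtimes> S')" using normalised_state[OF \<Theta>n] by simp
  have "?\<omega> = (\<iota> A \<otimes> \<epsilon> (S \<boxtimes> S')) \<cdot> \<Theta>"
  proof (rule state_eqI[OF normalised_state[OF \<omega>]])
    show "(\<iota> A \<otimes> \<epsilon> (S \<boxtimes> S')) \<cdot> \<Theta> \<in> states T A"
      by (rule state_apply_right[OF normalised_state[OF \<Theta>n] discard_effect])
    fix a assume a: "a \<in> effects T A"
    have aS: "a \<otimes> \<epsilon> S \<in> effects T (A \<boxtimes> S)" by (rule effect_par[OF a discard_effect])
    have "\<langle>a, (\<iota> A \<otimes> \<epsilon> (S \<boxtimes> S')) \<cdot> \<Theta>\<rangle> = \<langle>a \<otimes> \<epsilon> (S \<boxtimes> S'), \<Theta>\<rangle>"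
      by (rule pairing_slide(1)[OF a discard_effect normalised_state[OF \<Theta>n]])
    also have "\<dots> = \<langle>(a \<otimes> \<epsilon> S) \<otimes> \<epsilon> S', \<Theta>\<rangle>" by (simp add: discard_par)
    also have "\<dots> = \<langle>a \<otimes> \<epsilon> S, (\<iota> (A \<boxtimes> S) \<otimes> \<epsilon> S') \<cdot> \<Theta>\<rangle>"
      by (rule pairing_slide(1)[OF aS discard_effect \<Theta>s, symmetric])
    also have "\<dots> = (\<Sum>i\<in>{True, False}. \<langle>a \<otimes> \<epsilon> S, (\<iota> (A \<boxtimes> S) \<otimes> f i) \<cdot> \<Theta>\<rangle>)"
      by (rule dilated_state_marginal[OF \<Theta>s f aS])
    also have "\<dots> = \<langle>a \<otimes> \<epsilon> S, \<rho>'\<rangle> + \<langle>a \<otimes> \<epsilon> S, \<kappa>\<rangle>"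
      using eq[of True] eq[of False] by simp
    also have "\<dots> = e * \<langle>a \<otimes> \<epsilon> S, \<rho>\<rangle> + (1 - e) * \<langle>a \<otimes> \<epsilon> S, \<tau> \<otimes> \<eta>\<rangle>"
      by (simp only: \<rho>'(2)[OF aS] \<kappa>(2)[OF aS])
    also have "\<langle>a \<otimes> \<epsilon> S, \<rho>\<rangle> = \<langle>a, ?\<sigma>\<rangle>"
      by (rule pairing_slide(1)[OF a discard_effect normalised_state[OF \<rho>], symmetric])
    also have "\<langle>a \<otimes> \<epsilon> S, \<tau> \<otimes> \<eta>\<rangle> = \<langle>a, \<tau>\<rangle>"
      using pairing_par[OF a discard_effect normalised_state[OF \<tau>(1)] normalised_state[OF \<eta>]] normalised_pairing[OF \<eta>]
      by simp
    finally show "\<langle>a, ?\<omega>\<rangle> = \<langle>a, (\<iota> A \<otimes> \<epsilon> (S \<boxtimes> S')) \<cdot> \<Theta>\<rangle>" using \<tau>(2) a by simp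
  qed
  from extension[OF \<Psi> \<Theta>n this] obtain C where C: "channel T B (S \<boxtimes> S') C" "\<Theta> = (\<iota> A \<otimes> C) \<cdot> \<Psi>" .
  define D where "D = (\<iota> S \<otimes> f True) \<cdot> C"
  have ty: "src T \<Psi> = \<one>" "tgt T \<Psi> = A \<boxtimes> B" "src T C = B" "tgt T C = S \<boxtimes> S'" "src T (f True) = S'" "tgt T (f True) = \<one>"
    using \<Psi> channel_src[OF C(1)] channel_tgt[OF C(1)] test_hom[OF f, of True] by (auto simp: normalised_def hom_iffs)
  have "(\<iota> A \<otimes> D) \<cdot> \<Psi> = (\<iota> A \<otimes> (\<iota> S \<otimes> f True)) \<cdot> ((\<iota> A \<otimes> C) \<cdot> \<Psi>)"
    using ty by (simp add: D_def par_ident_seq assoc)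
  also have "\<iota> A \<otimes> (\<iota> S \<otimes> f True) = \<iota> (A \<boxtimes> S) \<otimes> f True"
    by (simp add: par_ident[symmetric])
  finally have "(\<iota> A \<otimes> D) \<cdot> \<Psi> = \<rho>'"
    using C(2) eq[of True] by simp
  moreover have "D \<in> hom T B S" using ty by (simp add: D_def hom_def)
  ultimately show thesis using \<rho>'(2) that by metis
qed

text \<open>Up to the factor \<open>e\<close> every normalised joint state is obtained from
  \<open>\<Psi>\<close> by a transformation of the other side, and that transformation commutes with
  \<open>f\<close> and \<open>g\<close>. Zero states are treated separately.\<close>

lemma faithful:
  assumes \<Psi>: "pure_normalised (A \<boxtimes> B) \<Psi>" and m: "mixed A e ((\<iota> A \<otimes> \<epsilon> B) \<cdot> \<Psi>)" and e: "0 < e" "e < 1"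
    and f: "f \<in> hom T A C" and g: "g \<in> hom T A C" and eq: "(f \<otimes> \<iota> B) \<cdot> \<Psi> = (g \<otimes> \<iota> B) \<cdot> \<Psi>"
  shows "f = g"
proof (rule transformation_eqI[OF f g])
  fix S \<rho> assume \<rho>: "\<rho> \<in> states T (A \<boxtimes> S)"
  show "(f \<otimes> \<iota> S) \<cdot> \<rho> = (g \<otimes> \<iota> S) \<cdot> \<rho>"
  proof (rule state_eqI)
    show "(f \<otimes> \<iota> S) \<cdot> \<rho> \<in> states T (C \<boxtimes> S)" "(g \<otimes> \<iota> S) \<cdot> \<rho> \<in> states T (C \<boxtimes> S)"
      using f g \<rho> by (simp_all add: hom_iffs)
    fix E assume E: "E \<in> effects T (C \<boxtimes> S)"
    have Eh: "E \<cdot> (h \<otimes> \<iota> S) \<in> effects T (A \<boxtimes> S)" "\<langle>E, (h \<otimes> \<iota> S) \<cdot> \<rho>\<rangle> = \<langle>E \<cdot> (h \<otimes> \<iota> S), \<rho>\<rangle>"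
      if "h \<in> hom T A C" for h
      using that E \<rho> by (simp_all add: hom_iffs pairing_seq)
    show "\<langle>E, (f \<otimes> \<iota> S) \<cdot> \<rho>\<rangle> = \<langle>E, (g \<otimes> \<iota> S) \<cdot> \<rho>\<rangle>"
    proof (cases "\<langle>\<epsilon> (A \<boxtimes> S), \<rho>\<rangle> = 0")
      case True
      have "\<langle>E \<cdot> (h \<otimes> \<iota> S), \<rho>\<rangle> = 0" if "h \<in> hom T A C" for h
        using effect_le_discard[OF Eh(1)[OF that] \<rho>] pairing_nonneg[OF Eh(1)[OF that] \<rho>] True by simp
      then show ?thesis using Eh(2) f g by simp
    next
      case False
      obtain \<sigma> where \<sigma>: "normalised T (A \<boxtimes> S) \<sigma>"
        "\<And>a. a \<in> effects T (A \<boxtimes> S) \<Longrightarrow> \<langle>a, \<rho>\<rangle> = \<langle>\<epsilon> (A \<boxtimes> S), \<rho>\<rangle> * \<langle>a, \<sigma>\<rangle>"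
        using normalise[OF \<rho> False] by blast
      obtain D where D: "D \<in> hom T B S" "\<And>E. E \<in> effects T (A \<boxtimes> S) \<Longrightarrow> \<langle>E, (\<iota> A \<otimes> D) \<cdot> \<Psi>\<rangle> = e * \<langle>E, \<sigma>\<rangle>"
        using mixed_steering[OF \<Psi> m e \<sigma>(1)] by blast
      have move: "\<langle>E \<cdot> (h \<otimes> \<iota> S), (\<iota> A \<otimes> D) \<cdot> \<Psi>\<rangle> = \<langle>E, (\<iota> C \<otimes> D) \<cdot> ((h \<otimes> \<iota> B) \<cdot> \<Psi>)\<rangle>"
        if h: "h \<in> hom T A C" for h
      proof -
        have ty: "src T \<Psi> = \<one>" "tgt T \<Psi> = A \<boxtimes> B" "src T D = B" "tgt T D = S" "src T h = A" "tgt T h = C"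
          "src T E = C \<boxtimes> S" "tgt T E = \<one>"
          using \<Psi> D(1) h E by (auto simp: normalised_def hom_iffs)
        have "(h \<otimes> \<iota> S) \<cdot> ((\<iota> A \<otimes> D) \<cdot> \<Psi>) = (\<iota> C \<otimes> D) \<cdot> ((h \<otimes> \<iota> B) \<cdot> \<Psi>)"
          using ty by (simp add: par_seq_assoc)
        then show ?thesis using ty by (simp add: pairing_def assoc)
      qed
      have "e * \<langle>E \<cdot> (f \<otimes> \<iota> S), \<sigma>\<rangle> = e * \<langle>E \<cdot> (g \<otimes> \<iota> S), \<sigma>\<rangle>"
        using D(2)[OF Eh(1)[OF f]] D(2)[OF Eh(1)[OF g]] move[OF f] move[OF g] eq by simp
      then have "\<langle>E \<cdot> (f \<otimes> \<iota> S), \<sigma>\<rangle> = \<langle>E \<cdot> (g \<otimes> \<iota> S), \<sigma>\<rangle>" using e(1) by simp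
      then show ?thesis
        unfolding Eh(2)[OF f] Eh(2)[OF g] \<sigma>(2)[OF Eh(1)[OF f]] \<sigma>(2)[OF Eh(1)[OF g]] by simp
    qed
  qed
qed

lemma mixed_purification:
  obtains B \<Psi> e where "pure_normalised (A \<boxtimes> B) \<Psi>" "mixed A e ((\<iota> A \<otimes> \<epsilon> B) \<cdot> \<Psi>)" "0 < e" "e < 1"
proof -
  obtain e \<omega> where e: "0 < e" "e < 1" and \<omega>: "mixed A e \<omega>" using mixed_exists .
  from \<omega> have "normalised T A \<omega>" by (simp add: mixed_def)
  from purification[OF this] obtain B \<Psi> where "normalised T (A \<boxtimes> B) \<Psi>" "pure T \<Psi>" "marginal T A B \<Psi> = \<omega>"
    by blast
  with e \<omega> that show thesis by (auto simp: marginal_def)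
qed

section \<open>Purity of identities and reversible channels\<close>

text \<open>No information without disturbance: each branch of a decomposition of the identity maps
  the faithful pure state to a multiple of itself, and is therefore a multiple of the
  identity.\<close>

lemma pure_ident: "pure T (\<iota> A)"
  unfolding pure_def src_ident tgt_ident
proof (intro allI impI ballI, elim conjE)
  fix X X0 :: "nat set" and D i
  assume D: "test T A A X D" "X0 \<subseteq> X" "is_sum T A A (\<iota> A) X0 D" and i: "i \<in> X0"
  obtain B \<Psi> e where \<Psi>: "pure_normalised (A \<boxtimes> B) \<Psi>" and m: "mixed A e ((\<iota> A \<otimes> \<epsilon> B) \<cdot> \<Psi>)" "0 < e" "e < 1"
    using mixed_purification .
  have \<Psi>s: "\<Psi> \<in> states T (A \<boxtimes> B)" using \<Psi> normalised_state by blast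
  have ty: "src T \<Psi> = \<one>" "tgt T \<Psi> = A \<boxtimes> B" using \<Psi>s by (auto simp: hom_iffs)
  have Dh: "j \<in> X \<Longrightarrow> D j \<in> hom T A A" for j by (rule test_hom[OF D(1)])
  have "test T (A \<boxtimes> B) (A \<boxtimes> B) (X \<times> {()}) (\<lambda>(i, j). D i \<otimes> \<iota> B)"
    by (rule parallel[OF D(1)]) (simp add: test_singleton test_ident)
  moreover have "bij_betw fst (X \<times> {()}) X" by (auto simp: bij_betw_def inj_on_def)
  from test_reindex[OF this, of T "A \<boxtimes> B" "A \<boxtimes> B" "\<lambda>i. D i \<otimes> \<iota> B"]
  have "test T (A \<boxtimes> B) (A \<boxtimes> B) (X \<times> {()}) (\<lambda>y. D (fst y) \<otimes> \<iota> B) \<longleftrightarrow> test T (A \<boxtimes> B) (A \<boxtimes> B) X (\<lambda>i. D i \<otimes> \<iota> B)" .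
  ultimately have "test T (A \<boxtimes> B) (A \<boxtimes> B) X (\<lambda>i. D i \<otimes> \<iota> B)" by (simp add: case_prod_unfold)
  moreover have "channel T \<one> (A \<boxtimes> B) \<Psi>" using \<Psi> by (simp add: normalised_iff_channel)
  ultimately have t: "test T \<one> (A \<boxtimes> B) X (\<lambda>i. (D i \<otimes> \<iota> B) \<cdot> \<Psi>)" by (intro test_seq')
  have st: "(D j \<otimes> \<iota> B) \<cdot> \<Psi> \<in> states T (A \<boxtimes> B)" if "j \<in> X" for j
    using test_hom[OF t that] by (simp add: states_def)
  have "\<langle>E, \<Psi>\<rangle> = (\<Sum>j\<in>X0. 1 * \<langle>E, (D j \<otimes> \<iota> B) \<cdot> \<Psi>\<rangle>)" if E: "E \<in> effects T (A \<boxtimes> B)" for E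
  proof -
    have "(B, \<Psi>, E) \<in> probes T A A" using \<Psi>s E by (simp add: probes_def)
    then have "probe_value T (\<iota> A) (B, \<Psi>, E) = (\<Sum>j\<in>X0. 1 * probe_value T (D j) (B, \<Psi>, E))"
      using D(3) by (simp add: is_lincomb_def)
    then show ?thesis using ty by (simp add: probe_value_def par_ident)
  qed
  then have "is_sum T \<one> (A \<boxtimes> B) \<Psi> X0 (\<lambda>i. (D i \<otimes> \<iota> B) \<cdot> \<Psi>)"
    unfolding state_lincomb_iff using \<Psi>s st D(2) D(3) by (auto simp: is_lincomb_def)
  then have "\<forall>j\<in>X0. is_multiple T \<one> (A \<boxtimes> B) ((D j \<otimes> \<iota> B) \<cdot> \<Psi>) \<Psi>"
    using \<Psi>[THEN conjunct2, unfolded pure_def ty, THEN spec, THEN spec, THEN spec, of X "\<lambda>i. (D i \<otimes> \<iota> B) \<cdot> \<Psi>" X0] t D(2)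
    by simp
  then have "\<exists>p. \<forall>E\<in>effects T (A \<boxtimes> B). \<langle>E, (D i \<otimes> \<iota> B) \<cdot> \<Psi>\<rangle> = p * \<langle>E, \<Psi>\<rangle>"
    using i by (simp add: is_multiple_def state_lincomb_iff)
  then obtain p where p: "\<And>E. E \<in> effects T (A \<boxtimes> B) \<Longrightarrow> \<langle>E, (D i \<otimes> \<iota> B) \<cdot> \<Psi>\<rangle> = p * \<langle>E, \<Psi>\<rangle>"
    by blast
  have iX: "i \<in> X" using i D(2) by blast
  have "p = \<langle>\<epsilon> (A \<boxtimes> B), (D i \<otimes> \<iota> B) \<cdot> \<Psi>\<rangle>"
    using p[OF discard_effect] \<Psi> normalised_pairing[of "A \<boxtimes> B" \<Psi>] by simp
  then have p01: "0 \<le> p" "p \<le> 1" using pairing_range[OF discard_effect st[OF iX]] by simp_all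
  note sp = scalar[OF p01]
  have "D i = scalar p \<otimes> \<iota> A"
  proof (rule faithful[OF \<Psi> m Dh[OF iX]])
    show "scalar p \<otimes> \<iota> A \<in> hom T A A" using sp by (simp add: hom_def)
    have "((scalar p \<otimes> \<iota> A) \<otimes> \<iota> B) \<cdot> \<Psi> = scalar p \<otimes> \<Psi>"
      using sp ty by (simp add: par_ident scalar_par_seq')
    moreover have "scalar p \<otimes> \<Psi> = (D i \<otimes> \<iota> B) \<cdot> \<Psi>"
    proof (rule state_eqI[OF _ st[OF iX]])
      show "scalar p \<otimes> \<Psi> \<in> states T (A \<boxtimes> B)" using sp ty by (simp add: hom_iffs)
      fix E assume E: "E \<in> effects T (A \<boxtimes> B)"
      have "\<langle>E, scalar p \<otimes> \<Psi>\<rangle> = p * \<langle>E, \<Psi>\<rangle>"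
        using E sp ty by (simp add: pairing_def scalar_par_seq scalar_par prob_mult hom_iffs)
      then show "\<langle>E, scalar p \<otimes> \<Psi>\<rangle> = \<langle>E, (D i \<otimes> \<iota> B) \<cdot> \<Psi>\<rangle>" using p[OF E] by simp
    qed
    ultimately show "(D i \<otimes> \<iota> B) \<cdot> \<Psi> = ((scalar p \<otimes> \<iota> A) \<otimes> \<iota> B) \<cdot> \<Psi>" by simp
  qed
  then have "probe_value T (D i) w = p * probe_value T (\<iota> A) w" if "w \<in> probes T A A" for w
    using probe_scale[OF sp(1,2) ident_hom that] sp(3) by simp
  then show "is_multiple T A A (D i) (\<iota> A)"
    unfolding is_multiple_def using Dh[OF iX] ident_hom by (auto simp: is_lincomb_def intro!: exI[of _ p])
qed

text \<open>Composing a decomposition of \<open>U\<close> with the inverse gives a decomposition of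
  the identity.\<close>

lemma reversible_pure:
  assumes U: "reversible T A B U"
  shows "pure T U"
  unfolding pure_def reversible_src[OF U] reversible_tgt[OF U]
proof (intro allI impI ballI, elim conjE)
  fix X X0 :: "nat set" and D i
  assume D: "test T A B X D" "X0 \<subseteq> X" "is_sum T A B U X0 D" and i: "i \<in> X0"
  obtain V where V: "reversible T B A V" "V \<cdot> U = \<iota> A" "U \<cdot> V = \<iota> B" using reversible_inverse[OF U] .
  have t: "test T A A X (\<lambda>i. V \<cdot> D i)" by (rule test_seq[OF D(1) reversible_channel[OF V(1)]])
  have "is_sum T A A (V \<cdot> U) X0 (\<lambda>i. V \<cdot> D i)"
    by (rule lincomb_post[OF D(3) channel_hom[OF reversible_channel[OF V(1)]]])
  then have "\<forall>j\<in>X0. is_multiple T A A (V \<cdot> D j) (\<iota> A)"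
    using pure_ident[of A, unfolded pure_def src_ident tgt_ident, THEN spec, THEN spec, THEN spec, of X "\<lambda>i. V \<cdot> D i" X0] t D(2) V(2)
    by simp
  then obtain p where "is_lincomb T A A (V \<cdot> D i) {()} (\<lambda>_. p) (\<lambda>_. \<iota> A)"
    using i by (auto simp: is_multiple_def)
  from lincomb_post[OF this channel_hom[OF reversible_channel[OF U]]]
  have "is_lincomb T A B (U \<cdot> (V \<cdot> D i)) {()} (\<lambda>_. p) (\<lambda>_. U \<cdot> \<iota> A)" .
  moreover have "tgt T (D i) = B" using test_hom[OF D(1)] i D(2) by (auto simp: hom_def)
  ultimately have "is_lincomb T A B (D i) {()} (\<lambda>_. p) (\<lambda>_. U)"
    using reversible_cancel[OF U V(3,1)] reversible_src[OF U] by simp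
  then show "is_multiple T A B (D i) U" by (auto simp: is_multiple_def)
qed

text \<open>A channel on \<open>A\<close> leaves the marginal on \<open>B\<close> unchanged, and a
  pure one keeps the faithful state pure. By uniqueness of purification it acts on that state as a
  reversible channel, hence equals it.\<close>

lemma pure_channel_reversible:
  assumes R: "channel T A A R" "pure T R"
  shows "reversible T A A R"
proof -
  obtain B \<Psi> e where \<Psi>: "pure_normalised (A \<boxtimes> B) \<Psi>" and m: "mixed A e ((\<iota> A \<otimes> \<epsilon> B) \<cdot> \<Psi>)" "0 < e" "e < 1"
    using mixed_purification .
  have ty: "src T \<Psi> = \<one>" "tgt T \<Psi> = A \<boxtimes> B" "src T R = A" "tgt T R = A"
    using \<Psi> normalised_src[of "A \<boxtimes> B" \<Psi>] normalised_tgt[of "A \<boxtimes> B" \<Psi>] channel_src[OF R(1)] channel_tgt[OF R(1)] by auto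
  have n: "normalised T (A \<boxtimes> B) ((R \<otimes> \<iota> B) \<cdot> \<Psi>)"
    by (rule channel_normalised[OF channel_par[OF R(1) test_ident]]) (use \<Psi> in simp)
  have "pure T ((R \<otimes> \<iota> B) \<cdot> \<Psi>)"
    by (rule pure_seq[of \<Psi> \<one> "A \<boxtimes> B" _ "A \<boxtimes> B"]) (use ty \<Psi> R pure_par[OF R(2) pure_ident] in \<open>simp_all add: hom_def\<close>)
  with n have p: "pure_normalised (A \<boxtimes> B) ((R \<otimes> \<iota> B) \<cdot> \<Psi>)" by simp
  have "(\<epsilon> A \<otimes> \<iota> B) \<cdot> ((R \<otimes> \<iota> B) \<cdot> \<Psi>) = ((\<epsilon> A \<cdot> R) \<otimes> \<iota> B) \<cdot> \<Psi>"
    using ty by (simp add: par_seq_assoc)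
  then have "(\<epsilon> A \<otimes> \<iota> B) \<cdot> \<Psi> = (\<epsilon> A \<otimes> \<iota> B) \<cdot> ((R \<otimes> \<iota> B) \<cdot> \<Psi>)" using discard_seq[OF R(1)] by simp
  from purification_unique'[OF \<Psi> p this] obtain U where U: "reversible T A A U" "(R \<otimes> \<iota> B) \<cdot> \<Psi> = (U \<otimes> \<iota> B) \<cdot> \<Psi>" .
  have "R = U"
    by (rule faithful[OF \<Psi> m channel_hom[OF R(1)] channel_hom[OF reversible_channel[OF U(1)]] U(2)])
  with U(1) show ?thesis by simp
qed

end

section \<open>State-effect duality\<close>

context causal_opt
begin

lemma effect_partial_sum:
  assumes t: "test T A \<one> X e" and X0: "X0 \<subseteq> X"
  obtains h where "h \<in> effects T A" "\<And>\<rho>. \<rho> \<in> states T A \<Longrightarrow> \<langle>h, \<rho>\<rangle> = (\<Sum>i\<in>X0. \<langle>e i, \<rho>\<rangle>)"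
proof (cases "X0 = {}")
  case True
  have "scalar 0 \<cdot> \<epsilon> A \<in> effects T A" "\<And>\<rho>. \<rho> \<in> states T A \<Longrightarrow> \<langle>scalar 0 \<cdot> \<epsilon> A, \<rho>\<rangle> = 0"
    using scale_effect[of "scalar 0" "\<epsilon> A" A] by (simp_all add: scalar)
  then show thesis using that[of "scalar 0 \<cdot> \<epsilon> A"] True by simp
next
  case False
  define g where "g i = (if i \<in> X0 then 1 else 0 :: nat)" for i
  obtain h where h: "\<And>j. j \<in> g ` X \<Longrightarrow> is_sum T A \<one> (h j) {i \<in> X. g i = j} e"
    using coarse[OF t, where g = g] by blast
  have "1 \<in> g ` X" using False X0 by (force simp: g_def)
  moreover have "{i \<in> X. g i = 1} = X0" using X0 by (auto simp: g_def)
  ultimately have "is_sum T A \<one> (h 1) X0 e" using h[of 1] by simp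
  then show thesis by (intro that[of "h 1"]) (auto simp: effect_lincomb_iff)
qed

section \<open>Limits of channels\<close>

lemma channel_limit:
  assumes F: "\<And>k. channel T A B (F k)" and lim: "converges_to T A B F f"
  shows "channel T A B f"
proof (rule channel_if_discard_preserving)
  show fh: "f \<in> hom T A B" using lim by (simp add: converges_to_def)
  show "\<epsilon> B \<cdot> f = \<epsilon> A"
  proof (rule effect_eqI[of _ A])
    show "\<epsilon> B \<cdot> f \<in> effects T A" "\<epsilon> A \<in> effects T A" using fh by (simp_all add: hom_iffs)
    fix \<rho> assume \<rho>: "\<rho> \<in> states T A"
    have pv: "probe_value T g (\<one>, \<rho>, \<epsilon> B) = \<langle>\<epsilon> B \<cdot> g, \<rho>\<rangle>" if "g \<in> hom T A B" for g
      using that \<rho> by (simp add: probe_value_def pairing_def hom_iffs assoc)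
    have "(\<one>, \<rho>, \<epsilon> B) \<in> probes T A B" using \<rho> by (simp add: probes_def)
    then have "(\<lambda>k. probe_value T (F k) (\<one>, \<rho>, \<epsilon> B)) \<longlonglongrightarrow> probe_value T f (\<one>, \<rho>, \<epsilon> B)"
      using lim by (simp add: converges_to_def)
    then have "(\<lambda>k. \<langle>\<epsilon> A, \<rho>\<rangle>) \<longlonglongrightarrow> \<langle>\<epsilon> B \<cdot> f, \<rho>\<rangle>"
      using pv[OF channel_hom[OF F]] pv[OF fh] discard_seq[OF F] by simp
    then show "\<langle>\<epsilon> B \<cdot> f, \<rho>\<rangle> = \<langle>\<epsilon> A, \<rho>\<rangle>" by (simp add: LIMSEQ_const_iff)
  qed
qed

text \<open>Joint continuity of composition: each probe is split into a varying effect and a varying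
  state around the intermediate system, which is the situation of
  \<open>pairing_tendsto\<close>.\<close>

lemma converges_seq:
  assumes G: "converges_to T A B G g" and F: "converges_to T B C F f"
  shows "converges_to T A C (\<lambda>k. F k \<cdot> G k) (f \<cdot> g)"
  unfolding converges_to_def
proof (intro conjI ballI)
  have Gh: "\<And>k. G k \<in> hom T A B" "g \<in> hom T A B" and Fh: "\<And>k. F k \<in> hom T B C" "f \<in> hom T B C"
    using G F by (auto simp: converges_to_def)
  show "range (\<lambda>k. F k \<cdot> G k) \<subseteq> hom T A C" "f \<cdot> g \<in> hom T A C"
    using seq_hom[OF Gh(1) Fh(1)] seq_hom[OF Gh(2) Fh(2)] by auto
  fix w assume w: "w \<in> probes T A C"
  obtain S \<rho> E where w': "w = (S, \<rho>, E)" by (cases w)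
  have \<rho>: "\<rho> \<in> states T (A \<boxtimes> S)" and E: "E \<in> effects T (C \<boxtimes> S)" using w by (auto simp: w' probes_def)
  have eq: "probe_value T (k \<cdot> h) w = \<langle>E \<cdot> (k \<otimes> \<iota> S), (h \<otimes> \<iota> S) \<cdot> \<rho>\<rangle>"
    if "h \<in> hom T A B" "k \<in> hom T B C" for h k
    using that \<rho> E unfolding w' probe_value_def by (simp add: hom_iffs pairing_def seq_par_ident assoc)
  have st: "(h \<otimes> \<iota> S) \<cdot> \<rho> \<in> states T (B \<boxtimes> S)" if "h \<in> hom T A B" for h
    using that \<rho> by (simp add: hom_iffs)
  have ef: "E \<cdot> (h \<otimes> \<iota> S) \<in> effects T (B \<boxtimes> S)" if "h \<in> hom T B C" for h
    using that E by (simp add: hom_iffs)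
  have "(\<lambda>k. \<langle>E \<cdot> (F k \<otimes> \<iota> S), (G k \<otimes> \<iota> S) \<cdot> \<rho>\<rangle>) \<longlonglongrightarrow> \<langle>E \<cdot> (f \<otimes> \<iota> S), (g \<otimes> \<iota> S) \<cdot> \<rho>\<rangle>"
  proof (rule pairing_tendsto[OF ef[OF Fh(1)] st[OF Gh(1)] st[OF Gh(2)]])
    fix \<tau> assume \<tau>: "\<tau> \<in> states T (B \<boxtimes> S)"
    have pv: "probe_value T h (S, \<tau>, E) = \<langle>E \<cdot> (h \<otimes> \<iota> S), \<tau>\<rangle>" if "h \<in> hom T B C" for h
      using that \<tau> E by (simp add: probe_value_def hom_iffs pairing_seq)
    have "(S, \<tau>, E) \<in> probes T B C" using \<tau> E by (simp add: probes_def)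
    then have "(\<lambda>k. probe_value T (F k) (S, \<tau>, E)) \<longlonglongrightarrow> probe_value T f (S, \<tau>, E)"
      using F by (simp add: converges_to_def)
    then show "(\<lambda>k. \<langle>E \<cdot> (F k \<otimes> \<iota> S), \<tau>\<rangle>) \<longlonglongrightarrow> \<langle>E \<cdot> (f \<otimes> \<iota> S), \<tau>\<rangle>"
      by (simp add: pv[OF Fh(1)] pv[OF Fh(2)])
  next
    fix a assume a: "a \<in> effects T (B \<boxtimes> S)"
    have "(S, \<rho>, a) \<in> probes T A B" using \<rho> a by (simp add: probes_def)
    then have "(\<lambda>k. probe_value T (G k) (S, \<rho>, a)) \<longlonglongrightarrow> probe_value T g (S, \<rho>, a)"
      using G by (simp add: converges_to_def)
    then show "(\<lambda>k. \<langle>a, (G k \<otimes> \<iota> S) \<cdot> \<rho>\<rangle>) \<longlonglongrightarrow> \<langle>a, (g \<otimes> \<iota> S) \<cdot> \<rho>\<rangle>"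
      by (simp add: probe_value_def)
  qed
  then show "(\<lambda>k. probe_value T (F k \<cdot> G k) w) \<longlonglongrightarrow> probe_value T (f \<cdot> g) w"
    by (simp add: eq[OF Gh(1) Fh(1)] eq[OF Gh(2) Fh(2)])
qed

lemma converges_unique:
  assumes "converges_to T A B F f" "converges_to T A B F g"
  shows "f = g"
proof (rule probe_eqI)
  show "f \<in> hom T A B" "g \<in> hom T A B" using assms by (auto simp: converges_to_def)
  fix w assume "w \<in> probes T A B"
  then show "probe_value T f w = probe_value T g w"
    using assms LIMSEQ_unique unfolding converges_to_def by blast
qed

lemma converges_const: "f \<in> hom T A B \<Longrightarrow> converges_to T A B (\<lambda>_. f) f"
  by (auto simp: converges_to_def)

lemma converges_subseq: "converges_to T A B F f \<Longrightarrow> strict_mono r \<Longrightarrow> converges_to T A B (\<lambda>k. F (r k)) f"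
  unfolding converges_to_def using LIMSEQ_subseq_LIMSEQ[of "\<lambda>k. probe_value T (F k) w" _ r for w]
  by (auto simp: o_def)

end

context sharp_theory_with_purification
begin

text \<open>By compactness the inverses converge along a subsequence, and joint continuity of
  composition makes their limit an inverse of \<open>f\<close>.\<close>

lemma reversible_limit:
  assumes F: "\<And>k. reversible T A A (F k)" and lim: "converges_to T A A F f"
  shows "reversible T A A f"
proof -
  have "\<exists>V. reversible T A A V \<and> V \<cdot> F k = \<iota> A \<and> F k \<cdot> V = \<iota> A" for k
    using reversible_inverse[OF F[of k]] by metis
  then obtain V where V: "\<And>k. reversible T A A (V k)" "\<And>k. V k \<cdot> F k = \<iota> A" "\<And>k. F k \<cdot> V k = \<iota> A"
    by metis
  obtain r g where r: "strict_mono r" and g: "converges_to T A A (\<lambda>k. V (r k)) g"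
    using hom_subsequence[of V A A] channel_hom[OF reversible_channel[OF V(1)]] by blast
  note lim' = converges_subseq[OF lim r]
  have "converges_to T A A (\<lambda>k. \<iota> A) (g \<cdot> f)" "converges_to T A A (\<lambda>k. \<iota> A) (f \<cdot> g)"
    using converges_seq[OF lim' g] converges_seq[OF g lim'] V(2,3) by simp_all
  then have "g \<cdot> f = \<iota> A" "f \<cdot> g = \<iota> A"
    using converges_unique converges_const[OF ident_hom[of A]] by blast+
  moreover have "channel T A A f" by (rule channel_limit[OF reversible_channel[OF F] lim])
  moreover have "channel T A A g" by (rule channel_limit[OF reversible_channel[OF V(1)] g])
  ultimately show ?thesis by (auto simp: reversible_def)
qed

section \<open>The invariant state\<close>

text \<open>One interior invariant state is fixed by choice. That it is the only invariant state,
  and hence the microcanonical one, can be proved only when bases are at hand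
  (\<open>invariant_unique\<close>).\<close>

definition chi :: "'s \<Rightarrow> 't" where
  "chi A = (SOME \<xi>. (\<exists>e. 0 < e \<and> e < 1 \<and> mixed A e \<xi>) \<and> (\<forall>U. reversible T A A U \<longrightarrow> U \<cdot> \<xi> = \<xi>))"

lemma chi_props: "(\<exists>e. 0 < e \<and> e < 1 \<and> mixed A e (chi A)) \<and> (\<forall>U. reversible T A A U \<longrightarrow> U \<cdot> chi A = chi A)"
  unfolding chi_def by (rule someI_ex) (metis invariant_mixed_exists)

lemma chi_mixed: obtains e where "0 < e" "e < 1" "mixed A e (chi A)"
  using chi_props[of A] by blast

lemma chi_invariant: "reversible T A A U \<Longrightarrow> U \<cdot> chi A = chi A"
  using chi_props[of A] by blast

lemma chi_normalised: "normalised T A (chi A)"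
  using chi_mixed[of A] by (auto simp: mixed_def)

lemma chi_state: "chi A \<in> states T A"
  by (rule normalised_state[OF chi_normalised])

lemma chi_decompose:
  assumes "normalised T A \<sigma>"
  obtains e \<tau> where "0 < e" "e < 1" "normalised T A \<tau>"
    "\<And>a. a \<in> effects T A \<Longrightarrow> \<langle>a, chi A\<rangle> = e * \<langle>a, \<sigma>\<rangle> + (1 - e) * \<langle>a, \<tau>\<rangle>"
proof -
  obtain e where e: "0 < e" "e < 1" "mixed A e (chi A)" using chi_mixed .
  with assms obtain \<tau> where "normalised T A \<tau>" "\<forall>a\<in>effects T A. \<langle>a, chi A\<rangle> = e * \<langle>a, \<sigma>\<rangle> + (1 - e) * \<langle>a, \<tau>\<rangle>"
    unfolding mixed_def by blast
  with e that show thesis by blast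
qed

text \<open>Every normalised state occurs in \<open>chi A\<close> with positive weight, so an effect
  that never fires on \<open>chi A\<close> never fires at all.\<close>

lemma chi_zero:
  assumes a: "a \<in> effects T A" and z: "\<langle>a, chi A\<rangle> = 0" and \<rho>: "\<rho> \<in> states T A"
  shows "\<langle>a, \<rho>\<rangle> = 0"
proof (cases "\<langle>\<epsilon> A, \<rho>\<rangle> = 0")
  case True
  then show ?thesis using effect_le_discard[OF a \<rho>] pairing_nonneg[OF a \<rho>] by simp
next
  case False
  obtain \<sigma> where \<sigma>: "normalised T A \<sigma>" "\<And>a. a \<in> effects T A \<Longrightarrow> \<langle>a, \<rho>\<rangle> = \<langle>\<epsilon> A, \<rho>\<rangle> * \<langle>a, \<sigma>\<rangle>"
    using normalise[OF \<rho> False] by blast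
  obtain e \<tau> where e: "0 < e" "e < 1" and \<tau>: "normalised T A \<tau>"
    and eq: "\<And>a. a \<in> effects T A \<Longrightarrow> \<langle>a, chi A\<rangle> = e * \<langle>a, \<sigma>\<rangle> + (1 - e) * \<langle>a, \<tau>\<rangle>"
    using chi_decompose[OF \<sigma>(1)] by blast
  have "0 \<le> (1 - e) * \<langle>a, \<tau>\<rangle>" "0 \<le> e * \<langle>a, \<sigma>\<rangle>"
    using e pairing_nonneg[OF a normalised_state[OF \<tau>]] pairing_nonneg[OF a normalised_state[OF \<sigma>(1)]] by auto
  with eq[OF a] z have "e * \<langle>a, \<sigma>\<rangle> = 0" by linarith
  then show ?thesis using \<sigma>(2)[OF a] e by simp
qed

lemma chi_purification:
  obtains B \<Psi> where "pure_normalised (A \<boxtimes> B) \<Psi>" "(\<iota> A \<otimes> \<epsilon> B) \<cdot> \<Psi> = chi A"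
  using purification[OF chi_normalised[of A]] that by (auto simp: marginal_def)

lemma chi_faithful:
  assumes \<Psi>: "pure_normalised (A \<boxtimes> B) \<Psi>" "(\<iota> A \<otimes> \<epsilon> B) \<cdot> \<Psi> = chi A"
    and ab: "a \<in> effects T A" "b \<in> effects T A" and eq: "(a \<otimes> \<iota> B) \<cdot> \<Psi> = (b \<otimes> \<iota> B) \<cdot> \<Psi>"
  shows "a = b"
proof -
  obtain e where e: "0 < e" "e < 1" "mixed A e (chi A)" using chi_mixed .
  show ?thesis
    by (rule faithful[OF \<Psi>(1) _ e(1,2) _ _ eq, of \<one>]) (use e(3) \<Psi>(2) ab in \<open>simp_all add: effects_def\<close>)
qed

section \<open>Sharp effects and their states\<close>

text \<open>Apply \<open>a\<close> to a purification of \<rho>. The complement of \<open>a\<close>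
  never fires, so the result is the full marginal on \<open>B\<close>, and it is pure. A product of
  pure states has the same marginal; by uniqueness the purification is itself such a product, and
  \<rho> is one of its factors.\<close>

lemma sharp_state_pure:
  assumes a: "a \<in> effects T A" "pure T a" and \<rho>: "normalised T A \<rho>" and one: "\<langle>a, \<rho>\<rangle> = 1"
  shows "pure T \<rho>"
proof -
  obtain B \<Phi> where \<Phi>: "normalised T (A \<boxtimes> B) \<Phi>" "pure T \<Phi>" and mg: "(\<iota> A \<otimes> \<epsilon> B) \<cdot> \<Phi> = \<rho>"
    using purification[OF \<rho>] by (auto simp: marginal_def)
  note \<Phi>s = normalised_state[OF \<Phi>(1)]
  obtain a' where a': "a' \<in> effects T A" "\<And>\<rho>. \<rho> \<in> states T A \<Longrightarrow> \<langle>a, \<rho>\<rangle> + \<langle>a', \<rho>\<rangle> = \<langle>\<epsilon> A, \<rho>\<rangle>"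
    using effect_complement[OF a(1)] by blast
  have a'0: "\<langle>a', \<rho>\<rangle> = 0" using a'(2)[OF normalised_state[OF \<rho>]] one normalised_pairing[OF \<rho>] by simp
  let ?\<beta> = "(a \<otimes> \<iota> B) \<cdot> \<Phi>"
  have eq: "?\<beta> = (\<epsilon> A \<otimes> \<iota> B) \<cdot> \<Phi>"
  proof (rule state_eqI[OF state_apply_left[OF \<Phi>s a(1)] state_apply_left[OF \<Phi>s discard_effect]])
    fix b assume b: "b \<in> effects T B"
    have "\<langle>a', (\<iota> A \<otimes> b) \<cdot> \<Phi>\<rangle> = \<langle>b, (a' \<otimes> \<iota> B) \<cdot> \<Phi>\<rangle>"
      using pairing_slide[OF a'(1) b \<Phi>s] by simp
    also have "\<dots> \<le> \<langle>\<epsilon> B, (a' \<otimes> \<iota> B) \<cdot> \<Phi>\<rangle>"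
      by (rule effect_le_discard[OF b state_apply_left[OF \<Phi>s a'(1)]])
    also have "\<dots> = \<langle>a', \<rho>\<rangle>" using pairing_slide[OF a'(1) discard_effect \<Phi>s] mg by simp
    finally have "\<langle>a', (\<iota> A \<otimes> b) \<cdot> \<Phi>\<rangle> = 0"
      using a'0 pairing_nonneg[OF a'(1) state_apply_right[OF \<Phi>s b]] by simp
    then have "\<langle>a, (\<iota> A \<otimes> b) \<cdot> \<Phi>\<rangle> = \<langle>\<epsilon> A, (\<iota> A \<otimes> b) \<cdot> \<Phi>\<rangle>"
      using a'(2)[OF state_apply_right[OF \<Phi>s b]] by simp
    then show "\<langle>b, ?\<beta>\<rangle> = \<langle>b, (\<epsilon> A \<otimes> \<iota> B) \<cdot> \<Phi>\<rangle>"
      using pairing_slide[OF a(1) b \<Phi>s] pairing_slide[OF discard_effect b \<Phi>s] by simp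
  qed
  have \<beta>n: "normalised T B ?\<beta>" unfolding eq by (rule channel_normalised[OF marginal_channel(2) \<Phi>(1)])
  have "pure T ?\<beta>"
    by (rule pure_seq[of \<Phi> \<one> "A \<boxtimes> B" _ B])
      (use \<Phi>s \<Phi>(2) a pure_par[OF a(2) pure_ident] in \<open>simp_all add: hom_iffs\<close>)
  obtain \<zeta> where \<zeta>: "normalised T A \<zeta>" "pure T \<zeta>" using pure_exists .
  have p1: "pure_normalised (A \<boxtimes> B) (\<zeta> \<otimes> ?\<beta>)"
    using pure_normalised_par[of A \<zeta> B ?\<beta>] \<zeta> \<beta>n \<open>pure T ?\<beta>\<close> by simp
  have p2: "pure_normalised (A \<boxtimes> B) \<Phi>" using \<Phi> by simp
  have "(\<epsilon> A \<otimes> \<iota> B) \<cdot> (\<zeta> \<otimes> ?\<beta>) = (\<epsilon> A \<otimes> \<iota> B) \<cdot> \<Phi>"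
    using discard_apply_left[OF \<zeta>(1) normalised_state[OF \<beta>n]] eq by simp
  from purification_unique'[OF p1 p2 this] obtain U where U: "reversible T A A U" "\<Phi> = (U \<otimes> \<iota> B) \<cdot> (\<zeta> \<otimes> ?\<beta>)" .
  have Un: "pure_normalised A (U \<cdot> \<zeta>)" by (rule reversible_pure_normalised[OF _ U(1)]) (use \<zeta> in simp)
  have "\<Phi> = (U \<cdot> \<zeta>) \<otimes> (\<iota> B \<cdot> ?\<beta>)"
    by (subst U(2), rule par_seq) (use \<zeta>(1) \<beta>n reversible_src[OF U(1)] in \<open>simp_all add: normalised_tgt\<close>)
  then have "\<Phi> = (U \<cdot> \<zeta>) \<otimes> ?\<beta>" using normalised_tgt[OF \<beta>n] by simp
  then have "\<rho> = U \<cdot> \<zeta>" using mg discard_apply_right[OF \<beta>n, of "U \<cdot> \<zeta>" A] Un normalised_state by metis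
  with Un show ?thesis by simp
qed

text \<open>The midpoint of the two states is also certain for \<open>a\<close>, hence pure, hence
  equal to both.\<close>

lemma sharp_state_unique:
  assumes a: "a \<in> effects T A" "pure T a" and \<rho>: "normalised T A \<rho>" "\<langle>a, \<rho>\<rangle> = 1"
    and \<sigma>: "normalised T A \<sigma>" "\<langle>a, \<sigma>\<rangle> = 1"
  shows "\<rho> = \<sigma>"
proof -
  obtain \<mu> where \<mu>: "normalised T A \<mu>" "\<And>a. a \<in> effects T A \<Longrightarrow> \<langle>a, \<mu>\<rangle> = (\<langle>a, \<rho>\<rangle> + \<langle>a, \<sigma>\<rangle>) / 2"
    using normalised_midpoint[OF \<rho>(1) \<sigma>(1)] by blast
  have "\<langle>a, \<mu>\<rangle> = 1" using \<mu>(2)[OF a(1)] \<rho>(2) \<sigma>(2) by simp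
  then have p: "pure T \<mu>" by (rule sharp_state_pure[OF a \<mu>(1)])
  have "\<rho> = \<mu>"
    by (rule pure_extreme[OF p \<mu>(1) \<rho>(1) \<sigma>(1), of "1/2"]) (use \<mu>(2) in \<open>auto simp: field_simps\<close>)
  moreover have "\<sigma> = \<mu>"
    by (rule pure_extreme[OF p \<mu>(1) \<sigma>(1) \<rho>(1), of "1/2"]) (use \<mu>(2) in \<open>auto simp: field_simps\<close>)
  ultimately show ?thesis by simp
qed

text \<open>A pure state is a purification of the unique normalised state of the trivial system, so
  this is uniqueness of purification with trivial \<open>A\<close>.\<close>

lemma transitive:
  assumes "pure_normalised A \<alpha>" "pure_normalised A \<beta>"
  obtains U where "reversible T A A U" "\<beta> = U \<cdot> \<alpha>"
proof -
  have "marginal T \<one> A \<alpha> = marginal T \<one> A \<beta>"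
    using assms by (simp add: marginal_def normalised_discard)
  with purification_unique[of \<one> A \<alpha> \<beta>] assms obtain U where "reversible T A A U" "\<beta> = (\<iota> \<one> \<otimes> U) \<cdot> \<alpha>"
    by auto
  with that show thesis by simp
qed

definition sharp :: "'s \<Rightarrow> 't" where
  "sharp A = (SOME a. a \<in> effects T A \<and> pure T a \<and> (\<exists>\<rho>\<in>states T A. \<langle>a, \<rho>\<rangle> = 1))"

text \<open>All effects are taken from a single orbit: maximisation over them reduces to compactness
  of the reversible channels, and an invariant state gives every member the same
  probability.\<close>

definition sharp_effects :: "'s \<Rightarrow> 't set" where
  "sharp_effects A = {sharp A \<cdot> U |U. reversible T A A U}"

text \<open>The analogue of the bra belonging to the ket \<alpha>. For a pure normalised \<alpha>
  the choice is immaterial by \<open>dag_unique\<close>.\<close>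

definition dag :: "'s \<Rightarrow> 't \<Rightarrow> 't" where
  "dag A \<alpha> = (SOME b. b \<in> sharp_effects A \<and> \<langle>b, \<alpha>\<rangle> = 1)"

text \<open>By \<open>basis_card\<close> this is the reciprocal of the size of a basis.\<close>

definition weight :: "'s \<Rightarrow> real" where
  "weight A = \<langle>sharp A, chi A\<rangle>"

lemma sharp_props: "sharp A \<in> effects T A \<and> pure T (sharp A) \<and> (\<exists>\<rho>\<in>states T A. \<langle>sharp A, \<rho>\<rangle> = 1)"
  unfolding sharp_def by (rule someI_ex) (use pure_sharpness[of A] in blast)

lemma sharp_state: obtains \<alpha> where "pure_normalised A \<alpha>" "\<langle>sharp A, \<alpha>\<rangle> = 1"
proof -
  have s: "sharp A \<in> effects T A" "pure T (sharp A)" using sharp_props by auto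
  obtain \<rho> where \<rho>: "\<rho> \<in> states T A" "\<langle>sharp A, \<rho>\<rangle> = 1" using sharp_props by blast
  have "\<langle>\<epsilon> A, \<rho>\<rangle> = 1"
    using effect_le_discard[OF s(1) \<rho>(1)] pairing_le_1[OF discard_effect \<rho>(1)] \<rho>(2) by linarith
  then have n: "normalised T A \<rho>" using \<rho>(1) by (simp add: normalised_def)
  with sharp_state_pure[OF s n \<rho>(2)] \<rho>(2) that show thesis by blast
qed

lemma sharp_effects_pure:
  assumes "b \<in> sharp_effects A"
  shows "b \<in> effects T A" "pure T b"
proof -
  obtain U where U: "reversible T A A U" "b = sharp A \<cdot> U" using assms by (auto simp: sharp_effects_def)
  show "b \<in> effects T A" unfolding U(2) by (rule effect_channel[OF _ reversible_channel[OF U(1)]]) (use sharp_props in simp)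
  show "pure T b" unfolding U(2)
    by (rule pure_seq[of U A A _ \<one>])
      (use sharp_props[of A] reversible_pure[OF U(1)] channel_hom[OF reversible_channel[OF U(1)]] in \<open>auto simp: effects_def\<close>)
qed

lemma sharp_effects_state:
  assumes "b \<in> sharp_effects A"
  obtains \<alpha> where "pure_normalised A \<alpha>" "\<langle>b, \<alpha>\<rangle> = 1"
proof -
  obtain U where U: "reversible T A A U" "b = sharp A \<cdot> U" using assms by (auto simp: sharp_effects_def)
  obtain V where V: "reversible T A A V" "V \<cdot> U = \<iota> A" "U \<cdot> V = \<iota> A" using reversible_inverse[OF U(1)] .
  obtain \<alpha> where \<alpha>: "pure_normalised A \<alpha>" "\<langle>sharp A, \<alpha>\<rangle> = 1" using sharp_state .
  have s: "sharp A \<in> effects T A" using sharp_props by simp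
  have "\<langle>b, V \<cdot> \<alpha>\<rangle> = 1"
    unfolding U(2) using reversible_pairing[OF V(1) U(1) V(3) s] \<alpha> normalised_state by simp
  with that[OF reversible_pure_normalised[OF \<alpha>(1) V(1)]] show thesis .
qed

lemma dag_props:
  assumes \<alpha>: "pure_normalised A \<alpha>"
  shows "dag A \<alpha> \<in> sharp_effects A \<and> \<langle>dag A \<alpha>, \<alpha>\<rangle> = 1"
  unfolding dag_def
proof (rule someI_ex)
  obtain \<beta> where \<beta>: "pure_normalised A \<beta>" "\<langle>sharp A, \<beta>\<rangle> = 1" using sharp_state .
  obtain U where U: "reversible T A A U" "\<beta> = U \<cdot> \<alpha>" using transitive[OF \<alpha> \<beta>(1)] .
  have s: "sharp A \<in> effects T A" using sharp_props by simp
  have "\<langle>sharp A \<cdot> U, \<alpha>\<rangle> = 1"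
    using pairing_channel[OF s reversible_channel[OF U(1)], of \<alpha>] \<alpha> normalised_state \<beta>(2) U(2) by simp
  with U(1) show "\<exists>b. b \<in> sharp_effects A \<and> \<langle>b, \<alpha>\<rangle> = 1" by (auto simp: sharp_effects_def)
qed

lemma dag_sharp: "pure_normalised A \<alpha> \<Longrightarrow> dag A \<alpha> \<in> sharp_effects A"
  and dag_self: "pure_normalised A \<alpha> \<Longrightarrow> \<langle>dag A \<alpha>, \<alpha>\<rangle> = 1"
  and dag_effect: "pure_normalised A \<alpha> \<Longrightarrow> dag A \<alpha> \<in> effects T A"
  and dag_pure: "pure_normalised A \<alpha> \<Longrightarrow> pure T (dag A \<alpha>)"
  using dag_props sharp_effects_pure by blast+

lemma dag_eq_state:
  "pure_normalised A \<alpha> \<Longrightarrow> normalised T A \<rho> \<Longrightarrow> \<langle>dag A \<alpha>, \<rho>\<rangle> = 1 \<Longrightarrow> \<rho> = \<alpha>"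
  using sharp_state_unique[OF dag_effect dag_pure] dag_self by blast

lemma weight_chi:
  assumes "b \<in> sharp_effects A"
  shows "\<langle>b, chi A\<rangle> = weight A"
proof -
  obtain U where U: "reversible T A A U" "b = sharp A \<cdot> U" using assms by (auto simp: sharp_effects_def)
  have "\<langle>sharp A \<cdot> U, chi A\<rangle> = \<langle>sharp A, U \<cdot> chi A\<rangle>"
    by (rule pairing_channel[OF _ reversible_channel[OF U(1)] chi_state, symmetric]) (use sharp_props in simp)
  then show ?thesis using U chi_invariant[OF U(1)] by (simp add: weight_def)
qed

lemma weight_pos: "0 < weight A"
proof -
  obtain \<alpha> where \<alpha>: "pure_normalised A \<alpha>" "\<langle>sharp A, \<alpha>\<rangle> = 1" using sharp_state .
  have s: "sharp A \<in> effects T A" using sharp_props by simp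
  obtain e \<tau> where e: "0 < e" "e < 1" and \<tau>: "normalised T A \<tau>"
    and eq: "\<And>a. a \<in> effects T A \<Longrightarrow> \<langle>a, chi A\<rangle> = e * \<langle>a, \<alpha>\<rangle> + (1 - e) * \<langle>a, \<tau>\<rangle>"
    using chi_decompose[of A \<alpha>] \<alpha>(1) by blast
  have "0 \<le> (1 - e) * \<langle>sharp A, \<tau>\<rangle>" using e pairing_nonneg[OF s normalised_state[OF \<tau>]] by simp
  with eq[OF s] \<alpha>(2) e show ?thesis by (simp add: weight_def)
qed

text \<open>
  A finite average of sharp effects spanning the orbit is positive on all pure states; as the minimum of an
  effect is attained at a pure state, it is positive on every state.
\<close>

lemma sharp_effect_positive:
  assumes \<rho>: "normalised T A \<rho>"
  obtains b where "b \<in> sharp_effects A" "0 < \<langle>b, \<rho>\<rangle>"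
proof (rule ccontr)
  assume "\<not> thesis"
  with that have np: "\<not> 0 < \<langle>b, \<rho>\<rangle>" if "b \<in> sharp_effects A" for b using \<open>b \<in> sharp_effects A\<close> by blast
  have zero: "\<langle>b, \<rho>\<rangle> = 0" if "b \<in> sharp_effects A" for b
    using np[OF that] pairing_nonneg[OF sharp_effects_pure(1)[OF that] normalised_state[OF \<rho>]] by linarith
  have sub: "sharp_effects A \<subseteq> effects T A" using sharp_effects_pure by blast
  obtain n :: nat and a E C where aE: "(\<forall>i<n. a i \<in> sharp_effects A \<and> (\<forall>b\<in>sharp_effects A. \<bar>E i b\<bar> \<le> C)) \<and>
      (\<forall>\<rho>\<in>states T A. \<forall>b\<in>sharp_effects A. \<langle>b, \<rho>\<rangle> = (\<Sum>i<n. \<langle>a i, \<rho>\<rangle> * E i b))"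
    using effect_coordinates[OF sub] by (elim exE) (rule that)
  have a: "i < n \<Longrightarrow> a i \<in> sharp_effects A" for i using aE by blast
  have eq: "\<rho> \<in> states T A \<Longrightarrow> b \<in> sharp_effects A \<Longrightarrow> \<langle>b, \<rho>\<rangle> = (\<Sum>i<n. \<langle>a i, \<rho>\<rangle> * E i b)" for \<rho> b
    using aE by blast
  obtain \<alpha>0 where \<alpha>0: "pure_normalised A \<alpha>0" "\<langle>sharp A, \<alpha>0\<rangle> = 1" using sharp_state .
  have "n \<noteq> 0"
  proof
    assume "n = 0"
    then have "\<langle>dag A \<alpha>0, \<alpha>0\<rangle> = 0" using eq[of \<alpha>0 "dag A \<alpha>0"] dag_sharp[OF \<alpha>0(1)] \<alpha>0(1) normalised_state by simp
    then show False using dag_self[OF \<alpha>0(1)] by simp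
  qed
  obtain e where e: "e \<in> effects T A" "\<And>\<rho>. \<rho> \<in> states T A \<Longrightarrow> \<langle>e, \<rho>\<rangle> = (\<Sum>i<n. 1 / n * \<langle>a i, \<rho>\<rangle>)"
    using mix_effects[of "{..<n}" "\<lambda>_. 1 / n" a A] a sub \<open>n \<noteq> 0\<close> by auto
  obtain e' where e': "e' \<in> effects T A" "\<And>\<rho>. \<rho> \<in> states T A \<Longrightarrow> \<langle>e, \<rho>\<rangle> + \<langle>e', \<rho>\<rangle> = \<langle>\<epsilon> A, \<rho>\<rangle>"
    using effect_complement[OF e(1)] by blast
  obtain \<alpha> where \<alpha>: "normalised T A \<alpha>" "pure T \<alpha>" "\<And>\<rho>. normalised T A \<rho> \<Longrightarrow> \<langle>e', \<rho>\<rangle> \<le> \<langle>e', \<alpha>\<rangle>"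
    using pure_maximiser[OF e'(1)] by blast
  have "\<langle>e, \<rho>\<rangle> = 0" using e(2)[OF normalised_state[OF \<rho>]] zero a by simp
  then have "\<langle>e, \<alpha>\<rangle> \<le> 0"
    using \<alpha>(3)[OF \<rho>] e'(2)[OF normalised_state[OF \<rho>]] e'(2)[OF normalised_state[OF \<alpha>(1)]]
      normalised_pairing[OF \<rho>] normalised_pairing[OF \<alpha>(1)] by simp
  then have "(\<Sum>i<n. 1 / n * \<langle>a i, \<alpha>\<rangle>) = 0"
    using e(2)[OF normalised_state[OF \<alpha>(1)]] pairing_nonneg[OF e(1) normalised_state[OF \<alpha>(1)]] by simp
  moreover have "\<forall>i\<in>{..<n}. 0 \<le> 1 / n * \<langle>a i, \<alpha>\<rangle>"
    using a sub pairing_nonneg[OF _ normalised_state[OF \<alpha>(1)]] by (simp add: subset_iff)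
  ultimately have "\<forall>i\<in>{..<n}. 1 / n * \<langle>a i, \<alpha>\<rangle> = 0"
    using sum_nonneg_eq_0_iff[of "{..<n}" "\<lambda>i. 1 / n * \<langle>a i, \<alpha>\<rangle>"] by blast
  then have "\<langle>dag A \<alpha>, \<alpha>\<rangle> = 0"
    using eq[OF normalised_state[OF \<alpha>(1)] dag_sharp] \<alpha>(1,2) \<open>n \<noteq> 0\<close> by simp
  then show False using dag_self[of A \<alpha>] \<alpha> by simp
qed

lemma sharp_effect_maximal:
  assumes \<rho>: "normalised T A \<rho>"
  obtains b where "b \<in> sharp_effects A" "\<And>c. c \<in> sharp_effects A \<Longrightarrow> \<langle>c, \<rho>\<rangle> \<le> \<langle>b, \<rho>\<rangle>"
proof -
  have s: "sharp A \<in> effects T A" using sharp_props by simp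
  let ?K = "{U. reversible T A A U}"
  let ?f = "\<lambda>U. \<langle>sharp A \<cdot> U, \<rho>\<rangle>"
  have se: "sharp A \<cdot> U \<in> effects T A" if "U \<in> ?K" for U
    using effect_channel[OF s reversible_channel] that by simp
  have "\<exists>U. U \<in> ?K \<and> (\<forall>V\<in>?K. ?f V \<le> ?f U)"
  proof (rule hom_maximum[of ?K A A ?f 1])
    show "?K \<noteq> {}" using reversible_ident by blast
    show "?K \<subseteq> hom T A A" using channel_hom[OF reversible_channel] by blast
    show "?f U \<le> 1" if "U \<in> ?K" for U
      by (rule pairing_le_1[OF se[OF that] normalised_state[OF \<rho>]])
    fix F f assume F: "\<And>k. F k \<in> ?K" "converges_to T A A F f"
    have f: "f \<in> ?K" using reversible_limit[OF _ F(2)] F(1) by simp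
    have pv: "probe_value T U (\<one>, \<rho>, sharp A) = ?f U" if "U \<in> ?K" for U
      using that s normalised_state[OF \<rho>] reversible_src[of A A U] reversible_tgt[of A A U]
      by (simp add: probe_value_def pairing_def hom_iffs assoc)
    have "(\<one>, \<rho>, sharp A) \<in> probes T A A" using s normalised_state[OF \<rho>] by (simp add: probes_def)
    then have "(\<lambda>k. probe_value T (F k) (\<one>, \<rho>, sharp A)) \<longlonglongrightarrow> probe_value T f (\<one>, \<rho>, sharp A)"
      using F(2) by (simp add: converges_to_def)
    then show "f \<in> ?K \<and> (\<lambda>k. ?f (F k)) \<longlonglongrightarrow> ?f f" using f by (simp only: pv[OF F(1)] pv[OF f])
  qed blast
  then obtain U where U: "U \<in> ?K" "\<forall>V\<in>?K. ?f V \<le> ?f U" by blast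
  show thesis
    by (rule that[of "sharp A \<cdot> U"]) (use U in \<open>auto simp: sharp_effects_def\<close>)
qed

lemma pure_apply_right:
  assumes \<Phi>: "pure_normalised (A \<boxtimes> B) \<Phi>" and c: "c \<in> sharp_effects B"
    and nz: "\<langle>\<epsilon> A, (\<iota> A \<otimes> c) \<cdot> \<Phi>\<rangle> \<noteq> 0"
  obtains \<alpha> where "pure_normalised A \<alpha>"
    "\<And>a. a \<in> effects T A \<Longrightarrow> \<langle>a, (\<iota> A \<otimes> c) \<cdot> \<Phi>\<rangle> = \<langle>\<epsilon> A, (\<iota> A \<otimes> c) \<cdot> \<Phi>\<rangle> * \<langle>a, \<alpha>\<rangle>"
proof -
  note ce = sharp_effects_pure[OF c]
  have \<Phi>s: "\<Phi> \<in> states T (A \<boxtimes> B)" using \<Phi> normalised_state by blast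
  have p: "pure T ((\<iota> A \<otimes> c) \<cdot> \<Phi>)"
    by (rule pure_seq[of \<Phi> \<one> "A \<boxtimes> B" _ A]) (use \<Phi>s \<Phi> ce pure_par[OF pure_ident ce(2)] in \<open>simp_all add: hom_iffs\<close>)
  show thesis using pure_normalise[OF p state_apply_right[OF \<Phi>s ce(1)] nz] that by blast
qed

lemma pure_apply_left:
  assumes \<Phi>: "pure_normalised (A \<boxtimes> B) \<Phi>" and c: "c \<in> sharp_effects A"
    and nz: "\<langle>\<epsilon> B, (c \<otimes> \<iota> B) \<cdot> \<Phi>\<rangle> \<noteq> 0"
  obtains \<beta> where "pure_normalised B \<beta>"
    "\<And>b. b \<in> effects T B \<Longrightarrow> \<langle>b, (c \<otimes> \<iota> B) \<cdot> \<Phi>\<rangle> = \<langle>\<epsilon> B, (c \<otimes> \<iota> B) \<cdot> \<Phi>\<rangle> * \<langle>b, \<beta>\<rangle>"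
proof -
  note ce = sharp_effects_pure[OF c]
  have \<Phi>s: "\<Phi> \<in> states T (A \<boxtimes> B)" using \<Phi> normalised_state by blast
  have p: "pure T ((c \<otimes> \<iota> B) \<cdot> \<Phi>)"
    by (rule pure_seq[of \<Phi> \<one> "A \<boxtimes> B" _ B]) (use \<Phi>s \<Phi> ce pure_par[OF ce(2) pure_ident] in \<open>simp_all add: hom_iffs\<close>)
  show thesis using pure_normalise[OF p state_apply_left[OF \<Phi>s ce(1)] nz] that by blast
qed

lemma marginal_split:
  assumes \<Phi>: "\<Phi> \<in> states T (A \<boxtimes> B)" and c: "c \<in> effects T B"
  obtains \<tau> where "\<tau> \<in> states T A"
    "\<And>a. a \<in> effects T A \<Longrightarrow> \<langle>a, (\<iota> A \<otimes> \<epsilon> B) \<cdot> \<Phi>\<rangle> = \<langle>a, (\<iota> A \<otimes> c) \<cdot> \<Phi>\<rangle> + \<langle>a, \<tau>\<rangle>"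
proof -
  obtain c' where c': "c' \<in> effects T B" "\<And>\<rho>. \<rho> \<in> states T B \<Longrightarrow> \<langle>c, \<rho>\<rangle> + \<langle>c', \<rho>\<rangle> = \<langle>\<epsilon> B, \<rho>\<rangle>"
    using effect_complement[OF c] by blast
  show thesis
  proof (rule that[OF state_apply_right[OF \<Phi> c'(1)]])
    fix a assume a: "a \<in> effects T A"
    show "\<langle>a, (\<iota> A \<otimes> \<epsilon> B) \<cdot> \<Phi>\<rangle> = \<langle>a, (\<iota> A \<otimes> c) \<cdot> \<Phi>\<rangle> + \<langle>a, (\<iota> A \<otimes> c') \<cdot> \<Phi>\<rangle>"
      using pairing_slide[OF a discard_effect \<Phi>] pairing_slide[OF a c \<Phi>] pairing_slide[OF a c'(1) \<Phi>]
        c'(2)[OF state_apply_left[OF \<Phi> a]] by simp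
  qed
qed

text \<open>
  A sharp effect with maximal probability exposes an eigenstate: pushing the effect through a purification
  and back can only increase the weight, so by maximality it returns to the same pure state.
\<close>

lemma maximal_eigenstate:
  assumes \<rho>: "normalised T A \<rho>" and b: "b \<in> sharp_effects A" and \<alpha>: "normalised T A \<alpha>" "\<langle>b, \<alpha>\<rangle> = 1"
    and max: "\<And>c. c \<in> sharp_effects A \<Longrightarrow> \<langle>c, \<rho>\<rangle> \<le> \<langle>b, \<rho>\<rangle>"
  obtains \<tau> where "\<tau> \<in> states T A" "\<And>a. a \<in> effects T A \<Longrightarrow> \<langle>a, \<rho>\<rangle> = \<langle>b, \<rho>\<rangle> * \<langle>a, \<alpha>\<rangle> + \<langle>a, \<tau>\<rangle>"
proof -
  note be = sharp_effects_pure[OF b]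
  obtain B \<Phi> where \<Phi>': "normalised T (A \<boxtimes> B) \<Phi>" "pure T \<Phi>" and mg: "(\<iota> A \<otimes> \<epsilon> B) \<cdot> \<Phi> = \<rho>"
    using purification[OF \<rho>] by (auto simp: marginal_def)
  have \<Phi>: "pure_normalised (A \<boxtimes> B) \<Phi>" using \<Phi>' by simp
  note \<Phi>s = normalised_state[OF \<Phi>'(1)]
  obtain b0 where b0: "b0 \<in> sharp_effects A" "0 < \<langle>b0, \<rho>\<rangle>" using sharp_effect_positive[OF \<rho>] .
  let ?q = "\<langle>b, \<rho>\<rangle>"
  have q: "0 < ?q" using max[OF b0(1)] b0(2) by linarith
  have eq: "\<langle>\<epsilon> B, (b \<otimes> \<iota> B) \<cdot> \<Phi>\<rangle> = ?q"
    using pairing_slide[OF be(1) discard_effect \<Phi>s] mg by simp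
  obtain \<beta> where \<beta>: "pure_normalised B \<beta>" "\<And>e. e \<in> effects T B \<Longrightarrow> \<langle>e, (b \<otimes> \<iota> B) \<cdot> \<Phi>\<rangle> = ?q * \<langle>e, \<beta>\<rangle>"
    using pure_apply_left[OF \<Phi> b] eq q by auto
  let ?c = "dag B \<beta>"
  note c = dag_sharp[OF \<beta>(1)] dag_effect[OF \<beta>(1)] dag_self[OF \<beta>(1)]
  let ?r = "\<langle>\<epsilon> A, (\<iota> A \<otimes> ?c) \<cdot> \<Phi>\<rangle>"
  have bq: "\<langle>b, (\<iota> A \<otimes> ?c) \<cdot> \<Phi>\<rangle> = ?q"
    using pairing_slide[OF be(1) c(2) \<Phi>s] \<beta>(2)[OF c(2)] c(3) by simp
  have r: "?q \<le> ?r"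
    using effect_le_discard[OF be(1) state_apply_right[OF \<Phi>s c(2)]] bq by simp
  obtain \<alpha>' where \<alpha>': "pure_normalised A \<alpha>'"
    "\<And>a. a \<in> effects T A \<Longrightarrow> \<langle>a, (\<iota> A \<otimes> ?c) \<cdot> \<Phi>\<rangle> = ?r * \<langle>a, \<alpha>'\<rangle>"
    using pure_apply_right[OF \<Phi> c(1)] q r by auto
  obtain \<tau> where \<tau>: "\<tau> \<in> states T A" "\<And>a. a \<in> effects T A \<Longrightarrow> \<langle>a, \<rho>\<rangle> = \<langle>a, (\<iota> A \<otimes> ?c) \<cdot> \<Phi>\<rangle> + \<langle>a, \<tau>\<rangle>"
    using marginal_split[OF \<Phi>s c(2)] unfolding mg by blast
  note d = dag_sharp[OF \<alpha>'(1)] dag_effect[OF \<alpha>'(1)] dag_self[OF \<alpha>'(1)]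
  have "?r \<le> \<langle>dag A \<alpha>', \<rho>\<rangle>"
    using \<tau>(2)[OF d(2)] \<alpha>'(2)[OF d(2)] d(3) pairing_nonneg[OF d(2) \<tau>(1)] by simp
  with max[OF d(1)] r have rq: "?r = ?q" by linarith
  have "\<langle>b, \<alpha>'\<rangle> = 1" using \<alpha>'(2)[OF be(1)] bq rq q by simp
  then have "\<alpha>' = \<alpha>" using sharp_state_unique[OF be _ _ \<alpha>] \<alpha>'(1) by blast
  then have "\<langle>a, \<rho>\<rangle> = ?q * \<langle>a, \<alpha>\<rangle> + \<langle>a, \<tau>\<rangle>" if "a \<in> effects T A" for a
    using \<tau>(2)[OF that] \<alpha>'(2)[OF that] rq by simp
  with \<tau>(1) that show thesis by blast
qed

section \<open>Conjugate states and minimality of sharp effects\<close>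

text \<open>When \<open>c\<close> fires it leaves \<open>A\<close> in a pure state \<alpha>, which
  thus occurs in \<open>chi A\<close> with at least that probability. \<open>dag A \<alpha>\<close>
  detects at least as much, and on \<open>chi A\<close> its probability is exactly the
  weight.\<close>

lemma conjugate_weight_le:
  assumes \<Psi>: "pure_normalised (A \<boxtimes> B) \<Psi>" and mg: "(\<iota> A \<otimes> \<epsilon> B) \<cdot> \<Psi> = chi A" and c: "c \<in> sharp_effects B"
  shows "\<langle>c, (\<epsilon> A \<otimes> \<iota> B) \<cdot> \<Psi>\<rangle> \<le> weight A"
proof -
  note ce = sharp_effects_pure[OF c]
  have \<Psi>s: "\<Psi> \<in> states T (A \<boxtimes> B)" using \<Psi> normalised_state by blast
  let ?t = "\<langle>\<epsilon> A, (\<iota> A \<otimes> c) \<cdot> \<Psi>\<rangle>"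
  have eq: "\<langle>c, (\<epsilon> A \<otimes> \<iota> B) \<cdot> \<Psi>\<rangle> = ?t" using pairing_slide[OF discard_effect ce(1) \<Psi>s] by simp
  show ?thesis
  proof (cases "?t = 0")
    case True
    then show ?thesis using eq weight_pos[of A] by simp
  next
    case False
    obtain \<alpha> where \<alpha>: "pure_normalised A \<alpha>" "\<And>a. a \<in> effects T A \<Longrightarrow> \<langle>a, (\<iota> A \<otimes> c) \<cdot> \<Psi>\<rangle> = ?t * \<langle>a, \<alpha>\<rangle>"
      using pure_apply_right[OF \<Psi> c False] by blast
    obtain \<tau> where \<tau>: "\<tau> \<in> states T A" "\<And>a. a \<in> effects T A \<Longrightarrow> \<langle>a, chi A\<rangle> = \<langle>a, (\<iota> A \<otimes> c) \<cdot> \<Psi>\<rangle> + \<langle>a, \<tau>\<rangle>"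
      using marginal_split[OF \<Psi>s ce(1)] unfolding mg by blast
    note d = dag_sharp[OF \<alpha>(1)] dag_effect[OF \<alpha>(1)] dag_self[OF \<alpha>(1)]
    show ?thesis
      using \<tau>(2)[OF d(2)] \<alpha>(2)[OF d(2)] d(3) weight_chi[OF d(1)] pairing_nonneg[OF d(2) \<tau>(1)] eq by simp
  qed
qed

text \<open>A round trip: \<open>dag A \<alpha>\<close> steers \<open>B\<close> to \<beta>, and
  \<open>dag B \<beta>\<close> steers \<open>A\<close> back. The return weight is at least
  \<open>weight A\<close>, and by \<open>conjugate_weight_le\<close> at most that, so nothing is
  lost and the state that returns is certain for \<open>dag A \<alpha>\<close>.\<close>

lemma conjugate_state:
  assumes \<Psi>: "pure_normalised (A \<boxtimes> B) \<Psi>" and mg: "(\<iota> A \<otimes> \<epsilon> B) \<cdot> \<Psi> = chi A" and \<alpha>: "pure_normalised A \<alpha>"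
  obtains \<beta> where "pure_normalised B \<beta>"
    "\<And>e. e \<in> effects T B \<Longrightarrow> \<langle>e, (dag A \<alpha> \<otimes> \<iota> B) \<cdot> \<Psi>\<rangle> = weight A * \<langle>e, \<beta>\<rangle>"
    "\<And>a. a \<in> effects T A \<Longrightarrow> \<langle>a, (\<iota> A \<otimes> dag B \<beta>) \<cdot> \<Psi>\<rangle> = weight A * \<langle>a, \<alpha>\<rangle>"
proof -
  have \<Psi>s: "\<Psi> \<in> states T (A \<boxtimes> B)" using \<Psi> normalised_state by blast
  let ?w = "weight A"
  note d = dag_sharp[OF \<alpha>] dag_effect[OF \<alpha>] dag_self[OF \<alpha>] dag_pure[OF \<alpha>]
  have w: "\<langle>\<epsilon> B, (dag A \<alpha> \<otimes> \<iota> B) \<cdot> \<Psi>\<rangle> = ?w"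
    using pairing_slide[OF d(2) discard_effect \<Psi>s] mg weight_chi[OF d(1)] by simp
  obtain \<beta> where \<beta>: "pure_normalised B \<beta>" "\<And>e. e \<in> effects T B \<Longrightarrow> \<langle>e, (dag A \<alpha> \<otimes> \<iota> B) \<cdot> \<Psi>\<rangle> = ?w * \<langle>e, \<beta>\<rangle>"
    using pure_apply_left[OF \<Psi> d(1)] w weight_pos[of A] by auto
  let ?c = "dag B \<beta>"
  note c = dag_sharp[OF \<beta>(1)] dag_effect[OF \<beta>(1)] dag_self[OF \<beta>(1)]
  let ?r = "\<langle>\<epsilon> A, (\<iota> A \<otimes> ?c) \<cdot> \<Psi>\<rangle>"
  have bq: "\<langle>dag A \<alpha>, (\<iota> A \<otimes> ?c) \<cdot> \<Psi>\<rangle> = ?w"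
    using pairing_slide[OF d(2) c(2) \<Psi>s] \<beta>(2)[OF c(2)] c(3) by simp
  have r1: "?w \<le> ?r"
    using effect_le_discard[OF d(2) state_apply_right[OF \<Psi>s c(2)]] bq by simp
  have r2: "?r \<le> ?w"
    using conjugate_weight_le[OF \<Psi> mg c(1)] pairing_slide[OF discard_effect c(2) \<Psi>s] by simp
  obtain \<alpha>' where \<alpha>': "pure_normalised A \<alpha>'"
    "\<And>a. a \<in> effects T A \<Longrightarrow> \<langle>a, (\<iota> A \<otimes> ?c) \<cdot> \<Psi>\<rangle> = ?r * \<langle>a, \<alpha>'\<rangle>"
    using pure_apply_right[OF \<Psi> c(1)] r1 weight_pos[of A] by auto
  have rw: "?r = ?w" using r1 r2 by (rule antisym[rotated])
  have "?w * \<langle>dag A \<alpha>, \<alpha>'\<rangle> = ?w" using \<alpha>'(2)[OF d(2)] unfolding bq rw by simp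
  then have "\<langle>dag A \<alpha>, \<alpha>'\<rangle> = 1" using weight_pos[of A] by simp
  then have "\<alpha>' = \<alpha>" using dag_eq_state[OF \<alpha>] \<alpha>'(1) by blast
  have "\<langle>a, (\<iota> A \<otimes> ?c) \<cdot> \<Psi>\<rangle> = ?w * \<langle>a, \<alpha>\<rangle>" if "a \<in> effects T A" for a
    using \<alpha>'(2)[OF that] \<open>\<alpha>' = \<alpha>\<close> unfolding rw by simp
  with \<beta> that show thesis by blast
qed

lemma steering':
  assumes \<Psi>: "pure_normalised (A \<boxtimes> B) \<Psi>" and X: "finite X" and s: "\<And>i. i \<in> X \<Longrightarrow> \<sigma> i \<in> states T B"
    and sum: "\<And>b. b \<in> effects T B \<Longrightarrow> \<langle>b, (\<epsilon> A \<otimes> \<iota> B) \<cdot> \<Psi>\<rangle> = (\<Sum>i\<in>X. \<langle>b, \<sigma> i\<rangle>)"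
  obtains a where "test T A \<one> X a" "\<And>i. i \<in> X \<Longrightarrow> (a i \<otimes> \<iota> B) \<cdot> \<Psi> = \<sigma> i"
proof -
  have \<Psi>s: "\<Psi> \<in> states T (A \<boxtimes> B)" using \<Psi> normalised_state by blast
  have swap: "(\<iota> B \<otimes> a) \<cdot> (swp T A B \<cdot> \<Psi>) = (a \<otimes> \<iota> B) \<cdot> \<Psi>" if a: "a \<in> effects T A" for a
  proof -
    have "(\<iota> B \<otimes> a) \<cdot> (swp T A B \<cdot> \<Psi>) = ((\<iota> B \<otimes> a) \<cdot> swp T A B) \<cdot> \<Psi>"
      by (rule assoc[symmetric]) (use a \<Psi>s in \<open>simp_all add: hom_iffs\<close>)
    also have "(\<iota> B \<otimes> a) \<cdot> swp T A B = a \<otimes> \<iota> B"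
      using swp_nat[of a A \<one> "\<iota> B" B B] a by (simp add: hom_iffs)
    finally show ?thesis .
  qed
  have p: "pure_normalised (B \<boxtimes> A) (swp T A B \<cdot> \<Psi>)"
    by (rule reversible_pure_normalised[OF \<Psi> reversible_swp])
  have sum': "\<langle>b, (\<iota> B \<otimes> \<epsilon> A) \<cdot> (swp T A B \<cdot> \<Psi>)\<rangle> = (\<Sum>i\<in>X. \<langle>b, \<sigma> i\<rangle>)" if "b \<in> effects T B" for b
    using sum[OF that] swap[OF discard_effect] by simp
  obtain a where a: "test T A \<one> X a" "\<And>i. i \<in> X \<Longrightarrow> (\<iota> B \<otimes> a i) \<cdot> (swp T A B \<cdot> \<Psi>) = \<sigma> i"
    using steering[OF p X s sum'] by blast
  have "(a i \<otimes> \<iota> B) \<cdot> \<Psi> = \<sigma> i" if i: "i \<in> X" for i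
    using a(2)[OF i] swap[of "a i"] test_hom[OF a(1) i] by (simp add: effects_def)
  with a(1) that show thesis by blast
qed

text \<open>Each effect becomes a state of \<open>B\<close> by acting on a purification of
  \<open>chi A\<close>. These states decompose the marginal on \<open>B\<close>, so steering
  realises them by a measurement on \<open>A\<close>, and faithfulness identifies that measurement
  with the given effects.\<close>

lemma effects_test:
  assumes X: "finite X" and e: "\<And>i. i \<in> X \<Longrightarrow> e i \<in> effects T A"
    and sum: "\<And>\<rho>. \<rho> \<in> states T A \<Longrightarrow> (\<Sum>i\<in>X. \<langle>e i, \<rho>\<rangle>) = \<langle>\<epsilon> A, \<rho>\<rangle>"
  shows "test T A \<one> X e"
proof -
  obtain B \<Psi> where \<Psi>: "pure_normalised (A \<boxtimes> B) \<Psi>" and mg: "(\<iota> A \<otimes> \<epsilon> B) \<cdot> \<Psi> = chi A"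
    using chi_purification .
  have \<Psi>s: "\<Psi> \<in> states T (A \<boxtimes> B)" using \<Psi> normalised_state by blast
  have "\<langle>b, (\<epsilon> A \<otimes> \<iota> B) \<cdot> \<Psi>\<rangle> = (\<Sum>i\<in>X. \<langle>b, (e i \<otimes> \<iota> B) \<cdot> \<Psi>\<rangle>)" if b: "b \<in> effects T B" for b
  proof -
    have "\<langle>b, (\<epsilon> A \<otimes> \<iota> B) \<cdot> \<Psi>\<rangle> = \<langle>\<epsilon> A, (\<iota> A \<otimes> b) \<cdot> \<Psi>\<rangle>"
      using pairing_slide[OF discard_effect b \<Psi>s] by simp
    also have "\<dots> = (\<Sum>i\<in>X. \<langle>e i, (\<iota> A \<otimes> b) \<cdot> \<Psi>\<rangle>)"
      by (rule sum[OF state_apply_right[OF \<Psi>s b], symmetric])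
    also have "\<dots> = (\<Sum>i\<in>X. \<langle>b, (e i \<otimes> \<iota> B) \<cdot> \<Psi>\<rangle>)"
      by (rule sum.cong[OF refl]) (use pairing_slide[OF e b \<Psi>s] in simp)
    finally show ?thesis .
  qed
  from steering'[OF \<Psi> X state_apply_left[OF \<Psi>s e] this] obtain a
    where a: "test T A \<one> X a" "\<And>i. i \<in> X \<Longrightarrow> (a i \<otimes> \<iota> B) \<cdot> \<Psi> = (e i \<otimes> \<iota> B) \<cdot> \<Psi>" by blast
  have "a i = e i" if i: "i \<in> X" for i
    by (rule chi_faithful[OF \<Psi> mg _ e[OF i] a(2)[OF i]]) (use test_hom[OF a(1) i] in \<open>simp add: effects_def\<close>)
  then have "test T A \<one> X a \<longleftrightarrow> test T A \<one> X e" by (rule test_cong)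
  with a(1) show ?thesis by simp
qed

text \<open>\<open>dag A \<alpha>\<close> is the least effect certain on \<alpha>. A purification of
  \<open>chi A\<close> turns effects into states of \<open>B\<close>; there
  \<open>dag B \<beta>\<close> is maximal on the state of \<open>a\<close>, so
  \<open>maximal_eigenstate\<close> splits off exactly the state of \<open>dag A \<alpha>\<close>,
  and steering turns the rest back into an effect.\<close>

lemma dag_below:
  assumes \<alpha>: "pure_normalised A \<alpha>" and a: "a \<in> effects T A" and one: "\<langle>a, \<alpha>\<rangle> = 1"
  obtains b where "b \<in> effects T A" "\<And>\<rho>. \<rho> \<in> states T A \<Longrightarrow> \<langle>a, \<rho>\<rangle> = \<langle>dag A \<alpha>, \<rho>\<rangle> + \<langle>b, \<rho>\<rangle>"
proof -
  obtain B \<Psi> where \<Psi>: "pure_normalised (A \<boxtimes> B) \<Psi>" and mg: "(\<iota> A \<otimes> \<epsilon> B) \<cdot> \<Psi> = chi A"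
    using chi_purification .
  have \<Psi>s: "\<Psi> \<in> states T (A \<boxtimes> B)" using \<Psi> normalised_state by blast
  let ?w = "weight A"
  let ?\<xi>' = "(\<epsilon> A \<otimes> \<iota> B) \<cdot> \<Psi>"
  note d = dag_effect[OF \<alpha>]
  obtain \<beta> where \<beta>: "pure_normalised B \<beta>"
    "\<And>e. e \<in> effects T B \<Longrightarrow> \<langle>e, (dag A \<alpha> \<otimes> \<iota> B) \<cdot> \<Psi>\<rangle> = ?w * \<langle>e, \<beta>\<rangle>"
    "\<And>a. a \<in> effects T A \<Longrightarrow> \<langle>a, (\<iota> A \<otimes> dag B \<beta>) \<cdot> \<Psi>\<rangle> = ?w * \<langle>a, \<alpha>\<rangle>"
    using conjugate_state[OF \<Psi> mg \<alpha>] by blast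
  note c = dag_sharp[OF \<beta>(1)] dag_effect[OF \<beta>(1)] dag_self[OF \<beta>(1)]
  obtain a' where a': "a' \<in> effects T A" "\<And>\<rho>. \<rho> \<in> states T A \<Longrightarrow> \<langle>a, \<rho>\<rangle> + \<langle>a', \<rho>\<rangle> = \<langle>\<epsilon> A, \<rho>\<rangle>"
    using effect_complement[OF a] by blast
  let ?s = "(a \<otimes> \<iota> B) \<cdot> \<Psi>" and ?s' = "(a' \<otimes> \<iota> B) \<cdot> \<Psi>"
  note ss = state_apply_left[OF \<Psi>s a] state_apply_left[OF \<Psi>s a'(1)]
  have split: "\<langle>e, ?s\<rangle> + \<langle>e, ?s'\<rangle> = \<langle>e, ?\<xi>'\<rangle>" if e: "e \<in> effects T B" for e
    using pairing_slide[OF a e \<Psi>s] pairing_slide[OF a'(1) e \<Psi>s] pairing_slide[OF discard_effect e \<Psi>s]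
      a'(2)[OF state_apply_right[OF \<Psi>s e]] by simp
  have cs: "\<langle>dag B \<beta>, ?s\<rangle> = ?w" using pairing_slide[OF a c(2) \<Psi>s] \<beta>(3)[OF a] one by simp
  let ?t = "\<langle>\<epsilon> B, ?s\<rangle>"
  have t: "0 < ?t" using effect_le_discard[OF c(2) ss(1)] cs weight_pos[of A] by linarith
  then obtain \<sigma> where \<sigma>: "normalised T B \<sigma>" "\<And>e. e \<in> effects T B \<Longrightarrow> \<langle>e, ?s\<rangle> = ?t * \<langle>e, \<sigma>\<rangle>"
    using normalise[OF ss(1)] by auto
  \<comment> \<open>The state of \<open>a\<close> is a part of the marginal on \<open>B\<close>, on
    which no sharp effect exceeds \<open>weight A\<close>, while \<open>dag B \<beta>\<close>
    already reaches this value on the part.\<close>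
  have max: "\<langle>f, \<sigma>\<rangle> \<le> \<langle>dag B \<beta>, \<sigma>\<rangle>" if f: "f \<in> sharp_effects B" for f
  proof -
    note fe = sharp_effects_pure(1)[OF f]
    have "?t * \<langle>f, \<sigma>\<rangle> \<le> \<langle>f, ?\<xi>'\<rangle>" using split[OF fe] \<sigma>(2)[OF fe] pairing_nonneg[OF fe ss(2)] by linarith
    also have "\<dots> \<le> ?w" by (rule conjugate_weight_le[OF \<Psi> mg f])
    also have "\<dots> = ?t * \<langle>dag B \<beta>, \<sigma>\<rangle>" using \<sigma>(2)[OF c(2)] cs by simp
    finally show ?thesis using t by simp
  qed
  obtain \<tau> where \<tau>: "\<tau> \<in> states T B" "\<And>e. e \<in> effects T B \<Longrightarrow> \<langle>e, \<sigma>\<rangle> = \<langle>dag B \<beta>, \<sigma>\<rangle> * \<langle>e, \<beta>\<rangle> + \<langle>e, \<tau>\<rangle>"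
    using maximal_eigenstate[OF \<sigma>(1) c(1) _ c(3) max] \<beta>(1) by blast
  have t1: "?t \<le> 1" by (rule pairing_le_1[OF discard_effect ss(1)])
  have "?t * \<langle>\<epsilon> B, \<tau>\<rangle> \<le> 1" using t1 t pairing_range[OF discard_effect \<tau>(1)] by (intro mult_le_one) auto
  then obtain \<tau>' where \<tau>': "\<tau>' \<in> states T B" "\<And>e. e \<in> effects T B \<Longrightarrow> \<langle>e, \<tau>'\<rangle> = ?t * \<langle>e, \<tau>\<rangle>"
    using state_scale[OF \<tau>(1), of ?t] t by auto
  have s_eq: "\<langle>e, ?s\<rangle> = \<langle>e, (dag A \<alpha> \<otimes> \<iota> B) \<cdot> \<Psi>\<rangle> + \<langle>e, \<tau>'\<rangle>" if e: "e \<in> effects T B" for e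
  proof -
    have "\<langle>e, ?s\<rangle> = (?t * \<langle>dag B \<beta>, \<sigma>\<rangle>) * \<langle>e, \<beta>\<rangle> + ?t * \<langle>e, \<tau>\<rangle>"
      unfolding \<sigma>(2)[OF e] by (subst \<tau>(2)[OF e]) (simp add: algebra_simps)
    also have "?t * \<langle>dag B \<beta>, \<sigma>\<rangle> = ?w" using \<sigma>(2)[OF c(2)] cs by simp
    finally show ?thesis using \<beta>(2)[OF e] \<tau>'(2)[OF e] by simp
  qed
  \<comment> \<open>Outcome 0 is the part of \<open>dag A \<alpha>\<close>, 1 the remainder of
    \<open>a\<close>, 2 the complement of \<open>a\<close>; together they exhaust the marginal on
    \<open>B\<close>.\<close>
  define \<sigma>s where "\<sigma>s i = (if i = 0 then (dag A \<alpha> \<otimes> \<iota> B) \<cdot> \<Psi> else if i = 1 then \<tau>' else ?s')" for i :: nat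
  have st: "\<sigma>s i \<in> states T B" for i using state_apply_left[OF \<Psi>s d] \<tau>'(1) ss(2) by (simp add: \<sigma>s_def)
  have sum: "\<langle>b, ?\<xi>'\<rangle> = (\<Sum>i\<in>{0, 1, 2}. \<langle>b, \<sigma>s i\<rangle>)" if b: "b \<in> effects T B" for b
    using split[OF b] s_eq[OF b] by (simp add: \<sigma>s_def)
  obtain f where f: "test T A \<one> {0, 1, 2} f" "\<And>i. i \<in> {0, 1, 2} \<Longrightarrow> (f i \<otimes> \<iota> B) \<cdot> \<Psi> = \<sigma>s i"
    using steering'[OF \<Psi> _ st sum] by blast
  have fe: "f i \<in> effects T A" if "i \<in> {0, 1, 2}" for i using test_hom[OF f(1) that] by (simp add: effects_def)
  have "f 0 = dag A \<alpha>"
    by (rule chi_faithful[OF \<Psi> mg fe d]) (use f(2)[of 0] in \<open>simp_all add: \<sigma>s_def\<close>)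
  moreover have "f 2 = a'"
    by (rule chi_faithful[OF \<Psi> mg fe a'(1)]) (use f(2)[of 2] in \<open>simp_all add: \<sigma>s_def\<close>)
  ultimately have "\<langle>a, \<rho>\<rangle> = \<langle>dag A \<alpha>, \<rho>\<rangle> + \<langle>f 1, \<rho>\<rangle>" if "\<rho> \<in> states T A" for \<rho>
    using observation_sum[OF f(1) that] a'(2)[OF that] by simp
  with fe[of 1] that show thesis by simp
qed

text \<open>\<open>dag_below\<close> writes \<open>a\<close> as \<open>dag A \<alpha>\<close> plus
  an effect. Purity of \<open>a\<close> makes the first part a multiple of it, and the value on
  \<alpha> fixes the factor.\<close>

lemma dag_unique:
  assumes \<alpha>: "pure_normalised A \<alpha>" and a: "a \<in> effects T A" "pure T a" and one: "\<langle>a, \<alpha>\<rangle> = 1"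
  shows "dag A \<alpha> = a"
proof -
  note d = dag_effect[OF \<alpha>]
  obtain b where b: "b \<in> effects T A" "\<And>\<rho>. \<rho> \<in> states T A \<Longrightarrow> \<langle>a, \<rho>\<rangle> = \<langle>dag A \<alpha>, \<rho>\<rangle> + \<langle>b, \<rho>\<rangle>"
    using dag_below[OF \<alpha> a(1) one] by blast
  obtain a' where a': "a' \<in> effects T A" "\<And>\<rho>. \<rho> \<in> states T A \<Longrightarrow> \<langle>a, \<rho>\<rangle> + \<langle>a', \<rho>\<rangle> = \<langle>\<epsilon> A, \<rho>\<rangle>"
    using effect_complement[OF a(1)] by blast
  define D where "D i = (if i = 0 then dag A \<alpha> else if i = 1 then b else a')" for i :: nat
  have t: "test T A \<one> {0, 1, 2} D"
  proof (rule effects_test)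
    show "D i \<in> effects T A" if "i \<in> {0, 1, 2}" for i using d b(1) a'(1) by (simp add: D_def)
    show "(\<Sum>i\<in>{0, 1, 2}. \<langle>D i, \<rho>\<rangle>) = \<langle>\<epsilon> A, \<rho>\<rangle>" if \<rho>: "\<rho> \<in> states T A" for \<rho>
      using b(2)[OF \<rho>] a'(2)[OF \<rho>] by (simp add: D_def)
  qed simp
  have "is_sum T A \<one> a {0, 1} D"
    using d b a(1) by (simp add: effect_lincomb_iff D_def)
  moreover have "src T a = A" "tgt T a = \<one>" using a(1) by (auto simp: hom_iffs)
  ultimately have "\<forall>i\<in>{0, 1}. is_multiple T A \<one> (D i) a"
    using a(2)[unfolded pure_def, THEN spec, THEN spec, THEN spec, of "{0, 1, 2}" D "{0, 1}"] t by simp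
  then have "is_multiple T A \<one> (dag A \<alpha>) a" by (simp add: D_def)
  then have "\<exists>c. \<forall>\<rho>\<in>states T A. \<langle>dag A \<alpha>, \<rho>\<rangle> = c * \<langle>a, \<rho>\<rangle>"
    by (auto simp: is_multiple_def effect_lincomb_iff)
  then obtain c where c: "\<And>\<rho>. \<rho> \<in> states T A \<Longrightarrow> \<langle>dag A \<alpha>, \<rho>\<rangle> = c * \<langle>a, \<rho>\<rangle>" by blast
  have "c = 1" using c[of \<alpha>] one dag_self[OF \<alpha>] \<alpha> normalised_state by simp
  with c show ?thesis by (intro effect_eqI[OF d a(1)]) simp
qed

end

section \<open>Orthonormal frames and diagonalisation\<close>

context sharp_theory_with_purification
begin

lemma maximal_eigenstate_scaled:
  assumes \<tau>: "\<tau> \<in> states T A" and b: "b \<in> sharp_effects A" and \<alpha>: "normalised T A \<alpha>" "\<langle>b, \<alpha>\<rangle> = 1"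
    and q: "0 < \<langle>b, \<tau>\<rangle>" and max: "\<And>c. c \<in> sharp_effects A \<Longrightarrow> \<langle>c, \<tau>\<rangle> \<le> \<langle>b, \<tau>\<rangle>"
  obtains \<kappa> where "\<kappa> \<in> states T A" "\<And>a. a \<in> effects T A \<Longrightarrow> \<langle>a, \<tau>\<rangle> = \<langle>b, \<tau>\<rangle> * \<langle>a, \<alpha>\<rangle> + \<langle>a, \<kappa>\<rangle>"
proof -
  let ?t = "\<langle>\<epsilon> A, \<tau>\<rangle>"
  note be = sharp_effects_pure(1)[OF b]
  have t: "0 < ?t" using effect_le_discard[OF be \<tau>] q by linarith
  then obtain \<sigma> where \<sigma>: "normalised T A \<sigma>" "\<And>a. a \<in> effects T A \<Longrightarrow> \<langle>a, \<tau>\<rangle> = ?t * \<langle>a, \<sigma>\<rangle>"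
    using normalise[OF \<tau>] by auto
  have max': "\<langle>c, \<sigma>\<rangle> \<le> \<langle>b, \<sigma>\<rangle>" if c: "c \<in> sharp_effects A" for c
  proof -
    have "?t * \<langle>c, \<sigma>\<rangle> \<le> ?t * \<langle>b, \<sigma>\<rangle>"
      using max[OF c] unfolding \<sigma>(2)[OF sharp_effects_pure(1)[OF c]] \<sigma>(2)[OF be] .
    then show ?thesis using t by simp
  qed
  obtain \<kappa> where \<kappa>: "\<kappa> \<in> states T A" "\<And>a. a \<in> effects T A \<Longrightarrow> \<langle>a, \<sigma>\<rangle> = \<langle>b, \<sigma>\<rangle> * \<langle>a, \<alpha>\<rangle> + \<langle>a, \<kappa>\<rangle>"
    using maximal_eigenstate[OF \<sigma>(1) b \<alpha> max'] by blast
  have "?t * \<langle>\<epsilon> A, \<kappa>\<rangle> \<le> 1"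
    using t pairing_le_1[OF discard_effect \<tau>] pairing_range[OF discard_effect \<kappa>(1)] by (intro mult_le_one) auto
  then obtain \<kappa>' where \<kappa>': "\<kappa>' \<in> states T A" "\<And>a. a \<in> effects T A \<Longrightarrow> \<langle>a, \<kappa>'\<rangle> = ?t * \<langle>a, \<kappa>\<rangle>"
    using state_scale[OF \<kappa>(1), of ?t] t by auto
  have "\<langle>a, \<tau>\<rangle> = \<langle>b, \<tau>\<rangle> * \<langle>a, \<alpha>\<rangle> + \<langle>a, \<kappa>'\<rangle>" if a: "a \<in> effects T A" for a
  proof -
    have "\<langle>a, \<tau>\<rangle> = ?t * \<langle>a, \<sigma>\<rangle>" by (rule \<sigma>(2)[OF a])
    also have "\<dots> = ?t * (\<langle>b, \<sigma>\<rangle> * \<langle>a, \<alpha>\<rangle> + \<langle>a, \<kappa>\<rangle>)" using \<kappa>(2)[OF a] by simp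
    also have "\<dots> = (?t * \<langle>b, \<sigma>\<rangle>) * \<langle>a, \<alpha>\<rangle> + \<langle>a, \<kappa>'\<rangle>" using \<kappa>'(2)[OF a] by (simp add: algebra_simps)
    also have "?t * \<langle>b, \<sigma>\<rangle> = \<langle>b, \<tau>\<rangle>" by (rule \<sigma>(2)[OF be, symmetric])
    finally show ?thesis .
  qed
  with \<kappa>'(1) that show thesis by blast
qed

text \<open>One peeling step. By \<open>dag_unique\<close> the maximal sharp effect is
  \<open>dag A \<alpha>\<close>, so removing \<alpha> with the full probability of this effect
  leaves a remainder on which the effect vanishes.\<close>

lemma eigenstate_exists:
  assumes \<tau>: "\<tau> \<in> states T A" and nz: "\<langle>\<epsilon> A, \<tau>\<rangle> \<noteq> 0"
  shows "\<exists>\<alpha> q \<kappa>. pure_normalised A \<alpha> \<and> 0 < q \<and> \<kappa> \<in> states T A \<and>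
    (\<forall>a\<in>effects T A. \<langle>a, \<tau>\<rangle> = q * \<langle>a, \<alpha>\<rangle> + \<langle>a, \<kappa>\<rangle>) \<and> \<langle>dag A \<alpha>, \<kappa>\<rangle> = 0"
proof -
  let ?t = "\<langle>\<epsilon> A, \<tau>\<rangle>"
  have t: "0 < ?t" using pairing_nonneg[OF discard_effect \<tau>] nz by linarith
  obtain \<sigma> where \<sigma>: "normalised T A \<sigma>" "\<And>a. a \<in> effects T A \<Longrightarrow> \<langle>a, \<tau>\<rangle> = ?t * \<langle>a, \<sigma>\<rangle>"
    using normalise[OF \<tau> nz] by blast
  obtain b where b: "b \<in> sharp_effects A" "\<And>c. c \<in> sharp_effects A \<Longrightarrow> \<langle>c, \<sigma>\<rangle> \<le> \<langle>b, \<sigma>\<rangle>"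
    using sharp_effect_maximal[OF \<sigma>(1)] by blast
  note be = sharp_effects_pure[OF b(1)]
  obtain b0 where b0: "b0 \<in> sharp_effects A" "0 < \<langle>b0, \<sigma>\<rangle>" using sharp_effect_positive[OF \<sigma>(1)] .
  have q: "0 < \<langle>b, \<tau>\<rangle>" using b(2)[OF b0(1)] b0(2) t \<sigma>(2)[OF be(1)] by simp
  have max: "\<langle>c, \<tau>\<rangle> \<le> \<langle>b, \<tau>\<rangle>" if c: "c \<in> sharp_effects A" for c
    unfolding \<sigma>(2)[OF sharp_effects_pure(1)[OF c]] \<sigma>(2)[OF be(1)] using b(2)[OF c] t by simp
  obtain \<alpha> where \<alpha>: "pure_normalised A \<alpha>" "\<langle>b, \<alpha>\<rangle> = 1" using sharp_effects_state[OF b(1)] .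
  obtain \<kappa> where \<kappa>: "\<kappa> \<in> states T A" "\<And>a. a \<in> effects T A \<Longrightarrow> \<langle>a, \<tau>\<rangle> = \<langle>b, \<tau>\<rangle> * \<langle>a, \<alpha>\<rangle> + \<langle>a, \<kappa>\<rangle>"
    using maximal_eigenstate_scaled[OF \<tau> b(1) _ \<alpha>(2) q max] \<alpha>(1) by blast
  have "dag A \<alpha> = b" by (rule dag_unique[OF \<alpha>(1) be \<alpha>(2)])
  then have "\<langle>dag A \<alpha>, \<kappa>\<rangle> = 0" using \<kappa>(2)[OF be(1)] \<alpha>(2) by simp
  with \<alpha>(1) q \<kappa> show ?thesis by blast
qed

text \<open>The analogue of an orthonormal family. The remainder effect \<open>e\<close> expresses
  that the daggers fit into one measurement; orthogonality is a consequence
  (\<open>frame_orthogonal\<close>).\<close>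

definition frame :: "'s \<Rightarrow> 't set \<Rightarrow> bool" where
  "frame A P \<longleftrightarrow> finite P \<and> (\<forall>\<phi>\<in>P. pure_normalised A \<phi>) \<and>
     (\<exists>e\<in>effects T A. \<forall>\<rho>\<in>states T A. (\<Sum>\<phi>\<in>P. \<langle>dag A \<phi>, \<rho>\<rangle>) + \<langle>e, \<rho>\<rangle> = \<langle>\<epsilon> A, \<rho>\<rangle>)"

definition basis :: "'s \<Rightarrow> 't set \<Rightarrow> bool" where
  "basis A P \<longleftrightarrow> finite P \<and> (\<forall>\<phi>\<in>P. pure_normalised A \<phi>) \<and>
     (\<forall>\<rho>\<in>states T A. (\<Sum>\<phi>\<in>P. \<langle>dag A \<phi>, \<rho>\<rangle>) = \<langle>\<epsilon> A, \<rho>\<rangle>)"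

lemma frame_finite: "frame A P \<Longrightarrow> finite P"
  and frame_pure: "frame A P \<Longrightarrow> \<phi> \<in> P \<Longrightarrow> pure_normalised A \<phi>"
  by (simp_all add: frame_def)

lemma basis_finite: "basis A P \<Longrightarrow> finite P"
  and basis_pure: "basis A P \<Longrightarrow> \<phi> \<in> P \<Longrightarrow> pure_normalised A \<phi>"
  and basis_sum: "basis A P \<Longrightarrow> \<rho> \<in> states T A \<Longrightarrow> (\<Sum>\<phi>\<in>P. \<langle>dag A \<phi>, \<rho>\<rangle>) = \<langle>\<epsilon> A, \<rho>\<rangle>"
  by (simp_all add: basis_def)

lemma zero_effect: obtains z where "z \<in> effects T A" "\<And>\<rho>. \<rho> \<in> states T A \<Longrightarrow> \<langle>z, \<rho>\<rangle> = 0"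
  using scale_effect[of "scalar 0" "\<epsilon> A" A] that[of "scalar 0 \<cdot> \<epsilon> A"] by (simp add: scalar)

lemma basis_frame:
  assumes "basis A P"
  shows "frame A P"
proof -
  obtain z where "z \<in> effects T A" "\<And>\<rho>. \<rho> \<in> states T A \<Longrightarrow> \<langle>z, \<rho>\<rangle> = 0" using zero_effect by blast
  with assms show ?thesis unfolding frame_def basis_def by auto
qed

lemma frame_empty: "frame A {}"
  unfolding frame_def using discard_effect by auto

text \<open>On \<open>\<psi>\<close> its own dagger takes the whole probability, so nothing is left
  for the other daggers.\<close>

lemma frame_orthogonal:
  assumes P: "frame A P" and \<phi>: "\<phi> \<in> P" and \<psi>: "\<psi> \<in> P"
  shows "\<langle>dag A \<phi>, \<psi>\<rangle> = (if \<phi> = \<psi> then 1 else 0)"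
proof (cases "\<phi> = \<psi>")
  case True
  then show ?thesis using dag_self[OF frame_pure[OF P \<psi>]] by simp
next
  case False
  have \<psi>n: "normalised T A \<psi>" using frame_pure[OF P \<psi>] by simp
  note \<psi>s = normalised_state[OF \<psi>n]
  obtain e where e: "e \<in> effects T A" "(\<Sum>\<phi>\<in>P. \<langle>dag A \<phi>, \<psi>\<rangle>) + \<langle>e, \<psi>\<rangle> = \<langle>\<epsilon> A, \<psi>\<rangle>"
    using P \<psi>s unfolding frame_def by blast
  have nn: "0 \<le> \<langle>dag A \<kappa>, \<psi>\<rangle>" if "\<kappa> \<in> P" for \<kappa>
    by (rule pairing_nonneg[OF dag_effect[OF frame_pure[OF P that]] \<psi>s])
  have "(\<Sum>\<kappa>\<in>{\<phi>, \<psi>}. \<langle>dag A \<kappa>, \<psi>\<rangle>) \<le> (\<Sum>\<kappa>\<in>P. \<langle>dag A \<kappa>, \<psi>\<rangle>)"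
    by (rule sum_mono2[OF frame_finite[OF P]]) (use \<phi> \<psi> nn in auto)
  then have "\<langle>dag A \<phi>, \<psi>\<rangle> + 1 \<le> (\<Sum>\<kappa>\<in>P. \<langle>dag A \<kappa>, \<psi>\<rangle>)"
    using False dag_self[OF frame_pure[OF P \<psi>]] by simp
  also have "\<dots> \<le> 1" using e(2) pairing_nonneg[OF e(1) \<psi>s] normalised_pairing[OF \<psi>n] by linarith
  finally show ?thesis using nn[OF \<phi>] False by simp
qed

text \<open>The remainder effect of the frame is certain on \<alpha>, so \<open>dag_below\<close>
  carves \<open>dag A \<alpha>\<close> out of it.\<close>

lemma frame_insert:
  assumes P: "frame A P" and \<alpha>: "pure_normalised A \<alpha>" and orth: "\<And>\<phi>. \<phi> \<in> P \<Longrightarrow> \<langle>dag A \<phi>, \<alpha>\<rangle> = 0"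
  shows "\<alpha> \<notin> P" "frame A (insert \<alpha> P)"
proof -
  show nin: "\<alpha> \<notin> P" using orth[of \<alpha>] dag_self[OF \<alpha>] by auto
  obtain e where e: "e \<in> effects T A" "\<And>\<rho>. \<rho> \<in> states T A \<Longrightarrow> (\<Sum>\<phi>\<in>P. \<langle>dag A \<phi>, \<rho>\<rangle>) + \<langle>e, \<rho>\<rangle> = \<langle>\<epsilon> A, \<rho>\<rangle>"
    using P unfolding frame_def by blast
  have "\<langle>e, \<alpha>\<rangle> = 1" using e(2)[of \<alpha>] orth \<alpha> normalised_state normalised_pairing by simp
  then obtain b where b: "b \<in> effects T A" "\<And>\<rho>. \<rho> \<in> states T A \<Longrightarrow> \<langle>e, \<rho>\<rangle> = \<langle>dag A \<alpha>, \<rho>\<rangle> + \<langle>b, \<rho>\<rangle>"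
    using dag_below[OF \<alpha> e(1)] by blast
  have "(\<Sum>\<phi>\<in>insert \<alpha> P. \<langle>dag A \<phi>, \<rho>\<rangle>) + \<langle>b, \<rho>\<rangle> = \<langle>\<epsilon> A, \<rho>\<rangle>" if \<rho>: "\<rho> \<in> states T A" for \<rho>
    using e(2)[OF \<rho>] b(2)[OF \<rho>] nin frame_finite[OF P] by simp
  with b(1) P \<alpha> show "frame A (insert \<alpha> P)" unfolding frame_def by blast
qed

section \<open>Uniform weights and the size of a basis\<close>

text \<open>Every frame element is a maximal eigenstate, since all sharp effects have the same
  probability \<open>c\<close>. Subtracting other frame elements leaves the value of
  \<open>dag A \<alpha>\<close> at \<open>c\<close> by orthogonality and can only lower the other
  sharp effects, so the peeling can continue.\<close>

lemma peel:
  assumes \<rho>: "normalised T A \<rho>" and c: "0 < c" and inv: "\<And>b. b \<in> sharp_effects A \<Longrightarrow> \<langle>b, \<rho>\<rangle> = c"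
    and P: "frame A P"
  obtains \<tau> where "\<tau> \<in> states T A" "\<And>a. a \<in> effects T A \<Longrightarrow> \<langle>a, \<rho>\<rangle> = c * (\<Sum>\<phi>\<in>P. \<langle>a, \<phi>\<rangle>) + \<langle>a, \<tau>\<rangle>"
proof -
  have "Q \<subseteq> P \<longrightarrow> (\<exists>\<tau>\<in>states T A. \<forall>a\<in>effects T A. \<langle>a, \<rho>\<rangle> = c * (\<Sum>\<phi>\<in>Q. \<langle>a, \<phi>\<rangle>) + \<langle>a, \<tau>\<rangle>)"
    if "finite Q" for Q
    using that
  proof (induction Q)
    case empty
    show ?case using normalised_state[OF \<rho>] by (intro impI bexI[of _ \<rho>]) auto
  next
    case (insert \<alpha> Q)
    show ?case
    proof
      assume sub: "insert \<alpha> Q \<subseteq> P"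
      then obtain \<tau> where \<tau>: "\<tau> \<in> states T A"
        "\<And>a. a \<in> effects T A \<Longrightarrow> \<langle>a, \<rho>\<rangle> = c * (\<Sum>\<phi>\<in>Q. \<langle>a, \<phi>\<rangle>) + \<langle>a, \<tau>\<rangle>"
        using insert.IH by blast
      have \<alpha>: "pure_normalised A \<alpha>" using frame_pure[OF P] sub by simp
      note d = dag_sharp[OF \<alpha>] dag_effect[OF \<alpha>] dag_self[OF \<alpha>]
      have "(\<Sum>\<phi>\<in>Q. \<langle>dag A \<alpha>, \<phi>\<rangle>) = 0"
      proof (rule sum.neutral, rule ballI)
        fix \<phi> assume "\<phi> \<in> Q"
        then show "\<langle>dag A \<alpha>, \<phi>\<rangle> = 0"
          using frame_orthogonal[OF P, of \<alpha> \<phi>] sub insert.hyps by auto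
      qed
      then have dc: "\<langle>dag A \<alpha>, \<tau>\<rangle> = c" using \<tau>(2)[OF d(2)] inv[OF d(1)] by simp
      have max: "\<langle>b, \<tau>\<rangle> \<le> \<langle>dag A \<alpha>, \<tau>\<rangle>" if b: "b \<in> sharp_effects A" for b
      proof -
        note be = sharp_effects_pure(1)[OF b]
        have "0 \<le> (\<Sum>\<phi>\<in>Q. \<langle>b, \<phi>\<rangle>)"
        proof (rule sum_nonneg)
          fix \<phi> assume "\<phi> \<in> Q"
          then have "normalised T A \<phi>" using frame_pure[OF P, of \<phi>] sub by auto
          then show "0 \<le> \<langle>b, \<phi>\<rangle>" by (rule pairing_nonneg[OF be normalised_state])
        qed
        then have "0 \<le> c * (\<Sum>\<phi>\<in>Q. \<langle>b, \<phi>\<rangle>)" using c by simp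
        then show ?thesis using \<tau>(2)[OF be] inv[OF b] dc by linarith
      qed
      have \<alpha>n: "normalised T A \<alpha>" using \<alpha> by simp
      have dpos: "0 < \<langle>dag A \<alpha>, \<tau>\<rangle>" using c dc by simp
      obtain \<kappa> where \<kappa>: "\<kappa> \<in> states T A" "\<And>a. a \<in> effects T A \<Longrightarrow> \<langle>a, \<tau>\<rangle> = \<langle>dag A \<alpha>, \<tau>\<rangle> * \<langle>a, \<alpha>\<rangle> + \<langle>a, \<kappa>\<rangle>"
        using maximal_eigenstate_scaled[OF \<tau>(1) d(1) \<alpha>n d(3) dpos max] by blast
      have "\<langle>a, \<rho>\<rangle> = c * (\<Sum>\<phi>\<in>insert \<alpha> Q. \<langle>a, \<phi>\<rangle>) + \<langle>a, \<kappa>\<rangle>" if a: "a \<in> effects T A" for a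
        using \<tau>(2)[OF a] \<kappa>(2)[OF a] dc insert.hyps by (simp add: algebra_simps)
      with \<kappa>(1) show "\<exists>\<tau>\<in>states T A. \<forall>a\<in>effects T A. \<langle>a, \<rho>\<rangle> = c * (\<Sum>\<phi>\<in>insert \<alpha> Q. \<langle>a, \<phi>\<rangle>) + \<langle>a, \<tau>\<rangle>"
        by blast
    qed
  qed
  from this[OF frame_finite[OF P]] that show thesis by blast
qed

lemma frame_card_le:
  assumes P: "frame A P"
  shows "real (card P) * weight A \<le> 1"
proof -
  obtain e where e: "e \<in> effects T A" "(\<Sum>\<phi>\<in>P. \<langle>dag A \<phi>, chi A\<rangle>) + \<langle>e, chi A\<rangle> = \<langle>\<epsilon> A, chi A\<rangle>"
    using P chi_state unfolding frame_def by blast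
  have "(\<Sum>\<phi>\<in>P. \<langle>dag A \<phi>, chi A\<rangle>) = (\<Sum>\<phi>\<in>P. weight A)"
    by (rule sum.cong) (auto intro!: weight_chi dag_sharp frame_pure[OF P])
  then show ?thesis
    using e(2) pairing_nonneg[OF e(1) chi_state] normalised_pairing[OF chi_normalised[of A]] by simp
qed

lemma basis_card:
  assumes P: "basis A P"
  shows "real (card P) * weight A = 1"
proof -
  have "(\<Sum>\<phi>\<in>P. \<langle>dag A \<phi>, chi A\<rangle>) = (\<Sum>\<phi>\<in>P. weight A)"
    by (rule sum.cong) (auto intro!: weight_chi dag_sharp basis_pure[OF P])
  then show ?thesis using basis_sum[OF P chi_state] normalised_pairing[OF chi_normalised[of A]] by simp
qed

text \<open>Peel the frame off \<open>chi A\<close>. If nothing remains, the remainder effect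
  vanishes on a faithful state and is zero. Otherwise an eigenstate of what remains is orthogonal to
  the frame.\<close>

lemma frame_extend:
  assumes P: "frame A P"
  shows "basis A P \<or> (\<exists>\<alpha>. \<alpha> \<notin> P \<and> frame A (insert \<alpha> P))"
proof -
  let ?w = "weight A"
  obtain \<tau> where \<tau>: "\<tau> \<in> states T A" "\<And>a. a \<in> effects T A \<Longrightarrow> \<langle>a, chi A\<rangle> = ?w * (\<Sum>\<phi>\<in>P. \<langle>a, \<phi>\<rangle>) + \<langle>a, \<tau>\<rangle>"
    using peel[OF chi_normalised weight_pos weight_chi P] by blast
  have dag0: "\<langle>dag A \<phi>, \<tau>\<rangle> = 0" if \<phi>: "\<phi> \<in> P" for \<phi>
  proof -
    have "(\<Sum>\<psi>\<in>P. \<langle>dag A \<phi>, \<psi>\<rangle>) = (\<Sum>\<psi>\<in>P. if \<phi> = \<psi> then 1 else 0)"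
      using frame_orthogonal[OF P \<phi>] by (intro sum.cong) auto
    also have "\<dots> = 1" using \<phi> frame_finite[OF P] by simp
    finally show ?thesis
      using \<tau>(2)[OF dag_effect[OF frame_pure[OF P \<phi>]]] weight_chi[OF dag_sharp[OF frame_pure[OF P \<phi>]]] by simp
  qed
  show ?thesis
  proof (cases "\<langle>\<epsilon> A, \<tau>\<rangle> = 0")
    case True
    have \<tau>0: "\<langle>a, \<tau>\<rangle> = 0" if "a \<in> effects T A" for a
      using effect_le_discard[OF that \<tau>(1)] pairing_nonneg[OF that \<tau>(1)] True by simp
    obtain e where e: "e \<in> effects T A" "\<And>\<rho>. \<rho> \<in> states T A \<Longrightarrow> (\<Sum>\<phi>\<in>P. \<langle>dag A \<phi>, \<rho>\<rangle>) + \<langle>e, \<rho>\<rangle> = \<langle>\<epsilon> A, \<rho>\<rangle>"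
      using P unfolding frame_def by blast
    have e0: "\<langle>e, \<phi>\<rangle> = 0" if \<phi>: "\<phi> \<in> P" for \<phi>
    proof -
      have n: "normalised T A \<phi>" using frame_pure[OF P \<phi>] by simp
      have "(\<Sum>\<psi>\<in>P. \<langle>dag A \<psi>, \<phi>\<rangle>) = (\<Sum>\<psi>\<in>P. if \<psi> = \<phi> then 1 else 0)"
        using frame_orthogonal[OF P _ \<phi>] by (intro sum.cong) auto
      also have "\<dots> = 1" using \<phi> frame_finite[OF P] by simp
      finally show ?thesis using e(2)[OF normalised_state[OF n]] normalised_pairing[OF n] by simp
    qed
    have "\<langle>e, chi A\<rangle> = 0" using \<tau>(2)[OF e(1)] \<tau>0[OF e(1)] e0 by simp
    then have "\<langle>e, \<rho>\<rangle> = 0" if "\<rho> \<in> states T A" for \<rho> using chi_zero[OF e(1) _ that] by blast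
    then have "basis A P" using P e(2) unfolding basis_def frame_def by simp
    then show ?thesis by simp
  next
    case False
    obtain \<alpha> q \<kappa> where \<alpha>: "pure_normalised A \<alpha>" and q: "0 < q" and \<kappa>: "\<kappa> \<in> states T A"
      and eq: "\<And>a. a \<in> effects T A \<Longrightarrow> \<langle>a, \<tau>\<rangle> = q * \<langle>a, \<alpha>\<rangle> + \<langle>a, \<kappa>\<rangle>"
      using eigenstate_exists[OF \<tau>(1) False] by blast
    have orth: "\<langle>dag A \<phi>, \<alpha>\<rangle> = 0" if \<phi>: "\<phi> \<in> P" for \<phi>
    proof -
      note d = dag_effect[OF frame_pure[OF P \<phi>]]
      have nn: "0 \<le> \<langle>dag A \<phi>, \<alpha>\<rangle>" using pairing_nonneg[OF d] \<alpha> normalised_state by blast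
      have "q * \<langle>dag A \<phi>, \<alpha>\<rangle> + \<langle>dag A \<phi>, \<kappa>\<rangle> = 0" using eq[OF d] dag0[OF \<phi>] by simp
      moreover have "0 \<le> q * \<langle>dag A \<phi>, \<alpha>\<rangle>" using q nn by simp
      ultimately have "q * \<langle>dag A \<phi>, \<alpha>\<rangle> = 0" using pairing_nonneg[OF d \<kappa>] by linarith
      then show ?thesis using q by simp
    qed
    from frame_insert[OF P \<alpha> orth] show ?thesis by blast
  qed
qed

lemma frame_card_bound: "frame A P \<Longrightarrow> card P \<le> nat \<lfloor>1 / weight A\<rfloor>"
proof -
  assume "frame A P"
  from frame_card_le[OF this] have "real (card P) \<le> 1 / weight A"
    using weight_pos[of A] by (simp add: field_simps)
  then show ?thesis by (simp add: le_nat_floor)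
qed

lemma frame_basis:
  assumes P: "frame A P"
  obtains Q where "P \<subseteq> Q" "basis A Q"
proof -
  let ?S = "\<lambda>Q. frame A Q \<and> P \<subseteq> Q"
  have "\<exists>Q. ?S Q \<and> (\<forall>Q'. ?S Q' \<longrightarrow> card Q' \<le> card Q)"
  proof (rule ex_has_greatest_nat[of ?S P card "Suc (nat \<lfloor>1 / weight A\<rfloor>)"])
    show "?S P" using P by simp
    show "\<forall>Q. ?S Q \<longrightarrow> card Q < Suc (nat \<lfloor>1 / weight A\<rfloor>)" using frame_card_bound le_imp_less_Suc by blast
  qed
  then obtain Q where Q: "frame A Q" "P \<subseteq> Q" "\<And>Q'. frame A Q' \<Longrightarrow> P \<subseteq> Q' \<Longrightarrow> card Q' \<le> card Q"
    by blast
  have "basis A Q"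
  proof (rule ccontr)
    assume "\<not> basis A Q"
    then obtain \<alpha> where \<alpha>: "\<alpha> \<notin> Q" "frame A (insert \<alpha> Q)" using frame_extend[OF Q(1)] by blast
    have "card (insert \<alpha> Q) \<le> card Q" by (rule Q(3)[OF \<alpha>(2)]) (use Q(2) in blast)
    then show False using \<alpha>(1) frame_finite[OF Q(1)] by simp
  qed
  with Q(2) that show thesis by blast
qed

lemma basis_exists: obtains P where "basis A P"
  using frame_basis[OF frame_empty] by blast

lemma basis_nonempty: "basis A P \<Longrightarrow> P \<noteq> {}"
  using basis_card by fastforce

text \<open>Peeling a whole basis off an invariant state exhausts it, because the peeled weights add
  up to 1. Hence a single basis determines all invariant states.\<close>

lemma uniform_state:
  assumes \<rho>: "normalised T A \<rho>" and inv: "\<And>U. reversible T A A U \<Longrightarrow> U \<cdot> \<rho> = \<rho>" and P: "basis A P"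
  shows "a \<in> effects T A \<Longrightarrow> \<langle>a, \<rho>\<rangle> = 1 / card P * (\<Sum>\<phi>\<in>P. \<langle>a, \<phi>\<rangle>)"
proof -
  let ?c = "\<langle>sharp A, \<rho>\<rangle>"
  have s: "sharp A \<in> effects T A" using sharp_props by simp
  have c: "\<langle>b, \<rho>\<rangle> = ?c" if "b \<in> sharp_effects A" for b
  proof -
    obtain U where U: "reversible T A A U" "b = sharp A \<cdot> U" using \<open>b \<in> sharp_effects A\<close> by (auto simp: sharp_effects_def)
    have "\<langle>sharp A \<cdot> U, \<rho>\<rangle> = \<langle>sharp A, U \<cdot> \<rho>\<rangle>"
      by (rule pairing_channel[OF s reversible_channel[OF U(1)] normalised_state[OF \<rho>], symmetric])
    then show ?thesis using U inv[OF U(1)] by simp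
  qed
  have "(\<Sum>\<phi>\<in>P. \<langle>dag A \<phi>, \<rho>\<rangle>) = (\<Sum>\<phi>\<in>P. ?c)"
    by (rule sum.cong) (auto intro!: c dag_sharp basis_pure[OF P])
  then have card: "real (card P) * ?c = 1"
    using basis_sum[OF P normalised_state[OF \<rho>]] normalised_pairing[OF \<rho>] by simp
  have n: "0 < card P" using basis_nonempty[OF P] basis_finite[OF P] by (simp add: card_gt_0_iff)
  have cd: "?c = 1 / card P" using card n by (simp add: field_simps)
  then have cpos: "0 < ?c" using n by simp
  obtain \<tau> where \<tau>: "\<tau> \<in> states T A" "\<And>a. a \<in> effects T A \<Longrightarrow> \<langle>a, \<rho>\<rangle> = ?c * (\<Sum>\<phi>\<in>P. \<langle>a, \<phi>\<rangle>) + \<langle>a, \<tau>\<rangle>"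
    using peel[OF \<rho> cpos c basis_frame[OF P]] by blast
  have "(\<Sum>\<phi>\<in>P. \<langle>\<epsilon> A, \<phi>\<rangle>) = (\<Sum>\<phi>\<in>P. 1)"
    by (rule sum.cong) (auto intro!: normalised_pairing basis_pure[OF P, THEN conjunct1])
  then have "\<langle>\<epsilon> A, \<tau>\<rangle> = 0" using \<tau>(2)[OF discard_effect] card normalised_pairing[OF \<rho>] by (simp add: mult.commute)
  then have "\<langle>a, \<tau>\<rangle> = 0" if "a \<in> effects T A" for a
    using effect_le_discard[OF that \<tau>(1)] pairing_nonneg[OF that \<tau>(1)] by simp
  then show "a \<in> effects T A \<Longrightarrow> \<langle>a, \<rho>\<rangle> = 1 / card P * (\<Sum>\<phi>\<in>P. \<langle>a, \<phi>\<rangle>)"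
    using \<tau>(2) cd by simp
qed

lemma chi_uniform:
  "basis A P \<Longrightarrow> a \<in> effects T A \<Longrightarrow> \<langle>a, chi A\<rangle> = 1 / card P * (\<Sum>\<phi>\<in>P. \<langle>a, \<phi>\<rangle>)"
  by (rule uniform_state[OF chi_normalised chi_invariant])

lemma invariant_unique:
  assumes \<rho>: "normalised T A \<rho>" and inv: "\<And>U. reversible T A A U \<Longrightarrow> U \<cdot> \<rho> = \<rho>"
  shows "\<rho> = chi A"
proof -
  obtain P where P: "basis A P" using basis_exists .
  show ?thesis
    by (rule state_eqI[OF normalised_state[OF \<rho>] chi_state])
      (simp only: uniform_state[OF \<rho> inv P] chi_uniform[OF P])
qed

lemma microcanonical_eq: "microcanonical T A = chi A"
  unfolding microcanonical_def
  by (rule the_equality) (use chi_normalised chi_invariant invariant_unique in blast)+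

lemma basis_card_unique: "basis A P \<Longrightarrow> basis A Q \<Longrightarrow> card P = card Q"
  using basis_card[of A P] basis_card[of A Q] weight_pos[of A] by (metis mult_right_cancel of_nat_eq_iff less_irrefl)

text \<open>Eigenstates of the remainder enlarge a frame whose part of \<rho> has already been split
  off. Frames have bounded size, and a largest one of this kind leaves remainder zero.\<close>

lemma diagonalisation:
  assumes \<rho>: "normalised T A \<rho>"
  shows "\<exists>P p. basis A P \<and> (\<forall>a\<in>effects T A. \<langle>a, \<rho>\<rangle> = (\<Sum>\<phi>\<in>P. p \<phi> * \<langle>a, \<phi>\<rangle>))"
proof -
  define S where "S P \<longleftrightarrow> frame A P \<and> (\<exists>p \<tau>. \<tau> \<in> states T A \<and>
    (\<forall>a\<in>effects T A. \<langle>a, \<rho>\<rangle> = (\<Sum>\<phi>\<in>P. p \<phi> * \<langle>a, \<phi>\<rangle>) + \<langle>a, \<tau>\<rangle>) \<and> (\<forall>\<phi>\<in>P. \<langle>dag A \<phi>, \<tau>\<rangle> = 0))" for P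
  have "S {}" unfolding S_def using frame_empty normalised_state[OF \<rho>] by auto
  have "\<exists>P. S P \<and> (\<forall>Q. S Q \<longrightarrow> card Q \<le> card P)"
  proof (rule ex_has_greatest_nat[of S "{}" card "Suc (nat \<lfloor>1 / weight A\<rfloor>)"])
    show "S {}" by fact
    show "\<forall>Q. S Q \<longrightarrow> card Q < Suc (nat \<lfloor>1 / weight A\<rfloor>)"
      unfolding S_def using frame_card_bound le_imp_less_Suc by blast
  qed
  then obtain P where P: "S P" "\<And>Q. S Q \<Longrightarrow> card Q \<le> card P" by blast
  obtain p \<tau> where fr: "frame A P" and \<tau>: "\<tau> \<in> states T A"
    and eq: "\<And>a. a \<in> effects T A \<Longrightarrow> \<langle>a, \<rho>\<rangle> = (\<Sum>\<phi>\<in>P. p \<phi> * \<langle>a, \<phi>\<rangle>) + \<langle>a, \<tau>\<rangle>"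
    and orth: "\<And>\<phi>. \<phi> \<in> P \<Longrightarrow> \<langle>dag A \<phi>, \<tau>\<rangle> = 0"
    using P(1) unfolding S_def by blast
  have "\<langle>\<epsilon> A, \<tau>\<rangle> = 0"
  proof (rule ccontr)
    assume nz: "\<langle>\<epsilon> A, \<tau>\<rangle> \<noteq> 0"
    obtain \<alpha> q \<kappa> where \<alpha>: "pure_normalised A \<alpha>" and q: "0 < q" and \<kappa>: "\<kappa> \<in> states T A"
      and eq2: "\<And>a. a \<in> effects T A \<Longrightarrow> \<langle>a, \<tau>\<rangle> = q * \<langle>a, \<alpha>\<rangle> + \<langle>a, \<kappa>\<rangle>" and \<alpha>\<kappa>: "\<langle>dag A \<alpha>, \<kappa>\<rangle> = 0"
      using eigenstate_exists[OF \<tau> nz] by blast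
    have both: "\<langle>dag A \<phi>, \<alpha>\<rangle> = 0 \<and> \<langle>dag A \<phi>, \<kappa>\<rangle> = 0" if \<phi>: "\<phi> \<in> P" for \<phi>
    proof -
      note d = dag_effect[OF frame_pure[OF fr \<phi>]]
      have nn: "0 \<le> \<langle>dag A \<phi>, \<alpha>\<rangle>" using pairing_nonneg[OF d] \<alpha> normalised_state by blast
      have "q * \<langle>dag A \<phi>, \<alpha>\<rangle> + \<langle>dag A \<phi>, \<kappa>\<rangle> = 0" using eq2[OF d] orth[OF \<phi>] by simp
      moreover have "0 \<le> q * \<langle>dag A \<phi>, \<alpha>\<rangle>" using q nn by simp
      ultimately have "q * \<langle>dag A \<phi>, \<alpha>\<rangle> = 0" "\<langle>dag A \<phi>, \<kappa>\<rangle> = 0"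
        using pairing_nonneg[OF d \<kappa>] by linarith+
      then show ?thesis using q by simp
    qed
    have ins: "\<alpha> \<notin> P" "frame A (insert \<alpha> P)"
      using frame_insert[OF fr \<alpha>] both by blast+
    have "S (insert \<alpha> P)"
      unfolding S_def
    proof (intro conjI ins(2) exI[of _ "p(\<alpha> := q)"] exI[of _ \<kappa>] ballI \<kappa>)
      show "\<langle>dag A \<phi>, \<kappa>\<rangle> = 0" if "\<phi> \<in> insert \<alpha> P" for \<phi> using both \<alpha>\<kappa> that by blast
      fix a assume a: "a \<in> effects T A"
      have "(\<Sum>\<phi>\<in>P. (p(\<alpha> := q)) \<phi> * \<langle>a, \<phi>\<rangle>) = (\<Sum>\<phi>\<in>P. p \<phi> * \<langle>a, \<phi>\<rangle>)"
        by (rule sum.cong) (use ins(1) in auto)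
      then show "\<langle>a, \<rho>\<rangle> = (\<Sum>\<phi>\<in>insert \<alpha> P. (p(\<alpha> := q)) \<phi> * \<langle>a, \<phi>\<rangle>) + \<langle>a, \<kappa>\<rangle>"
        using eq[OF a] eq2[OF a] ins(1) frame_finite[OF fr] by simp
    qed
    from P(2)[OF this] ins(1) frame_finite[OF fr] show False by simp
  qed
  then have \<tau>0: "\<langle>a, \<tau>\<rangle> = 0" if "a \<in> effects T A" for a
    using effect_le_discard[OF that \<tau>] pairing_nonneg[OF that \<tau>] by simp
  \<comment> \<open>The state may be exhausted before the frame is complete; the basis elements
    added here get eigenvalue 0.\<close>
  obtain Q where Q: "P \<subseteq> Q" "basis A Q" using frame_basis[OF fr] .
  show ?thesis
  proof (intro exI[of _ Q] exI[of _ "\<lambda>\<phi>. if \<phi> \<in> P then p \<phi> else 0"] conjI ballI Q(2))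
    fix a assume a: "a \<in> effects T A"
    have "(\<Sum>\<phi>\<in>P. p \<phi> * \<langle>a, \<phi>\<rangle>) = (\<Sum>\<phi>\<in>Q. (if \<phi> \<in> P then p \<phi> else 0) * \<langle>a, \<phi>\<rangle>)"
      by (rule sum.mono_neutral_cong_left[OF basis_finite[OF Q(2)] Q(1)]) auto
    then show "\<langle>a, \<rho>\<rangle> = (\<Sum>\<phi>\<in>Q. (if \<phi> \<in> P then p \<phi> else 0) * \<langle>a, \<phi>\<rangle>)"
      using eq[OF a] \<tau>0[OF a] by simp
  qed
qed

section \<open>Pure maximal sets as bases\<close>

lemma basis_orthogonal: "basis A P \<Longrightarrow> \<phi> \<in> P \<Longrightarrow> \<psi> \<in> P \<Longrightarrow> \<langle>dag A \<phi>, \<psi>\<rangle> = (if \<phi> = \<psi> then 1 else 0)"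
  by (rule frame_orthogonal[OF basis_frame])

lemma basis_test: "basis A P \<Longrightarrow> test T A \<one> P (dag A)"
  by (rule effects_test) (auto simp: basis_finite basis_sum intro!: dag_effect basis_pure)

text \<open>In a test distinguishing the enlarged set, the effect of each \<phi> dominates
  \<open>dag A \<phi>\<close>. The daggers already exhaust the probability on every state, so none
  is left for the effect of \<open>\<rho>\<close>.\<close>

lemma basis_pure_maximal_set:
  assumes P: "basis A P"
  shows "pure_maximal_set T A P"
  unfolding pure_maximal_set_def
proof (intro conjI ballI allI impI notI)
  show "perfectly_distinguishable T A P"
    unfolding perfectly_distinguishable_def
    using basis_pure[OF P] basis_test[OF P] basis_orthogonal[OF P] by blast
  show "pure T \<phi>" if "\<phi> \<in> P" for \<phi> using basis_pure[OF P that] by simp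
  fix \<rho> assume \<rho>: "\<rho> \<notin> P" and pd: "perfectly_distinguishable T A (insert \<rho> P)"
  obtain b where b: "test T A \<one> (insert \<rho> P) b"
    "\<And>\<phi> \<psi>. \<phi> \<in> insert \<rho> P \<Longrightarrow> \<psi> \<in> insert \<rho> P \<Longrightarrow> \<langle>b \<phi>, \<psi>\<rangle> = (if \<phi> = \<psi> then 1 else 0)"
    using pd unfolding perfectly_distinguishable_def by blast
  have n: "normalised T A \<rho>" using pd by (simp add: perfectly_distinguishable_def)
  note \<rho>s = normalised_state[OF n]
  have be: "b \<phi> \<in> effects T A" if "\<phi> \<in> insert \<rho> P" for \<phi>
    using test_hom[OF b(1) that] by (simp add: effects_def)
  have "\<langle>dag A \<phi>, \<rho>\<rangle> \<le> \<langle>b \<phi>, \<rho>\<rangle>" if \<phi>: "\<phi> \<in> P" for \<phi>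
  proof -
    have "\<langle>b \<phi>, \<phi>\<rangle> = 1" using b(2)[of \<phi> \<phi>] \<phi> by simp
    then obtain c where c: "c \<in> effects T A" "\<And>\<rho>. \<rho> \<in> states T A \<Longrightarrow> \<langle>b \<phi>, \<rho>\<rangle> = \<langle>dag A \<phi>, \<rho>\<rangle> + \<langle>c, \<rho>\<rangle>"
      using dag_below[OF basis_pure[OF P \<phi>] be] \<phi> by blast
    show ?thesis using c(2)[OF \<rho>s] pairing_nonneg[OF c(1) \<rho>s] by simp
  qed
  then have "(\<Sum>\<phi>\<in>P. \<langle>dag A \<phi>, \<rho>\<rangle>) \<le> (\<Sum>\<phi>\<in>P. \<langle>b \<phi>, \<rho>\<rangle>)" by (rule sum_mono)
  moreover have "\<langle>b \<rho>, \<rho>\<rangle> + (\<Sum>\<phi>\<in>P. \<langle>b \<phi>, \<rho>\<rangle>) = 1"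
    using observation_sum[OF b(1) \<rho>s] \<rho> basis_finite[OF P] normalised_pairing[OF n] by simp
  moreover have "\<langle>b \<rho>, \<rho>\<rangle> = 1" using b(2)[of \<rho> \<rho>] by simp
  ultimately show False using basis_sum[OF P \<rho>s] normalised_pairing[OF n] by simp
qed

text \<open>The distinguishing effects dominate the daggers, so the daggers fit into one measurement
  and \<open>P\<close> is a frame. Were it not a basis, \<open>frame_extend\<close> would supply a
  further distinguishable state.\<close>

lemma pure_maximal_set_basis:
  assumes P: "pure_maximal_set T A P"
  shows "basis A P"
proof -
  have pn: "pure_normalised A \<phi>" if "\<phi> \<in> P" for \<phi>
    using P that by (simp add: pure_maximal_set_def perfectly_distinguishable_def)
  obtain a where a: "test T A \<one> P a"
    "\<And>\<phi> \<psi>. \<phi> \<in> P \<Longrightarrow> \<psi> \<in> P \<Longrightarrow> \<langle>a \<phi>, \<psi>\<rangle> = (if \<phi> = \<psi> then 1 else 0)"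
    using P unfolding pure_maximal_set_def perfectly_distinguishable_def by blast
  have fin: "finite P" by (rule test_finite[OF a(1)])
  have ae: "a \<phi> \<in> effects T A" if "\<phi> \<in> P" for \<phi>
    using test_hom[OF a(1) that] by (simp add: effects_def)
  have "\<exists>b. \<phi> \<in> P \<longrightarrow> b \<in> effects T A \<and> (\<forall>\<rho>\<in>states T A. \<langle>a \<phi>, \<rho>\<rangle> = \<langle>dag A \<phi>, \<rho>\<rangle> + \<langle>b, \<rho>\<rangle>)" for \<phi>
  proof (cases "\<phi> \<in> P")
    case True
    have "\<langle>a \<phi>, \<phi>\<rangle> = 1" using a(2)[OF True True] by simp
    then obtain b where "b \<in> effects T A" "\<And>\<rho>. \<rho> \<in> states T A \<Longrightarrow> \<langle>a \<phi>, \<rho>\<rangle> = \<langle>dag A \<phi>, \<rho>\<rangle> + \<langle>b, \<rho>\<rangle>"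
      using dag_below[OF pn[OF True] ae[OF True]] by blast
    then show ?thesis by blast
  qed simp
  then obtain b where b: "\<And>\<phi>. \<phi> \<in> P \<Longrightarrow> b \<phi> \<in> effects T A"
    "\<And>\<phi> \<rho>. \<phi> \<in> P \<Longrightarrow> \<rho> \<in> states T A \<Longrightarrow> \<langle>a \<phi>, \<rho>\<rangle> = \<langle>dag A \<phi>, \<rho>\<rangle> + \<langle>b \<phi>, \<rho>\<rangle>"
    by metis
  \<comment> \<open>Each distinguishing effect is refined into its dagger and a surplus, which
    \<open>effects_test\<close> permits; the surplus parts are then merged into the remainder effect
    of the frame.\<close>
  define D where "D = (\<lambda>(i, \<phi>). if i then dag A \<phi> else b \<phi>)"
  have Dsum: "(\<Sum>x\<in>{True, False} \<times> P. \<langle>D x, \<rho>\<rangle>) = \<langle>\<epsilon> A, \<rho>\<rangle>" if \<rho>: "\<rho> \<in> states T A" for \<rho>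
  proof -
    have "(\<Sum>x\<in>{True, False} \<times> P. \<langle>D x, \<rho>\<rangle>) = (\<Sum>i\<in>{True, False}. \<Sum>\<phi>\<in>P. \<langle>D (i, \<phi>), \<rho>\<rangle>)"
      unfolding sum.cartesian_product by (rule sum.cong) auto
    also have "\<dots> = (\<Sum>\<phi>\<in>P. \<langle>dag A \<phi>, \<rho>\<rangle>) + (\<Sum>\<phi>\<in>P. \<langle>b \<phi>, \<rho>\<rangle>)"
      by (simp add: D_def)
    also have "\<dots> = (\<Sum>\<phi>\<in>P. \<langle>a \<phi>, \<rho>\<rangle>)"
      unfolding sum.distrib[symmetric] by (rule sum.cong) (use b(2) \<rho> in auto)
    finally show ?thesis using observation_sum[OF a(1) \<rho>] by simp
  qed
  have t: "test T A \<one> ({True, False} \<times> P) D"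
  proof (rule effects_test)
    show "finite ({True, False} \<times> P)" using fin by simp
    show "D x \<in> effects T A" if "x \<in> {True, False} \<times> P" for x
      using that b(1) dag_effect[OF pn] by (auto simp: D_def)
  qed (rule Dsum)
  obtain e where e: "e \<in> effects T A" "\<And>\<rho>. \<rho> \<in> states T A \<Longrightarrow> \<langle>e, \<rho>\<rangle> = (\<Sum>x\<in>{False} \<times> P. \<langle>D x, \<rho>\<rangle>)"
    using effect_partial_sum[OF t, of "{False} \<times> P"] by blast
  have es: "(\<Sum>\<phi>\<in>P. \<langle>dag A \<phi>, \<rho>\<rangle>) + \<langle>e, \<rho>\<rangle> = \<langle>\<epsilon> A, \<rho>\<rangle>" if \<rho>: "\<rho> \<in> states T A" for \<rho>
  proof -
    have "(\<Sum>x\<in>{False} \<times> P. \<langle>D x, \<rho>\<rangle>) = (\<Sum>i\<in>{False}. \<Sum>\<phi>\<in>P. \<langle>D (i, \<phi>), \<rho>\<rangle>)"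
      unfolding sum.cartesian_product by (rule sum.cong) auto
    then have e': "\<langle>e, \<rho>\<rangle> = (\<Sum>\<phi>\<in>P. \<langle>b \<phi>, \<rho>\<rangle>)" using e(2)[OF \<rho>] by (simp add: D_def)
    have "(\<Sum>\<phi>\<in>P. \<langle>dag A \<phi>, \<rho>\<rangle>) + (\<Sum>\<phi>\<in>P. \<langle>b \<phi>, \<rho>\<rangle>) = (\<Sum>\<phi>\<in>P. \<langle>a \<phi>, \<rho>\<rangle>)"
      unfolding sum.distrib[symmetric] by (rule sum.cong) (use b(2) \<rho> in auto)
    then show ?thesis using observation_sum[OF a(1) \<rho>] e' by simp
  qed
  have fr: "frame A P" unfolding frame_def using fin pn e(1) es by blast
  show ?thesis
  proof (rule ccontr)
    assume "\<not> basis A P"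
    then obtain \<alpha> where \<alpha>: "\<alpha> \<notin> P" "frame A (insert \<alpha> P)" using frame_extend[OF fr] by blast
    \<comment> \<open>The new state receives the whole remainder \<open>e\<close> instead of its
      dagger, so that the effects add up to the deterministic one.\<close>
    define g where "g \<phi> = (if \<phi> = \<alpha> then e else dag A \<phi>)" for \<phi>
    have "test T A \<one> (insert \<alpha> P) g"
    proof (rule effects_test)
      show "finite (insert \<alpha> P)" using fin by simp
      show "g \<phi> \<in> effects T A" if "\<phi> \<in> insert \<alpha> P" for \<phi>
        using that e(1) dag_effect[OF pn] by (auto simp: g_def)
      fix \<rho> assume \<rho>: "\<rho> \<in> states T A"
      have "(\<Sum>\<phi>\<in>P. \<langle>g \<phi>, \<rho>\<rangle>) = (\<Sum>\<phi>\<in>P. \<langle>dag A \<phi>, \<rho>\<rangle>)"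
        by (rule sum.cong) (use \<alpha>(1) in \<open>auto simp: g_def\<close>)
      then show "(\<Sum>\<phi>\<in>insert \<alpha> P. \<langle>g \<phi>, \<rho>\<rangle>) = \<langle>\<epsilon> A, \<rho>\<rangle>"
        using es[OF \<rho>] \<alpha>(1) fin by (simp add: g_def)
    qed
    moreover have "\<langle>g \<phi>, \<psi>\<rangle> = (if \<phi> = \<psi> then 1 else 0)"
      if \<phi>: "\<phi> \<in> insert \<alpha> P" and \<psi>: "\<psi> \<in> insert \<alpha> P" for \<phi> \<psi>
    proof (cases "\<phi> = \<alpha>")
      case False
      then show ?thesis using frame_orthogonal[OF \<alpha>(2) \<phi> \<psi>] by (simp add: g_def)
    next
      case True
      have \<psi>n: "normalised T A \<psi>" using frame_pure[OF \<alpha>(2) \<psi>] by simp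
      have "(\<Sum>\<kappa>\<in>P. \<langle>dag A \<kappa>, \<psi>\<rangle>) = (\<Sum>\<kappa>\<in>P. if \<kappa> = \<psi> then 1 else 0)"
        using frame_orthogonal[OF \<alpha>(2) _ \<psi>] by (intro sum.cong) auto
      also have "\<dots> = (if \<psi> \<in> P then 1 else 0)" using fin by simp
      finally show ?thesis
        using es[OF normalised_state[OF \<psi>n]] normalised_pairing[OF \<psi>n] True \<alpha>(1) \<psi> by (auto simp: g_def)
    qed
    moreover have "normalised T A \<phi>" if "\<phi> \<in> insert \<alpha> P" for \<phi> using frame_pure[OF \<alpha>(2) that] by simp
    ultimately have "perfectly_distinguishable T A (insert \<alpha> P)"
      unfolding perfectly_distinguishable_def by blast
    with P \<alpha>(1) show False by (simp add: pure_maximal_set_def)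
  qed
qed

lemma pure_maximal_set_iff: "pure_maximal_set T A P \<longleftrightarrow> basis A P"
  using basis_pure_maximal_set pure_maximal_set_basis by blast

end

section \<open>Composite systems and unital channels\<close>

context sharp_theory_with_purification
begin

lemma tensor_inject:
  assumes "normalised T A \<phi>" "normalised T B \<psi>" "normalised T A \<phi>'" "normalised T B \<psi>'" "\<phi> \<otimes> \<psi> = \<phi>' \<otimes> \<psi>'"
  shows "\<phi> = \<phi>' \<and> \<psi> = \<psi>'"
  using assms discard_apply_left[OF assms(1) normalised_state[OF assms(2)]]
    discard_apply_left[OF assms(3) normalised_state[OF assms(4)]]
    discard_apply_right[OF assms(2) normalised_state[OF assms(1)]]
    discard_apply_right[OF assms(4) normalised_state[OF assms(3)]] by simp

text \<open>Purity preservation makes the product effect pure, and a pure effect certain on the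
  product state is its dagger.\<close>

lemma dag_par:
  assumes "pure_normalised A \<phi>" "pure_normalised B \<psi>"
  shows "dag (A \<boxtimes> B) (\<phi> \<otimes> \<psi>) = dag A \<phi> \<otimes> dag B \<psi>"
proof (rule dag_unique[OF pure_normalised_par[OF assms]])
  show "dag A \<phi> \<otimes> dag B \<psi> \<in> effects T (A \<boxtimes> B)"
    by (rule effect_par[OF dag_effect[OF assms(1)] dag_effect[OF assms(2)]])
  show "pure T (dag A \<phi> \<otimes> dag B \<psi>)"
    by (rule pure_par[OF dag_pure[OF assms(1)] dag_pure[OF assms(2)]])
  show "\<langle>dag A \<phi> \<otimes> dag B \<psi>, \<phi> \<otimes> \<psi>\<rangle> = 1"
    using pairing_par[OF dag_effect[OF assms(1)] dag_effect[OF assms(2)], of \<phi> \<psi>]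
      assms normalised_state dag_self by simp
qed

lemma tensor_inj_on:
  assumes "basis A P" "basis B Q"
  shows "inj_on (\<lambda>(\<phi>, \<psi>). \<phi> \<otimes> \<psi>) (P \<times> Q)"
proof (rule inj_onI, clarify)
  fix \<phi> \<psi> \<phi>' \<psi>' assume h: "\<phi> \<in> P" "\<psi> \<in> Q" "\<phi>' \<in> P" "\<psi>' \<in> Q" and eq: "\<phi> \<otimes> \<psi> = \<phi>' \<otimes> \<psi>'"
  have "normalised T A \<phi>" "normalised T A \<phi>'" "normalised T B \<psi>" "normalised T B \<psi>'"
    using basis_pure[OF assms(1)] basis_pure[OF assms(2)] h by auto
  with tensor_inject eq show "\<phi> = \<phi>' \<and> \<psi> = \<psi>'" by blast
qed

text \<open>Completeness is checked one factor at a time: conditioning the joint state on an effect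
  of one factor leaves a state of the other, so correlated states cause no trouble.\<close>

lemma basis_par:
  assumes P: "basis A P" and Q: "basis B Q"
  shows "basis (A \<boxtimes> B) ((\<lambda>(\<phi>, \<psi>). \<phi> \<otimes> \<psi>) ` (P \<times> Q))"
  unfolding basis_def
proof (intro conjI ballI)
  let ?f = "\<lambda>(\<phi>, \<psi>). \<phi> \<otimes> \<psi>"
  show "finite (?f ` (P \<times> Q))" using basis_finite[OF P] basis_finite[OF Q] by simp
  show "normalised T (A \<boxtimes> B) x" "pure T x" if mem: "x \<in> ?f ` (P \<times> Q)" for x
  proof -
    obtain \<phi> \<psi> where "\<phi> \<in> P" "\<psi> \<in> Q" and x: "x = \<phi> \<otimes> \<psi>" using mem by auto
    then have "pure_normalised (A \<boxtimes> B) (\<phi> \<otimes> \<psi>)"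
      using pure_normalised_par[OF basis_pure[OF P] basis_pure[OF Q]] by blast
    then show "normalised T (A \<boxtimes> B) x" "pure T x" by (simp_all add: x)
  qed
  fix \<Theta> assume \<Theta>: "\<Theta> \<in> states T (A \<boxtimes> B)"
  have "(\<Sum>\<phi>\<in>?f ` (P \<times> Q). \<langle>dag (A \<boxtimes> B) \<phi>, \<Theta>\<rangle>) = (\<Sum>x\<in>P \<times> Q. \<langle>dag (A \<boxtimes> B) (?f x), \<Theta>\<rangle>)"
    using sum.reindex[OF tensor_inj_on[OF P Q]] by (simp add: o_def)
  also have "\<dots> = (\<Sum>(\<phi>, \<psi>)\<in>P \<times> Q. \<langle>dag A \<phi> \<otimes> dag B \<psi>, \<Theta>\<rangle>)"
    by (rule sum.cong) (use dag_par basis_pure[OF P] basis_pure[OF Q] in auto)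
  also have "\<dots> = (\<Sum>\<phi>\<in>P. \<Sum>\<psi>\<in>Q. \<langle>dag A \<phi> \<otimes> dag B \<psi>, \<Theta>\<rangle>)"
    by (rule sum.cartesian_product[symmetric])
  also have "\<dots> = (\<Sum>\<phi>\<in>P. \<langle>dag A \<phi>, (\<iota> A \<otimes> \<epsilon> B) \<cdot> \<Theta>\<rangle>)"
  proof (rule sum.cong[OF refl])
    fix \<phi> assume \<phi>: "\<phi> \<in> P"
    note d = dag_effect[OF basis_pure[OF P \<phi>]]
    have "(\<Sum>\<psi>\<in>Q. \<langle>dag A \<phi> \<otimes> dag B \<psi>, \<Theta>\<rangle>) = (\<Sum>\<psi>\<in>Q. \<langle>dag B \<psi>, (dag A \<phi> \<otimes> \<iota> B) \<cdot> \<Theta>\<rangle>)"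
      by (rule sum.cong[OF refl]) (use pairing_slide(2)[OF d dag_effect[OF basis_pure[OF Q]] \<Theta>] in simp)
    also have "\<dots> = \<langle>\<epsilon> B, (dag A \<phi> \<otimes> \<iota> B) \<cdot> \<Theta>\<rangle>"
      by (rule basis_sum[OF Q state_apply_left[OF \<Theta> d]])
    finally show "(\<Sum>\<psi>\<in>Q. \<langle>dag A \<phi> \<otimes> dag B \<psi>, \<Theta>\<rangle>) = \<langle>dag A \<phi>, (\<iota> A \<otimes> \<epsilon> B) \<cdot> \<Theta>\<rangle>"
      using pairing_slide[OF d discard_effect \<Theta>] by simp
  qed
  also have "\<dots> = \<langle>\<epsilon> A, (\<iota> A \<otimes> \<epsilon> B) \<cdot> \<Theta>\<rangle>"
    by (rule basis_sum[OF P state_apply_right[OF \<Theta> discard_effect]])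
  also have "\<dots> = \<langle>\<epsilon> (A \<boxtimes> B), \<Theta>\<rangle>"
    using pairing_slide(1)[OF discard_effect discard_effect \<Theta>] by (simp add: discard_par)
  finally show "(\<Sum>\<phi>\<in>?f ` (P \<times> Q). \<langle>dag (A \<boxtimes> B) \<phi>, \<Theta>\<rangle>) = \<langle>\<epsilon> (A \<boxtimes> B), \<Theta>\<rangle>" .
qed

lemma pairing_tensor_left:
  assumes "E \<in> effects T (A \<boxtimes> B)" "\<rho> \<in> states T A" "\<sigma> \<in> states T B"
  shows "E \<cdot> (\<iota> A \<otimes> \<sigma>) \<in> effects T A" "\<langle>E, \<rho> \<otimes> \<sigma>\<rangle> = \<langle>E \<cdot> (\<iota> A \<otimes> \<sigma>), \<rho>\<rangle>"
  using assms par_state_right[of \<rho> \<one> \<sigma>] by (simp_all add: hom_iffs pairing_def assoc)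

lemma pairing_tensor_right:
  assumes "E \<in> effects T (A \<boxtimes> B)" "\<rho> \<in> states T A" "\<sigma> \<in> states T B"
  shows "E \<cdot> (\<rho> \<otimes> \<iota> B) \<in> effects T B" "\<langle>E, \<rho> \<otimes> \<sigma>\<rangle> = \<langle>E \<cdot> (\<rho> \<otimes> \<iota> B), \<sigma>\<rangle>"
  using assms par_state_left[of \<sigma> \<one> \<rho>] by (simp_all add: hom_iffs pairing_def assoc)

text \<open>Both sides are the uniform mixture of one product basis.\<close>

lemma chi_par: "chi (A \<boxtimes> B) = chi A \<otimes> chi B"
proof (rule state_eqI[OF chi_state normalised_state[OF normalised_par[OF chi_normalised chi_normalised]]])
  fix E assume E: "E \<in> effects T (A \<boxtimes> B)"
  obtain P where P: "basis A P" using basis_exists .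
  obtain Q where Q: "basis B Q" using basis_exists .
  let ?f = "\<lambda>(\<phi>, \<psi>). \<phi> \<otimes> \<psi>"
  have ps: "\<phi> \<in> states T A" if "\<phi> \<in> P" for \<phi> using basis_pure[OF P that] normalised_state by blast
  have qs: "\<psi> \<in> states T B" if "\<psi> \<in> Q" for \<psi> using basis_pure[OF Q that] normalised_state by blast
  have "\<langle>E, chi (A \<boxtimes> B)\<rangle> = 1 / card (?f ` (P \<times> Q)) * (\<Sum>\<phi>\<in>?f ` (P \<times> Q). \<langle>E, \<phi>\<rangle>)"
    by (rule chi_uniform[OF basis_par[OF P Q] E])
  also have "card (?f ` (P \<times> Q)) = card P * card Q"
    using card_image[OF tensor_inj_on[OF P Q]] by (simp add: card_cartesian_product)
  also have "(\<Sum>\<phi>\<in>?f ` (P \<times> Q). \<langle>E, \<phi>\<rangle>) = (\<Sum>(\<phi>, \<psi>)\<in>P \<times> Q. \<langle>E, \<phi> \<otimes> \<psi>\<rangle>)"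
    using sum.reindex[OF tensor_inj_on[OF P Q], of "\<lambda>\<phi>. \<langle>E, \<phi>\<rangle>"] by (simp add: o_def case_prod_unfold)
  also have "\<dots> = (\<Sum>\<phi>\<in>P. \<Sum>\<psi>\<in>Q. \<langle>E, \<phi> \<otimes> \<psi>\<rangle>)"
    by (rule sum.cartesian_product[symmetric])
  also have "\<dots> = (\<Sum>\<phi>\<in>P. card Q * \<langle>E, \<phi> \<otimes> chi B\<rangle>)"
  proof (rule sum.cong[OF refl])
    fix \<phi> assume \<phi>: "\<phi> \<in> P"
    have "\<langle>E, \<phi> \<otimes> chi B\<rangle> = 1 / card Q * (\<Sum>\<psi>\<in>Q. \<langle>E \<cdot> (\<phi> \<otimes> \<iota> B), \<psi>\<rangle>)"
      unfolding pairing_tensor_right(2)[OF E ps[OF \<phi>] chi_state]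
      by (rule chi_uniform[OF Q pairing_tensor_right(1)[OF E ps[OF \<phi>] chi_state]])
    also have "(\<Sum>\<psi>\<in>Q. \<langle>E \<cdot> (\<phi> \<otimes> \<iota> B), \<psi>\<rangle>) = (\<Sum>\<psi>\<in>Q. \<langle>E, \<phi> \<otimes> \<psi>\<rangle>)"
      by (rule sum.cong[OF refl]) (use pairing_tensor_right(2)[OF E ps[OF \<phi>] qs] in simp)
    finally show "(\<Sum>\<psi>\<in>Q. \<langle>E, \<phi> \<otimes> \<psi>\<rangle>) = card Q * \<langle>E, \<phi> \<otimes> chi B\<rangle>"
      using basis_nonempty[OF Q] basis_finite[OF Q] by simp
  qed
  also have "\<dots> = card Q * (\<Sum>\<phi>\<in>P. \<langle>E \<cdot> (\<iota> A \<otimes> chi B), \<phi>\<rangle>)"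
    unfolding sum_distrib_left
    by (rule sum.cong[OF refl]) (use pairing_tensor_left(2)[OF E ps chi_state] in simp)
  also have "(\<Sum>\<phi>\<in>P. \<langle>E \<cdot> (\<iota> A \<otimes> chi B), \<phi>\<rangle>) = card P * \<langle>E \<cdot> (\<iota> A \<otimes> chi B), chi A\<rangle>"
    using chi_uniform[OF P pairing_tensor_left(1)[OF E chi_state chi_state]] basis_nonempty[OF P] basis_finite[OF P]
    by simp
  also have "\<langle>E \<cdot> (\<iota> A \<otimes> chi B), chi A\<rangle> = \<langle>E, chi A \<otimes> chi B\<rangle>"
    by (rule pairing_tensor_left(2)[OF E chi_state chi_state, symmetric])
  finally show "\<langle>E, chi (A \<boxtimes> B)\<rangle> = \<langle>E, chi A \<otimes> chi B\<rangle>"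
    using basis_nonempty[OF P] basis_finite[OF P] basis_nonempty[OF Q] basis_finite[OF Q] by simp
qed

text \<open>Conjugation by \<open>U\<close> carries reversible channels of \<open>B\<close> to
  reversible channels of \<open>A\<close>, so the image of the invariant state is invariant, and
  invariance determines it.\<close>

lemma reversible_chi:
  assumes U: "reversible T A B U"
  shows "U \<cdot> chi A = chi B"
proof (rule invariant_unique)
  show "normalised T B (U \<cdot> chi A)" by (rule channel_normalised[OF reversible_channel[OF U] chi_normalised])
  fix W assume W: "reversible T B B W"
  obtain V where V: "reversible T B A V" "V \<cdot> U = \<iota> A" "U \<cdot> V = \<iota> B" using reversible_inverse[OF U] .
  note ty = reversible_src[OF U] reversible_tgt[OF U] reversible_src[OF V(1)] reversible_tgt[OF V(1)]
    reversible_src[OF W] reversible_tgt[OF W] normalised_src[OF chi_normalised[of A]] normalised_tgt[OF chi_normalised[of A]]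
  have "V \<cdot> (W \<cdot> U) \<cdot> chi A = chi A"
    using chi_invariant[OF reversible_seq[OF reversible_seq[OF U W] V(1)]] ty by (simp add: assoc)
  then have "U \<cdot> (V \<cdot> (W \<cdot> U \<cdot> chi A)) = U \<cdot> chi A"
    using ty by (simp add: assoc)
  then show "W \<cdot> U \<cdot> chi A = U \<cdot> chi A"
    using reversible_cancel[OF U V(3,1), of "W \<cdot> U \<cdot> chi A"] ty by simp
qed

lemma converges_apply:
  assumes lim: "converges_to T A B F f" and \<rho>: "\<rho> \<in> states T A" and a: "a \<in> effects T B"
  shows "(\<lambda>k. \<langle>a, F k \<cdot> \<rho>\<rangle>) \<longlonglongrightarrow> \<langle>a, f \<cdot> \<rho>\<rangle>"
proof -
  have "(\<one>, \<rho>, a) \<in> probes T A B" using \<rho> a by (simp add: probes_def)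
  then have "(\<lambda>k. probe_value T (F k) (\<one>, \<rho>, a)) \<longlonglongrightarrow> probe_value T f (\<one>, \<rho>, a)"
    using lim by (simp add: converges_to_def)
  then show ?thesis by (simp add: probe_value_def)
qed

lemma lincomb_apply:
  assumes l: "is_lincomb T A B F X p U" and \<rho>: "\<rho> \<in> states T A" and a: "a \<in> effects T B"
  shows "\<langle>a, F \<cdot> \<rho>\<rangle> = (\<Sum>i\<in>X. p i * \<langle>a, U i \<cdot> \<rho>\<rangle>)"
proof -
  have "(\<one>, \<rho>, a) \<in> probes T A B" using \<rho> a by (simp add: probes_def)
  then have "probe_value T F (\<one>, \<rho>, a) = (\<Sum>i\<in>X. p i * probe_value T (U i) (\<one>, \<rho>, a))"
    using l by (simp add: is_lincomb_def)
  then show ?thesis by (simp add: probe_value_def)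
qed

section \<open>Free operations are unital\<close>

lemma basic_noisy_unital:
  assumes "N \<in> basic_noisy_operations T A A'"
  shows "channel T A A' N" "N \<cdot> chi A = chi A'"
proof -
  obtain E E' U where N: "N = (\<iota> A' \<otimes> \<epsilon> E') \<cdot> U \<cdot> (\<iota> A \<otimes> chi E)" and U: "reversible T (A \<boxtimes> E) (A' \<boxtimes> E') U"
    using assms unfolding basic_noisy_operations_def microcanonical_eq by blast
  have c1: "channel T A (A \<boxtimes> E) (\<iota> A \<otimes> chi E)"
    using channel_par[OF test_ident[of A] chi_normalised[of E, unfolded normalised_iff_channel]] by simp
  show "channel T A A' N"
    unfolding N by (rule channel_seq[OF channel_seq[OF c1 reversible_channel[OF U]] marginal_channel(1)])
  have ty: "src T (chi A) = \<one>" "tgt T (chi A) = A" "src T (chi E) = \<one>" "tgt T (chi E) = E"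
    "src T U = A \<boxtimes> E" "tgt T U = A' \<boxtimes> E'"
    using chi_state reversible_src[OF U] reversible_tgt[OF U] by (auto simp: hom_iffs)
  have "N \<cdot> chi A = (\<iota> A' \<otimes> \<epsilon> E') \<cdot> (U \<cdot> ((\<iota> A \<otimes> chi E) \<cdot> chi A))"
    unfolding N using ty by (simp add: assoc)
  also have "(\<iota> A \<otimes> chi E) \<cdot> chi A = chi (A \<boxtimes> E)"
    using par_state_right[of "chi A" \<one> "chi E"] ty by (simp add: chi_par)
  also have "U \<cdot> chi (A \<boxtimes> E) = chi A' \<otimes> chi E'"
    unfolding reversible_chi[OF U] by (rule chi_par)
  also have "(\<iota> A' \<otimes> \<epsilon> E') \<cdot> (chi A' \<otimes> chi E') = chi A'"
    by (rule discard_apply_right[OF chi_normalised chi_state])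
  finally show "N \<cdot> chi A = chi A'" .
qed

lemma noisy_unital: "noisy_operations T A A' \<subseteq> unital_channels T A A'"
proof
  fix F assume "F \<in> noisy_operations T A A'"
  then obtain N where N: "\<And>k. N k \<in> basic_noisy_operations T A A'" and lim: "converges_to T A A' N F"
    unfolding noisy_operations_def by blast
  have c: "channel T A A' F" by (rule channel_limit[OF basic_noisy_unital(1)[OF N] lim])
  have "F \<cdot> chi A = chi A'"
  proof (rule state_eqI[OF channel_state[OF chi_state c] chi_state])
    fix a assume a: "a \<in> effects T A'"
    have "(\<lambda>k. \<langle>a, chi A'\<rangle>) \<longlonglongrightarrow> \<langle>a, F \<cdot> chi A\<rangle>"
      using converges_apply[OF lim chi_state a] basic_noisy_unital(2)[OF N] by simp
    then show "\<langle>a, F \<cdot> chi A\<rangle> = \<langle>a, chi A'\<rangle>" by (simp add: LIMSEQ_const_iff)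
  qed
  with c show "F \<in> unital_channels T A A'" by (simp add: unital_channels_def microcanonical_eq)
qed

lemma rare_unital: "rare_channels T A \<subseteq> unital_channels T A A"
proof
  fix F assume "F \<in> rare_channels T A"
  then obtain X :: "nat set" and p U where c: "channel T A A F" and p: "(\<Sum>i\<in>X. p i) = 1"
    and U: "\<And>i. i \<in> X \<Longrightarrow> reversible T A A (U i)" and l: "is_lincomb T A A F X p U"
    unfolding rare_channels_def by blast
  have "F \<cdot> chi A = chi A"
  proof (rule state_eqI[OF channel_state[OF chi_state c] chi_state])
    fix a assume a: "a \<in> effects T A"
    have "\<langle>a, F \<cdot> chi A\<rangle> = (\<Sum>i\<in>X. p i * \<langle>a, U i \<cdot> chi A\<rangle>)" by (rule lincomb_apply[OF l chi_state a])
    also have "\<dots> = (\<Sum>i\<in>X. p i * \<langle>a, chi A\<rangle>)"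
      by (rule sum.cong[OF refl]) (use chi_invariant[OF U] in simp)
    finally show "\<langle>a, F \<cdot> chi A\<rangle> = \<langle>a, chi A\<rangle>" using p by (simp add: sum_distrib_right[symmetric])
  qed
  with c show "F \<in> unital_channels T A A" by (simp add: unital_channels_def microcanonical_eq)
qed

text \<open>Realises any relabelling of a basis by a channel without assuming any symmetry; it
  provides the unital channel from which permutability is extracted.\<close>

lemma measure_prepare:
  assumes P: "basis A P" and \<kappa>: "\<And>\<phi>. \<phi> \<in> P \<Longrightarrow> normalised T B (\<kappa> \<phi>)"
  obtains D where "channel T A B D"
    "\<And>\<rho> a. \<rho> \<in> states T A \<Longrightarrow> a \<in> effects T B \<Longrightarrow> \<langle>a, D \<cdot> \<rho>\<rangle> = (\<Sum>\<phi>\<in>P. \<langle>dag A \<phi>, \<rho>\<rangle> * \<langle>a, \<kappa> \<phi>\<rangle>)"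
proof -
  have t: "test T A B P (\<lambda>\<phi>. \<kappa> \<phi> \<cdot> dag A \<phi>)"
    by (rule test_then[OF basis_test[OF P]]) (use \<kappa> in \<open>simp add: normalised_iff_channel\<close>)
  obtain D where D: "channel T A B D" "is_sum T A B D P (\<lambda>\<phi>. \<kappa> \<phi> \<cdot> dag A \<phi>)"
    using sum_channel[OF t test_not_empty[OF t]] .
  have "\<langle>a, D \<cdot> \<rho>\<rangle> = (\<Sum>\<phi>\<in>P. \<langle>dag A \<phi>, \<rho>\<rangle> * \<langle>a, \<kappa> \<phi>\<rangle>)" if \<rho>: "\<rho> \<in> states T A" and a: "a \<in> effects T B" for \<rho> a
  proof -
    have "\<langle>a, D \<cdot> \<rho>\<rangle> = (\<Sum>\<phi>\<in>P. 1 * \<langle>a, (\<kappa> \<phi> \<cdot> dag A \<phi>) \<cdot> \<rho>\<rangle>)" by (rule lincomb_apply[OF D(2) \<rho> a])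
    also have "\<dots> = (\<Sum>\<phi>\<in>P. \<langle>dag A \<phi>, \<rho>\<rangle> * \<langle>a, \<kappa> \<phi>\<rangle>)"
    proof (rule sum.cong[OF refl])
      fix \<phi> assume \<phi>: "\<phi> \<in> P"
      have ty: "src T a = B" "tgt T a = \<one>" "src T \<rho> = \<one>" "tgt T \<rho> = A" "src T (\<kappa> \<phi>) = \<one>" "tgt T (\<kappa> \<phi>) = B"
        "src T (dag A \<phi>) = A" "tgt T (dag A \<phi>) = \<one>"
        using a \<rho> \<kappa>[OF \<phi>] dag_effect[OF basis_pure[OF P \<phi>]] by (auto simp: hom_iffs normalised_def)
      have "a \<cdot> ((\<kappa> \<phi> \<cdot> dag A \<phi>) \<cdot> \<rho>) = (a \<cdot> \<kappa> \<phi>) \<cdot> (dag A \<phi> \<cdot> \<rho>)" using ty by (simp add: assoc)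
      then show "1 * \<langle>a, (\<kappa> \<phi> \<cdot> dag A \<phi>) \<cdot> \<rho>\<rangle> = \<langle>dag A \<phi>, \<rho>\<rangle> * \<langle>a, \<kappa> \<phi>\<rangle>"
        using ty by (simp add: pairing_def prob_mult)
    qed
    finally show ?thesis .
  qed
  with D(1) that show thesis by blast
qed

section \<open>Unrestricted reversibility\<close>

lemma permutability_if_rare_unital:
  assumes conv: "\<And>A \<rho> \<sigma>. normalised T A \<rho> \<Longrightarrow> normalised T A \<sigma> \<Longrightarrow>
    convertible T (unital_channels T A A) \<rho> \<sigma> \<Longrightarrow> convertible T (rare_channels T A) \<rho> \<sigma>"
  shows "permutability T"
  unfolding permutability_def
proof (intro allI impI, elim conjE)
  fix A P \<pi> assume "pure_maximal_set T A P" and \<pi>: "bij_betw \<pi> P P"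
  then have P: "basis A P" by (simp add: pure_maximal_set_iff)
  note fin = basis_finite[OF P]
  define d where "d = card P"
  have d: "0 < d" using basis_nonempty[OF P] fin by (simp add: d_def card_gt_0_iff)
  obtain h where h: "bij_betw h {..<d} P" using finite_nat_bij[OF fin] by (auto simp: d_def)
  have hP: "h i \<in> P" if "i < d" for i using bij_betwE[OF h] that by simp
  have \<pi>P: "\<pi> \<phi> \<in> P" if "\<phi> \<in> P" for \<phi> using bij_betwE[OF \<pi>] that by blast
  have hn: "normalised T A (h i)" if "i < d" for i using basis_pure[OF P hP[OF that]] by simp
  have \<pi>n: "normalised T A (\<pi> (h i))" if "i < d" for i using basis_pure[OF P \<pi>P[OF hP[OF that]]] by simp
  have hinj: "h i = h j \<longleftrightarrow> i = j" if "i < d" "j < d" for i j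
    using h that by (auto simp: bij_betw_def inj_on_def)
  have \<pi>inj: "\<pi> \<phi> = \<pi> \<psi> \<longleftrightarrow> \<phi> = \<psi>" if "\<phi> \<in> P" "\<psi> \<in> P" for \<phi> \<psi>
    using \<pi> that by (auto simp: bij_betw_def inj_on_def)
  \<comment> \<open>The eigenvalues are d, d - 1, ..., 1 divided by their sum; what matters is that
    they are strictly decreasing.\<close>
  define Z where "Z = (\<Sum>i<d. real (d - i))"
  have Z: "0 < Z" unfolding Z_def by (rule sum_pos) (use d in auto)
  define w where "w i = real (d - i) / Z" for i
  have w0: "0 \<le> w i" for i using Z by (simp add: w_def)
  have w1: "(\<Sum>i<d. w i) = 1"
    unfolding w_def sum_divide_distrib[symmetric] Z_def[symmetric] using Z by simp
  have wdec: "w j < w i" if "i < j" "j < d" for i j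
    using that Z by (simp add: w_def divide_strict_right_mono)
  obtain \<rho> where \<rho>: "\<rho> \<in> states T A" "\<And>a. a \<in> effects T A \<Longrightarrow> \<langle>a, \<rho>\<rangle> = (\<Sum>i<d. w i * \<langle>a, h i\<rangle>)"
    by (rule state_cone[of "{..<d}" h A w])
      (use normalised_state[OF hn] normalised_pairing[OF hn] w0 w1 in auto)
  obtain \<sigma> where \<sigma>: "\<sigma> \<in> states T A" "\<And>a. a \<in> effects T A \<Longrightarrow> \<langle>a, \<sigma>\<rangle> = (\<Sum>i<d. w i * \<langle>a, \<pi> (h i)\<rangle>)"
    by (rule state_cone[of "{..<d}" "\<lambda>i. \<pi> (h i)" A w])
      (use normalised_state[OF \<pi>n] normalised_pairing[OF \<pi>n] w0 w1 in auto)
  have \<rho>n: "normalised T A \<rho>" using \<rho>(1) \<rho>(2)[OF discard_effect] normalised_pairing[OF hn] w1 by (simp add: normalised_def)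
  have \<sigma>n: "normalised T A \<sigma>" using \<sigma>(1) \<sigma>(2)[OF discard_effect] normalised_pairing[OF \<pi>n] w1 by (simp add: normalised_def)
  have dagh: "\<langle>dag A (h j), h i\<rangle> = (if i = j then 1 else 0)" if "i < d" "j < d" for i j
    using basis_orthogonal[OF P hP[OF that(2)] hP[OF that(1)]] hinj[OF that(2,1)] by auto
  have dag\<pi>: "\<langle>dag A (\<pi> (h j)), \<pi> (h i)\<rangle> = (if i = j then 1 else 0)" if "i < d" "j < d" for i j
    using basis_orthogonal[OF P \<pi>P[OF hP[OF that(2)]] \<pi>P[OF hP[OF that(1)]]]
      \<pi>inj[OF hP[OF that(2)] hP[OF that(1)]] hinj[OF that(2,1)] by auto
  have "\<And>\<phi>. \<phi> \<in> P \<Longrightarrow> normalised T A (\<pi> \<phi>)" using basis_pure[OF P \<pi>P] by simp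
  from measure_prepare[where B = A and \<kappa> = \<pi>, OF P this] obtain D where D: "channel T A A D"
    "\<And>\<rho> a. \<rho> \<in> states T A \<Longrightarrow> a \<in> effects T A \<Longrightarrow> \<langle>a, D \<cdot> \<rho>\<rangle> = (\<Sum>\<phi>\<in>P. \<langle>dag A \<phi>, \<rho>\<rangle> * \<langle>a, \<pi> \<phi>\<rangle>)"
    by blast
  have chid: "\<langle>dag A \<phi>, chi A\<rangle> = 1 / d" if "\<phi> \<in> P" for \<phi>
    using weight_chi[OF dag_sharp[OF basis_pure[OF P that]]] basis_card[OF P] d by (simp add: d_def field_simps)
  have "D \<cdot> chi A = chi A"
  proof (rule state_eqI[OF channel_state[OF chi_state D(1)] chi_state])
    fix a assume a: "a \<in> effects T A"
    have "\<langle>a, D \<cdot> chi A\<rangle> = (\<Sum>\<phi>\<in>P. 1 / d * \<langle>a, \<pi> \<phi>\<rangle>)"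
      unfolding D(2)[OF chi_state a] by (rule sum.cong) (use chid in auto)
    also have "\<dots> = 1 / d * (\<Sum>\<phi>\<in>P. \<langle>a, \<pi> \<phi>\<rangle>)" by (rule sum_distrib_left[symmetric])
    also have "(\<Sum>\<phi>\<in>P. \<langle>a, \<pi> \<phi>\<rangle>) = (\<Sum>\<phi>\<in>P. \<langle>a, \<phi>\<rangle>)"
      by (rule sum.reindex_bij_betw[OF \<pi>])
    finally show "\<langle>a, D \<cdot> chi A\<rangle> = \<langle>a, chi A\<rangle>" using chi_uniform[OF P a] by (simp add: d_def)
  qed
  with D(1) have Du: "D \<in> unital_channels T A A" by (simp add: unital_channels_def microcanonical_eq)
  have "\<sigma> = D \<cdot> \<rho>"
  proof (rule state_eqI[OF \<sigma>(1) channel_state[OF \<rho>(1) D(1)]])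
    fix a assume a: "a \<in> effects T A"
    have dagw: "\<langle>dag A (h j), \<rho>\<rangle> = w j" if j: "j < d" for j
    proof -
      have "\<langle>dag A (h j), \<rho>\<rangle> = (\<Sum>i<d. w i * (if i = j then 1 else 0))"
        unfolding \<rho>(2)[OF dag_effect[OF basis_pure[OF P hP[OF j]]]] by (rule sum.cong) (use dagh j in auto)
      also have "\<dots> = (\<Sum>i<d. if i = j then w i else 0)" by (rule sum.cong) auto
      finally show ?thesis using j by simp
    qed
    have "\<langle>a, D \<cdot> \<rho>\<rangle> = (\<Sum>i<d. \<langle>dag A (h i), \<rho>\<rangle> * \<langle>a, \<pi> (h i)\<rangle>)"
      unfolding D(2)[OF \<rho>(1) a] by (rule sum.reindex_bij_betw[OF h, symmetric])
    also have "\<dots> = (\<Sum>i<d. w i * \<langle>a, \<pi> (h i)\<rangle>)" by (rule sum.cong) (use dagw in auto)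
    finally show "\<langle>a, \<sigma>\<rangle> = \<langle>a, D \<cdot> \<rho>\<rangle>" using \<sigma>(2)[OF a] by simp
  qed
  with Du have "convertible T (unital_channels T A A) \<rho> \<sigma>" by (auto simp: convertible_def)
  from conv[OF \<rho>n \<sigma>n this] obtain F where "F \<in> rare_channels T A" and F: "\<sigma> = F \<cdot> \<rho>"
    by (auto simp: convertible_def)
  then obtain X :: "nat set" and p U where p: "\<And>i. i \<in> X \<Longrightarrow> 0 \<le> p i" "(\<Sum>i\<in>X. p i) = 1"
    and U: "\<And>i. i \<in> X \<Longrightarrow> reversible T A A (U i)" and l: "is_lincomb T A A F X p U"
    unfolding rare_channels_def by blast
  have finX: "finite X" using l by (simp add: is_lincomb_def)
  \<comment> \<open>Transition probabilities of each reversible channel into the permuted basis.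
    Invariance of \<open>chi A\<close> makes the rows sum to 1.\<close>
  define m where "m k i j = \<langle>dag A (\<pi> (h i)), U k \<cdot> h j\<rangle>" for k i j
  have \<pi>d: "dag A (\<pi> (h i)) \<in> effects T A" if "i < d" for i
    by (rule dag_effect[OF basis_pure[OF P \<pi>P[OF hP[OF that]]]])
  have Uh: "normalised T A (U k \<cdot> h j)" if "k \<in> X" "j < d" for k j
    by (rule channel_normalised[OF reversible_channel[OF U[OF that(1)]] hn[OF that(2)]])
  have m0: "0 \<le> m k i j" if "k \<in> X" "i < d" "j < d" for k i j
    unfolding m_def by (rule pairing_nonneg[OF \<pi>d[OF that(2)] normalised_state[OF Uh[OF that(1,3)]]])
  have mU: "m k i j = \<langle>dag A (\<pi> (h i)) \<cdot> U k, h j\<rangle>" if "k \<in> X" "i < d" "j < d" for k i j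
    unfolding m_def by (rule pairing_channel[OF \<pi>d[OF that(2)] reversible_channel[OF U[OF that(1)]] normalised_state[OF hn[OF that(3)]]])
  have row: "(\<Sum>j<d. m k i j) = 1" if k: "k \<in> X" and i: "i < d" for k i
  proof -
    note e = effect_channel[OF \<pi>d[OF i] reversible_channel[OF U[OF k]]]
    have "(\<Sum>j<d. m k i j) = (\<Sum>j<d. \<langle>dag A (\<pi> (h i)) \<cdot> U k, h j\<rangle>)" by (rule sum.cong) (use mU k i in auto)
    also have "\<dots> = (\<Sum>\<phi>\<in>P. \<langle>dag A (\<pi> (h i)) \<cdot> U k, \<phi>\<rangle>)" by (rule sum.reindex_bij_betw[OF h])
    also have "\<dots> = d * \<langle>dag A (\<pi> (h i)) \<cdot> U k, chi A\<rangle>" using chi_uniform[OF P e] d by (simp add: d_def)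
    also have "\<langle>dag A (\<pi> (h i)) \<cdot> U k, chi A\<rangle> = 1 / d"
      using pairing_channel[OF \<pi>d[OF i] reversible_channel[OF U[OF k]] chi_state] chi_invariant[OF U[OF k]]
        chid[OF \<pi>P[OF hP[OF i]]] by simp
    finally show ?thesis using d by simp
  qed
  \<comment> \<open>From the largest eigenvalue downwards. Earlier basis elements have known images,
    so row \<open>i\<close> is supported on \<open>j \<ge> i\<close>, where
    \<open>w j \<le> w i\<close> with equality only at \<open>i\<close>. The average of the rows
    over \<open>k\<close> has to reproduce \<open>w i\<close>, which leaves no weight off the
    diagonal.\<close>
  have main: "\<forall>k\<in>X. 0 < p k \<longrightarrow> U k \<cdot> h i = \<pi> (h i)" if "i < d" for i
    using that
  proof (induction i rule: less_induct)
    case (less i)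
    let ?b = "dag A (\<pi> (h i))"
    have i: "i < d" by fact
    have below: "m k i j = 0" if k: "k \<in> X" "0 < p k" and j: "j < i" for k j
    proof -
      have "U k \<cdot> h j = \<pi> (h j)" using less.IH[OF j] j i k by simp
      then show ?thesis unfolding m_def using dag\<pi>[of j i] j i by simp
    qed
    \<comment> \<open>How far channel \<open>k\<close> falls short of \<open>w i\<close>. The
      shortfalls with positive \<open>p k\<close> are nonnegative and average to zero.\<close>
    define g where "g k = (\<Sum>j<d. (w i - w j) * m k i j)" for k
    have term0: "0 \<le> (w i - w j) * m k i j" if k: "k \<in> X" "0 < p k" and j: "j < d" for k j
    proof (cases "j < i")
      case True
      then show ?thesis using below[OF k True] by simp
    next
      case False
      then have "w j \<le> w i" using wdec[of i j] j by (cases "i = j") auto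
      then show ?thesis using m0[OF k(1) i j] by simp
    qed
    have gk: "w i - (\<Sum>j<d. w j * m k i j) = g k" if k: "k \<in> X" for k
    proof -
      have "g k = w i * (\<Sum>j<d. m k i j) - (\<Sum>j<d. w j * m k i j)"
        by (simp add: g_def left_diff_distrib sum_subtractf sum_distrib_left)
      then show ?thesis using row[OF k i] by simp
    qed
    have "w i = \<langle>?b, \<sigma>\<rangle>"
    proof -
      have "\<langle>?b, \<sigma>\<rangle> = (\<Sum>j<d. if j = i then w j else 0)"
        unfolding \<sigma>(2)[OF \<pi>d[OF i]] by (rule sum.cong) (use dag\<pi> i in auto)
      then show ?thesis using i by simp
    qed
    also have "\<dots> = (\<Sum>k\<in>X. p k * \<langle>?b, U k \<cdot> \<rho>\<rangle>)"
      unfolding F by (rule lincomb_apply[OF l \<rho>(1) \<pi>d[OF i]])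
    also have "\<dots> = (\<Sum>k\<in>X. p k * (\<Sum>j<d. w j * m k i j))"
    proof (rule sum.cong[OF refl])
      fix k assume k: "k \<in> X"
      have "\<langle>?b, U k \<cdot> \<rho>\<rangle> = \<langle>?b \<cdot> U k, \<rho>\<rangle>"
        by (rule pairing_channel[OF \<pi>d[OF i] reversible_channel[OF U[OF k]] \<rho>(1)])
      also have "\<dots> = (\<Sum>j<d. w j * \<langle>?b \<cdot> U k, h j\<rangle>)"
        by (rule \<rho>(2)[OF effect_channel[OF \<pi>d[OF i] reversible_channel[OF U[OF k]]]])
      also have "\<dots> = (\<Sum>j<d. w j * m k i j)" by (rule sum.cong) (use mU k i in auto)
      finally show "p k * \<langle>?b, U k \<cdot> \<rho>\<rangle> = p k * (\<Sum>j<d. w j * m k i j)" by simp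
    qed
    finally have wi: "w i = (\<Sum>k\<in>X. p k * (\<Sum>j<d. w j * m k i j))" .
    have "(\<Sum>k\<in>X. p k * g k) = (\<Sum>k\<in>X. p k * w i - p k * (\<Sum>j<d. w j * m k i j))"
      by (rule sum.cong[OF refl]) (use gk in \<open>simp add: right_diff_distrib[symmetric]\<close>)
    also have "\<dots> = w i * (\<Sum>k\<in>X. p k) - (\<Sum>k\<in>X. p k * (\<Sum>j<d. w j * m k i j))"
      unfolding sum_subtractf sum_distrib_left by (simp add: mult.commute)
    also have "\<dots> = 0" unfolding wi[symmetric] p(2) by simp
    finally have sum0: "(\<Sum>k\<in>X. p k * g k) = 0" .
    have pg0: "0 \<le> p k * g k" if k: "k \<in> X" for k
    proof (cases "p k = 0")
      case False
      then have "0 < p k" using p(1)[OF k] by simp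
      then have "0 \<le> g k" unfolding g_def by (intro sum_nonneg term0[OF k]) auto
      then show ?thesis using p(1)[OF k] by simp
    qed simp
    show ?case
    proof (intro ballI impI)
      fix k assume k: "k \<in> X" "0 < p k"
      have "p k * g k = 0" using sum0 pg0 sum_nonneg_eq_0_iff[OF finX, of "\<lambda>k. p k * g k"] k(1) by blast
      then have "g k = 0" using k(2) by simp
      then have z: "(w i - w j) * m k i j = 0" if "j < d" for j
        using term0[OF k] sum_nonneg_eq_0_iff[of "{..<d}" "\<lambda>j. (w i - w j) * m k i j"] that
        unfolding g_def by (simp only: finite_lessThan lessThan_iff) blast
      have off: "m k i j = 0" if "j < d" "j \<noteq> i" for j
      proof (cases "j < i")
        case True
        then show ?thesis by (rule below[OF k])
      next
        case False
        then have "w j < w i" using wdec[of i j] that by simp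
        then show ?thesis using z[OF that(1)] by simp
      qed
      have "(\<Sum>j<d. m k i j) = (\<Sum>j<d. if j = i then m k i i else 0)" by (rule sum.cong) (use off in auto)
      then have "m k i i = 1" using row[OF k(1) i] i by simp
      then show "U k \<cdot> h i = \<pi> (h i)"
        unfolding m_def by (intro dag_eq_state[OF basis_pure[OF P \<pi>P[OF hP[OF i]]] Uh[OF k(1) i]])
    qed
  qed
  have "\<exists>k\<in>X. 0 < p k"
  proof (rule ccontr)
    assume "\<not> (\<exists>k\<in>X. 0 < p k)"
    then have "(\<Sum>k\<in>X. p k) \<le> 0" by (intro sum_nonpos) (simp add: not_less)
    then show False using p(2) by simp
  qed
  then obtain k where k: "k \<in> X" "0 < p k" by blast
  have "U k \<cdot> \<phi> = \<pi> \<phi>" if "\<phi> \<in> P" for \<phi>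
  proof -
    obtain i where "i < d" "h i = \<phi>" using h \<open>\<phi> \<in> P\<close> by (auto simp: bij_betw_def)
    then show ?thesis using main[of i] k by blast
  qed
  with U[OF k(1)] show "\<exists>U. reversible T A A U \<and> (\<forall>\<phi>\<in>P. U \<cdot> \<phi> = \<pi> \<phi>)" by blast
qed

text \<open>
  A reversible channel moving the pure states of a basis past a fixed pure state restricts to a pure channel on
  one factor, and pure channels are reversible.
\<close>

lemma reduce_to_factor:
  assumes P: "basis A P" and V: "reversible T (A \<boxtimes> A) (A \<boxtimes> A) V"
    and \<beta>: "pure_normalised A \<beta>" and \<gamma>: "pure_normalised A \<gamma>"
    and \<kappa>: "\<And>\<alpha>. \<alpha> \<in> P \<Longrightarrow> normalised T A (\<kappa> \<alpha>)" and eq: "\<And>\<alpha>. \<alpha> \<in> P \<Longrightarrow> V \<cdot> (\<alpha> \<otimes> \<beta>) = \<kappa> \<alpha> \<otimes> \<gamma>"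
  obtains R where "reversible T A A R" "\<And>\<alpha>. \<alpha> \<in> P \<Longrightarrow> R \<cdot> \<alpha> = \<kappa> \<alpha>"
proof -
  \<comment> \<open>A composite of pure transformations, hence pure; that projecting the second
    output onto \<gamma> loses no probability is proved below.\<close>
  define R where "R = (\<iota> A \<otimes> dag A \<gamma>) \<cdot> (V \<cdot> (\<iota> A \<otimes> \<beta>))"
  note d = dag_effect[OF \<gamma>] dag_pure[OF \<gamma>] dag_self[OF \<gamma>]
  have ty [simp]: "src T V = A \<boxtimes> A" "tgt T V = A \<boxtimes> A" "src T \<beta> = \<one>" "tgt T \<beta> = A" "src T \<gamma> = \<one>" "tgt T \<gamma> = A"
    "src T (dag A \<gamma>) = A" "tgt T (dag A \<gamma>) = \<one>"
    using reversible_src[OF V] reversible_tgt[OF V] \<beta> \<gamma> d(1) by (auto simp: hom_iffs normalised_def)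
  have Rh: "R \<in> hom T A A" by (simp add: R_def hom_def)
  have "pure T (V \<cdot> (\<iota> A \<otimes> \<beta>))"
    by (rule pure_seq[of _ A "A \<boxtimes> A" _ "A \<boxtimes> A"]) (use pure_par[OF pure_ident, of \<beta>] \<beta> reversible_pure[OF V] in \<open>simp_all add: hom_def\<close>)
  then have Rp: "pure T R"
    unfolding R_def
    by (intro pure_seq[of "V \<cdot> (\<iota> A \<otimes> \<beta>)" A "A \<boxtimes> A" _ A]) (use pure_par[OF pure_ident d(2)] in \<open>simp_all add: hom_def\<close>)
  have one: "dag A \<gamma> \<cdot> \<gamma> = \<iota> \<one>" by (rule prob_eq_1) (use d(3) in \<open>simp_all add: pairing_def\<close>)
  have R\<alpha>: "R \<cdot> \<alpha> = \<kappa> \<alpha>" if \<alpha>: "\<alpha> \<in> P" for \<alpha>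
  proof -
    have n: "normalised T A \<alpha>" using basis_pure[OF P \<alpha>] by simp
    note [simp] = normalised_src[OF n] normalised_tgt[OF n] normalised_src[OF \<kappa>[OF \<alpha>]] normalised_tgt[OF \<kappa>[OF \<alpha>]]
    have "R \<cdot> \<alpha> = (\<iota> A \<otimes> dag A \<gamma>) \<cdot> (V \<cdot> ((\<iota> A \<otimes> \<beta>) \<cdot> \<alpha>))" by (simp add: R_def assoc)
    also have "(\<iota> A \<otimes> \<beta>) \<cdot> \<alpha> = \<alpha> \<otimes> \<beta>" using par_state_right[of \<alpha> \<one> \<beta>] by simp
    also have "V \<cdot> (\<alpha> \<otimes> \<beta>) = \<kappa> \<alpha> \<otimes> \<gamma>" by (rule eq[OF \<alpha>])
    also have "(\<iota> A \<otimes> dag A \<gamma>) \<cdot> (\<kappa> \<alpha> \<otimes> \<gamma>) = \<kappa> \<alpha>" by (simp add: par_seq one)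
    finally show ?thesis .
  qed
  have "channel T A A R"
  proof (rule channel_if_discard_preserving[OF Rh])
    have e: "\<epsilon> A \<cdot> R \<in> effects T A" using Rh by (simp add: hom_iffs)
    obtain a' where a': "a' \<in> effects T A" "\<And>\<rho>. \<rho> \<in> states T A \<Longrightarrow> \<langle>\<epsilon> A \<cdot> R, \<rho>\<rangle> + \<langle>a', \<rho>\<rangle> = \<langle>\<epsilon> A, \<rho>\<rangle>"
      using effect_complement[OF e] by blast
    have "\<langle>\<epsilon> A \<cdot> R, \<alpha>\<rangle> = 1" if \<alpha>: "\<alpha> \<in> P" for \<alpha>
    proof -
      have "tgt T \<alpha> = A" using basis_pure[OF P \<alpha>] normalised_tgt by blast
      then have "\<langle>\<epsilon> A \<cdot> R, \<alpha>\<rangle> = \<langle>\<epsilon> A, R \<cdot> \<alpha>\<rangle>" using Rh by (simp add: pairing_seq hom_def)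
      then show ?thesis using R\<alpha>[OF \<alpha>] normalised_pairing[OF \<kappa>[OF \<alpha>]] by simp
    qed
    \<comment> \<open>\<open>R\<close> is known on the basis only, but the faithful state is a
      mixture of the basis, so normalisation there extends to all states.\<close>
    then have "\<langle>\<epsilon> A \<cdot> R, chi A\<rangle> = 1"
      using chi_uniform[OF P e] basis_nonempty[OF P] basis_finite[OF P] by simp
    then have "\<langle>a', chi A\<rangle> = 0" using a'(2)[OF chi_state] normalised_pairing[OF chi_normalised[of A]] by simp
    then have "\<langle>a', \<rho>\<rangle> = 0" if "\<rho> \<in> states T A" for \<rho> using chi_zero[OF a'(1) _ that] by blast
    then show "\<epsilon> A \<cdot> R = \<epsilon> A" using a'(2) by (intro effect_eqI[OF e discard_effect]) simp
  qed
  from pure_channel_reversible[OF this Rp] R\<alpha> that show thesis by blast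
qed

text \<open>The product basis is permuted by exchanging the registers through \<beta>: the pair
  \<phi>, \<psi> goes to the preimage of \<psi> and the image of \<phi>. With the second input fixed
  at \<open>\<beta> \<alpha>0\<close>, the first output is constantly \<alpha>0 and the second is
  \<open>\<beta> \<alpha>\<close>; a swap puts the constant register last.\<close>

lemma strong_symmetry_if_permutability:
  assumes perm: "permutability T"
  shows "strong_symmetry T"
  unfolding strong_symmetry_def
proof (intro allI impI, elim conjE)
  fix A P Q \<beta> assume "pure_maximal_set T A P" "pure_maximal_set T A Q" and \<beta>: "bij_betw \<beta> P Q"
  then have P: "basis A P" and Q: "basis A Q" by (simp_all add: pure_maximal_set_iff)
  let ?f = "\<lambda>(\<phi>, \<psi>). \<phi> \<otimes> \<psi>"
  let ?R = "?f ` (P \<times> Q)"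
  define g where "g = (\<lambda>(\<phi>, \<psi>). (inv_into P \<beta> \<psi>, \<beta> \<phi>))"
  have \<beta>Q: "\<beta> \<phi> \<in> Q" if "\<phi> \<in> P" for \<phi> using bij_betwE[OF \<beta>] that by blast
  have inv1: "inv_into P \<beta> (\<beta> \<phi>) = \<phi>" if "\<phi> \<in> P" for \<phi> by (rule bij_betw_inv_into_left[OF \<beta> that])
  have inv2: "\<beta> (inv_into P \<beta> \<psi>) = \<psi>" if "\<psi> \<in> Q" for \<psi> by (rule bij_betw_inv_into_right[OF \<beta> that])
  have inv3: "inv_into P \<beta> \<psi> \<in> P" if "\<psi> \<in> Q" for \<psi> using bij_betwE[OF bij_betw_inv_into[OF \<beta>]] that by blast
  \<comment> \<open>The exchange is an involution and hence its own inverse.\<close>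
  have g: "bij_betw g (P \<times> Q) (P \<times> Q)"
    by (rule bij_betw_byWitness[of _ g]) (auto simp: g_def inv1 inv2 inv3 \<beta>Q)
  have f: "bij_betw ?f (P \<times> Q) ?R" using tensor_inj_on[OF P Q] by (simp add: bij_betw_def)
  define \<pi> where "\<pi> = (\<lambda>x. ?f (g (inv_into (P \<times> Q) ?f x)))"
  have \<pi>: "bij_betw \<pi> ?R ?R"
    using bij_betw_trans[OF bij_betw_inv_into[OF f] bij_betw_trans[OF g f]] by (simp add: \<pi>_def o_def)
  have \<pi>_eq: "\<pi> (\<phi> \<otimes> \<psi>) = inv_into P \<beta> \<psi> \<otimes> \<beta> \<phi>" if "\<phi> \<in> P" "\<psi> \<in> Q" for \<phi> \<psi>
    using bij_betw_inv_into_left[OF f, of "(\<phi>, \<psi>)"] that by (simp add: \<pi>_def g_def)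
  have "pure_maximal_set T (A \<boxtimes> A) ?R" using basis_par[OF P Q] by (simp add: pure_maximal_set_iff)
  with perm \<pi> obtain V where V: "reversible T (A \<boxtimes> A) (A \<boxtimes> A) V" "\<forall>x\<in>?R. V \<cdot> x = \<pi> x"
    unfolding permutability_def by blast
  obtain \<alpha>0 where \<alpha>0: "\<alpha>0 \<in> P" using basis_nonempty[OF P] by blast
  let ?V = "swp T A A \<cdot> V"
  have V': "reversible T (A \<boxtimes> A) (A \<boxtimes> A) ?V" by (rule reversible_seq[OF V(1) reversible_swp])
  have n\<beta>: "\<And>\<alpha>. \<alpha> \<in> P \<Longrightarrow> normalised T A (\<beta> \<alpha>)" using basis_pure[OF Q \<beta>Q] by simp
  have eq: "?V \<cdot> (\<alpha> \<otimes> \<beta> \<alpha>0) = \<beta> \<alpha> \<otimes> \<alpha>0" if \<alpha>: "\<alpha> \<in> P" for \<alpha>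
  proof -
    have n: "normalised T A \<alpha>" "normalised T A \<alpha>0" using basis_pure[OF P] \<alpha> \<alpha>0 by auto
    note ty [simp] = normalised_src[OF n(1)] normalised_tgt[OF n(1)] normalised_src[OF n(2)] normalised_tgt[OF n(2)]
      normalised_src[OF n\<beta>[OF \<alpha>]] normalised_tgt[OF n\<beta>[OF \<alpha>]] normalised_src[OF n\<beta>[OF \<alpha>0]] normalised_tgt[OF n\<beta>[OF \<alpha>0]]
      reversible_src[OF V(1)] reversible_tgt[OF V(1)]
    have "?V \<cdot> (\<alpha> \<otimes> \<beta> \<alpha>0) = swp T A A \<cdot> (V \<cdot> (\<alpha> \<otimes> \<beta> \<alpha>0))" by (rule assoc) simp_all
    also have "V \<cdot> (\<alpha> \<otimes> \<beta> \<alpha>0) = \<pi> (\<alpha> \<otimes> \<beta> \<alpha>0)"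
      using V(2) \<alpha> \<beta>Q[OF \<alpha>0] by blast
    also have "\<dots> = \<alpha>0 \<otimes> \<beta> \<alpha>" using \<pi>_eq[OF \<alpha> \<beta>Q[OF \<alpha>0]] inv1[OF \<alpha>0] by simp
    also have "swp T A A \<cdot> (\<alpha>0 \<otimes> \<beta> \<alpha>) = \<beta> \<alpha> \<otimes> \<alpha>0"
      using swp_nat[of \<alpha>0 \<one> A "\<beta> \<alpha>" \<one> A] by simp
    finally show ?thesis .
  qed
  obtain R where "reversible T A A R" "\<And>\<alpha>. \<alpha> \<in> P \<Longrightarrow> R \<cdot> \<alpha> = \<beta> \<alpha>"
    using reduce_to_factor[OF P V' basis_pure[OF Q \<beta>Q[OF \<alpha>0]] basis_pure[OF P \<alpha>0] n\<beta> eq] by blast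
  then show "\<exists>U. reversible T A A U \<and> (\<forall>\<phi>\<in>P. U \<cdot> \<phi> = \<beta> \<phi>)" by blast
qed

text \<open>Compute and uncompute. Controlled by \<alpha>, the second register moves from
  \<open>\<beta> \<alpha>0\<close> to \<open>\<beta> \<alpha>\<close>; after a swap,
  \<open>\<beta> \<alpha>\<close> controls the return of \<alpha> to \<alpha>0. The register left
  constant is removed by \<open>reduce_to_factor\<close>.\<close>

lemma strong_symmetry_if_controllability:
  assumes rc: "reversible_controllability T"
  shows "strong_symmetry T"
  unfolding strong_symmetry_def
proof (intro allI impI, elim conjE)
  fix A P Q \<beta> assume PQ: "pure_maximal_set T A P" "pure_maximal_set T A Q" and \<beta>: "bij_betw \<beta> P Q"
  then have P: "basis A P" and Q: "basis A Q" by (simp_all add: pure_maximal_set_iff)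
  have \<beta>Q: "\<beta> \<phi> \<in> Q" if "\<phi> \<in> P" for \<phi> using bij_betwE[OF \<beta>] that by blast
  have inv1: "inv_into P \<beta> (\<beta> \<phi>) = \<phi>" if "\<phi> \<in> P" for \<phi> by (rule bij_betw_inv_into_left[OF \<beta> that])
  have inv3: "inv_into P \<beta> \<psi> \<in> P" if "\<psi> \<in> Q" for \<psi> using bij_betwE[OF bij_betw_inv_into[OF \<beta>]] that by blast
  obtain \<alpha>0 where \<alpha>0: "\<alpha>0 \<in> P" using basis_nonempty[OF P] by blast
  note p\<alpha>0 = basis_pure[OF P \<alpha>0] and p\<beta>0 = basis_pure[OF Q \<beta>Q[OF \<alpha>0]]
  have "\<exists>U. \<alpha> \<in> P \<longrightarrow> reversible T A A U \<and> \<beta> \<alpha> = U \<cdot> \<beta> \<alpha>0" for \<alpha>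
    using transitive[OF p\<beta>0 basis_pure[OF Q \<beta>Q]] by metis
  then obtain U where U: "\<And>\<alpha>. \<alpha> \<in> P \<Longrightarrow> reversible T A A (U \<alpha>)" "\<And>\<alpha>. \<alpha> \<in> P \<Longrightarrow> \<beta> \<alpha> = U \<alpha> \<cdot> \<beta> \<alpha>0"
    by metis
  have "\<exists>W. \<psi> \<in> Q \<longrightarrow> reversible T A A W \<and> \<alpha>0 = W \<cdot> inv_into P \<beta> \<psi>" for \<psi>
    using transitive[OF basis_pure[OF P inv3] p\<alpha>0] by metis
  then obtain W where W: "\<And>\<psi>. \<psi> \<in> Q \<Longrightarrow> reversible T A A (W \<psi>)" "\<And>\<psi>. \<psi> \<in> Q \<Longrightarrow> \<alpha>0 = W \<psi> \<cdot> inv_into P \<beta> \<psi>"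
    by metis
  obtain V1 where V1: "reversible T (A \<boxtimes> A) (A \<boxtimes> A) V1" "\<forall>\<alpha>\<in>P. V1 \<cdot> (\<alpha> \<otimes> \<iota> A) = \<alpha> \<otimes> U \<alpha>"
    using rc PQ(1) U(1) unfolding reversible_controllability_def by blast
  obtain V2 where V2: "reversible T (A \<boxtimes> A) (A \<boxtimes> A) V2" "\<forall>\<psi>\<in>Q. V2 \<cdot> (\<psi> \<otimes> \<iota> A) = \<psi> \<otimes> W \<psi>"
    using rc PQ(2) W(1) unfolding reversible_controllability_def by blast
  let ?V = "V2 \<cdot> (swp T A A \<cdot> V1)"
  have V': "reversible T (A \<boxtimes> A) (A \<boxtimes> A) ?V"
    by (rule reversible_seq[OF reversible_seq[OF V1(1) reversible_swp] V2(1)])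
  have n\<beta>: "\<And>\<alpha>. \<alpha> \<in> P \<Longrightarrow> normalised T A (\<beta> \<alpha>)" using basis_pure[OF Q \<beta>Q] by simp
  have controlled: "V \<cdot> (\<phi> \<otimes> \<psi>) = \<phi> \<otimes> (G \<cdot> \<psi>)"
    if "V \<cdot> (\<phi> \<otimes> \<iota> A) = \<phi> \<otimes> G" "normalised T A \<phi>" "normalised T A \<psi>" "src T V = A \<boxtimes> A" "src T G = A" "tgt T V = A \<boxtimes> A" for V \<phi> \<psi> G
  proof -
    note [simp] = that(4,5,6) normalised_src[OF that(2)] normalised_tgt[OF that(2)] normalised_src[OF that(3)] normalised_tgt[OF that(3)]
    have "\<phi> \<otimes> \<psi> = (\<phi> \<otimes> \<iota> A) \<cdot> \<psi>" using par_state_left[of \<psi> \<one> \<phi>] by simp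
    then have "V \<cdot> (\<phi> \<otimes> \<psi>) = (V \<cdot> (\<phi> \<otimes> \<iota> A)) \<cdot> \<psi>" by (simp add: assoc)
    also have "\<dots> = (\<phi> \<otimes> G) \<cdot> (\<iota> \<one> \<otimes> \<psi>)" using that(1) by simp
    also have "\<dots> = (\<phi> \<cdot> \<iota> \<one>) \<otimes> (G \<cdot> \<psi>)" by (rule par_seq) simp_all
    finally show ?thesis by simp
  qed
  have eq: "?V \<cdot> (\<alpha> \<otimes> \<beta> \<alpha>0) = \<beta> \<alpha> \<otimes> \<alpha>0" if \<alpha>: "\<alpha> \<in> P" for \<alpha>
  proof -
    have n: "normalised T A \<alpha>" "normalised T A \<alpha>0" using basis_pure[OF P] \<alpha> \<alpha>0 by auto
    note ty [simp] = normalised_src[OF n(1)] normalised_tgt[OF n(1)] normalised_src[OF n(2)] normalised_tgt[OF n(2)]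
      normalised_src[OF n\<beta>[OF \<alpha>]] normalised_tgt[OF n\<beta>[OF \<alpha>]] normalised_src[OF n\<beta>[OF \<alpha>0]] normalised_tgt[OF n\<beta>[OF \<alpha>0]]
      reversible_src[OF V1(1)] reversible_tgt[OF V1(1)] reversible_src[OF V2(1)] reversible_tgt[OF V2(1)]
    have "?V \<cdot> (\<alpha> \<otimes> \<beta> \<alpha>0) = V2 \<cdot> (swp T A A \<cdot> (V1 \<cdot> (\<alpha> \<otimes> \<beta> \<alpha>0)))" by (simp add: assoc)
    also have "V1 \<cdot> (\<alpha> \<otimes> \<beta> \<alpha>0) = \<alpha> \<otimes> (U \<alpha> \<cdot> \<beta> \<alpha>0)"
      by (rule controlled) (use V1(2) \<alpha> n n\<beta>[OF \<alpha>0] reversible_src[OF U(1)[OF \<alpha>]] in auto)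
    also have "U \<alpha> \<cdot> \<beta> \<alpha>0 = \<beta> \<alpha>" by (rule U(2)[OF \<alpha>, symmetric])
    also have "swp T A A \<cdot> (\<alpha> \<otimes> \<beta> \<alpha>) = \<beta> \<alpha> \<otimes> \<alpha>"
      using swp_nat[of \<alpha> \<one> A "\<beta> \<alpha>" \<one> A] by simp
    also have "V2 \<cdot> (\<beta> \<alpha> \<otimes> \<alpha>) = \<beta> \<alpha> \<otimes> (W (\<beta> \<alpha>) \<cdot> \<alpha>)"
      by (rule controlled) (use V2(2) \<beta>Q[OF \<alpha>] n n\<beta>[OF \<alpha>] reversible_src[OF W(1)[OF \<beta>Q[OF \<alpha>]]] in auto)
    also have "W (\<beta> \<alpha>) \<cdot> \<alpha> = \<alpha>0" using W(2)[OF \<beta>Q[OF \<alpha>]] inv1[OF \<alpha>] by simp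
    finally show ?thesis .
  qed
  obtain R where "reversible T A A R" "\<And>\<alpha>. \<alpha> \<in> P \<Longrightarrow> R \<cdot> \<alpha> = \<beta> \<alpha>"
    using reduce_to_factor[OF P V' p\<beta>0 p\<alpha>0 n\<beta> eq] by blast
  then show "\<exists>U. reversible T A A U \<and> (\<forall>\<phi>\<in>P. U \<cdot> \<phi> = \<beta> \<phi>)" by blast
qed

lemma strong_symmetry_if_unrestricted: "unrestricted_reversibility T \<Longrightarrow> strong_symmetry T"
  unfolding unrestricted_reversibility_def
  using strong_symmetry_if_permutability strong_symmetry_if_controllability by blast

end

section \<open>Majorisation\<close>

text \<open>The first \<open>k\<close> rows together put weights from [0, 1] with total
  \<open>k\<close> on the entries of \<open>p\<close>; the largest value results from weight 1 on
  the \<open>k\<close> largest entries.\<close>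

lemma partial_sums_doubly_stochastic:
  fixes p :: "nat \<Rightarrow> real"
  assumes M: "\<And>i j. i < d \<Longrightarrow> j < d \<Longrightarrow> 0 \<le> M i j" and row: "\<And>i. i < d \<Longrightarrow> (\<Sum>j<d. M i j) = 1"
    and col: "\<And>j. j < d \<Longrightarrow> (\<Sum>i<d. M i j) = 1" and dec: "\<And>i j. i \<le> j \<Longrightarrow> j < d \<Longrightarrow> p j \<le> p i"
    and k: "k \<le> d"
  shows "(\<Sum>i<k. \<Sum>j<d. M i j * p j) \<le> (\<Sum>i<k. p i)"
proof (cases k)
  case 0
  then show ?thesis by simp
next
  case (Suc k')
  \<comment> \<open>The k-th largest entry serves as threshold: in each product
    \<open>(s j - c j) * (p j - t)\<close> the factors never have opposite signs, and
    \<open>t\<close> drops out of the sum because \<open>s\<close> and \<open>c\<close> have the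
    same total.\<close>
  define t where "t = p k'"
  define c where "c j = (\<Sum>i<k. M i j)" for j
  define s where "s j = (if j < k then 1 else 0 :: real)" for j
  have c0: "0 \<le> c j" if "j < d" for j
    unfolding c_def by (rule sum_nonneg) (use M that k in auto)
  have c1: "c j \<le> 1" if "j < d" for j
  proof -
    have "c j \<le> (\<Sum>i<d. M i j)" unfolding c_def by (rule sum_mono2) (use M that k in auto)
    then show ?thesis using col[OF that] by simp
  qed
  have sub: "{j \<in> {..<d}. j < k} = {..<k}" using k by auto
  have s_sum: "(\<Sum>j<d. s j * f j) = (\<Sum>j<k. f j)" for f
  proof -
    have "(\<Sum>j<d. s j * f j) = (\<Sum>j<d. if j < k then f j else 0)" by (rule sum.cong) (auto simp: s_def)
    also have "\<dots> = (\<Sum>j\<in>{j \<in> {..<d}. j < k}. f j)" by (rule sum.inter_filter[symmetric]) simp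
    finally show ?thesis by (simp only: sub)
  qed
  have csum: "(\<Sum>j<d. c j) = k"
  proof -
    have "(\<Sum>j<d. c j) = (\<Sum>i<k. \<Sum>j<d. M i j)" unfolding c_def by (rule sum.swap)
    also have "\<dots> = (\<Sum>i<k. 1)" by (rule sum.cong) (use row k in auto)
    finally show ?thesis by simp
  qed
  have "(\<Sum>i<k. \<Sum>j<d. M i j * p j) = (\<Sum>j<d. c j * p j)"
    unfolding c_def sum_distrib_right by (rule sum.swap)
  moreover have "0 \<le> (\<Sum>j<d. (s j - c j) * (p j - t))"
  proof (rule sum_nonneg)
    fix j assume "j \<in> {..<d}"
    then have j: "j < d" by simp
    show "0 \<le> (s j - c j) * (p j - t)"
    proof (cases "j < k")
      case True
      then have "t \<le> p j" unfolding t_def using dec[of j k'] Suc k by simp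
      then show ?thesis using True c1[OF j] by (simp add: s_def)
    next
      case False
      then have "p j \<le> t" unfolding t_def using dec[of k' j] Suc j by simp
      then have "0 \<le> (- c j) * (p j - t)" using c0[OF j] by (simp add: mult_nonneg_nonpos)
      then show ?thesis using False by (simp add: s_def)
    qed
  qed
  moreover have "(\<Sum>j<d. (s j - c j) * (p j - t)) = (\<Sum>j<d. s j * p j) - (\<Sum>j<d. c j * p j) - t * ((\<Sum>j<d. s j * 1) - (\<Sum>j<d. c j))"
    by (simp add: algebra_simps sum_subtractf sum.distrib sum_distrib_left)
  ultimately show ?thesis unfolding s_sum csum by simp
qed

text \<open>Hardy, Littlewood and Polya: each step moves weight between two entries so that one more entry agrees.\<close>

lemma majorisation_permutations:
  fixes p q :: "nat \<Rightarrow> real"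
  assumes maj: "\<And>k. k \<le> d \<Longrightarrow> (\<Sum>i<k. q i) \<le> (\<Sum>i<k. p i)" and tot: "(\<Sum>i<d. q i) = (\<Sum>i<d. p i)"
    and dec: "\<And>i j. i \<le> j \<Longrightarrow> j < d \<Longrightarrow> q j \<le> q i"
  shows "\<exists>L. (\<forall>x\<in>set L. 0 \<le> fst x \<and> snd x permutes {..<d}) \<and> sum_list (map fst L) = 1 \<and>
    (\<forall>i<d. q i = sum_list (map (\<lambda>x. fst x * p (snd x i)) L))"
  using maj tot
\<comment> \<open>The vector \<open>p\<close> varies and need not be ordered, since transfers can
  destroy its order; the order of \<open>q\<close> bounds the transfers.\<close>
proof (induction "card {i \<in> {..<d}. p i \<noteq> q i}" arbitrary: p rule: less_induct)
  case less
  note maj = less.prems(1) and tot = less.prems(2)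
  show ?case
  proof (cases "\<forall>i<d. p i = q i")
    case True
    then show ?thesis by (intro exI[of _ "[(1, id)]"]) (auto simp: permutes_id)
  next
    case False
    have "\<exists>k<d. p k < q k"
    proof (rule ccontr)
      assume "\<not> (\<exists>k<d. p k < q k)"
      then have ge: "q i \<le> p i" if "i < d" for i using that by (meson not_le)
      have "(\<Sum>i<d. p i - q i) = 0" using tot by (simp add: sum_subtractf)
      then have "\<forall>i\<in>{..<d}. p i - q i = 0" using ge by (subst (asm) sum_nonneg_eq_0_iff) auto
      with False show False by auto
    qed
    \<comment> \<open>The first deficit. Majorisation up to and including \<open>k\<close> forces a
      surplus at some earlier \<open>j\<close>.\<close>
    then obtain k where k: "k < d" "p k < q k" and kmin: "\<And>i. i < k \<Longrightarrow> \<not> (i < d \<and> p i < q i)"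
      using exists_least_iff[of "\<lambda>k. k < d \<and> p k < q k"] by blast
    have below: "q i \<le> p i" if "i < k" for i using kmin[OF that] k(1) that by simp
    have "\<exists>j<k. q j < p j"
    proof (rule ccontr)
      assume "\<not> (\<exists>j<k. q j < p j)"
      then have "p i \<le> q i" if "i < k" for i using that by (meson not_less)
      then have "p i = q i" if "i < k" for i using below[OF that] that by (intro antisym) auto
      then have "(\<Sum>i<k. p i) = (\<Sum>i<k. q i)" by simp
      then have "(\<Sum>i<Suc k. p i) < (\<Sum>i<Suc k. q i)" using k(2) by simp
      with maj[of "Suc k"] k(1) show False by simp
    qed
    then obtain j where j: "j < k" "q j < p j" by blast
    \<comment> \<open>The largest transfer from \<open>j\<close> to \<open>k\<close> that overshoots
      neither target, so at least one of the two entries reaches its target.\<close>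
    define e where "e = min (p j - q j) (q k - p k)"
    have e: "0 < e" "e \<le> p j - q j" "e \<le> q k - p k" using j(2) k(2) by (auto simp: e_def)
    define p' where "p' = p(j := p j - e, k := p k + e)"
    have jk: "j \<noteq> k" "j < d" using j(1) k(1) by auto
    have p'_sum: "(\<Sum>i<n. p' i) = (\<Sum>i<n. p i) - (if j < n \<and> n \<le> k then e else 0)" for n
    proof -
      have "p' i = p i - (if i = j then e else 0) + (if i = k then e else 0)" for i
        using jk(1) by (simp add: p'_def)
      then have "(\<Sum>i<n. p' i) = (\<Sum>i<n. p i) - (\<Sum>i<n. if i = j then e else 0) + (\<Sum>i<n. if i = k then e else 0)"
        by (simp add: sum.distrib sum_subtractf)
      also have "(\<Sum>i<n. if i = j then e else 0) = (if j < n then e else 0)" by simp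
      also have "(\<Sum>i<n. if i = k then e else 0) = (if k < n then e else 0)" by simp
      finally show ?thesis using j(1) by auto
    qed
    \<comment> \<open>Only partial sums that contain \<open>j\<close> but not \<open>k\<close> drop.
      All entries before \<open>k\<close> are at least their targets, so the surplus at
      \<open>j\<close> covers the loss.\<close>
    have maj': "(\<Sum>i<n. q i) \<le> (\<Sum>i<n. p' i)" if n: "n \<le> d" for n
    proof (cases "j < n \<and> n \<le> k")
      case True
      have "p j - q j \<le> (\<Sum>i<n. p i - q i)"
        by (rule member_le_sum[of j "{..<n}" "\<lambda>i. p i - q i"]) (use True below in auto)
      then have "e \<le> (\<Sum>i<n. p i) - (\<Sum>i<n. q i)" using e(2) by (simp add: sum_subtractf)
      then show ?thesis unfolding p'_sum using True by simp
    next
      case False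
      then show ?thesis unfolding p'_sum using maj[OF n] by auto
    qed
    have tot': "(\<Sum>i<d. q i) = (\<Sum>i<d. p' i)" unfolding p'_sum using tot k(1) by simp
    have "{i \<in> {..<d}. p' i \<noteq> q i} \<subset> {i \<in> {..<d}. p i \<noteq> q i}"
    proof -
      have "{i \<in> {..<d}. p' i \<noteq> q i} \<subseteq> {i \<in> {..<d}. p i \<noteq> q i}"
        using j(2) k(2) by (auto simp: p'_def split: if_splits)
      moreover have "p' j = q j \<or> p' k = q k" using jk(1) by (auto simp: p'_def e_def min_def)
      moreover have "j \<in> {i \<in> {..<d}. p i \<noteq> q i}" "k \<in> {i \<in> {..<d}. p i \<noteq> q i}"
        using j(2) k jk(2) by auto
      ultimately show ?thesis by (elim disjE) (auto intro!: psubsetI)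
    qed
    then have "card {i \<in> {..<d}. p' i \<noteq> q i} < card {i \<in> {..<d}. p i \<noteq> q i}"
      by (intro psubset_card_mono) auto
    from less.hyps[OF this maj' tot'] obtain L where
      L: "\<And>x. x \<in> set L \<Longrightarrow> 0 \<le> fst x \<and> snd x permutes {..<d}" "sum_list (map fst L) = 1"
      "\<And>i. i < d \<Longrightarrow> q i = sum_list (map (\<lambda>x. fst x * p' (snd x i)) L)" by blast
    \<comment> \<open>The transfer is a mixture of the identity and a transposition. As
      \<open>q k \<le> q j\<close>, the amount \<open>e\<close> is at most \<open>p j - p k\<close>,
      which puts \<open>t\<close> into [0, 1].\<close>
    define t where "t = e / (p j - p k)"
    define \<tau> where "\<tau> = Transposition.transpose j k"
    have "q k \<le> q j" using dec[of j k] j(1) k(1) by simp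
    then have big: "e \<le> p j - p k" "0 < p j - p k" using e by linarith+
    have t: "0 \<le> t" "t \<le> 1" using big e(1) by (simp_all add: t_def)
    have te: "t * (p j - p k) = e" using big by (simp add: t_def)
    have p'_eq: "p' x = (1 - t) * p x + t * p (\<tau> x)" for x
    proof -
      have "(1 - t) * p j + t * p k = p j - t * (p j - p k)" "(1 - t) * p k + t * p j = p k + t * (p j - p k)"
        by (simp_all add: algebra_simps)
      then have "(1 - t) * p j + t * p k = p j - e" "(1 - t) * p k + t * p j = p k + e" unfolding te by auto
      moreover have "(1 - t) * p x + t * p x = p x" by (simp add: algebra_simps)
      ultimately show ?thesis using jk(1) by (auto simp: p'_def \<tau>_def Transposition.transpose_def)
    qed
    have \<tau>: "\<tau> permutes {..<d}" unfolding \<tau>_def by (rule permutes_swap_id) (use jk k in auto)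
    define L' where "L' = map (\<lambda>x. ((1 - t) * fst x, snd x)) L @ map (\<lambda>x. (t * fst x, \<tau> \<circ> snd x)) L"
    have "sum_list (map fst L') = (1 - t) * sum_list (map fst L) + t * sum_list (map fst L)"
      by (simp add: L'_def o_def sum_list_const_mult)
    then have "sum_list (map fst L') = 1" using L(2) by simp
    moreover have "0 \<le> fst x \<and> snd x permutes {..<d}" if "x \<in> set L'" for x
      using that L(1) t \<tau> permutes_compose[OF _ \<tau>] by (auto simp: L'_def)
    moreover have "q i = sum_list (map (\<lambda>x. fst x * p (snd x i)) L')" if i: "i < d" for i
    proof -
      have "sum_list (map (\<lambda>x. fst x * p (snd x i)) L') =
          sum_list (map (\<lambda>x. (1 - t) * fst x * p (snd x i)) L) + sum_list (map (\<lambda>x. t * fst x * p (\<tau> (snd x i))) L)"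
        by (simp add: L'_def o_def)
      also have "\<dots> = sum_list (map (\<lambda>x. (1 - t) * fst x * p (snd x i) + t * fst x * p (\<tau> (snd x i))) L)"
        by (rule sum_list_addf[symmetric])
      also have "\<dots> = sum_list (map (\<lambda>x. fst x * p' (snd x i)) L)"
        by (rule arg_cong[of _ _ sum_list], rule map_cong[OF refl]) (simp add: p'_eq algebra_simps)
      finally show ?thesis using L(3)[OF i] by simp
    qed
    ultimately show ?thesis by (intro exI[of _ L']) blast
  qed
qed

lemma decreasing_enumeration:
  fixes p :: "'a \<Rightarrow> real"
  assumes "finite P"
  obtains h where "bij_betw h {..<card P} P" "\<And>i j. i \<le> j \<Longrightarrow> j < card P \<Longrightarrow> p (h j) \<le> p (h i)"
proof -
  obtain xs where xs: "set xs = P" "distinct xs" using finite_distinct_list[OF assms] by blast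
  define ys where "ys = sort_key (\<lambda>x. - p x) xs"
  have ys: "set ys = P" "distinct ys" "sorted (map (\<lambda>x. - p x) ys)" using xs by (simp_all add: ys_def)
  have len: "length ys = card P" using distinct_card[OF ys(2)] ys(1) by simp
  have "bij_betw ((!) ys) {..<card P} P" by (rule bij_betw_nth) (use ys len in auto)
  moreover have "p (ys ! j) \<le> p (ys ! i)" if "i \<le> j" "j < card P" for i j
    using sorted_nth_mono[OF ys(3), of i j] that len by simp
  ultimately show thesis by (rule that)
qed

text \<open>All counts are rounded down except at index 0, which takes whatever is missing from
  \<open>N\<close>. Its frequency converges because the others do.\<close>

lemma count_approximation:
  fixes w :: "nat \<Rightarrow> real"
  assumes K: "0 < K" and w: "\<And>k. k < K \<Longrightarrow> 0 \<le> w k" and sum: "(\<Sum>k<K. w k) = 1"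
  obtains c :: "nat \<Rightarrow> nat \<Rightarrow> nat" where "\<And>N. (\<Sum>k<K. c N k) = N" "\<And>k. k < K \<Longrightarrow> (\<lambda>N. c N k / N) \<longlonglongrightarrow> w k"
proof -
  define f where "f N k = nat \<lfloor>w k * real N\<rfloor>" for N k
  have f_le: "real (f N k) \<le> w k * N" if "k < K" for N k
    using w[OF that] by (simp add: f_def of_nat_nat zero_le_mult_iff)
  have f_ge: "w k * N - 1 \<le> real (f N k)" if "k < K" for N k
  proof -
    have "w k * N - 1 \<le> real_of_int \<lfloor>w k * real N\<rfloor>" by linarith
    also have "\<dots> \<le> real (f N k)" unfolding f_def by simp
    finally show ?thesis .
  qed
  have split: "(\<Sum>k<K. g k) = g 0 + (\<Sum>k\<in>{1..<K}. g k)" for g :: "nat \<Rightarrow> 'b :: comm_monoid_add"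
  proof -
    have "{..<K} = insert 0 {1..<K}" using K by auto
    then show ?thesis by simp
  qed
  have total: "(\<Sum>k\<in>{1..<K}. f N k) \<le> N" for N
  proof -
    have "real (\<Sum>k\<in>{1..<K}. f N k) = (\<Sum>k\<in>{1..<K}. real (f N k))" by simp
    also have "\<dots> \<le> (\<Sum>k\<in>{1..<K}. w k * N)" by (rule sum_mono) (use f_le in auto)
    also have "\<dots> = (\<Sum>k\<in>{1..<K}. w k) * N" by (simp add: sum_distrib_right)
    also have "\<dots> \<le> 1 * real N" using split[of w] sum w[OF K] by (intro mult_right_mono) simp_all
    also have "\<dots> = real N" by simp
    finally show ?thesis by (simp only: of_nat_le_iff)
  qed
  have fl: "(\<lambda>N. real (f N k) / N) \<longlonglongrightarrow> w k" if k: "k < K" for k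
  proof (rule tendsto_sandwich)
    show "\<forall>\<^sub>F N in sequentially. w k - 1 / real N \<le> real (f N k) / N"
      using eventually_gt_at_top[of 0]
    proof eventually_elim
      case (elim N)
      have "(w k * real N - 1) / N \<le> real (f N k) / N" by (rule divide_right_mono[OF f_ge[OF k]]) simp
      then show ?case using elim by (simp add: diff_divide_distrib)
    qed
    show "\<forall>\<^sub>F N in sequentially. real (f N k) / N \<le> w k"
      using eventually_gt_at_top[of 0]
    proof eventually_elim
      case (elim N)
      have "real (f N k) / N \<le> w k * real N / N" by (rule divide_right_mono[OF f_le[OF k]]) simp
      then show ?case using elim by simp
    qed
    show "(\<lambda>N. w k - 1 / real N) \<longlonglongrightarrow> w k"
      using tendsto_diff[OF tendsto_const[of "w k"] lim_1_over_n] by simp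
  qed simp
  define c where "c N k = (if k = 0 then N - (\<Sum>k\<in>{1..<K}. f N k) else f N k)" for N k
  have "(\<Sum>k<K. c N k) = N" for N
  proof -
    have "(\<Sum>k\<in>{1..<K}. c N k) = (\<Sum>k\<in>{1..<K}. f N k)" by (rule sum.cong) (auto simp: c_def)
    then show ?thesis using split[of "c N"] total[of N] by (simp add: c_def)
  qed
  moreover have "(\<lambda>N. c N k / N) \<longlonglongrightarrow> w k" if k: "k < K" for k
  proof (cases "k = 0")
    case False
    then show ?thesis using fl[OF k] by (simp add: c_def)
  next
    case True
    have "(\<lambda>N. 1 - (\<Sum>k\<in>{1..<K}. real (f N k) / N)) \<longlonglongrightarrow> 1 - (\<Sum>k\<in>{1..<K}. w k)"
      by (intro tendsto_intros fl) auto
    also have "1 - (\<Sum>k\<in>{1..<K}. w k) = w 0" using split[of w] sum by simp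
    finally have lim: "(\<lambda>N. 1 - (\<Sum>k\<in>{1..<K}. real (f N k) / N)) \<longlonglongrightarrow> w 0" .
    have "\<forall>\<^sub>F N in sequentially. 1 - (\<Sum>k\<in>{1..<K}. real (f N k) / N) = c N k / N"
      using eventually_gt_at_top[of 0]
    proof eventually_elim
      case (elim N)
      have "real (c N k) = real N - (\<Sum>k\<in>{1..<K}. real (f N k))"
        using total[of N] True by (simp add: c_def of_nat_diff)
      then show ?case using elim by (simp add: sum_divide_distrib[symmetric] diff_divide_distrib)
    qed
    from Lim_transform_eventually[OF lim this] show ?thesis using True by simp
  qed
  ultimately show thesis by (rule that)
qed

section \<open>Equivalence of the three resource theories\<close>

context sharp_theory_with_purification
begin

lemma diagonalisation_sorted:
  assumes "normalised T A \<rho>"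
  shows "\<exists>P h p. basis A P \<and> bij_betw h {..<card P} P \<and> (\<forall>i j. i \<le> j \<longrightarrow> j < card P \<longrightarrow> p j \<le> p i) \<and>
    (\<forall>a\<in>effects T A. \<langle>a, \<rho>\<rangle> = (\<Sum>i<card P. p i * \<langle>a, h i\<rangle>))"
proof -
  obtain P p where Pp: "basis A P \<and> (\<forall>a\<in>effects T A. \<langle>a, \<rho>\<rangle> = (\<Sum>\<phi>\<in>P. p \<phi> * \<langle>a, \<phi>\<rangle>))"
    using diagonalisation[OF assms] by (elim exE) (rule that)
  then have P: "basis A P" and eq: "\<And>a. a \<in> effects T A \<Longrightarrow> \<langle>a, \<rho>\<rangle> = (\<Sum>\<phi>\<in>P. p \<phi> * \<langle>a, \<phi>\<rangle>)"
    by blast+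
  obtain h where h: "bij_betw h {..<card P} P" "\<And>i j. i \<le> j \<Longrightarrow> j < card P \<Longrightarrow> p (h j) \<le> p (h i)"
    using decreasing_enumeration[OF basis_finite[OF P]] by blast
  have "\<langle>a, \<rho>\<rangle> = (\<Sum>i<card P. p (h i) * \<langle>a, h i\<rangle>)" if "a \<in> effects T A" for a
    unfolding eq[OF that] by (rule sum.reindex_bij_betw[OF h(1), symmetric])
  with P h show ?thesis
    by (intro exI[of _ P] exI[of _ h] exI[of _ "\<lambda>i. p (h i)"] conjI allI impI ballI) auto
qed

text \<open>The combination of permutations reproduces the action of \<open>D\<close> on this
  particular \<rho> only, which is all that convertibility asks for.\<close>

lemma unital_spectra:
  assumes \<rho>: "normalised T A \<rho>" and \<sigma>: "normalised T A \<sigma>" and D: "D \<in> unital_channels T A A" and eq: "\<sigma> = D \<cdot> \<rho>"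
  shows "\<exists>P Q h g p L. basis A P \<and> basis A Q \<and> bij_betw h {..<card P} P \<and> bij_betw g {..<card P} Q \<and>
    (\<forall>a\<in>effects T A. \<langle>a, \<rho>\<rangle> = (\<Sum>i<card P. p i * \<langle>a, h i\<rangle>)) \<and>
    (\<forall>x\<in>set L. 0 \<le> fst x \<and> snd x permutes {..<card P}) \<and> sum_list (map fst L) = 1 \<and>
    (\<forall>a\<in>effects T A. \<langle>a, \<sigma>\<rangle> = (\<Sum>i<card P. sum_list (map (\<lambda>x. fst x * p (snd x i)) L) * \<langle>a, g i\<rangle>))"
proof -
  have Dc: "channel T A A D" and D\<chi>: "D \<cdot> chi A = chi A"
    using D by (simp_all add: unital_channels_def microcanonical_eq)
  obtain P h p where Php: "basis A P \<and> bij_betw h {..<card P} P \<and> (\<forall>i j. i \<le> j \<longrightarrow> j < card P \<longrightarrow> p j \<le> p i) \<and>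
    (\<forall>a\<in>effects T A. \<langle>a, \<rho>\<rangle> = (\<Sum>i<card P. p i * \<langle>a, h i\<rangle>))"
    using diagonalisation_sorted[OF \<rho>] by (elim exE) (rule that)
  obtain Q g q where Qgq: "basis A Q \<and> bij_betw g {..<card Q} Q \<and> (\<forall>i j. i \<le> j \<longrightarrow> j < card Q \<longrightarrow> q j \<le> q i) \<and>
    (\<forall>a\<in>effects T A. \<langle>a, \<sigma>\<rangle> = (\<Sum>i<card Q. q i * \<langle>a, g i\<rangle>))"
    using diagonalisation_sorted[OF \<sigma>] by (elim exE) (rule that)
  define d where "d = card P"
  have P: "basis A P" "d = card P" and h: "bij_betw h {..<d} P" and pdec: "\<And>i j. i \<le> j \<Longrightarrow> j < d \<Longrightarrow> p j \<le> p i"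
    and \<rho>eq: "\<And>a. a \<in> effects T A \<Longrightarrow> \<langle>a, \<rho>\<rangle> = (\<Sum>i<d. p i * \<langle>a, h i\<rangle>)"
    using Php unfolding d_def by blast+
  have Q: "basis A Q" using Qgq by blast
  have dd: "card Q = d" unfolding d_def by (rule basis_card_unique[OF Q P(1)])
  have g: "bij_betw g {..<d} Q" and qdec: "\<And>i j. i \<le> j \<Longrightarrow> j < d \<Longrightarrow> q j \<le> q i"
    and \<sigma>eq: "\<And>a. a \<in> effects T A \<Longrightarrow> \<langle>a, \<sigma>\<rangle> = (\<Sum>i<d. q i * \<langle>a, g i\<rangle>)"
    using Qgq unfolding dd by blast+
  have d: "0 < d" using basis_nonempty[OF P(1)] basis_finite[OF P(1)] P(2) by (simp add: card_gt_0_iff)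
  have hn: "normalised T A (h i)" if "i < d" for i using basis_pure[OF P(1)] bij_betwE[OF h] that by simp
  have gQ: "g i \<in> Q" if "i < d" for i using bij_betwE[OF g] that by simp
  have gp: "pure_normalised A (g i)" if "i < d" for i using basis_pure[OF Q gQ[OF that]] .
  have gn: "normalised T A (g i)" if "i < d" for i using gp[OF that] by simp
  have ginj: "g i = g j \<longleftrightarrow> i = j" if "i < d" "j < d" for i j
    using g that by (auto simp: bij_betw_def inj_on_def)
  define M where "M i j = \<langle>dag A (g i), D \<cdot> h j\<rangle>" for i j
  have Dh: "normalised T A (D \<cdot> h j)" if "j < d" for j by (rule channel_normalised[OF Dc hn[OF that]])
  have Mnn: "0 \<le> M i j" if "i < d" "j < d" for i j
    unfolding M_def by (rule pairing_nonneg[OF dag_effect[OF gp[OF that(1)]] normalised_state[OF Dh[OF that(2)]]])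
  have MD: "M i j = \<langle>dag A (g i) \<cdot> D, h j\<rangle>" if "i < d" "j < d" for i j
    unfolding M_def by (rule pairing_channel[OF dag_effect[OF gp[OF that(1)]] Dc normalised_state[OF hn[OF that(2)]]])
  \<comment> \<open>Unitality enters here: the eigenbasis of \<rho> averages to
    \<open>chi A\<close>, which \<open>D\<close> fixes and on which every dagger has probability
    \<open>weight A\<close>. The columns sum to 1 because \<open>D\<close> preserves
    normalisation.\<close>
  have row: "(\<Sum>j<d. M i j) = 1" if i: "i < d" for i
  proof -
    note e = effect_channel[OF dag_effect[OF gp[OF i]] Dc]
    have "(\<Sum>j<d. M i j) = (\<Sum>j<d. \<langle>dag A (g i) \<cdot> D, h j\<rangle>)" by (rule sum.cong) (use MD i in auto)
    also have "\<dots> = (\<Sum>\<phi>\<in>P. \<langle>dag A (g i) \<cdot> D, \<phi>\<rangle>)" by (rule sum.reindex_bij_betw[OF h])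
    also have "\<dots> = d * \<langle>dag A (g i) \<cdot> D, chi A\<rangle>" using chi_uniform[OF P(1) e] d P(2) by simp
    also have "\<langle>dag A (g i) \<cdot> D, chi A\<rangle> = weight A"
      using pairing_channel[OF dag_effect[OF gp[OF i]] Dc chi_state] D\<chi> weight_chi[OF dag_sharp[OF gp[OF i]]] by simp
    finally show ?thesis using basis_card[OF P(1)] P(2) by simp
  qed
  have col: "(\<Sum>i<d. M i j) = 1" if j: "j < d" for j
  proof -
    have "(\<Sum>i<d. M i j) = (\<Sum>\<psi>\<in>Q. \<langle>dag A \<psi>, D \<cdot> h j\<rangle>)"
      unfolding M_def by (rule sum.reindex_bij_betw[OF g])
    then show ?thesis using basis_sum[OF Q normalised_state[OF Dh[OF j]]] normalised_pairing[OF Dh[OF j]] by simp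
  qed
  have qM: "q i = (\<Sum>j<d. M i j * p j)" if i: "i < d" for i
  proof -
    note e = dag_effect[OF gp[OF i]]
    have "\<langle>dag A (g i), \<sigma>\<rangle> = (\<Sum>j<d. if j = i then q j else 0)"
      unfolding \<sigma>eq[OF e]
    proof (rule sum.cong[OF refl])
      fix j assume "j \<in> {..<d}"
      then show "q j * \<langle>dag A (g i), g j\<rangle> = (if j = i then q j else 0)"
        using basis_orthogonal[OF Q gQ[OF i] gQ[of j]] ginj[OF i, of j] by auto
    qed
    then have "q i = \<langle>dag A (g i), D \<cdot> \<rho>\<rangle>" using i eq by simp
    also have "\<dots> = \<langle>dag A (g i) \<cdot> D, \<rho>\<rangle>" by (rule pairing_channel[OF e Dc normalised_state[OF \<rho>]])
    also have "\<dots> = (\<Sum>j<d. p j * \<langle>dag A (g i) \<cdot> D, h j\<rangle>)" by (rule \<rho>eq[OF effect_channel[OF e Dc]])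
    also have "\<dots> = (\<Sum>j<d. M i j * p j)" by (rule sum.cong) (use MD i in auto)
    finally show ?thesis .
  qed
  have maj: "(\<Sum>i<k. q i) \<le> (\<Sum>i<k. p i)" if k: "k \<le> d" for k
  proof -
    have "(\<Sum>i<k. q i) = (\<Sum>i<k. \<Sum>j<d. M i j * p j)" by (rule sum.cong) (use qM k in auto)
    also have "\<dots> \<le> (\<Sum>i<k. p i)" by (rule partial_sums_doubly_stochastic[OF Mnn row col pdec k])
    finally show ?thesis .
  qed
  have "(\<Sum>i<d. q i) = 1" "(\<Sum>i<d. p i) = 1"
    using \<sigma>eq[OF discard_effect] \<rho>eq[OF discard_effect] normalised_pairing[OF \<rho>] normalised_pairing[OF \<sigma>]
      normalised_pairing[OF hn] normalised_pairing[OF gn] by simp_all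
  then have tot: "(\<Sum>i<d. q i) = (\<Sum>i<d. p i)" by simp
  from majorisation_permutations[OF maj tot qdec] obtain L where
    L: "\<forall>x\<in>set L. 0 \<le> fst x \<and> snd x permutes {..<d}" "sum_list (map fst L) = 1"
    and qL: "\<And>i. i < d \<Longrightarrow> q i = sum_list (map (\<lambda>x. fst x * p (snd x i)) L)" by blast
  have e1: "\<forall>a\<in>effects T A. \<langle>a, \<rho>\<rangle> = (\<Sum>i<d. p i * \<langle>a, h i\<rangle>)" using \<rho>eq by (intro ballI)
  have "\<langle>a, \<sigma>\<rangle> = (\<Sum>i<d. sum_list (map (\<lambda>x. fst x * p (snd x i)) L) * \<langle>a, g i\<rangle>)" if "a \<in> effects T A" for a
    unfolding \<sigma>eq[OF that] by (rule sum.cong) (use qL in auto)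
  then have "\<forall>a\<in>effects T A. \<langle>a, \<sigma>\<rangle> = (\<Sum>i<d. sum_list (map (\<lambda>x. fst x * p (snd x i)) L) * \<langle>a, g i\<rangle>)" by (intro ballI)
  then have "basis A P \<and> basis A Q \<and> bij_betw h {..<d} P \<and> bij_betw g {..<d} Q \<and>
    (\<forall>a\<in>effects T A. \<langle>a, \<rho>\<rangle> = (\<Sum>i<d. p i * \<langle>a, h i\<rangle>)) \<and>
    (\<forall>x\<in>set L. 0 \<le> fst x \<and> snd x permutes {..<d}) \<and> sum_list (map fst L) = 1 \<and>
    (\<forall>a\<in>effects T A. \<langle>a, \<sigma>\<rangle> = (\<Sum>i<d. sum_list (map (\<lambda>x. fst x * p (snd x i)) L) * \<langle>a, g i\<rangle>))"
    using P(1) Q h g L e1 by (intro conjI)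
  then show ?thesis unfolding d_def by (intro exI)
qed

lemma strong_symmetry_indexed:
  assumes ss: "strong_symmetry T" and P: "basis A P" and Q: "basis A Q"
    and f: "bij_betw f I P" and g: "bij_betw g I Q"
  obtains U where "reversible T A A U" "\<And>i. i \<in> I \<Longrightarrow> U \<cdot> f i = g i"
proof -
  have b: "bij_betw (\<lambda>\<phi>. g (inv_into I f \<phi>)) P Q"
    using bij_betw_trans[OF bij_betw_inv_into[OF f] g] by (simp add: o_def)
  then obtain U where U: "reversible T A A U" "\<forall>\<phi>\<in>P. U \<cdot> \<phi> = g (inv_into I f \<phi>)"
    using ss P Q unfolding strong_symmetry_def pure_maximal_set_iff by blast
  have "U \<cdot> f i = g i" if i: "i \<in> I" for i
    using U(2) bij_betwE[OF f] bij_betw_inv_into_left[OF f i] i by simp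
  with U(1) that show thesis by blast
qed

lemma permutes_bij_index: "\<pi> permutes {..<d} \<Longrightarrow> bij_betw h {..<d} P \<Longrightarrow> bij_betw (\<lambda>i. h (\<pi> i)) {..<d} P"
  using bij_betw_trans[OF permutes_imp_bij] by (auto simp: o_def)

lemma rare_if_unital:
  assumes ss: "strong_symmetry T" and \<rho>: "normalised T A \<rho>" and \<sigma>: "normalised T A \<sigma>"
    and conv: "convertible T (unital_channels T A A) \<rho> \<sigma>"
  shows "convertible T (rare_channels T A) \<rho> \<sigma>"
proof -
  obtain D where D: "D \<in> unital_channels T A A" "\<sigma> = D \<cdot> \<rho>" using conv by (auto simp: convertible_def)
  obtain P Q h g p L where spectra: "basis A P \<and> basis A Q \<and> bij_betw h {..<card P} P \<and> bij_betw g {..<card P} Q \<and>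
    (\<forall>a\<in>effects T A. \<langle>a, \<rho>\<rangle> = (\<Sum>i<card P. p i * \<langle>a, h i\<rangle>)) \<and>
    (\<forall>x\<in>set L. 0 \<le> fst x \<and> snd x permutes {..<card P}) \<and> sum_list (map fst L) = 1 \<and>
    (\<forall>a\<in>effects T A. \<langle>a, \<sigma>\<rangle> = (\<Sum>i<card P. sum_list (map (\<lambda>x. fst x * p (snd x i)) L) * \<langle>a, g i\<rangle>))"
    using unital_spectra[OF \<rho> \<sigma> D] by (elim exE) (rule that)
  define d where "d = card P"
  have P: "basis A P" and Q: "basis A Q" and h: "bij_betw h {..<d} P" and g: "bij_betw g {..<d} Q"
    and \<rho>eq: "\<And>a. a \<in> effects T A \<Longrightarrow> \<langle>a, \<rho>\<rangle> = (\<Sum>i<d. p i * \<langle>a, h i\<rangle>)"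
    and L: "\<forall>x\<in>set L. 0 \<le> fst x \<and> snd x permutes {..<d}" "sum_list (map fst L) = 1"
    and \<sigma>eq: "\<And>a. a \<in> effects T A \<Longrightarrow> \<langle>a, \<sigma>\<rangle> = (\<Sum>i<d. sum_list (map (\<lambda>x. fst x * p (snd x i)) L) * \<langle>a, g i\<rangle>)"
    using spectra unfolding d_def by blast+
  define K where "K = length L"
  define w where "w k = fst (L ! k)" for k
  define \<pi> where "\<pi> k = snd (L ! k)" for k
  have LK: "L ! k \<in> set L" if "k < K" for k using that by (simp add: K_def)
  have w: "0 \<le> w k" and \<pi>: "\<pi> k permutes {..<d}" if "k < K" for k using L(1) LK[OF that] by (auto simp: w_def \<pi>_def)
  have wsum: "(\<Sum>k<K. w k) = 1" using L(2) by (simp add: sum_list_sum_nth w_def K_def atLeast0LessThan)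
  have hn: "normalised T A (h i)" if "i < d" for i using basis_pure[OF P] bij_betwE[OF h] that by simp
  \<comment> \<open>One reversible channel both rearranges the eigenvalues by \<open>\<pi> k\<close>
    and carries the eigenbasis of \<rho> to that of \<sigma>.\<close>
  have "\<exists>U. k < K \<longrightarrow> reversible T A A U \<and> (\<forall>i\<in>{..<d}. U \<cdot> h (\<pi> k i) = g i)" for k
  proof (cases "k < K")
    case True
    obtain U where "reversible T A A U" "\<And>i. i \<in> {..<d} \<Longrightarrow> U \<cdot> h (\<pi> k i) = g i"
      using strong_symmetry_indexed[OF ss P Q permutes_bij_index[OF \<pi>[OF True] h] g] by blast
    then show ?thesis by blast
  qed simp
  then obtain U where U: "\<And>k. k < K \<Longrightarrow> reversible T A A (U k)" "\<And>k i. k < K \<Longrightarrow> i < d \<Longrightarrow> U k \<cdot> h (\<pi> k i) = g i"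
    by (metis lessThan_iff)
  obtain F where F: "channel T A A F" "is_lincomb T A A F {..<K} w U"
    using mix_channels[of "{..<K}" w A A U] w wsum U(1) reversible_channel by auto
  have "F \<in> rare_channels T A"
    unfolding rare_channels_def using F w wsum U(1) by blast
  moreover have "\<sigma> = F \<cdot> \<rho>"
  proof (rule state_eqI[OF normalised_state[OF \<sigma>] channel_state[OF normalised_state[OF \<rho>] F(1)]])
    fix a assume a: "a \<in> effects T A"
    have each: "\<langle>a, U k \<cdot> \<rho>\<rangle> = (\<Sum>i<d. p (\<pi> k i) * \<langle>a, g i\<rangle>)" if k: "k < K" for k
    proof -
      note Uc = reversible_channel[OF U(1)[OF k]]
      have "\<langle>a, U k \<cdot> \<rho>\<rangle> = \<langle>a \<cdot> U k, \<rho>\<rangle>" by (rule pairing_channel[OF a Uc normalised_state[OF \<rho>]])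
      also have "\<dots> = (\<Sum>i<d. p i * \<langle>a \<cdot> U k, h i\<rangle>)" by (rule \<rho>eq[OF effect_channel[OF a Uc]])
      also have "\<dots> = (\<Sum>i<d. p (\<pi> k i) * \<langle>a \<cdot> U k, h (\<pi> k i)\<rangle>)"
        by (rule sum.reindex_bij_betw[OF permutes_imp_bij[OF \<pi>[OF k]], symmetric])
      also have "\<dots> = (\<Sum>i<d. p (\<pi> k i) * \<langle>a, g i\<rangle>)"
      proof (rule sum.cong[OF refl])
        fix i assume "i \<in> {..<d}"
        then have i: "i < d" "\<pi> k i < d" using permutes_in_image[OF \<pi>[OF k], of i] by auto
        have "\<langle>a \<cdot> U k, h (\<pi> k i)\<rangle> = \<langle>a, U k \<cdot> h (\<pi> k i)\<rangle>"
          by (rule pairing_channel[OF a Uc normalised_state[OF hn[OF i(2)]], symmetric])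
        then show "p (\<pi> k i) * \<langle>a \<cdot> U k, h (\<pi> k i)\<rangle> = p (\<pi> k i) * \<langle>a, g i\<rangle>" using U(2)[OF k i(1)] by simp
      qed
      finally show ?thesis .
    qed
    have "\<langle>a, F \<cdot> \<rho>\<rangle> = (\<Sum>k<K. w k * \<langle>a, U k \<cdot> \<rho>\<rangle>)"
      by (rule lincomb_apply[OF F(2) normalised_state[OF \<rho>] a])
    also have "\<dots> = (\<Sum>k<K. \<Sum>i<d. w k * p (\<pi> k i) * \<langle>a, g i\<rangle>)"
      by (rule sum.cong[OF refl]) (use each in \<open>simp add: sum_distrib_left mult.assoc\<close>)
    also have "\<dots> = (\<Sum>i<d. \<Sum>k<K. w k * p (\<pi> k i) * \<langle>a, g i\<rangle>)" by (rule sum.swap)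
    also have "\<dots> = (\<Sum>i<d. sum_list (map (\<lambda>x. fst x * p (snd x i)) L) * \<langle>a, g i\<rangle>)"
      by (rule sum.cong[OF refl]) (simp add: sum_list_sum_nth w_def \<pi>_def K_def atLeast0LessThan sum_distrib_right)
    finally show "\<langle>a, \<sigma>\<rangle> = \<langle>a, F \<cdot> \<rho>\<rangle>" using \<sigma>eq[OF a] by simp
  qed
  ultimately show ?thesis by (auto simp: convertible_def)
qed

section \<open>Noisy operations with powers of the system as environment\<close>

primrec power_system :: "'s \<Rightarrow> nat \<Rightarrow> 's" where
  "power_system A 0 = \<one>"
| "power_system A (Suc n) = A \<boxtimes> power_system A n"

text \<open>A lower bound suffices, as the environment only has to become large enough to
  approximate the weights.\<close>

lemma power_system_basis:
  assumes P: "basis A P"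
  obtains R where "basis (power_system A n) R" "card P ^ n \<le> card R"
proof (induction n arbitrary: thesis)
  case 0
  obtain R where R: "basis \<one> R" using basis_exists .
  then have "1 \<le> card R" using basis_nonempty[OF R] basis_finite[OF R] by (simp add: Suc_le_eq card_gt_0_iff)
  with R 0 show ?case by simp
next
  case (Suc n)
  obtain R where R: "basis (power_system A n) R" "card P ^ n \<le> card R" using Suc.IH .
  have "card ((\<lambda>(\<phi>, \<psi>). \<phi> \<otimes> \<psi>) ` (P \<times> R)) = card P * card R"
    using card_image[OF tensor_inj_on[OF P R(1)]] by (simp add: card_cartesian_product)
  then show ?case using Suc.prems[of "(\<lambda>(\<phi>, \<psi>). \<phi> \<otimes> \<psi>) ` (P \<times> R)"] basis_par[OF P R(1)] R(2) by simp
qed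

text \<open>
  A basis of the environment in its microcanonical state acts as a uniform random number that controls which
  permutation is applied to the system.
\<close>

lemma controlled_permutation_noisy:
  fixes c :: "nat \<Rightarrow> nat"
  assumes ss: "strong_symmetry T" and P: "basis A P" and Q: "basis A Q" and R: "basis E R"
    and h: "bij_betw h {..<d} P" and g: "bij_betw g {..<d} Q" and \<rho>: "normalised T A \<rho>"
    and \<rho>eq: "\<And>a. a \<in> effects T A \<Longrightarrow> \<langle>a, \<rho>\<rangle> = (\<Sum>i<d. p i * \<langle>a, h i\<rangle>)"
    and \<pi>: "\<And>k. k < K \<Longrightarrow> \<pi> k permutes {..<d}" and c: "(\<Sum>k<K. c k) = card R"
  shows "\<exists>F. F \<in> basic_noisy_operations T A A \<and>
    (\<forall>a\<in>effects T A. \<langle>a, F \<cdot> \<rho>\<rangle> = (\<Sum>k<K. c k / card R * (\<Sum>i<d. p (\<pi> k i) * \<langle>a, g i\<rangle>)))"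
proof -
  \<comment> \<open>The environment basis is cut into blocks; block \<open>k\<close> has
    \<open>c k\<close> elements and triggers the permutation \<open>\<pi> k\<close>.\<close>
  define J where "J = (SIGMA k:{..<K}. {..<c k})"
  have "card J = card R" unfolding J_def using c by (simp add: card_SigmaI)
  moreover have "finite J" by (simp add: J_def)
  ultimately obtain r where r: "bij_betw r J R"
    using finite_same_card_bij[of J R] basis_finite[OF R] by blast
  have rn: "normalised T E (r j)" if "j \<in> J" for j using basis_pure[OF R] bij_betwE[OF r] that by simp
  have hn: "normalised T A (h i)" if "i < d" for i using basis_pure[OF P] bij_betwE[OF h] that by simp
  have gn: "normalised T A (g i)" if "i < d" for i using basis_pure[OF Q] bij_betwE[OF g] that by simp
  have \<pi>J: "\<pi> (fst j) permutes {..<d}" if "j \<in> J" for j using \<pi> that by (auto simp: J_def)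
  let ?t = "\<lambda>(\<phi>, \<psi>). \<phi> \<otimes> \<psi>"
  \<comment> \<open>\<open>f1\<close> permutes the system index according to the block of the
    environment index, \<open>f2\<close> leaves it alone. Strong Symmetry on the composite carries
    one enumeration to the other, which is a controlled permutation.\<close>
  define f1 where "f1 x = (h (\<pi> (fst (snd x)) (fst x)), r (snd x))" for x
  define f2 where "f2 x = (g (fst x), r (snd x))" for x
  have b1: "bij_betw f1 ({..<d} \<times> J) (P \<times> R)"
    unfolding bij_betw_def
  proof
    show "inj_on f1 ({..<d} \<times> J)"
    proof (rule inj_onI)
      fix x y assume x: "x \<in> {..<d} \<times> J" and y: "y \<in> {..<d} \<times> J" and eq: "f1 x = f1 y"
      have s: "snd x = snd y" using eq r x y by (auto simp: f1_def bij_betw_def inj_on_def)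
      have "bij_betw (\<lambda>i. h (\<pi> (fst (snd x)) i)) {..<d} P"
        by (rule permutes_bij_index[OF \<pi>J h]) (use x in auto)
      then have "fst x = fst y" using eq s x y by (auto simp: f1_def bij_betw_def inj_on_def)
      with s show "x = y" by (simp add: prod_eq_iff)
    qed
    show "f1 ` ({..<d} \<times> J) = P \<times> R"
    proof (intro equalityI subsetI)
      fix z assume "z \<in> f1 ` ({..<d} \<times> J)"
      then obtain x where x: "x \<in> {..<d} \<times> J" "z = f1 x" by blast
      have "bij_betw (\<lambda>i. h (\<pi> (fst (snd x)) i)) {..<d} P"
        by (rule permutes_bij_index[OF \<pi>J h]) (use x in auto)
      then show "z \<in> P \<times> R" using x bij_betwE[OF r] by (auto simp: f1_def dest: bij_betwE)
    next
      fix z assume "z \<in> P \<times> R"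
      then obtain \<phi> \<psi> where z: "z = (\<phi>, \<psi>)" "\<phi> \<in> P" "\<psi> \<in> R" by blast
      obtain j where j: "j \<in> J" "r j = \<psi>" using r z(3) by (auto simp: bij_betw_def)
      have "bij_betw (\<lambda>i. h (\<pi> (fst j) i)) {..<d} P" by (rule permutes_bij_index[OF \<pi>J[OF j(1)] h])
      then obtain i where "i < d" "h (\<pi> (fst j) i) = \<phi>" using z(2) by (auto simp: bij_betw_def)
      then show "z \<in> f1 ` ({..<d} \<times> J)" using j z(1) by (intro image_eqI[of _ _ "(i, j)"]) (auto simp: f1_def)
    qed
  qed
  have b2: "bij_betw f2 ({..<d} \<times> J) (Q \<times> R)"
    unfolding f2_def using bij_betw_map_prod[OF g r] by (simp add: map_prod_def case_prod_unfold)
  have t1: "bij_betw ?t (P \<times> R) (?t ` (P \<times> R))" and t2: "bij_betw ?t (Q \<times> R) (?t ` (Q \<times> R))"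
    using tensor_inj_on[OF P R] tensor_inj_on[OF Q R] by (simp_all add: bij_betw_def)
  have c1: "bij_betw (\<lambda>x. ?t (f1 x)) ({..<d} \<times> J) (?t ` (P \<times> R))"
    and c2: "bij_betw (\<lambda>x. ?t (f2 x)) ({..<d} \<times> J) (?t ` (Q \<times> R))"
    using bij_betw_trans[OF b1 t1] bij_betw_trans[OF b2 t2] by (simp_all add: o_def)
  obtain V where V: "reversible T (A \<boxtimes> E) (A \<boxtimes> E) V"
    and Veq: "\<And>x. x \<in> {..<d} \<times> J \<Longrightarrow> V \<cdot> ?t (f1 x) = ?t (f2 x)"
    using strong_symmetry_indexed[OF ss basis_par[OF P R] basis_par[OF Q R] c1 c2] by blast
  define F where "F = (\<iota> A \<otimes> \<epsilon> E) \<cdot> V \<cdot> (\<iota> A \<otimes> chi E)"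
  have FN: "F \<in> basic_noisy_operations T A A"
    unfolding basic_noisy_operations_def microcanonical_eq F_def using V by blast
  have "\<langle>a, F \<cdot> \<rho>\<rangle> = (\<Sum>k<K. c k / card R * (\<Sum>i<d. p (\<pi> k i) * \<langle>a, g i\<rangle>))" if a: "a \<in> effects T A" for a
  proof -
    define e where "e = (a \<otimes> \<epsilon> E) \<cdot> V"
    have aE: "a \<otimes> \<epsilon> E \<in> effects T (A \<boxtimes> E)" by (rule effect_par[OF a discard_effect])
    have e: "e \<in> effects T (A \<boxtimes> E)" unfolding e_def by (rule effect_channel[OF aE reversible_channel[OF V]])
    note \<rho>s = normalised_state[OF \<rho>]
    have ty: "src T \<rho> = \<one>" "tgt T \<rho> = A" "src T (chi E) = \<one>" "tgt T (chi E) = E" "src T V = A \<boxtimes> E" "tgt T V = A \<boxtimes> E"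
      "src T a = A" "tgt T a = \<one>"
      using \<rho>s chi_state[of E] reversible_src[OF V] reversible_tgt[OF V] a by (auto simp: hom_iffs)
    have "a \<cdot> (F \<cdot> \<rho>) = e \<cdot> (\<rho> \<otimes> chi E)"
    proof -
      have "a \<cdot> (F \<cdot> \<rho>) = (a \<cdot> (\<iota> A \<otimes> \<epsilon> E)) \<cdot> (V \<cdot> ((\<iota> A \<otimes> chi E) \<cdot> \<rho>))"
        using ty by (simp add: F_def assoc)
      also have "a \<cdot> (\<iota> A \<otimes> \<epsilon> E) = a \<otimes> \<epsilon> E"
        using par_split'[of a A \<one> "\<epsilon> E" E \<one>] ty by simp
      also have "(\<iota> A \<otimes> chi E) \<cdot> \<rho> = \<rho> \<otimes> chi E"
        using par_state_right[of \<rho> \<one> "chi E"] ty by simp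
      also have "(a \<otimes> \<epsilon> E) \<cdot> (V \<cdot> (\<rho> \<otimes> chi E)) = e \<cdot> (\<rho> \<otimes> chi E)"
        using ty by (simp add: e_def assoc)
      finally show ?thesis .
    qed
    then have "\<langle>a, F \<cdot> \<rho>\<rangle> = \<langle>e, \<rho> \<otimes> chi E\<rangle>" by (simp add: pairing_def)
    also have "\<dots> = \<langle>e \<cdot> (\<rho> \<otimes> \<iota> E), chi E\<rangle>" by (rule pairing_tensor_right(2)[OF e \<rho>s chi_state])
    also have "\<dots> = 1 / card R * (\<Sum>\<psi>\<in>R. \<langle>e \<cdot> (\<rho> \<otimes> \<iota> E), \<psi>\<rangle>)"
      by (rule chi_uniform[OF R pairing_tensor_right(1)[OF e \<rho>s chi_state]])
    also have "(\<Sum>\<psi>\<in>R. \<langle>e \<cdot> (\<rho> \<otimes> \<iota> E), \<psi>\<rangle>) = (\<Sum>j\<in>J. \<langle>e \<cdot> (\<rho> \<otimes> \<iota> E), r j\<rangle>)"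
      by (rule sum.reindex_bij_betw[OF r, symmetric])
    also have "\<dots> = (\<Sum>j\<in>J. \<Sum>i<d. p (\<pi> (fst j) i) * \<langle>a, g i\<rangle>)"
    proof (rule sum.cong[OF refl])
      fix j assume j: "j \<in> J"
      note rs = normalised_state[OF rn[OF j]]
      have "\<langle>e \<cdot> (\<rho> \<otimes> \<iota> E), r j\<rangle> = \<langle>e, \<rho> \<otimes> r j\<rangle>" by (rule pairing_tensor_right(2)[OF e \<rho>s rs, symmetric])
      also have "\<dots> = \<langle>e \<cdot> (\<iota> A \<otimes> r j), \<rho>\<rangle>" by (rule pairing_tensor_left(2)[OF e \<rho>s rs])
      also have "\<dots> = (\<Sum>i<d. p i * \<langle>e \<cdot> (\<iota> A \<otimes> r j), h i\<rangle>)" by (rule \<rho>eq[OF pairing_tensor_left(1)[OF e \<rho>s rs]])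
      also have "\<dots> = (\<Sum>i<d. p (\<pi> (fst j) i) * \<langle>e \<cdot> (\<iota> A \<otimes> r j), h (\<pi> (fst j) i)\<rangle>)"
        by (rule sum.reindex_bij_betw[OF permutes_imp_bij[OF \<pi>J[OF j]], symmetric])
      also have "\<dots> = (\<Sum>i<d. p (\<pi> (fst j) i) * \<langle>a, g i\<rangle>)"
      proof (rule sum.cong[OF refl])
        fix i assume "i \<in> {..<d}"
        then have i: "i < d" "\<pi> (fst j) i < d" using permutes_in_image[OF \<pi>J[OF j], of i] by auto
        note hs = normalised_state[OF hn[OF i(2)]] and gs = normalised_state[OF gn[OF i(1)]]
        have hr: "h (\<pi> (fst j) i) \<otimes> r j \<in> states T (A \<boxtimes> E)"
          using normalised_state[OF normalised_par[OF hn[OF i(2)] rn[OF j]]] .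
        have "\<langle>e \<cdot> (\<iota> A \<otimes> r j), h (\<pi> (fst j) i)\<rangle> = \<langle>e, h (\<pi> (fst j) i) \<otimes> r j\<rangle>"
          by (rule pairing_tensor_left(2)[OF e hs rs, symmetric])
        also have "\<dots> = \<langle>a \<otimes> \<epsilon> E, V \<cdot> (h (\<pi> (fst j) i) \<otimes> r j)\<rangle>"
          unfolding e_def by (rule pairing_channel[OF aE reversible_channel[OF V] hr, symmetric])
        also have "V \<cdot> (h (\<pi> (fst j) i) \<otimes> r j) = g i \<otimes> r j"
          using Veq[of "(i, j)"] i(1) j by (simp add: f1_def f2_def)
        also have "\<langle>a \<otimes> \<epsilon> E, g i \<otimes> r j\<rangle> = \<langle>a, g i\<rangle>"
          using pairing_par[OF a discard_effect gs rs] normalised_pairing[OF rn[OF j]] by simp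
        finally show "p (\<pi> (fst j) i) * \<langle>e \<cdot> (\<iota> A \<otimes> r j), h (\<pi> (fst j) i)\<rangle> = p (\<pi> (fst j) i) * \<langle>a, g i\<rangle>" by simp
      qed
      finally show "\<langle>e \<cdot> (\<rho> \<otimes> \<iota> E), r j\<rangle> = (\<Sum>i<d. p (\<pi> (fst j) i) * \<langle>a, g i\<rangle>)" .
    qed
    also have "\<dots> = (\<Sum>k<K. \<Sum>l<c k. \<Sum>i<d. p (\<pi> k i) * \<langle>a, g i\<rangle>)"
      unfolding J_def by (subst sum.Sigma) (simp_all add: case_prod_unfold)
    also have "\<dots> = (\<Sum>k<K. c k * (\<Sum>i<d. p (\<pi> k i) * \<langle>a, g i\<rangle>))" by simp
    finally show ?thesis by (simp add: sum_distrib_left)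
  qed
  with FN show ?thesis by (intro exI conjI ballI)
qed

lemma noisy_if_unital:
  assumes ss: "strong_symmetry T" and \<rho>: "normalised T A \<rho>" and \<sigma>: "normalised T A \<sigma>"
    and conv: "convertible T (unital_channels T A A) \<rho> \<sigma>"
  shows "convertible T (noisy_operations T A A) \<rho> \<sigma>"
proof -
  obtain D where D: "D \<in> unital_channels T A A" "\<sigma> = D \<cdot> \<rho>" using conv by (auto simp: convertible_def)
  obtain P Q h g p L where spectra: "basis A P \<and> basis A Q \<and> bij_betw h {..<card P} P \<and> bij_betw g {..<card P} Q \<and>
    (\<forall>a\<in>effects T A. \<langle>a, \<rho>\<rangle> = (\<Sum>i<card P. p i * \<langle>a, h i\<rangle>)) \<and>
    (\<forall>x\<in>set L. 0 \<le> fst x \<and> snd x permutes {..<card P}) \<and> sum_list (map fst L) = 1 \<and>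
    (\<forall>a\<in>effects T A. \<langle>a, \<sigma>\<rangle> = (\<Sum>i<card P. sum_list (map (\<lambda>x. fst x * p (snd x i)) L) * \<langle>a, g i\<rangle>))"
    using unital_spectra[OF \<rho> \<sigma> D] by (elim exE) (rule that)
  define d where "d = card P"
  have P: "basis A P" and Q: "basis A Q" and dP: "d = card P" and h: "bij_betw h {..<d} P" and g: "bij_betw g {..<d} Q"
    and \<rho>eq: "\<And>a. a \<in> effects T A \<Longrightarrow> \<langle>a, \<rho>\<rangle> = (\<Sum>i<d. p i * \<langle>a, h i\<rangle>)"
    and L: "\<forall>x\<in>set L. 0 \<le> fst x \<and> snd x permutes {..<d}" "sum_list (map fst L) = 1"
    and \<sigma>eq: "\<And>a. a \<in> effects T A \<Longrightarrow> \<langle>a, \<sigma>\<rangle> = (\<Sum>i<d. sum_list (map (\<lambda>x. fst x * p (snd x i)) L) * \<langle>a, g i\<rangle>)"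
    using spectra unfolding d_def by blast+
  define K where "K = length L"
  define w where "w k = fst (L ! k)" for k
  define \<pi> where "\<pi> k = snd (L ! k)" for k
  have LK: "L ! k \<in> set L" if "k < K" for k using that by (simp add: K_def)
  have w: "0 \<le> w k" and \<pi>: "\<pi> k permutes {..<d}" if "k < K" for k using L(1) LK[OF that] by (auto simp: w_def \<pi>_def)
  have wsum: "(\<Sum>k<K. w k) = 1" using L(2) by (simp add: sum_list_sum_nth w_def K_def atLeast0LessThan)
  have K: "0 < K" using wsum by (cases K) auto
  define G where "G a k = (\<Sum>i<d. p (\<pi> k i) * \<langle>a, g i\<rangle>)" for a k
  have \<sigma>G: "\<langle>a, \<sigma>\<rangle> = (\<Sum>k<K. w k * G a k)" if a: "a \<in> effects T A" for a
  proof -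
    have "(\<Sum>k<K. w k * G a k) = (\<Sum>k<K. \<Sum>i<d. w k * p (\<pi> k i) * \<langle>a, g i\<rangle>)"
      by (simp add: G_def sum_distrib_left mult.assoc)
    also have "\<dots> = (\<Sum>i<d. \<Sum>k<K. w k * p (\<pi> k i) * \<langle>a, g i\<rangle>)" by (rule sum.swap)
    also have "\<dots> = (\<Sum>i<d. sum_list (map (\<lambda>x. fst x * p (snd x i)) L) * \<langle>a, g i\<rangle>)"
      by (rule sum.cong[OF refl]) (simp add: sum_list_sum_nth w_def \<pi>_def K_def atLeast0LessThan sum_distrib_right)
    finally show ?thesis using \<sigma>eq[OF a] by simp
  qed
  obtain c :: "nat \<Rightarrow> nat \<Rightarrow> nat" where c: "\<And>N. (\<Sum>k<K. c N k) = N" "\<And>k. k < K \<Longrightarrow> (\<lambda>N. c N k / N) \<longlonglongrightarrow> w k"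
    using count_approximation[of K w] K w wsum by blast
  have "\<exists>R. basis (power_system A n) R \<and> card P ^ n \<le> card R" for n using power_system_basis[OF P] by metis
  then obtain R where R: "\<And>n. basis (power_system A n) (R n)" "\<And>n. card P ^ n \<le> card (R n)" by metis
  have Rpos: "0 < card (R n)" for n using basis_nonempty[OF R(1)] basis_finite[OF R(1)] by (simp add: card_gt_0_iff)
  have "\<exists>F. F \<in> basic_noisy_operations T A A \<and>
    (\<forall>a\<in>effects T A. \<langle>a, F \<cdot> \<rho>\<rangle> = (\<Sum>k<K. c (card (R n)) k / card (R n) * G a k))" for n
    using controlled_permutation_noisy[OF ss P Q R(1)[of n] h g \<rho> \<rho>eq \<pi> c(1)] unfolding G_def .
  then obtain F where F: "\<forall>n. F n \<in> basic_noisy_operations T A A \<and>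
    (\<forall>a\<in>effects T A. \<langle>a, F n \<cdot> \<rho>\<rangle> = (\<Sum>k<K. c (card (R n)) k / card (R n) * G a k))"
    by (rule choice[OF allI, THEN exE])
  have FN: "F n \<in> basic_noisy_operations T A A" for n using F by blast
  have Feq: "\<langle>a, F n \<cdot> \<rho>\<rangle> = (\<Sum>k<K. c (card (R n)) k / card (R n) * G a k)" if "a \<in> effects T A" for n a
    using F that by blast
  have lim: "(\<lambda>n. \<langle>a, F n \<cdot> \<rho>\<rangle>) \<longlonglongrightarrow> \<langle>a, \<sigma>\<rangle>" if a: "a \<in> effects T A" for a
  \<comment> \<open>For \<open>d = 1\<close> the environments need not grow, but then all
    permutations are trivial and every approximation is exact. For \<open>d \<ge> 2\<close> the size
    of the environment basis exceeds any bound.\<close>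
  proof (cases "d = 1")
    case True
    have G0: "G a k = G a 0" if k: "k < K" for k
    proof -
      have "\<pi> k 0 = 0" "\<pi> 0 0 = 0"
        using permutes_in_image[OF \<pi>[OF k], of 0] permutes_in_image[OF \<pi>[OF K], of 0] True by auto
      then show ?thesis using True by (simp add: G_def)
    qed
    have "\<langle>a, F n \<cdot> \<rho>\<rangle> = \<langle>a, \<sigma>\<rangle>" for n
    proof -
      have "\<langle>a, F n \<cdot> \<rho>\<rangle> = (\<Sum>k<K. real (c (card (R n)) k) / card (R n) * G a 0)"
        unfolding Feq[OF a] by (intro sum.cong refl arg_cong2[where f="(*)"] G0) simp
      also have "\<dots> = real (\<Sum>k<K. c (card (R n)) k) / card (R n) * G a 0"
        by (simp add: sum_distrib_right sum_divide_distrib)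
      also have "\<dots> = (\<Sum>k<K. w k) * G a 0" unfolding c(1) wsum using Rpos[of n] by simp
      also have "\<dots> = (\<Sum>k<K. w k * G a k)" unfolding sum_distrib_right by (intro sum.cong refl arg_cong2[where f="(*)"] G0[symmetric]) simp
      finally show ?thesis using \<sigma>G[OF a] by simp
    qed
    then show ?thesis by simp
  next
    case False
    have "0 < d" using Rpos basis_nonempty[OF P] basis_finite[OF P] by (simp add: dP card_gt_0_iff)
    with False have d2: "2 \<le> d" by simp
    have "filterlim (\<lambda>n. card (R n)) sequentially sequentially"
    proof (rule filterlim_at_top_mono)
      show "filterlim (\<lambda>n. n) sequentially sequentially" by (rule filterlim_ident)
      have "n \<le> card (R n)" for n
      proof -
        have "n < 2 ^ n" by simp
        also have "\<dots> \<le> d ^ n" using d2 by (rule power_mono) simp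
        also have "\<dots> \<le> card (R n)" using R(2)[of n] by (simp add: dP)
        finally show ?thesis by simp
      qed
      then show "\<forall>\<^sub>F n in sequentially. n \<le> card (R n)" by simp
    qed
    then have "(\<lambda>n. c (card (R n)) k / card (R n)) \<longlonglongrightarrow> w k" if "k < K" for k
      using filterlim_compose[OF c(2)[OF that]] by blast
    then have "(\<lambda>n. \<Sum>k<K. c (card (R n)) k / card (R n) * G a k) \<longlonglongrightarrow> (\<Sum>k<K. w k * G a k)"
      by (intro tendsto_sum tendsto_mult tendsto_const) auto
    then show ?thesis using Feq[OF a] \<sigma>G[OF a] by simp
  qed
  have Fh: "F n \<in> hom T A A" for n by (rule channel_hom[OF basic_noisy_unital(1)[OF FN]])
  \<comment> \<open>So far only the images of \<rho> converge. Compactness yields a subsequence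
    along which the operations themselves converge, as the definition of noisy operations
    demands.\<close>
  obtain s f where s: "strict_mono s" and f: "converges_to T A A (\<lambda>n. F (s n)) f"
    using hom_subsequence[of F A A, OF Fh] by blast
  have "f \<in> noisy_operations T A A"
    unfolding noisy_operations_def mem_Collect_eq by (intro exI[of _ "\<lambda>n. F (s n)"] conjI image_subsetI FN f)
  moreover have "\<sigma> = f \<cdot> \<rho>"
  proof (rule state_eqI[OF normalised_state[OF \<sigma>]])
    show "f \<cdot> \<rho> \<in> states T A" using f normalised_state[OF \<rho>] by (simp add: converges_to_def hom_iffs)
    fix a assume a: "a \<in> effects T A"
    have "(\<lambda>n. \<langle>a, F (s n) \<cdot> \<rho>\<rangle>) \<longlonglongrightarrow> \<langle>a, \<sigma>\<rangle>"
      using LIMSEQ_subseq_LIMSEQ[OF lim[OF a] s] by (simp add: o_def)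
    with converges_apply[OF f normalised_state[OF \<rho>] a] show "\<langle>a, \<sigma>\<rangle> = \<langle>a, f \<cdot> \<rho>\<rangle>"
      by (rule LIMSEQ_unique[rotated])
  qed
  ultimately show ?thesis by (auto simp: convertible_def)
qed

lemma convertible_mono: "convertible T F \<rho> \<sigma> \<Longrightarrow> F \<subseteq> G \<Longrightarrow> convertible T G \<rho> \<sigma>"
  by (auto simp: convertible_def)

text \<open>RaRe and noisy conversions are always unital conversions. The first direction uses that
  unital conversions are then RaRe conversions; the second supplies the converses for both RaRe and
  noisy operations.\<close>

lemma equivalent_convertibility_iff: "equivalent_convertibility T \<longleftrightarrow> unrestricted_reversibility T"
proof
  assume "equivalent_convertibility T"
  then have "permutability T"
    unfolding equivalent_convertibility_def by (intro permutability_if_rare_unital) blast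
  then show "unrestricted_reversibility T" by (simp add: unrestricted_reversibility_def)
next
  assume "unrestricted_reversibility T"
  then have ss: "strong_symmetry T" by (rule strong_symmetry_if_unrestricted)
  show "equivalent_convertibility T"
    unfolding equivalent_convertibility_def
    using rare_if_unital[OF ss] noisy_if_unital[OF ss] convertible_mono[OF _ rare_unital]
      convertible_mono[OF _ noisy_unital] by blast
qed

end

theorem theorem5p8p9:
  fixes T :: "('s, 't) opt"
  assumes "sharp_theory_with_purification T"
  shows "equivalent_convertibility T \<longleftrightarrow> unrestricted_reversibility T"
  using sharp_theory_with_purification.equivalent_convertibility_iff[OF assms] .

end
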